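(* Let $\lambda>0$. For any interval $I\subset\mathbb{R}$, $$\frac{1}{|\Lambda_L|}\operatorname{Tr}\left(E_{H^\omega_{\lambda,L}}(I)\right)\xrightarrow{L\to\infty} n_{\mathcal{C},\lambda}(I)\qquad\text{almost surely},$$ where $$n_{\mathcal{C},\lambda}(I)=\frac{K-1}{K}\sum_{n=0}^\infty K^{-n}\,\mathbb{E}_\omega\left[\left\langle\delta_{x_n},E_{H^\omega_{\mathcal{C},\lambda}}(I)\delta_{x_n}\right\rangle\right],$$ and $\{x_n\}_{n=0}^\infty$ is a sequence of vertices of the canopy tree $\mathcal{C}$ such that $d(\partial\mathcal{C},x_n)=n$. Moreover, the measure $n_{\mathcal{C},\lambda}$ is absolutely continuous with respect to Lebesgue measure.
   Context: Let $K\ge 2$ and $m_0\geq 1$ be integers. For a self-adjoint operator $H$, $E_H(I)$ denotes its spectral projection on $I$. $\delta_x$ is the indicator function of $\{x\}$, $d$ denotes graph distance, and $\chi_U$ is the orthogonal projection given by multiplication by the indicator function of a vertex set $U$. $\rho\in L^\infty(\mathbb{R})$ is a compactly supported probability density. Bethe lattice: $\mathcal{B}=(V_{\mathcal{B}},E_{\mathcal{B}})$ is the infinite tree in which every vertex has exactly $K+1$ neighbours, with a root $0$. Write $y\prec x$ if $d(0,x)=d(0,y)+d(y,x)$. On $\ell^2(\mathcal{B})$ let $(\Delta\psi)(x)=\sum_{y:\,d(x,y)=1}\psi(y)$. Let $J=\{x\in V_{\mathcal{B}}: d(0,x)\in (m_0+1)\mathbb{N}\cup\{0\}\}$, and for $y\in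 J$ let $P_y=\chi_{\{x:\ d(y,x)\le m_0,\ y\prec x\}}$. Let $\{\omega_y\}_{y\in J}$ be i.i.d. with distribution $\rho(x)\,dx$, and $H^\omega_\lambda=\Delta+\lambda\sum_{y\in J}\omega_yP_y$. With $\Lambda_L=\{y\in V_{\mathcal{B}}: d(0,y)\le L\}$, set $H^\omega_{\lambda,L}=\chi_{\Lambda_L}H^\omega_\lambda\chi_{\Lambda_L}$ on $\ell^2(\Lambda_L)$. Canopy tree: $\mathcal{C}=(V_{\mathcal{C}},E_{\mathcal{C}})$ is defined layer by layer, starting from a countably infinite set of boundary vertices $\mathcal{C}_0=\partial\mathcal{C}$; each layer $\mathcal{C}_n$ is a countable set of vertices that is partitioned into sets of $K$ vertices, and the $K$ vertices of each such set are joined to a single unique vertex in the layer $\mathcal{C}_{n+1}$ (the resulting graph is the infinite tree with $d(x,\partial\mathcal{C})=n$ for $x\in\mathcal{C}_n$). Let $\Delta_{\mathcal{C}}$ be the adjacency operator on $\ell^2(\mathcal{C})$, $J_{\mathcal{C}}=\{y\in V_{\mathcal{C}}: d(\partial\mathcal{C},y)=m_0+(m_0+1)k\text{ for some }k\in\mathbb{N}\cup\{0\}\}$, and for $y\in J_{\mathcal{C}}$ let $P_y=\chi_{\tilde\Lambda_{m_0}(y)}$ where $\tilde\Lambda_{m_0}(y)=\{x\in V_{\mathcal{C}}: d(y,x)\le m_0,\ d(\partial\mathcal{C},y)=d(\partial\mathcal{C},x)+d(x,y)\}$. With $\{\omega_y\}_{y\in J_{\mathcal{C}}}$ i.i.d.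 with distribution $\rho(x)\,dx$, set $H^\omega_{\mathcal{C},\lambda}=\Delta_{\mathcal{C}}+\lambda\sum_{y\in J_{\mathcal{C}}}\omega_yP_y$ on $\ell^2(\mathcal{C})$. $\mathbb{E}_\omega$ denotes expectation over the random variables.
   Formalization: The limit L→∞ is taken along L = m_0+(m_0+1)k, where Λ_L is a union of complete blocks; for other residues of L mod m_0+1 the outer blocks are cut off and the limit differs (already in the fourth moment), so the claim over all L is false. *)

theory Defs
  imports "HOL-Probability.Probability" "HOL-Library.Disjoint_Sets"
begin

section \<open>Graphs and trees\<close>

text \<open>A graph has all elements of a type as vertices and is given by its adjacency relation.\<close>

definition simple_graph :: "('v \<Rightarrow> 'v \<Rightarrow> bool) \<Rightarrow> bool" where
  "simple_graph adj \<longleftrightarrow> symp adj \<and> irreflp adj"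

definition graph_connected :: "('v \<Rightarrow> 'v \<Rightarrow> bool) \<Rightarrow> bool" where
  "graph_connected adj \<longleftrightarrow> (\<forall>x y. adj\<^sup>*\<^sup>* x y)"

definition graph_cycle :: "('v \<Rightarrow> 'v \<Rightarrow> bool) \<Rightarrow> 'v list \<Rightarrow> bool" where
  "graph_cycle adj xs \<longleftrightarrow>
     3 \<le> length xs \<and> distinct xs \<and> successively adj xs \<and> adj (last xs) (hd xs)"

definition is_tree :: "('v \<Rightarrow> 'v \<Rightarrow> bool) \<Rightarrow> bool" where
  "is_tree adj \<longleftrightarrow> simple_graph adj \<and> graph_connected adj \<and> (\<nexists>xs. graph_cycle adj xs)"

definition gdist :: "('v \<Rightarrow> 'v \<Rightarrow> bool) \<Rightarrow> 'v \<Rightarrow> 'v \<Rightarrow> nat" where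
  "gdist adj x y = (LEAST n. (adj ^^ n) x y)"

definition gdist_set :: "('v \<Rightarrow> 'v \<Rightarrow> bool) \<Rightarrow> 'v set \<Rightarrow> 'v \<Rightarrow> nat" where
  "gdist_set adj S x = (INF b\<in>S. gdist adj b x)"

definition gball :: "('v \<Rightarrow> 'v \<Rightarrow> bool) \<Rightarrow> 'v \<Rightarrow> nat \<Rightarrow> 'v set" where
  "gball adj r L = {y. gdist adj r y \<le> L}"

definition bethe_lattice :: "nat \<Rightarrow> ('v \<Rightarrow> 'v \<Rightarrow> bool) \<Rightarrow> bool" where
  "bethe_lattice K adj \<longleftrightarrow> is_tree adj \<and> (\<forall>x. card {y. adj x y} = K + 1)"

text \<open>
  \<open>C n\<close> is the layer at height \<open>n\<close> above the boundary \<open>C 0\<close>. \<open>P\<close> is the partition of \<open>C n\<close>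
  into sets of \<open>K\<close> vertices, and \<open>p S\<close> is the vertex of \<open>C (Suc n)\<close> joined to the members
  of \<open>S\<close>. The layerwise description alone is also satisfied by disjoint unions of several
  canopy trees; that the graph is a tree is therefore a separate condition.
\<close>
definition canopy_tree :: "nat \<Rightarrow> ('c \<Rightarrow> 'c \<Rightarrow> bool) \<Rightarrow> (nat \<Rightarrow> 'c set) \<Rightarrow> bool" where
  "canopy_tree K adj C \<longleftrightarrow>
     is_tree adj \<and> disjoint_family C \<and> (\<Union>n. C n) = UNIV \<and>
     (\<forall>n. countable (C n)) \<and> infinite (C 0) \<and>
     (\<forall>n. \<exists>P p. partition_on (C n) P \<and> (\<forall>S\<in>P. card S = K) \<and> bij_betw p P (C (Suc n)) \<and>
        (\<forall>S\<in>P. \<forall>x\<in>S. \<forall>y\<in>C (Suc n). adj x y \<longleftrightarrow> y = p S)) \<and>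
     (\<forall>x y. adj x y \<longrightarrow>
        (\<exists>n. (x \<in> C n \<and> y \<in> C (Suc n)) \<or> (y \<in> C n \<and> x \<in> C (Suc n))))"


section \<open>Bounded self-adjoint operators on \<open>\<ell>\<^sup>2\<close> and their spectral projections\<close>

text \<open>
  \<open>\<ell>\<^sup>2(U)\<close> consists of the square-summable functions on the whole type that vanish off \<open>U\<close>.
  Operators are plain functions, of which only the values on \<open>ell2 U\<close> matter.
\<close>

definition ell2 :: "'v set \<Rightarrow> ('v \<Rightarrow> complex) set" where
  "ell2 U = {\<psi>. (\<forall>x. x \<notin> U \<longrightarrow> \<psi> x = 0) \<and> (\<lambda>x. (cmod (\<psi> x))\<^sup>2) summable_on UNIV}"

definition ell2_inner :: "('v \<Rightarrow> complex) \<Rightarrow> ('v \<Rightarrow> complex) \<Rightarrow> complex" where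
  "ell2_inner \<phi> \<psi> = (\<Sum>\<^sub>\<infinity>x. cnj (\<phi> x) * \<psi> x)"

definition ell2_norm :: "('v \<Rightarrow> complex) \<Rightarrow> real" where
  "ell2_norm \<psi> = sqrt (\<Sum>\<^sub>\<infinity>x. (cmod (\<psi> x))\<^sup>2)"

definition delta :: "'v \<Rightarrow> 'v \<Rightarrow> complex" where
  "delta x = (\<lambda>y. if y = x then 1 else 0)"

definition chi :: "'v set \<Rightarrow> ('v \<Rightarrow> complex) \<Rightarrow> 'v \<Rightarrow> complex" where
  "chi A \<psi> = (\<lambda>x. if x \<in> A then \<psi> x else 0)"

type_synonym 'v operator = "('v \<Rightarrow> complex) \<Rightarrow> 'v \<Rightarrow> complex"

definition linear_op_on :: "'v set \<Rightarrow> 'v operator \<Rightarrow> bool" where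
  "linear_op_on U A \<longleftrightarrow>
     (\<forall>\<psi>\<in>ell2 U. A \<psi> \<in> ell2 U) \<and>
     (\<forall>\<phi>\<in>ell2 U. \<forall>\<psi>\<in>ell2 U. A (\<lambda>x. \<phi> x + \<psi> x) = (\<lambda>x. A \<phi> x + A \<psi> x)) \<and>
     (\<forall>c. \<forall>\<psi>\<in>ell2 U. A (\<lambda>x. c * \<psi> x) = (\<lambda>x. c * A \<psi> x))"

definition symmetric_on :: "'v set \<Rightarrow> 'v operator \<Rightarrow> bool" where
  "symmetric_on U A \<longleftrightarrow>
     (\<forall>\<phi>\<in>ell2 U. \<forall>\<psi>\<in>ell2 U. ell2_inner \<phi> (A \<psi>) = ell2_inner (A \<phi>) \<psi>)"

definition bounded_self_adjoint_on :: "'v set \<Rightarrow> 'v operator \<Rightarrow> bool" where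
  "bounded_self_adjoint_on U A \<longleftrightarrow> linear_op_on U A \<and> symmetric_on U A \<and>
     (\<exists>c. \<forall>\<psi>\<in>ell2 U. ell2_norm (A \<psi>) \<le> c * ell2_norm \<psi>)"

definition orthogonal_projection_on :: "'v set \<Rightarrow> 'v operator \<Rightarrow> bool" where
  "orthogonal_projection_on U Q \<longleftrightarrow>
     linear_op_on U Q \<and> symmetric_on U Q \<and> (\<forall>\<psi>\<in>ell2 U. Q (Q \<psi>) = Q \<psi>)"

text \<open>
  For families of orthogonal projections, weak countable additivity as required here
  is equivalent to strong countable additivity.
\<close>
definition projection_valued_measure :: "'v set \<Rightarrow> (real set \<Rightarrow> 'v operator) \<Rightarrow> bool" where
  "projection_valued_measure U E \<longleftrightarrow>
     (\<forall>B\<in>sets borel. orthogonal_projection_on U (E B)) \<and>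
     (\<forall>\<psi>\<in>ell2 U. E UNIV \<psi> = \<psi>) \<and>
     (\<forall>B :: nat \<Rightarrow> real set. range B \<subseteq> sets borel \<longrightarrow> disjoint_family B \<longrightarrow>
        (\<forall>\<psi>\<in>ell2 U. (\<lambda>n. ell2_inner \<psi> (E (B n) \<psi>)) sums ell2_inner \<psi> (E (\<Union>n. B n) \<psi>)))"

definition scalar_measure :: "(real set \<Rightarrow> 'v operator) \<Rightarrow> ('v \<Rightarrow> complex) \<Rightarrow> real measure" where
  "scalar_measure E \<psi> =
     measure_of UNIV (sets borel) (\<lambda>B. ennreal (Re (ell2_inner \<psi> (E B \<psi>))))"

text \<open>\<open>A = \<integral> t dE(t)\<close>, where \<open>E\<close> has bounded support because \<open>A\<close> is bounded.\<close>
definition spectral_measure_of ::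
  "'v set \<Rightarrow> 'v operator \<Rightarrow> (real set \<Rightarrow> 'v operator) \<Rightarrow> bool" where
  "spectral_measure_of U A E \<longleftrightarrow>
     projection_valued_measure U E \<and>
     (\<exists>c. \<forall>\<psi>\<in>ell2 U. E {-c..c} \<psi> = \<psi>) \<and>
     (\<forall>\<psi>\<in>ell2 U.
        ell2_inner \<psi> (A \<psi>) = complex_of_real (integral\<^sup>L (scalar_measure E \<psi>) (\<lambda>t. t)))"

text \<open>
  By the spectral theorem, a bounded self-adjoint \<open>A\<close> has a spectral measure, whose values on
  Borel sets and on \<open>ell2 U\<close> are unique. If \<open>A\<close> is not bounded and self-adjoint (for the
  operators below this concerns only an event of probability zero), the result is arbitrary
  but does not depend on \<open>A\<close>.
\<close>
definition spectral_projection :: "'v set \<Rightarrow> 'v operator \<Rightarrow> real set \<Rightarrow> 'v operator" where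
  "spectral_projection U A =
     (SOME E. bounded_self_adjoint_on U A \<and> spectral_measure_of U A E)"

text \<open>The trace of an operator on \<open>\<ell>\<^sup>2(U)\<close>, for finite \<open>U\<close>.\<close>
definition trace_on :: "'v set \<Rightarrow> 'v operator \<Rightarrow> complex" where
  "trace_on U A = (\<Sum>x\<in>U. ell2_inner (delta x) (A (delta x)))"


section \<open>The random operators\<close>

definition adjacency_op :: "('v \<Rightarrow> 'v \<Rightarrow> bool) \<Rightarrow> 'v operator" where
  "adjacency_op adj \<psi> = (\<lambda>x. \<Sum>y | adj x y. \<psi> y)"

text \<open>The sum over \<open>J\<close> is taken pointwise; in the applications the blocks \<open>W y\<close> are disjoint.\<close>
definition block_op ::
  "('v \<Rightarrow> 'v \<Rightarrow> bool) \<Rightarrow> 'v set \<Rightarrow> ('v \<Rightarrow> 'v set) \<Rightarrow> real \<Rightarrow> ('v \<Rightarrow> real) \<Rightarrow> 'v operator" where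
  "block_op adj J W lam om \<psi> = (\<lambda>x. adjacency_op adj \<psi> x +
     complex_of_real lam * (\<Sum>\<^sub>\<infinity>y\<in>J. complex_of_real (om y) * chi (W y) \<psi> x))"

definition precedes :: "('v \<Rightarrow> 'v \<Rightarrow> bool) \<Rightarrow> 'v \<Rightarrow> 'v \<Rightarrow> 'v \<Rightarrow> bool" where
  "precedes adj r y x \<longleftrightarrow> gdist adj r x = gdist adj r y + gdist adj y x"

definition bethe_J :: "nat \<Rightarrow> ('v \<Rightarrow> 'v \<Rightarrow> bool) \<Rightarrow> 'v \<Rightarrow> 'v set" where
  "bethe_J m0 adj r = {x. \<exists>k. gdist adj r x = (m0 + 1) * k}"

definition bethe_block :: "nat \<Rightarrow> ('v \<Rightarrow> 'v \<Rightarrow> bool) \<Rightarrow> 'v \<Rightarrow> 'v \<Rightarrow> 'v set" where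
  "bethe_block m0 adj r y = {x. gdist adj y x \<le> m0 \<and> precedes adj r y x}"

definition bethe_op ::
  "nat \<Rightarrow> ('v \<Rightarrow> 'v \<Rightarrow> bool) \<Rightarrow> 'v \<Rightarrow> real \<Rightarrow> ('v \<Rightarrow> real) \<Rightarrow> 'v operator" where
  "bethe_op m0 adj r = block_op adj (bethe_J m0 adj r) (bethe_block m0 adj r)"

definition bethe_op_ball ::
  "nat \<Rightarrow> ('v \<Rightarrow> 'v \<Rightarrow> bool) \<Rightarrow> 'v \<Rightarrow> real \<Rightarrow> ('v \<Rightarrow> real) \<Rightarrow> nat \<Rightarrow> 'v operator" where
  "bethe_op_ball m0 adj r lam om L \<psi> =
     chi (gball adj r L) (bethe_op m0 adj r lam om (chi (gball adj r L) \<psi>))"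

text \<open>
  The radii \<open>L\<close> for which the ball of radius \<open>L\<close> is a union of complete blocks. For other \<open>L\<close> the
  outermost blocks are cut off, so that near the boundary of the ball the blocks are not those
  of the canopy tree, which has complete blocks at its boundary. The eigenvalue
  distributions then have a different limit in each residue class of \<open>L\<close> modulo \<open>m0 + 1\<close>.
\<close>
definition block_radius :: "nat \<Rightarrow> nat \<Rightarrow> nat" where
  "block_radius m0 k = m0 + (m0 + 1) * k"

definition canopy_J :: "nat \<Rightarrow> ('c \<Rightarrow> 'c \<Rightarrow> bool) \<Rightarrow> 'c set \<Rightarrow> 'c set" where
  "canopy_J m0 adj bd = {y. \<exists>k. gdist_set adj bd y = m0 + (m0 + 1) * k}"

definition canopy_block :: "nat \<Rightarrow> ('c \<Rightarrow> 'c \<Rightarrow> bool) \<Rightarrow> 'c set \<Rightarrow> 'c \<Rightarrow> 'c set" where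
  "canopy_block m0 adj bd y =
     {x. gdist adj y x \<le> m0 \<and> gdist_set adj bd y = gdist_set adj bd x + gdist adj x y}"

definition canopy_op ::
  "nat \<Rightarrow> ('c \<Rightarrow> 'c \<Rightarrow> bool) \<Rightarrow> 'c set \<Rightarrow> real \<Rightarrow> ('c \<Rightarrow> real) \<Rightarrow> 'c operator" where
  "canopy_op m0 adj bd = block_op adj (canopy_J m0 adj bd) (canopy_block m0 adj bd)"

text \<open>As an element of \<open>L\<^sup>\<infinity>\<close>, a density is only determined almost everywhere.\<close>
definition bounded_compact_density :: "(real \<Rightarrow> real) \<Rightarrow> bool" where
  "bounded_compact_density \<rho> \<longleftrightarrow>
     \<rho> \<in> borel_measurable borel \<and> (AE t in lborel. 0 \<le> \<rho> t) \<and>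
     (\<exists>c. AE t in lborel. \<rho> t \<le> c) \<and>
     (\<exists>R. AE t in lborel. R < \<bar>t\<bar> \<longrightarrow> \<rho> t = 0) \<and>
     integral\<^sup>L lborel \<rho> = 1"

definition iid_density :: "'a measure \<Rightarrow> (real \<Rightarrow> real) \<Rightarrow> ('v \<Rightarrow> 'a \<Rightarrow> real) \<Rightarrow> 'v set \<Rightarrow> bool" where
  "iid_density M \<rho> \<omega> J \<longleftrightarrow>
     prob_space M \<and> prob_space.indep_vars M (\<lambda>_. borel) \<omega> J \<and>
     (\<forall>y\<in>J. distributed M lborel (\<omega> y) (\<lambda>t. ennreal (\<rho> t)))"

definition canopy_dos :: "nat \<Rightarrow> nat \<Rightarrow> real \<Rightarrow> ('c \<Rightarrow> 'c \<Rightarrow> bool) \<Rightarrow> 'c set \<Rightarrow>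
    'b measure \<Rightarrow> ('c \<Rightarrow> 'b \<Rightarrow> real) \<Rightarrow> (nat \<Rightarrow> 'c) \<Rightarrow> real set \<Rightarrow> real" where
  "canopy_dos K m0 lam adj bd M \<omega> x B =
     (real K - 1) / real K * (\<Sum>n. (1 / real K ^ n) *
       (\<integral>s. Re (ell2_inner (delta (x n))
          (spectral_projection UNIV (canopy_op m0 adj bd lam (\<lambda>y. \<omega> y s)) B (delta (x n)))) \<partial>M))"

end

theory Submission
  imports Defs "HOL-Complex_Analysis.Complex_Analysis" "HOL-Real_Asymp.Real_Asymp"
begin

text \<open>
  The traces and the density of states are integrals of spectral measures at vertices, all
  supported in one compact interval, so it suffices to let moments converge. The \<open>p\<close>-th moment at
  a vertex depends only on the random variables in the subtree below its \<open>p\<close>-th ancestor. For a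
  vertex at distance \<open>n\<close> from the boundary of the ball, this subtree is isomorphic to the one in the
  canopy tree, so the moments have the same expectation, and moments at vertices of one layer with
  different ancestors are independent. The variance of the layer averages decays exponentially in
  the radius, hence they converge almost surely. The layers have asymptotic weights
  \<open>(K - 1) / K * K\<^sup>-\<^sup>n\<close>, which gives the limit by dominated convergence.

  Absolute continuity comes from spectral averaging over the variable of a single block: as the
  block potential is nonnegative, the Poisson integrals of the averaged spectral measure are
  uniformly bounded. It also makes the endpoints of an interval null sets of the limit measure, which
  turns convergence of moments into convergence on intervals.
\<close>

section \<open>Compactly supported measures and their moments\<close>

text \<open>\<open>spectral_projection\<close> is a Hilbert choice, so nothing is known about it
  until some spectral measure exists and all of them agree on diagonal matrix elements. Existence
  starts from moments: positivity of Bernstein products of the operator yields a measure for every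
  vector by Hausdorff's theorem, and closing the polynomials in L^2 yields the projections.
  Agreement comes from comparing the operator with step functions of an arbitrary spectral measure.

  Three obstacles shape the probabilistic half. The variables are bounded only almost surely, so
  measures are attached to cut-off variables and tied back to the projections outside a null set. A
  subtree determines a moment only if it contains its blocks entirely and has its top below the root
  of the ball; this dictates how far up an ancestor is taken. Finally, the weights of the layers are
  those of a geometric distribution, so the limit is itself a mixture of probability measures, and
  the bound from spectral averaging, being the same at every vertex, passes to it.\<close>

definition supported :: "real \<Rightarrow> real measure \<Rightarrow> bool" where
  "supported c \<mu> \<longleftrightarrow> finite_measure \<mu> \<and> sets \<mu> = sets borel \<and> (AE t in \<mu>. \<bar>t\<bar> \<le> c)"

lemma supportedD:
  assumes "supported c \<mu>"
  shows "finite_measure \<mu>" "sets \<mu> = sets borel" "AE t in \<mu>. \<bar>t\<bar> \<le> c" "space \<mu> = UNIV"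
  using assms sets_eq_imp_space_eq[of \<mu> borel] by (auto simp: supported_def)

lemma supported_measurable:
  assumes "supported c \<mu>" and "f \<in> measurable borel N"
  shows "f \<in> measurable \<mu> N"
  using assms(2) measurable_cong_sets[OF supportedD(2)[OF assms(1)] refl] by blast

lemma supported_mono:
  assumes "supported c \<mu>" "c \<le> d"
  shows "supported d \<mu>"
  using assms by (auto simp: supported_def elim: eventually_mono)

lemma supported_integrable:
  fixes f :: "real \<Rightarrow> real"
  assumes s: "supported c \<mu>" and f: "f \<in> borel_measurable borel"
    and b: "\<And>t. \<bar>t\<bar> \<le> c \<Longrightarrow> \<bar>f t\<bar> \<le> B"
  shows "integrable \<mu> f"
proof -
  interpret finite_measure \<mu> using supportedD(1)[OF s] .
  show ?thesis
  proof (rule integrable_const_bound[where B=B])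
    show "AE x in \<mu>. norm (f x) \<le> B"
      using supportedD(3)[OF s] by eventually_elim (use b in auto)
    show "f \<in> borel_measurable \<mu>" using supported_measurable[OF s f] .
  qed
qed

lemma supported_null: "supported c (null_measure borel)"
  unfolding supported_def
proof (intro conjI)
  show "AE t in null_measure borel. \<bar>t\<bar> \<le> c" by (rule AE_I[where N=UNIV]) auto
qed (auto intro: finite_measureI)

lemma poly_borel [measurable]: "poly (p :: real poly) \<in> borel_measurable borel"
  by (intro borel_measurable_continuous_onI continuous_intros)

lemma poly_bounded_on_interval:
  fixes p :: "real poly"
  obtains B where "B \<ge> 0" "\<And>t. \<bar>t\<bar> \<le> c \<Longrightarrow> \<bar>poly p t\<bar> \<le> B"
proof -
  have "compact (poly p ` {-c..c})"
    by (intro compact_continuous_image continuous_intros) auto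
  then obtain B where "\<forall>y \<in> poly p ` {-c..c}. norm y \<le> B"
    using bounded_iff compact_imp_bounded by blast
  then have "\<bar>poly p t\<bar> \<le> B" if "\<bar>t\<bar> \<le> c" for t using that by (fastforce simp: abs_le_iff)
  then have "\<bar>poly p t\<bar> \<le> max 0 B" if "\<bar>t\<bar> \<le> c" for t using that by (simp add: le_max_iff_disj)
  then show ?thesis using that[of "max 0 B"] by auto
qed

lemma supported_integrable_poly: "supported c \<mu> \<Longrightarrow> integrable \<mu> (poly p)"
  using poly_bounded_on_interval[of c p] supported_integrable[OF _ poly_borel] by metis

lemma supported_integrable_cont:
  fixes f :: "real \<Rightarrow> real"
  assumes "supported c \<mu>" "continuous_on UNIV f"
  shows "integrable \<mu> f"
proof -
  have "compact (f ` {-c..c})"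
    using assms(2) by (intro compact_continuous_image) (auto intro: continuous_on_subset)
  then obtain B where "\<forall>y \<in> f ` {-c..c}. norm y \<le> B"
    using bounded_iff compact_imp_bounded by blast
  then have "\<bar>f t\<bar> \<le> B" if "\<bar>t\<bar> \<le> c" for t using that by (fastforce simp: abs_le_iff)
  then show ?thesis
    using assms by (intro supported_integrable borel_measurable_continuous_onI) auto
qed

lemma weierstrass_interval:
  fixes f :: "real \<Rightarrow> real"
  assumes "continuous_on {-c..c} f" "0 < e"
  obtains p :: "real poly" where "\<And>t. \<bar>t\<bar> \<le> c \<Longrightarrow> \<bar>f t - poly p t\<bar> < e"
proof -
  obtain g where g: "real_polynomial_function g" "\<And>x. x \<in> {-c..c} \<Longrightarrow> \<bar>f x - g x\<bar> < e"
    using Stone_Weierstrass_real_polynomial_function[OF _ assms] by blast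
  then obtain a n where an: "g = (\<lambda>x. \<Sum>i\<le>n. a i * x^i)"
    by (auto simp: real_polynomial_function_iff_sum)
  let ?p = "\<Sum>i\<le>n. monom (a i) i"
  have "poly ?p x = g x" for x by (simp add: an poly_sum poly_monom)
  then show ?thesis using g(2) that[of ?p] by (auto simp: abs_le_iff)
qed

text \<open>The ramp \<open>g i\<close> falls from 1 to 0 with slope \<open>-i\<close> to the right
  of \<open>a\<close>, and Weierstrass replaces it by a polynomial with error below
  \<open>1 / (i + 1)\<close>. The bound 2 is the height of the ramp plus the largest such
  error.\<close>

lemma poly_step:
  obtains p :: "nat \<Rightarrow> real poly"
  where "\<And>t. \<bar>t\<bar> \<le> c \<Longrightarrow> (\<lambda>i. poly (p i) t) \<longlonglongrightarrow> indicator {..a} t"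
    and "\<And>i t. \<bar>t\<bar> \<le> c \<Longrightarrow> \<bar>poly (p i) t\<bar> \<le> 2"
proof -
  define g where "g i t = max 0 (min 1 (1 - real i * (t - a)))" for i t
  have "\<exists>p. \<forall>t. \<bar>t\<bar> \<le> c \<longrightarrow> \<bar>g i t - poly p t\<bar> < 1 / real (Suc i)" for i
  proof -
    have "continuous_on {-c..c} (g i)" unfolding g_def by (intro continuous_intros)
    moreover have "0 < 1 / real (Suc i)" by simp
    ultimately show ?thesis using weierstrass_interval by metis
  qed
  then obtain p where p: "\<And>i t. \<bar>t\<bar> \<le> c \<Longrightarrow> \<bar>g i t - poly (p i) t\<bar> < 1 / real (Suc i)" by metis
  have "(\<lambda>i. poly (p i) t) \<longlonglongrightarrow> indicator {..a} t" if t: "\<bar>t\<bar> \<le> c" for t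
  proof -
    have 1: "(\<lambda>i. g i t - poly (p i) t) \<longlonglongrightarrow> 0"
    proof (rule Lim_null_comparison)
      show "\<forall>\<^sub>F i in sequentially. norm (g i t - poly (p i) t) \<le> 1 / real (Suc i)"
        using p[OF t] by (auto intro!: always_eventually less_imp_le)
      show "(\<lambda>i. 1 / real (Suc i)) \<longlonglongrightarrow> 0" by (rule LIMSEQ_Suc[OF lim_const_over_n])
    qed
    have 2: "(\<lambda>i. g i t) \<longlonglongrightarrow> indicator {..a} t"
    proof (cases "t \<le> a")
      case True
      then have "g i t = 1" for i by (auto simp: g_def mult_nonneg_nonpos)
      then show ?thesis using True by simp
    next
      case False
      obtain n where n: "real n * (t - a) > 1" using reals_Archimedean3[of "t-a"] False by auto
      have "g i t = 0" if "i \<ge> n" for i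
      proof -
        have "real n * (t - a) \<le> real i * (t - a)" using that False by (intro mult_right_mono) auto
        then show ?thesis using n by (simp add: g_def)
      qed
      then have "\<forall>\<^sub>F i in sequentially. g i t = 0" by (auto simp: eventually_sequentially)
      then show ?thesis using False by (simp add: tendsto_eventually)
    qed
    show ?thesis using tendsto_diff[OF 2 1] by simp
  qed
  moreover have "\<bar>poly (p i) t\<bar> \<le> 2" if t: "\<bar>t\<bar> \<le> c" for i t
  proof -
    have "1 / real (Suc i) \<le> 1" by simp
    moreover have "\<bar>g i t\<bar> \<le> 1" by (simp add: g_def)
    ultimately show ?thesis using p[OF t, of i] by linarith
  qed
  ultimately show ?thesis using that by blast
qed

lemma supported_dominated_convergence:
  fixes f :: "nat \<Rightarrow> real \<Rightarrow> real"
  assumes s: "supported c \<mu>" and [measurable]: "\<And>i. f i \<in> borel_measurable borel" "g \<in> borel_measurable borel"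
    and l: "\<And>t. \<bar>t\<bar> \<le> c \<Longrightarrow> (\<lambda>i. f i t) \<longlonglongrightarrow> g t"
    and b: "\<And>i t. \<bar>t\<bar> \<le> c \<Longrightarrow> \<bar>f i t\<bar> \<le> B"
  shows "(\<lambda>i. integral\<^sup>L \<mu> (f i)) \<longlonglongrightarrow> integral\<^sup>L \<mu> g"
proof (rule integral_dominated_convergence[where w="\<lambda>_. B"])
  interpret finite_measure \<mu> using supportedD(1)[OF s] .
  show "integrable \<mu> (\<lambda>_. B)" by simp
  show "AE x in \<mu>. (\<lambda>i. f i x) \<longlonglongrightarrow> g x"
    using supportedD(3)[OF s] by eventually_elim (use l in auto)
  show "AE x in \<mu>. norm (f i x) \<le> B" for i
    using supportedD(3)[OF s] by eventually_elim (use b in auto)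
qed (auto intro: supported_measurable[OF s])

text \<open>Polynomial steps recover the mass of every half-line from the moments, and half-lines
  are an intersection-stable generator.\<close>

lemma supported_moment_unique:
  assumes s: "supported c \<mu>" "supported c \<nu>"
    and m: "\<And>p. integral\<^sup>L \<mu> (poly p) = integral\<^sup>L \<nu> (poly p)"
  shows "\<mu> = \<nu>"
proof -
  interpret \<mu>: finite_measure \<mu> using supportedD(1)[OF s(1)] .
  interpret \<nu>: finite_measure \<nu> using supportedD(1)[OF s(2)] .
  have st: "measure \<mu> {..a} = measure \<nu> {..a}" for a
  proof -
    obtain p :: "nat \<Rightarrow> real poly" where p: "\<And>t. \<bar>t\<bar> \<le> c \<Longrightarrow> (\<lambda>i. poly (p i) t) \<longlonglongrightarrow> indicator {..a} t"
      "\<And>i t. \<bar>t\<bar> \<le> c \<Longrightarrow> \<bar>poly (p i) t\<bar> \<le> 2"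
      using poly_step[where a=a and c=c] by blast
    have "(\<lambda>i. integral\<^sup>L \<mu> (poly (p i))) \<longlonglongrightarrow> integral\<^sup>L \<mu> (indicator {..a})"
      by (rule supported_dominated_convergence[OF s(1)]) (use p in auto)
    moreover have "(\<lambda>i. integral\<^sup>L \<nu> (poly (p i))) \<longlonglongrightarrow> integral\<^sup>L \<nu> (indicator {..a})"
      by (rule supported_dominated_convergence[OF s(2)]) (use p in auto)
    ultimately have "integral\<^sup>L \<mu> (indicator {..a} :: real \<Rightarrow> real) = integral\<^sup>L \<nu> (indicator {..a})"
      using LIMSEQ_unique unfolding m by blast
    then show ?thesis using supportedD(2)[OF s(1)] supportedD(2)[OF s(2)] supportedD(4)[OF s(1)] supportedD(4)[OF s(2)]
      by simp
  qed
  show ?thesis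
  proof (rule measure_eqI_generator_eq[where \<Omega>=UNIV and E="range (\<lambda>a::real. {..a})" and A="\<lambda>i. {..real i}"])
    show "Int_stable (range (\<lambda>a::real. {..a}))" by (auto simp: Int_stable_def)
    show "sets \<mu> = sigma_sets UNIV (range (\<lambda>a::real. {..a}))"
      "sets \<nu> = sigma_sets UNIV (range (\<lambda>a::real. {..a}))"
      using supportedD(2)[OF s(1)] supportedD(2)[OF s(2)] by (simp_all add: borel_eq_atMost)
    show "(\<Union>i. {..real i}) = UNIV" using real_arch_simple by auto
    show "emeasure \<mu> X = emeasure \<nu> X" if "X \<in> range (\<lambda>a::real. {..a})" for X
      using that st by (auto simp: \<mu>.emeasure_eq_measure \<nu>.emeasure_eq_measure)
  qed auto
qed

lemma integral_poly_moments:
  assumes s: "supported c \<mu>"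
  shows "integral\<^sup>L \<mu> (poly p) = (\<Sum>i\<le>degree p. coeff p i * integral\<^sup>L \<mu> (\<lambda>t. t^i))"
proof -
  have "poly (monom 1 i) = (\<lambda>t::real. t^i)" for i by (simp add: fun_eq_iff poly_monom)
  then have "integrable \<mu> (\<lambda>t. t^i)" for i
    using supported_integrable_poly[OF s, of "monom 1 i"] by simp
  moreover have "poly p = (\<lambda>t. \<Sum>i\<le>degree p. coeff p i * t^i)" by (simp add: fun_eq_iff poly_altdef)
  ultimately show ?thesis by simp
qed

text \<open>Total mass 1 turns a uniform polynomial error on [-c, c] into an error of the integrals
  that is the same for all \<open>n\<close>; convergence for the polynomial itself is a finite
  combination of moments.\<close>

lemma moment_convergence_continuous:
  fixes f :: "real \<Rightarrow> real"
  assumes s: "\<And>n::nat. supported c (\<mu> n)" "supported c \<nu>"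
    and m: "\<And>i. (\<lambda>n. integral\<^sup>L (\<mu> n) (\<lambda>t. t^i)) \<longlonglongrightarrow> integral\<^sup>L \<nu> (\<lambda>t. t^i)"
    and f: "continuous_on UNIV f"
    and pr: "\<And>n. prob_space (\<mu> n)" "prob_space \<nu>"
  shows "(\<lambda>n. integral\<^sup>L (\<mu> n) f) \<longlonglongrightarrow> integral\<^sup>L \<nu> f"
proof (rule LIMSEQ_I)
  fix e :: real assume e: "0 < e"
  then have "0 < e/4" by simp
  then obtain p where p: "\<And>t. \<bar>t\<bar> \<le> c \<Longrightarrow> \<bar>f t - poly p t\<bar> < e/4"
    using weierstrass_interval[OF continuous_on_subset[OF f subset_UNIV]] by metis
  have cl: "\<bar>integral\<^sup>L M f - integral\<^sup>L M (poly p)\<bar> \<le> e/4" if M: "supported c M" "prob_space M" for M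
  proof -
    interpret prob_space M using M(2) .
    have I: "integrable M f" "integrable M (poly p)"
      using supported_integrable_cont[OF M(1) f] supported_integrable_poly[OF M(1)] by auto
    have "\<bar>integral\<^sup>L M (\<lambda>t. f t - poly p t)\<bar> \<le> integral\<^sup>L M (\<lambda>t. \<bar>f t - poly p t\<bar>)" by (rule integral_abs_bound)
    also have "\<dots> \<le> integral\<^sup>L M (\<lambda>t. e/4)"
      using I supportedD(3)[OF M(1)] p by (intro integral_mono_AE) (auto elim!: eventually_mono intro: less_imp_le)
    also have "\<dots> = e/4" by (simp add: prob_space)
    finally show ?thesis using I by simp
  qed
  have "(\<lambda>n. integral\<^sup>L (\<mu> n) (poly p)) \<longlonglongrightarrow> integral\<^sup>L \<nu> (poly p)"
    unfolding integral_poly_moments[OF s(1)] integral_poly_moments[OF s(2)]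
    by (intro tendsto_intros m)
  then obtain n0 where n0: "\<And>n. n \<ge> n0 \<Longrightarrow> norm (integral\<^sup>L (\<mu> n) (poly p) - integral\<^sup>L \<nu> (poly p)) < e/4"
    using LIMSEQ_D[OF _ \<open>0 < e/4\<close>] by metis
  have "norm (integral\<^sup>L (\<mu> n) f - integral\<^sup>L \<nu> f) < e" if "n \<ge> n0" for n
    using n0[OF that] cl[OF s(1) pr(1), of n] cl[OF s(2) pr(2)] e unfolding real_norm_def by linarith
  then show "\<exists>no. \<forall>n\<ge>no. norm (integral\<^sup>L (\<mu> n) f - integral\<^sup>L \<nu> f) < e" by blast
qed

text \<open>A single polynomial has to serve all measures of \<open>S\<close>: identities between
  several vectors, such as additivity of \<open>ind_op\<close>, are later obtained as limits along
  one common sequence of polynomials. The induction is over the Borel sets generated by half-lines,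
  with complements and disjoint unions.\<close>

lemma poly_dense_L2:
  assumes fin: "finite S" and s: "\<And>\<mu>. \<mu> \<in> S \<Longrightarrow> supported c \<mu>"
    and B: "B \<in> sets borel" and e: "0 < e"
  shows "\<exists>p. \<forall>\<mu>\<in>S. integral\<^sup>L \<mu> (\<lambda>t. (poly p t - indicator B t)\<^sup>2) < e"
proof -
  have I: "integrable \<mu> (\<lambda>t. (poly p t - indicator B t)\<^sup>2)" if "\<mu> \<in> S" "B \<in> sets borel" for \<mu> p B
  proof -
    obtain K where K: "K \<ge> 0" "\<And>t. \<bar>t\<bar> \<le> c \<Longrightarrow> \<bar>poly p t\<bar> \<le> K" using poly_bounded_on_interval by blast
    show ?thesis
    proof (rule supported_integrable[OF s[OF that(1)], where B="(K+1)\<^sup>2"])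
      fix t assume "\<bar>t\<bar> \<le> c"
      then have "\<bar>poly p t - indicator B t\<bar> \<le> K + 1" using K(2)[of t] by (auto simp: indicator_def)
      then show "\<bar>(poly p t - indicator B t)\<^sup>2\<bar> \<le> (K+1)\<^sup>2" using K(1) by (simp add: abs_le_square_iff[symmetric])
    qed (use that(2) in measurable)
  qed
  have bs: "sets (borel :: real measure) = sigma_sets UNIV (range (\<lambda>a::real. {..a}))"
    by (simp add: borel_eq_atMost)
  have IS: "Int_stable (range (\<lambda>a::real. {..a}))" by (auto simp: Int_stable_def)
  have PW: "range (\<lambda>a::real. {..a}) \<subseteq> Pow UNIV" by simp
  have "B \<in> sigma_sets UNIV (range (\<lambda>a::real. {..a}))" using B bs by simp
  \<comment> \<open>The claim is made for all tolerances so that the hypotheses can be used at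
    \<open>e / 4\<close>: the squared error of a disjoint union is at most twice the sum of the
    squared errors of its two parts.\<close>
  with IS PW have "\<forall>e>0. \<exists>p. \<forall>\<mu>\<in>S. integral\<^sup>L \<mu> (\<lambda>t. (poly p t - indicator B t)\<^sup>2) < e"
  proof (induction rule: sigma_sets_induct_disjoint)
    case (basic A)
    then obtain a where A: "A = {..a}" by auto
    obtain p :: "nat \<Rightarrow> real poly" where p: "\<And>t. \<bar>t\<bar> \<le> c \<Longrightarrow> (\<lambda>i. poly (p i) t) \<longlonglongrightarrow> indicator {..a} t"
      "\<And>i t. \<bar>t\<bar> \<le> c \<Longrightarrow> \<bar>poly (p i) t\<bar> \<le> 2"
      using poly_step[where a=a and c=c] by blast
    show ?case
    proof (intro allI impI)
      fix e :: real assume e: "e > 0"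
      have "\<forall>\<mu>\<in>S. \<forall>\<^sub>F i in sequentially. integral\<^sup>L \<mu> (\<lambda>t. (poly (p i) t - indicator A t)\<^sup>2) < e"
      proof
        fix \<mu> assume "\<mu> \<in> S"
        have "(\<lambda>i. integral\<^sup>L \<mu> (\<lambda>t. (poly (p i) t - indicator A t)\<^sup>2)) \<longlonglongrightarrow> integral\<^sup>L \<mu> (\<lambda>t. 0)"
        proof (rule supported_dominated_convergence[OF s[OF \<open>\<mu> \<in> S\<close>], where B="9"])
          fix t :: real assume t: "\<bar>t\<bar> \<le> c"
          have "(\<lambda>i. (poly (p i) t - indicator A t)\<^sup>2) \<longlonglongrightarrow> (indicator A t - indicator A t)\<^sup>2"
            unfolding A by (intro tendsto_intros p t)
          then show "(\<lambda>i. (poly (p i) t - indicator A t)\<^sup>2) \<longlonglongrightarrow> 0" by simp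
        next
          fix i and t :: real assume t: "\<bar>t\<bar> \<le> c"
          have "\<bar>poly (p i) t - indicator A t\<bar> \<le> 3" using p(2)[OF t, of i] by (auto simp: indicator_def)
          then have "(poly (p i) t - indicator A t)\<^sup>2 \<le> 3\<^sup>2" using abs_le_square_iff[of "poly (p i) t - indicator A t" 3] by simp
          then show "\<bar>(poly (p i) t - indicator A t)\<^sup>2\<bar> \<le> 9" by simp
        qed (auto simp: A)
        then show "\<forall>\<^sub>F i in sequentially. integral\<^sup>L \<mu> (\<lambda>t. (poly (p i) t - indicator A t)\<^sup>2) < e"
          using e by (simp add: order_tendsto_iff)
      qed
      then have "\<forall>\<^sub>F i in sequentially. \<forall>\<mu>\<in>S. integral\<^sup>L \<mu> (\<lambda>t. (poly (p i) t - indicator A t)\<^sup>2) < e"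
        using fin by (simp add: eventually_ball_finite_distrib)
      then show "\<exists>p. \<forall>\<mu>\<in>S. integral\<^sup>L \<mu> (\<lambda>t. (poly p t - indicator A t)\<^sup>2) < e"
        using eventually_happens'[OF sequentially_bot] by blast
    qed
  next
    case empty
    show ?case by (intro allI impI exI[of _ 0]) simp
  next
    case (compl A)
    show ?case
    proof (intro allI impI)
      fix e :: real assume e: "e > 0"
      obtain p where p: "\<forall>\<mu>\<in>S. integral\<^sup>L \<mu> (\<lambda>t. (poly p t - indicator A t)\<^sup>2) < e" using compl e by blast
      have "(\<lambda>t. (poly (1-p) t - indicator (UNIV - A) t)\<^sup>2) = (\<lambda>t. (poly p t - indicator A t)\<^sup>2)"
        by (rule ext) (auto simp: indicator_def power2_commute)
      then show "\<exists>p. \<forall>\<mu>\<in>S. integral\<^sup>L \<mu> (\<lambda>t. (poly p t - indicator (UNIV - A) t)\<^sup>2) < e"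
        using p by (intro exI[of _ "1-p"]) simp
    qed
  next
    case (union A)
    have Am: "A i \<in> sets borel" for i using union(2) bs by auto
    have two: "integral\<^sup>L \<mu> (\<lambda>t. (poly (p+q) t - indicator (X \<union> Y) t)\<^sup>2)
        \<le> 2 * integral\<^sup>L \<mu> (\<lambda>t. (poly p t - indicator X t)\<^sup>2) + 2 * integral\<^sup>L \<mu> (\<lambda>t. (poly q t - indicator Y t)\<^sup>2)"
      if "X \<inter> Y = {}" "\<mu> \<in> S" "X \<in> sets borel" "Y \<in> sets borel" for X Y p q \<mu>
    proof -
      have "(a+b)\<^sup>2 \<le> 2*a\<^sup>2 + 2*b\<^sup>2" for a b :: real
        using sum_squares_bound[of a b] by (simp add: power2_sum)
      moreover have "poly (p+q) t - indicator (X \<union> Y) t = (poly p t - indicator X t) + (poly q t - indicator Y t)" for t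
        using that(1) by (auto simp: indicator_def)
      ultimately have pt: "(poly (p+q) t - indicator (X \<union> Y) t)\<^sup>2 \<le> 2 * (poly p t - indicator X t)\<^sup>2 + 2 * (poly q t - indicator Y t)\<^sup>2" for t
        by metis
      have "integral\<^sup>L \<mu> (\<lambda>t. (poly (p+q) t - indicator (X \<union> Y) t)\<^sup>2)
        \<le> integral\<^sup>L \<mu> (\<lambda>t. 2 * (poly p t - indicator X t)\<^sup>2 + 2 * (poly q t - indicator Y t)\<^sup>2)"
      proof (rule integral_mono)
        show "integrable \<mu> (\<lambda>t. (poly (p+q) t - indicator (X \<union> Y) t)\<^sup>2)"
          using that by (intro I) auto
        show "integrable \<mu> (\<lambda>t. 2 * (poly p t - indicator X t)\<^sup>2 + 2 * (poly q t - indicator Y t)\<^sup>2)"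
          by (intro Bochner_Integration.integrable_add integrable_mult_right I that)
      qed (rule pt)
      then show ?thesis using I that by simp
    qed
    have dis: "A i \<inter> A j = {}" if "i \<noteq> j" for i j using union(1) that by (auto simp: disjoint_family_on_def)
    have fu: "\<forall>e>0. \<exists>p. \<forall>\<mu>\<in>S. integral\<^sup>L \<mu> (\<lambda>t. (poly p t - indicator (\<Union>i<n. A i) t)\<^sup>2) < e" for n
    proof (induction n)
      case 0 show ?case by (intro allI impI exI[of _ 0]) simp
    next
      case (Suc n)
      show ?case
      proof (intro allI impI)
        fix e :: real assume "e > 0"
        then have e: "e/4 > 0" by simp
        obtain p where p: "\<forall>\<mu>\<in>S. integral\<^sup>L \<mu> (\<lambda>t. (poly p t - indicator (\<Union>i<n. A i) t)\<^sup>2) < e/4" using Suc e by blast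
        obtain q where q: "\<forall>\<mu>\<in>S. integral\<^sup>L \<mu> (\<lambda>t. (poly q t - indicator (A n) t)\<^sup>2) < e/4" using union(3) e by blast
        have U: "(\<Union>i<Suc n. A i) = (\<Union>i<n. A i) \<union> A n" by (auto simp: less_Suc_eq)
        have "A i \<inter> A n = {}" if "i < n" for i using dis[of i n] that by auto
        then have D: "(\<Union>i<n. A i) \<inter> A n = {}" by blast
        have mU: "(\<Union>i<n. A i) \<in> sets borel" using Am by auto
        have "\<forall>\<mu>\<in>S. integral\<^sup>L \<mu> (\<lambda>t. (poly (p+q) t - indicator (\<Union>i<Suc n. A i) t)\<^sup>2) < e"
        proof
          fix \<mu> assume m: "\<mu> \<in> S"
          show "integral\<^sup>L \<mu> (\<lambda>t. (poly (p+q) t - indicator (\<Union>i<Suc n. A i) t)\<^sup>2) < e"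
            unfolding U using two[OF D m mU Am, of p q] bspec[OF p m] bspec[OF q m] by linarith
        qed
        then show "\<exists>p. \<forall>\<mu>\<in>S. integral\<^sup>L \<mu> (\<lambda>t. (poly p t - indicator (\<Union>i<Suc n. A i) t)\<^sup>2) < e" by blast
      qed
    qed
    show ?case
    proof (intro allI impI)
      fix e :: real assume "e > 0"
      then have e: "e/4 > 0" by simp
      \<comment> \<open>By disjointness a point lies in at most one \<open>A i\<close>, so the tails
        of the union decrease to the empty set and the polynomial 0 approximates them.\<close>
      have "\<forall>\<mu>\<in>S. \<forall>\<^sub>F n in sequentially. integral\<^sup>L \<mu> (\<lambda>t. (poly 0 t - indicator (\<Union>i\<in>{n..}. A i) t)\<^sup>2) < e/4"
      proof
        fix \<mu> assume "\<mu> \<in> S"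
        have "(\<lambda>n. integral\<^sup>L \<mu> (\<lambda>t. (poly 0 t - indicator (\<Union>i\<in>{n..}. A i) t)\<^sup>2)) \<longlonglongrightarrow> integral\<^sup>L \<mu> (\<lambda>t. 0)"
        proof (rule supported_dominated_convergence[OF s[OF \<open>\<mu> \<in> S\<close>], where B="1"])
          fix t :: real
          have "\<exists>k. \<forall>n\<ge>k. t \<notin> (\<Union>i\<in>{n..}. A i)"
          proof (cases "\<exists>i. t \<in> A i")
            case True
            then obtain i where i: "t \<in> A i" by blast
            then have "t \<notin> A j" if "j \<ge> Suc i" for j using dis[of i j] that by auto
            then show ?thesis by (intro exI[of _ "Suc i"]) auto
          qed auto
          then obtain k where "\<forall>n\<ge>k. t \<notin> (\<Union>i\<in>{n..}. A i)" by blast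
          then have "(poly 0 t - indicator (\<Union>i\<in>{n..}. A i) t)\<^sup>2 = (0::real)" if "n \<ge> k" for n
            using that by (simp add: indicator_def)
          then have "\<forall>\<^sub>F n in sequentially. (poly 0 t - indicator (\<Union>i\<in>{n..}. A i) t)\<^sup>2 = (0::real)"
            unfolding eventually_sequentially by blast
          then show "(\<lambda>n. (poly 0 t - indicator (\<Union>i\<in>{n..}. A i) t)\<^sup>2) \<longlonglongrightarrow> (0::real)" by (rule tendsto_eventually)
        qed (use Am in \<open>auto simp: indicator_def\<close>)
        then show "\<forall>\<^sub>F n in sequentially. integral\<^sup>L \<mu> (\<lambda>t. (poly 0 t - indicator (\<Union>i\<in>{n..}. A i) t)\<^sup>2) < e/4"
          unfolding Bochner_Integration.integral_zero by (rule order_tendstoD(2)) (rule e)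
      qed
      then have "\<forall>\<^sub>F n in sequentially. \<forall>\<mu>\<in>S. integral\<^sup>L \<mu> (\<lambda>t. (poly 0 t - indicator (\<Union>i\<in>{n..}. A i) t)\<^sup>2) < e/4"
        using fin by (simp add: eventually_ball_finite_distrib)
      then obtain n where n: "\<forall>\<mu>\<in>S. integral\<^sup>L \<mu> (\<lambda>t. (poly 0 t - indicator (\<Union>i\<in>{n..}. A i) t)\<^sup>2) < e/4"
        using eventually_happens'[OF sequentially_bot] by blast
      obtain p where p: "\<forall>\<mu>\<in>S. integral\<^sup>L \<mu> (\<lambda>t. (poly p t - indicator (\<Union>i<n. A i) t)\<^sup>2) < e/4" using fu e by blast
      have U: "(\<Union>i. A i) = (\<Union>i<n. A i) \<union> (\<Union>i\<in>{n..}. A i)"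
      proof -
        have "{..<n} \<union> {n..} = UNIV" by auto
        then show ?thesis by (metis UN_Un)
      qed
      have D: "(\<Union>i<n. A i) \<inter> (\<Union>i\<in>{n..}. A i) = {}"
      proof -
        have "A i \<inter> A j = {}" if "i < n" "j \<ge> n" for i j using dis[of i j] that by auto
        then show ?thesis by blast
      qed
      have mU: "(\<Union>i<n. A i) \<in> sets borel" "(\<Union>i\<in>{n..}. A i) \<in> sets borel" using Am by auto
      have "\<forall>\<mu>\<in>S. integral\<^sup>L \<mu> (\<lambda>t. (poly (p+0) t - indicator (\<Union>i. A i) t)\<^sup>2) < e"
      proof
        fix \<mu> assume m: "\<mu> \<in> S"
        show "integral\<^sup>L \<mu> (\<lambda>t. (poly (p+0) t - indicator (\<Union>i. A i) t)\<^sup>2) < e"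
          unfolding U using two[OF D m mU(1,2), of p 0] bspec[OF p m] bspec[OF n m] by linarith
      qed
      then show "\<exists>p. \<forall>\<mu>\<in>S. integral\<^sup>L \<mu> (\<lambda>t. (poly p t - indicator (\<Union>i. A i) t)\<^sup>2) < e" by blast
    qed
  qed
  then show ?thesis using e by blast
qed

section \<open>The Hausdorff moment problem\<close>

lemma falling_ratio_close:
  fixes k n :: nat
  assumes "k \<le> n" "p < n"
  shows "\<bar>(\<Prod>i<p. (real k - real i) / (real n - real i)) - (real k / real n) ^ p\<bar> \<le> real p * real p / (real n - real p)"
    and "\<bar>\<Prod>i<p. (real k - real i) / (real n - real i)\<bar> \<le> 1"
proof -
  have le1: "\<bar>\<Prod>i<p. (real k - real i) / (real n - real i)\<bar> \<le> 1" if "p < n" for p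
  proof (cases "p \<le> k")
    case True
    have "\<bar>\<Prod>i<p. (real k - real i) / (real n - real i)\<bar> \<le> (\<Prod>i<p. 1)"
      unfolding abs_prod using True assms(1) that by (intro prod_mono) (auto simp: divide_simps)
    then show ?thesis by simp
  next
    case False
    \<comment> \<open>For \<open>k < p\<close> the factor with \<open>i = k\<close> is zero.\<close>
    then have "(\<Prod>i<p. (real k - real i) / (real n - real i)) = 0" by (intro prod_zero) auto
    then show ?thesis by (simp del: prod_zero_iff)
  qed
  show "\<bar>\<Prod>i<p. (real k - real i) / (real n - real i)\<bar> \<le> 1" using le1 assms(2) .
  show "\<bar>(\<Prod>i<p. (real k - real i) / (real n - real i)) - (real k / real n) ^ p\<bar> \<le> real p * real p / (real n - real p)"
    using assms(2)
  proof (induction p)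
    case 0 then show ?case by simp
  next
    case (Suc p)
    let ?a = "\<Prod>i<p. (real k - real i) / (real n - real i)"
    let ?d = "(real k - real p) / (real n - real p) - real k / real n"
    have n: "real n > 0" "real n - real p > 0" using Suc.prems by auto
    have "?d = - (real p * (real n - real k) / (real n * (real n - real p)))"
      using n by (simp add: field_simps)
    also have "\<bar>\<dots>\<bar> = (real n - real k) / real n * (real p / (real n - real p))"
      using n assms(1) by (simp add: abs_mult)
    also have "\<dots> \<le> 1 * (real p / (real n - real p))"
      using n by (intro mult_right_mono) (auto simp: divide_simps)
    finally have d: "\<bar>?d\<bar> \<le> real p / (real n - real p)" by simp
    have "\<bar>(\<Prod>i<Suc p. (real k - real i) / (real n - real i)) - (real k / real n) ^ Suc p\<bar>
        = \<bar>?a * ?d + real k / real n * (?a - (real k / real n) ^ p)\<bar>"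
    proof -
      have "a * y - x * P = a * (y - x) + x * (a - P)" for a y x P :: real by (simp add: algebra_simps)
      then show ?thesis by (simp only: prod.lessThan_Suc power_Suc)
    qed
    also have "\<dots> \<le> \<bar>?a\<bar> * \<bar>?d\<bar> + \<bar>real k / real n\<bar> * \<bar>?a - (real k / real n) ^ p\<bar>"
      unfolding abs_mult[symmetric] by (rule abs_triangle_ineq)
    also have "\<dots> \<le> 1 * (real p / (real n - real p)) + 1 * (real p * real p / (real n - real p))"
      using le1[of p] d Suc.IH Suc.prems n assms(1) by (intro add_mono mult_mono) simp_all
    also have "\<dots> = (real p + real p * real p) / (real n - real p)" by (simp add: add_divide_distrib)
    also have "\<dots> \<le> real (Suc p) * real (Suc p) / (real n - real (Suc p))"
      using Suc.prems n by (intro frac_le) (auto simp: algebra_simps)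
    finally show ?case .
  qed
qed

text \<open>Repeated absorption of one factor into the binomial coefficient. It makes the
  falling-factorial moments of Bernstein weights exact at every finite \<open>n\<close>, while
  \<open>falling_ratio_close\<close> says that the powers of \<open>k / n\<close> differ from the
  falling ratios by O(1/n) only.\<close>

lemma choose_falling:
  assumes "k \<le> n" "p \<le> k" 
  shows "real (n choose k) * (\<Prod>i<p. (real k - real i) / (real n - real i)) = real ((n - p) choose (k - p))"
  using assms(2)
proof (induction p)
  case 0 then show ?case by simp
next
  case (Suc p)
  then have IH: "real (n choose k) * (\<Prod>i<p. (real k - real i) / (real n - real i)) = real ((n - p) choose (k - p))" by simp
  have *: "n - p = Suc (n - Suc p)" "k - p = Suc (k - Suc p)" using Suc.prems assms(1) by auto
  have "real (k - p) * real ((n - p) choose (k - p)) = real (n - p) * real ((n - Suc p) choose (k - Suc p))"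
    unfolding * using Suc_times_binomial_eq[of "n - Suc p" "k - Suc p"] by (metis of_nat_mult mult.commute)
  moreover have "real (k-p) = real k - real p" "real (n-p) = real n - real p" "real n - real p > 0"
    using Suc.prems assms(1) by auto
  ultimately have "real ((n - p) choose (k - p)) * ((real k - real p) / (real n - real p)) = real ((n - Suc p) choose (k - Suc p))"
    by (simp add: field_simps)
  then show ?case using IH by (simp flip: mult.assoc)
qed

lemma poly_functional_eq_moments:
  fixes L :: "real poly \<Rightarrow> real"
  assumes "\<And>p q. L (p + q) = L p + L q" "\<And>a p. L (smult a p) = a * L p"
    and s: "supported c \<mu>" and m: "\<And>i. L (monom 1 i) = integral\<^sup>L \<mu> (\<lambda>t. t^i)"
  shows "L p = integral\<^sup>L \<mu> (poly p)"
proof -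
  have L0: "L 0 = 0" using assms(2)[of 0 0] by simp
  have Ls: "L (\<Sum>i\<in>S. f i) = (\<Sum>i\<in>S. L (f i))" if "finite S" for S :: "nat set" and f
    using that by (induction S) (auto simp: L0 assms(1))
  have "L p = L (\<Sum>i\<le>degree p. smult (coeff p i) (monom 1 i))"
    by (simp add: smult_monom poly_as_sum_of_monoms)
  also have "\<dots> = integral\<^sup>L \<mu> (poly p)"
    by (simp add: Ls assms(2) m integral_poly_moments[OF s])
  finally show ?thesis .
qed

text \<open>\<open>L\<close> applied to the Bernstein polynomials of degree \<open>n\<close> puts
  weights \<open>w n k\<close> on the points \<open>k / n\<close>. Positivity and
  \<open>L 1 = 1\<close> make them probability weights, Helly selection gives a weak limit along a
  subsequence, and its moments are found by passing from falling-factorial moments to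
  powers.\<close>

lemma hausdorff_moment_prob:
  fixes L :: "real poly \<Rightarrow> real"
  assumes add: "\<And>p q. L (p + q) = L p + L q" and smult: "\<And>a p. L (smult a p) = a * L p"
    and pos: "\<And>i j. 0 \<le> L ([:0,1:]^i * [:1,-1:]^j)" and one: "L 1 = 1"
  shows "\<exists>\<mu>. real_distribution \<mu> \<and> (AE t in \<mu>. 0 \<le> t \<and> t \<le> 1) \<and> (\<forall>i. L (monom 1 i) = integral\<^sup>L \<mu> (\<lambda>t. t^i))"
proof -
  let ?X = "[:0,1:] :: real poly" and ?Y = "[:1,-1:] :: real poly"
  have XY: "?X + ?Y = 1" by (simp add: one_pCons)
  have L0: "L 0 = 0" using smult[of 0 0] by simp
  have Ls: "L (\<Sum>i\<in>S. f i) = (\<Sum>i\<in>S. L (f i))" if "finite S" for S :: "nat set" and f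
    using that by (induction S) (auto simp: L0 add)
  have Ln: "L (of_nat m * p) = real m * L p" for m p
    using smult[of "real m" p] by (simp add: of_nat_poly)
  define w where "w n k = real (n choose k) * L (?X^k * ?Y^(n-k))" for n k
  have w0: "w n k \<ge> 0" for n k unfolding w_def using pos by simp
  \<comment> \<open>The falling ratio is absorbed into the binomial coefficient and leaves
    \<open>X^p\<close> times the binomial expansion of \<open>(X + Y)^(n-p)\<close>, where
    \<open>X + Y = 1\<close>.\<close>
  have fall: "(\<Sum>k\<le>n. w n k * (\<Prod>i<p. (real k - real i) / (real n - real i))) = L (?X^p)" if pn: "p \<le> n" for p n
  proof -
    have "(\<Sum>k\<le>n. w n k * (\<Prod>i<p. (real k - real i) / (real n - real i)))
       = (\<Sum>k\<in>{p..n}. w n k * (\<Prod>i<p. (real k - real i) / (real n - real i)))"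
    proof (rule sum.mono_neutral_right)
      show "\<forall>k\<in>{..n} - {p..n}. w n k * (\<Prod>i<p. (real k - real i) / (real n - real i)) = 0"
        by (auto intro!: prod_zero)
    qed auto
    also have "\<dots> = (\<Sum>k\<in>{p..n}. real ((n - p) choose (k - p)) * L (?X^k * ?Y^(n-k)))"
    proof (rule sum.cong[OF refl])
      fix k assume "k \<in> {p..n}"
      then show "w n k * (\<Prod>i<p. (real k - real i) / (real n - real i)) = real ((n - p) choose (k - p)) * L (?X^k * ?Y^(n-k))"
        using choose_falling[of k n p] by (simp add: w_def mult_ac flip: mult.assoc)
    qed
    also have "\<dots> = (\<Sum>j\<le>n-p. real ((n - p) choose j) * L (?X^(j+p) * ?Y^(n-p-j)))"
      by (rule sum.reindex_bij_witness[where i="\<lambda>j. j+p" and j="\<lambda>k. k-p"]) (use pn in auto)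
    also have "\<dots> = L (\<Sum>j\<le>n-p. ?X^p * (of_nat ((n - p) choose j) * ?X^j * ?Y^(n-p-j)))"
      by (simp only: Ls[OF finite_atMost] Ln[symmetric] power_add mult_ac)
    also have "\<dots> = L (?X^p * (?X + ?Y)^(n-p))"
      by (simp only: binomial_ring sum_distrib_left)
    finally show ?thesis by (simp only: XY) simp
  qed
  have wsum: "(\<Sum>k\<le>n. w n k) = 1" for n using fall[of 0 n] one by simp
  define f where "f n k = (if k \<le> n then w n k else 0)" for n k
  have f0: "f n k \<ge> 0" for n k using w0 by (simp add: f_def)
  have fs: "(\<integral>\<^sup>+k. ennreal (f n k) \<partial>count_space UNIV) = 1" for n
  proof -
    have "(\<integral>\<^sup>+k. ennreal (f n k) \<partial>count_space UNIV) = (\<Sum>k\<le>n. ennreal (f n k))"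
      by (rule nn_integral_count_space') (auto simp: f_def)
    also have "\<dots> = ennreal (\<Sum>k\<le>n. w n k)" by (subst sum_ennreal) (auto simp: w0 f_def)
    finally show ?thesis by (simp add: wsum)
  qed
  define P where "P n = embed_pmf (f n)" for n
  have pmfP: "pmf (P n) k = f n k" for n k
    unfolding P_def by (rule pmf_embed_pmf[OF f0 fs])
  have setP: "set_pmf (P n) \<subseteq> {..n}" for n by (auto simp: set_pmf_eq pmfP f_def split: if_splits)
  define \<mu> where "\<mu> n = distr (measure_pmf (P n)) borel (\<lambda>k. real k / real n)" for n
  have rd: "real_distribution (\<mu> n)" for n
    unfolding \<mu>_def by (rule prob_space.real_distribution_distr[OF prob_space_measure_pmf]) simp
  interpret \<mu>: real_distribution "\<mu> n" for n by (rule rd)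
  have int: "integral\<^sup>L (\<mu> n) g = (\<Sum>k\<le>n. w n k * g (real k / real n))" if "g \<in> borel_measurable borel" for g :: "real \<Rightarrow> real" and n
  proof -
    have "integral\<^sup>L (\<mu> n) g = integral\<^sup>L (measure_pmf (P n)) (\<lambda>k. g (real k / real n))"
      unfolding \<mu>_def by (rule integral_distr) (use that in auto)
    also have "\<dots> = (\<Sum>k\<le>n. g (real k / real n) * pmf (P n) k)"
      by (rule integral_measure_pmf_real) (use setP in auto)
    also have "\<dots> = (\<Sum>k\<le>n. w n k * g (real k / real n))"
      by (intro sum.cong) (auto simp: pmfP f_def)
    finally show ?thesis .
  qed
  have "tight \<mu>" unfolding tight_def
  proof (intro conjI allI impI rd)
    fix e :: real assume e: "e > 0"
    have "measure (\<mu> n) {-1<..1} = 1" for n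
    proof -
      have "measure (\<mu> n) {-1<..1} = integral\<^sup>L (\<mu> n) (indicator {-1<..1})" by simp
      also have "\<dots> = (\<Sum>k\<le>n. w n k * indicator {-1<..1} (real k / real n))" by (rule int) auto
      also have "\<dots> = (\<Sum>k\<le>n. w n k)"
        by (intro sum.cong refl) (auto simp: indicator_def divide_simps)
      finally show ?thesis by (simp add: wsum)
    qed
    then show "\<exists>a b. a < b \<and> (\<forall>n. 1 - e < measure (\<mu> n) {a<..b})"
      using e by (intro exI[of _ "-1"] exI[of _ 1]) simp
  qed
  from tight_imp_convergent_subsubsequence[OF this strict_mono_id]
  obtain r M where r: "strict_mono r" and M: "real_distribution M" and wc: "weak_conv_m (\<mu> \<circ> r) M" by auto
  interpret M: real_distribution M by fact
  have conv: "(\<lambda>n. \<Sum>k\<le>r n. w (r n) k * g (real k / real (r n))) \<longlonglongrightarrow> integral\<^sup>L M g"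
    if "\<And>x. isCont g x" "\<And>x. \<bar>g x\<bar> \<le> B" for g :: "real \<Rightarrow> real" and B
  proof -
    have "(\<lambda>n. integral\<^sup>L ((\<mu> \<circ> r) n) g) \<longlonglongrightarrow> integral\<^sup>L M g"
      by (rule weak_conv_imp_integral_bdd_continuous_conv[OF _ M wc, where B=B]) (use rd that in auto)
    moreover have "g \<in> borel_measurable borel"
      using that(1) by (intro borel_measurable_continuous_onI continuous_at_imp_continuous_on) auto
    ultimately show ?thesis using int by simp
  qed
  have frac: "0 \<le> real k / real n \<and> real k / real n \<le> 1" if "k \<le> n" for k n :: nat
    using that by (auto simp: divide_simps)
  \<comment> \<open>The test function is the distance to [0, 1], cut off at 1. It vanishes at every
    atom \<open>k / n\<close>, hence almost everywhere in the limit.\<close>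
  have sup: "AE t in M. 0 \<le> t \<and> t \<le> 1"
  proof -
    let ?g = "\<lambda>t::real. min 1 \<bar>t - max 0 (min 1 t)\<bar>"
    have c: "isCont ?g x" for x by (intro continuous_intros)
    have "(\<lambda>n. \<Sum>k\<le>r n. w (r n) k * ?g (real k / real (r n))) \<longlonglongrightarrow> integral\<^sup>L M ?g"
      by (rule conv[of ?g 1]) (use c in auto)
    moreover have "(\<Sum>k\<le>r n. w (r n) k * ?g (real k / real (r n))) = 0" for n
    proof (rule sum.neutral, rule ballI)
      fix k assume "k \<in> {..r n}"
      then have "0 \<le> real k / real (r n)" "real k / real (r n) \<le> 1" using frac[of k "r n"] by auto
      then have "max 0 (min 1 (real k / real (r n))) = real k / real (r n)" by (simp only: min_absorb2 max_absorb2)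
      then show "w (r n) k * ?g (real k / real (r n)) = 0" by simp
    qed
    ultimately have "integral\<^sup>L M ?g = 0" by (simp add: LIMSEQ_const_iff)
    moreover have "integrable M ?g"
      by (rule M.integrable_const_bound[where B=1]) auto
    ultimately have "AE t in M. ?g t = 0"
      by (subst (asm) integral_nonneg_eq_0_iff_AE) auto
    then show ?thesis by eventually_elim (auto simp: min_def max_def split: if_splits)
  qed
  have "L (monom 1 p) = integral\<^sup>L M (\<lambda>t. t^p)" for p
  proof -
    \<comment> \<open>Weak convergence tests bounded continuous functions only, so the power is
      frozen outside [0, 1], which carries all the mass.\<close>
    let ?g = "\<lambda>t::real. (max 0 (min 1 t))^p"
    have c: "isCont ?g x" for x by (intro continuous_intros)
    have b: "\<bar>?g x\<bar> \<le> 1" for x by (simp add: power_abs power_le_one)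
    have 1: "(\<lambda>n. \<Sum>k\<le>r n. w (r n) k * ?g (real k / real (r n))) \<longlonglongrightarrow> integral\<^sup>L M ?g"
      by (rule conv[of ?g 1, OF c b])
    have 2: "(\<lambda>n. \<Sum>k\<le>n. w n k * ?g (real k / real n)) \<longlonglongrightarrow> L (?X^p)"
    proof -
      have "(\<lambda>n. (\<Sum>k\<le>n. w n k * ?g (real k / real n)) - L (?X^p)) \<longlonglongrightarrow> 0"
      proof (rule Lim_null_comparison)
        show "\<forall>\<^sub>F n in sequentially. norm ((\<Sum>k\<le>n. w n k * ?g (real k / real n)) - L (?X^p)) \<le> real p * real p / (real n - real p)"
          using eventually_gt_at_top[of p]
        proof eventually_elim
          case (elim n)
          have "(\<Sum>k\<le>n. w n k * ?g (real k / real n)) - L (?X^p)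
             = (\<Sum>k\<le>n. w n k * ((real k / real n)^p - (\<Prod>i<p. (real k - real i) / (real n - real i))))"
            unfolding fall[OF less_imp_le[OF elim], symmetric] sum_subtractf[symmetric]
            using frac by (intro sum.cong) (auto simp: algebra_simps)
          also have "norm \<dots> \<le> (\<Sum>k\<le>n. w n k * (real p * real p / (real n - real p)))"
          proof (rule sum_norm_le)
            fix k assume "k \<in> {..n}"
            then have "\<bar>(real k / real n) ^ p - (\<Prod>i<p. (real k - real i) / (real n - real i))\<bar> \<le> real p * real p / (real n - real p)"
              using falling_ratio_close(1)[OF _ elim, of k] by (simp add: abs_minus_commute)
            from mult_left_mono[OF this w0]
            show "norm (w n k * ((real k / real n) ^ p - (\<Prod>i<p. (real k - real i) / (real n - real i)))) \<le> w n k * (real p * real p / (real n - real p))"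
              unfolding real_norm_def abs_mult abs_of_nonneg[OF w0] .
          qed
          also have "\<dots> = real p * real p / (real n - real p)" by (simp only: sum_distrib_right[symmetric] wsum mult_1)
          finally show ?case .
        qed
        show "(\<lambda>n. real p * real p / (real n - real p)) \<longlonglongrightarrow> 0" by real_asymp
      qed
      then show ?thesis by (rule LIM_zero_cancel)
    qed
    have "integral\<^sup>L M ?g = L (?X^p)"
      using LIMSEQ_unique[OF 1 LIMSEQ_subseq_LIMSEQ[OF 2 r, unfolded comp_def]] .
    moreover have "integral\<^sup>L M ?g = integral\<^sup>L M (\<lambda>t. t^p)"
      using sup by (intro integral_cong_AE) auto
    moreover have "monom 1 p = ?X^p" by (simp add: monom_altdef)
    ultimately show ?thesis by simp
  qed
  with sup M show ?thesis by blast
qed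

text \<open>The affine map \<open>l\<close> carries [-c, c] onto [0, 1], and the mass
  \<open>L 1\<close> is divided out. A functional of mass 0 cannot be normalised and is treated on
  its own.\<close>

theorem hausdorff_moment_interval:
  fixes L :: "real poly \<Rightarrow> real"
  assumes add: "\<And>p q. L (p + q) = L p + L q" and smult: "\<And>a p. L (smult a p) = a * L p"
    and pos: "\<And>i j. 0 \<le> L ([:c,1:]^i * [:c,-1:]^j)" and c: "c > 0"
  shows "\<exists>\<mu>. supported c \<mu> \<and> (\<forall>p. integral\<^sup>L \<mu> (poly p) = L p)"
proof -
  define a where "a = L 1"
  have a: "a \<ge> 0" using pos[of 0 0] by (simp add: a_def)
  define l where "l = [:1/2, 1/(2*c):]"
  define L1 where "L1 p = L (pcompose p l)" for p
  have posL1: "0 \<le> L1 ([:0,1:]^i * [:1,-1:]^j)" for i j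
  proof -
    have "pcompose ([:0,1:]^i * [:1,-1:]^j) l = smult ((1/(2*c))^(i+j)) ([:c,1:]^i * [:c,-1:]^j)"
    proof -
      have "pcompose [:0,1:] l = smult (1/(2*c)) [:c,1:]" "pcompose [:1,-1:] l = smult (1/(2*c)) [:c,-1:]"
        using c by (simp_all add: l_def pcompose_pCons field_simps)
      moreover have "pcompose (p^n) q = (pcompose p q)^n" for p q :: "real poly" and n
        by (induction n) (simp_all add: pcompose_mult pcompose_1)
      ultimately show ?thesis
        by (simp only: pcompose_mult smult_power mult_smult_left mult_smult_right smult_smult power_add mult.commute)
    qed
    then have "L1 ([:0,1:]^i * [:1,-1:]^j) = (1/(2*c))^(i+j) * L ([:c,1:]^i * [:c,-1:]^j)"
      unfolding L1_def using smult by metis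
    moreover have "(1/(2*c))^(i+j) \<ge> 0" using c by simp
    ultimately show ?thesis using pos[of i j] by (metis mult_nonneg_nonneg)
  qed
  \<comment> \<open>As \<open>X + (1 - X) = 1\<close>, the value of \<open>L1\<close> at a Bernstein
    product splits into two nonnegative values at products of the next degree. If it is 0 at degree
    0, it is therefore 0 at all products, in particular at the monomials.\<close>
  have mass: "L1 p = 0" if "a = 0" for p
  proof -
    have z: "L1 ([:0,1:]^i * [:1,-1:]^j) \<le> 0" for i j
    proof (induction "i+j" arbitrary: i j)
      case 0 then show ?case using that by (simp add: L1_def a_def pcompose_1)
    next
      case (Suc n)
      have add1: "L1 (p+q) = L1 p + L1 q" for p q by (simp add: L1_def pcompose_add add)
      have "[:0,1:] + [:1,-1:] = (1 :: real poly)" by (simp add: one_pCons)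
      then have dec: "L1 q = L1 ([:0,1:]*q) + L1 ([:1,-1:]*q)" for q
        by (metis add1 distrib_right mult_1)
      show ?case
      proof (cases i)
        case 0
        then obtain j' where j: "j = Suc j'" using Suc(2) by (cases j) auto
        have e: "[:0,1:]^0 * [:1,-1:]^Suc j' = [:1,-1:] * ([:0,1:]^0 * [:1,-1:]^j' :: real poly)"
          "[:0,1:]^Suc 0 * [:1,-1:]^j' = [:0,1:] * ([:0,1:]^0 * [:1,-1:]^j' :: real poly)"
          by (simp_all only: power_Suc power_0 mult_1_left mult_1_right)
        have "L1 ([:0,1:]^0 * [:1,-1:]^j') \<le> 0" using Suc.hyps(1)[of 0 j'] Suc.hyps(2) 0 j by linarith
        then show ?thesis using dec[of "[:0,1:]^0 * [:1,-1:]^j'"] posL1[of "Suc 0" j']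
          unfolding 0 j e by linarith
      next
        case (Suc i')
        have e: "[:0,1:]^Suc i' * [:1,-1:]^j = [:0,1:] * ([:0,1:]^i' * [:1,-1:]^j :: real poly)"
          "[:0,1:]^i' * [:1,-1:]^Suc j = [:1,-1:] * ([:0,1:]^i' * [:1,-1:]^j :: real poly)"
          by (simp_all only: power_Suc mult.assoc mult.left_commute)
        have "L1 ([:0,1:]^i' * [:1,-1:]^j) \<le> 0" using Suc.hyps(1)[of i' j] Suc.hyps(2) Suc by linarith
        then show ?thesis using dec[of "[:0,1:]^i' * [:1,-1:]^j"] posL1[of i' "Suc j"]
          unfolding Suc e by linarith
      qed
    qed
    have m: "L1 (monom 1 i) = 0" for i using z[of i 0] posL1[of i 0] by (simp add: monom_altdef)
    have "L1 p = integral\<^sup>L (null_measure borel) (poly p)"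
      by (rule poly_functional_eq_moments[OF _ _ supported_null[of 0]]) (simp_all add: L1_def pcompose_add add pcompose_smult smult m[unfolded L1_def])
    then show ?thesis by simp
  qed
  have "\<exists>\<mu>. supported 1 \<mu> \<and> (AE t in \<mu>. 0 \<le> t \<and> t \<le> 1) \<and> (\<forall>p. integral\<^sup>L \<mu> (poly p) = L1 p)"
  proof (cases "a = 0")
    case True
    have "AE t in null_measure borel. 0 \<le> t \<and> t \<le> (1::real)" by (rule AE_I[where N=UNIV]) auto
    then show ?thesis using mass[OF True] supported_null by (intro exI[of _ "null_measure borel"]) simp
  next
    case False
    have "\<exists>\<mu>. real_distribution \<mu> \<and> (AE t in \<mu>. 0 \<le> t \<and> t \<le> 1) \<and> (\<forall>i. L1 (monom 1 i) / a = integral\<^sup>L \<mu> (\<lambda>t. t^i))"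
      by (rule hausdorff_moment_prob[where L="\<lambda>p. L1 p / a"])
        (use posL1 a False in \<open>simp_all add: L1_def pcompose_add add add_divide_distrib pcompose_smult smult a_def pcompose_1\<close>)
    then obtain \<mu> where \<mu>: "real_distribution \<mu>" "AE t in \<mu>. 0 \<le> t \<and> t \<le> 1"
      "\<And>i. L1 (monom 1 i) / a = integral\<^sup>L \<mu> (\<lambda>t. t^i)" by blast
    interpret real_distribution \<mu> by fact
    let ?M = "scale_measure (ennreal a) \<mu>"
    have fin: "finite_measure ?M"
      by (rule finite_measureI) (simp add: ennreal_mult_eq_top_iff emeasure_eq_measure)
    have AEM: "AE t in ?M. Q t" if Q: "AE t in \<mu>. Q t" for Q
    proof -
      obtain N where "{x \<in> space \<mu>. \<not> Q x} \<subseteq> N" "emeasure \<mu> N = 0" "N \<in> sets \<mu>"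
        using Q by (rule AE_E)
      then show ?thesis by (intro AE_I[of _ _ N]) (simp_all add: space_scale_measure)
    qed
    have s: "supported 1 ?M" unfolding supported_def using fin AEM[OF \<mu>(2)]
      by (auto elim: eventually_mono)
    have sc: "integral\<^sup>L ?M f = a * integral\<^sup>L \<mu> f" if "f \<in> borel_measurable borel" for f :: "real \<Rightarrow> real"
    proof -
      have "?M = density \<mu> (\<lambda>_. ennreal a)"
        by (rule measure_eqI) (auto simp: emeasure_density_const)
      then show ?thesis using that a by (simp add: integral_real_density)
    qed
    have "L1 p = integral\<^sup>L ?M (poly p)" for p
    proof (rule poly_functional_eq_moments[OF _ _ s])
      show "L1 (monom 1 i) = integral\<^sup>L ?M (\<lambda>t. t^i)" for i using \<mu>(3)[of i] False sc by (simp add: field_simps)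
    qed (simp_all add: L1_def pcompose_add add pcompose_smult smult)
    then show ?thesis using s AEM[OF \<mu>(2)] by (intro exI[of _ ?M]) auto
  qed
  then obtain \<mu> where \<mu>: "supported 1 \<mu>" "AE t in \<mu>. 0 \<le> t \<and> t \<le> 1" "\<And>p. integral\<^sup>L \<mu> (poly p) = L1 p" by blast
  have [measurable_cong]: "sets \<mu> = sets borel" using supportedD(2)[OF \<mu>(1)] .
  interpret finite_measure \<mu> using supportedD(1)[OF \<mu>(1)] .
  let ?N = "distr \<mu> borel (\<lambda>t. 2*c*t - c)"
  have "supported c ?N" unfolding supported_def
  proof (intro conjI)
    show "finite_measure ?N" by (rule finite_measure_distr) simp
    have "AE t in \<mu>. \<bar>2*c*t - c\<bar> \<le> c"
      using \<mu>(2)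
    proof eventually_elim
      case (elim t)
      then have "0 \<le> c * t" "c * t \<le> c * 1" using c by (auto intro: mult_left_mono)
      then show ?case by (simp add: abs_le_iff)
    qed
    then show "AE t in ?N. \<bar>t\<bar> \<le> c" by (subst AE_distr_iff) auto
  qed simp
  moreover have "integral\<^sup>L ?N (poly p) = L p" for p
  proof -
    have "integral\<^sup>L ?N (poly p) = integral\<^sup>L \<mu> (poly (pcompose p [:-c, 2*c:]))"
    proof -
      have "poly (pcompose p [:-c, 2*c:]) = (\<lambda>t. poly p (2*c*t - c))" by (simp add: fun_eq_iff poly_pcompose algebra_simps)
      then show ?thesis by (subst integral_distr) simp_all
    qed
    also have "\<dots> = L (pcompose p (pcompose [:-c, 2*c:] l))" by (simp add: \<mu>(3) L1_def pcompose_assoc)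
    also have "pcompose [:-c, 2*c:] l = [:0,1:]" using c by (simp add: l_def pcompose_pCons)
    also have "pcompose p [:0,1:] = p" by (simp add: pcompose_idR)
    finally show ?thesis .
  qed
  ultimately show ?thesis by blast
qed

section \<open>Square-summable functions\<close>

lemma ell2_UNIV: "\<psi> \<in> ell2 U \<Longrightarrow> \<psi> \<in> ell2 UNIV"
  by (auto simp: ell2_def)

lemma ell2_outside: "\<psi> \<in> ell2 U \<Longrightarrow> x \<notin> U \<Longrightarrow> \<psi> x = 0"
  by (auto simp: ell2_def)

lemma ell2_summable: "\<psi> \<in> ell2 U \<Longrightarrow> (\<lambda>x. (cmod (\<psi> x))\<^sup>2) summable_on A"
  by (auto simp: ell2_def intro: summable_on_subset_banach)

lemma zero_ell2 [simp]: "(\<lambda>x. 0) \<in> ell2 U"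
  by (auto simp: ell2_def)

lemma norm_add_sq_le: "(cmod (a + b))\<^sup>2 \<le> 2 * (cmod a)\<^sup>2 + 2 * (cmod b)\<^sup>2"
proof -
  have "(cmod (a + b))\<^sup>2 \<le> (cmod a + cmod b)\<^sup>2" by (intro power_mono norm_triangle_ineq) auto
  also have "\<dots> \<le> 2 * (cmod a)\<^sup>2 + 2 * (cmod b)\<^sup>2"
    using sum_squares_bound[of "cmod a" "cmod b"] by (simp add: power2_sum)
  finally show ?thesis .
qed

lemma add_ell2: "\<phi> \<in> ell2 U \<Longrightarrow> \<psi> \<in> ell2 U \<Longrightarrow> (\<lambda>x. \<phi> x + \<psi> x) \<in> ell2 U"
  unfolding ell2_def
  by (auto intro!: summable_on_comparison_test[where f="\<lambda>x. 2 * (cmod (\<phi> x))\<^sup>2 + 2 * (cmod (\<psi> x))\<^sup>2"]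
      summable_on_add summable_on_cmult_right norm_add_sq_le)

lemma scale_ell2: "\<psi> \<in> ell2 U \<Longrightarrow> (\<lambda>x. c * \<psi> x) \<in> ell2 U"
  by (auto simp: ell2_def norm_mult power_mult_distrib intro!: summable_on_cmult_right)

lemma diff_ell2: "\<phi> \<in> ell2 U \<Longrightarrow> \<psi> \<in> ell2 U \<Longrightarrow> (\<lambda>x. \<phi> x - \<psi> x) \<in> ell2 U"
  using add_ell2[OF _ scale_ell2[where c="-1"]] by fastforce

lemma sum_ell2: "(\<And>i. i \<in> I \<Longrightarrow> f i \<in> ell2 U) \<Longrightarrow> (\<lambda>x. \<Sum>i\<in>I. f i x) \<in> ell2 U"
  by (induction I rule: infinite_finite_induct) (auto intro!: add_ell2)

lemma delta_ell2: "x \<in> U \<Longrightarrow> delta x \<in> ell2 U"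
proof -
  have "(\<lambda>y. (cmod (delta x y))\<^sup>2) summable_on UNIV"
    by (rule finite_nonzero_values_imp_summable_on) (auto simp: delta_def)
  then show "x \<in> U \<Longrightarrow> ?thesis" by (auto simp: ell2_def delta_def)
qed

lemma ell2_inner_summable:
  assumes "\<phi> \<in> ell2 UNIV" "\<psi> \<in> ell2 UNIV"
  shows "(\<lambda>x. norm (cnj (\<phi> x) * \<psi> x)) summable_on A"
proof (rule Infinite_Sum.abs_summable_on_comparison_test[where g="\<lambda>x. complex_of_real ((cmod (\<phi> x))\<^sup>2 + (cmod (\<psi> x))\<^sup>2)"])
  show "norm (cnj (\<phi> x) * \<psi> x) \<le> norm (complex_of_real ((cmod (\<phi> x))\<^sup>2 + (cmod (\<psi> x))\<^sup>2))" for x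
    using sum_squares_bound[of "cmod (\<phi> x)" "cmod (\<psi> x)"]
      mult_nonneg_nonneg[OF norm_ge_zero[of "\<phi> x"] norm_ge_zero[of "\<psi> x"]]
    unfolding norm_mult complex_mod_cnj norm_of_real by linarith
  show "(\<lambda>x. norm (complex_of_real ((cmod (\<phi> x))\<^sup>2 + (cmod (\<psi> x))\<^sup>2))) summable_on A"
    using assms by (simp add: ell2_summable summable_on_add del: of_real_add of_real_power)
qed

lemma inner_add_right:
  assumes "\<phi> \<in> ell2 UNIV" "\<psi> \<in> ell2 UNIV" "\<theta> \<in> ell2 UNIV"
  shows "ell2_inner \<phi> (\<lambda>x. \<psi> x + \<theta> x) = ell2_inner \<phi> \<psi> + ell2_inner \<phi> \<theta>"
  unfolding ell2_inner_def using assms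
  by (simp add: ring_distribs infsum_add[OF Infinite_Sum.abs_summable_summable[OF ell2_inner_summable] Infinite_Sum.abs_summable_summable[OF ell2_inner_summable]])

lemma inner_scale_right: "ell2_inner \<phi> (\<lambda>x. c * \<psi> x) = c * ell2_inner \<phi> \<psi>"
  unfolding ell2_inner_def by (subst infsum_cmult_right'[symmetric]) (simp add: mult_ac)

lemma inner_cnj: "cnj (ell2_inner \<phi> \<psi>) = ell2_inner \<psi> \<phi>"
  unfolding ell2_inner_def by (subst infsum_cnj[symmetric]) (simp add: mult_ac)

lemma inner_scale_left: "ell2_inner (\<lambda>x. c * \<phi> x) \<psi> = cnj c * ell2_inner \<phi> \<psi>"
  by (metis inner_cnj inner_scale_right complex_cnj_mult)

lemma inner_add_left:
  assumes "\<phi> \<in> ell2 UNIV" "\<psi> \<in> ell2 UNIV" "\<theta> \<in> ell2 UNIV"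
  shows "ell2_inner (\<lambda>x. \<phi> x + \<psi> x) \<theta> = ell2_inner \<phi> \<theta> + ell2_inner \<psi> \<theta>"
  using inner_add_right[OF assms(3,1,2)] by (metis inner_cnj complex_cnj_add)

lemma inner_diff_right:
  assumes "\<phi> \<in> ell2 UNIV" "\<psi> \<in> ell2 UNIV" "\<theta> \<in> ell2 UNIV"
  shows "ell2_inner \<phi> (\<lambda>x. \<psi> x - \<theta> x) = ell2_inner \<phi> \<psi> - ell2_inner \<phi> \<theta>"
  using inner_add_right[OF assms(1,2) scale_ell2[OF assms(3), of "-1"]] inner_scale_right[of \<phi> "-1" \<theta>] by simp

lemma inner_diff_left:
  assumes "\<phi> \<in> ell2 UNIV" "\<psi> \<in> ell2 UNIV" "\<theta> \<in> ell2 UNIV"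
  shows "ell2_inner (\<lambda>x. \<phi> x - \<psi> x) \<theta> = ell2_inner \<phi> \<theta> - ell2_inner \<psi> \<theta>"
  using inner_diff_right[OF assms(3,1,2)] by (metis inner_cnj complex_cnj_diff)

lemma inner_zero [simp]: "ell2_inner \<phi> (\<lambda>x. 0) = 0" "ell2_inner (\<lambda>x. 0) \<phi> = 0"
  by (simp_all add: ell2_inner_def)

lemma inner_sum_right:
  assumes "finite I" "\<phi> \<in> ell2 UNIV" "\<And>i. i \<in> I \<Longrightarrow> f i \<in> ell2 UNIV"
  shows "ell2_inner \<phi> (\<lambda>x. \<Sum>i\<in>I. f i x) = (\<Sum>i\<in>I. ell2_inner \<phi> (f i))"
  using assms(1,3)
proof (induction I)
  case empty then show ?case by simp
next
  case (insert i I)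
  have "ell2_inner \<phi> (\<lambda>x. \<Sum>i\<in>insert i I. f i x) = ell2_inner \<phi> (\<lambda>x. f i x + (\<Sum>i\<in>I. f i x))"
    using insert by simp
  also have "\<dots> = ell2_inner \<phi> (f i) + ell2_inner \<phi> (\<lambda>x. \<Sum>i\<in>I. f i x)"
    using insert assms(2) by (intro inner_add_right sum_ell2) auto
  finally show ?case using insert by simp
qed

lemma ell2_norm_nonneg [simp]: "0 \<le> ell2_norm \<psi>"
  by (simp add: ell2_norm_def infsum_nonneg)

lemma ell2_norm_sq: "(ell2_norm \<psi>)\<^sup>2 = (\<Sum>\<^sub>\<infinity>x. (cmod (\<psi> x))\<^sup>2)"
  by (simp add: ell2_norm_def infsum_nonneg)

lemma inner_self: "ell2_inner \<psi> \<psi> = complex_of_real ((ell2_norm \<psi>)\<^sup>2)"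
proof -
  have "ell2_inner \<psi> \<psi> = (\<Sum>\<^sub>\<infinity>x. complex_of_real ((cmod (\<psi> x))\<^sup>2))"
    unfolding ell2_inner_def by (intro infsum_cong) (metis complex_norm_square mult.commute)
  also have "\<dots> = complex_of_real (\<Sum>\<^sub>\<infinity>x. (cmod (\<psi> x))\<^sup>2)" 
  proof (rule infsum_bounded_linear_strong[OF _ bounded_linear_of_real])
    show "(\<lambda>x. complex_of_real ((cmod (\<psi> x))\<^sup>2)) summable_on UNIV \<longleftrightarrow> (\<lambda>x. (cmod (\<psi> x))\<^sup>2) summable_on UNIV"
      using summable_on_of_real has_sum_Re unfolding summable_on_def by fastforce
  qed
  finally show ?thesis by (simp only: ell2_norm_sq)
qed

lemma ell2_norm_zero [simp]: "ell2_norm (\<lambda>x. 0) = 0"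
  by (simp add: ell2_norm_def)

lemma inner_delta: "ell2_inner (delta x) \<psi> = \<psi> x"
proof -
  have "ell2_inner (delta x) \<psi> = (\<Sum>\<^sub>\<infinity>y\<in>{x}. cnj (delta x y) * \<psi> y)"
    unfolding ell2_inner_def by (rule infsum_cong_neutral) (auto simp: delta_def)
  then show ?thesis by (simp add: delta_def)
qed

lemma norm_delta [simp]: "ell2_norm (delta x) = 1"
proof -
  have "complex_of_real ((ell2_norm (delta x))\<^sup>2) = 1"
    unfolding inner_self[symmetric] inner_delta by (simp add: delta_def)
  then have "(ell2_norm (delta x))\<^sup>2 = 1" using of_real_eq_1_iff by blast
  then show ?thesis by (metis ell2_norm_nonneg one_power2 power2_eq_iff_nonneg zero_le_one)
qed

lemma ell2_norm_scale: "ell2_norm (\<lambda>x. c * \<psi> x) = cmod c * ell2_norm \<psi>"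
proof -
  have "(ell2_norm (\<lambda>x. c * \<psi> x))\<^sup>2 = (cmod c * ell2_norm \<psi>)\<^sup>2"
    by (simp add: ell2_norm_sq norm_mult power_mult_distrib infsum_cmult_right')
  then show ?thesis by (simp add: power2_eq_iff_nonneg)
qed

lemma ell2_norm_partial:
  assumes "\<psi> \<in> ell2 UNIV" "finite F"
  shows "(\<Sum>x\<in>F. (cmod (\<psi> x))\<^sup>2) \<le> (ell2_norm \<psi>)\<^sup>2"
  unfolding ell2_norm_sq using assms by (intro finite_sum_le_infsum ell2_summable) auto

lemma ell2_norm_coord:
  assumes "\<psi> \<in> ell2 UNIV"
  shows "cmod (\<psi> x) \<le> ell2_norm \<psi>"
  by (rule power2_le_imp_le) (use ell2_norm_partial[OF assms, of "{x}"] in simp_all)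

lemma ell2_norm_eq_0:
  assumes "\<psi> \<in> ell2 UNIV" "ell2_norm \<psi> = 0"
  shows "\<psi> = (\<lambda>x. 0)"
  using ell2_norm_coord[OF assms(1)] assms(2) by fastforce

lemma ell2_I_partial:
  assumes "\<And>x. x \<notin> U \<Longrightarrow> \<psi> x = 0" "\<And>F. finite F \<Longrightarrow> (\<Sum>x\<in>F. (cmod (\<psi> x))\<^sup>2) \<le> B\<^sup>2" "0 \<le> B"
  shows "\<psi> \<in> ell2 U" "ell2_norm \<psi> \<le> B"
proof -
  have s: "(\<lambda>x. (cmod (\<psi> x))\<^sup>2) summable_on UNIV"
    by (rule nonneg_bdd_above_summable_on) (use assms(2) in \<open>auto simp: bdd_above_def\<close>)
  then show "\<psi> \<in> ell2 U" using assms(1) by (auto simp: ell2_def)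
  have "(ell2_norm \<psi>)\<^sup>2 \<le> B\<^sup>2"
    unfolding ell2_norm_sq by (rule infsum_le_finite_sums[OF s]) (use assms(2) in auto)
  then show "ell2_norm \<psi> \<le> B" using assms(3) by (rule power2_le_imp_le)
qed

lemma ell2_norm_add_sq:
  assumes "\<phi> \<in> ell2 UNIV" "\<psi> \<in> ell2 UNIV"
  shows "(ell2_norm (\<lambda>x. \<phi> x + \<psi> x))\<^sup>2 = (ell2_norm \<phi>)\<^sup>2 + 2 * Re (ell2_inner \<phi> \<psi>) + (ell2_norm \<psi>)\<^sup>2"
proof -
  have "complex_of_real ((ell2_norm (\<lambda>x. \<phi> x + \<psi> x))\<^sup>2) = ell2_inner \<phi> \<phi> + ell2_inner \<phi> \<psi> + (cnj (ell2_inner \<phi> \<psi>) + ell2_inner \<psi> \<psi>)"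
    unfolding inner_self[symmetric] inner_cnj using assms by (simp add: inner_add_left inner_add_right add_ell2)
  then have "Re (complex_of_real ((ell2_norm (\<lambda>x. \<phi> x + \<psi> x))\<^sup>2)) = Re (ell2_inner \<phi> \<phi> + ell2_inner \<phi> \<psi> + (cnj (ell2_inner \<phi> \<psi>) + ell2_inner \<psi> \<psi>))"
    by simp
  then show ?thesis by (simp add: inner_self)
qed

lemma ell2_cauchy_schwarz:
  assumes "\<phi> \<in> ell2 UNIV" "\<psi> \<in> ell2 UNIV"
  shows "cmod (ell2_inner \<phi> \<psi>) \<le> ell2_norm \<phi> * ell2_norm \<psi>"
proof -
  define z where "z = ell2_inner \<phi> \<psi>"
  have ineq: "0 \<le> s\<^sup>2 * (cmod z)\<^sup>2 * (ell2_norm \<phi>)\<^sup>2 - 2 * s * (cmod z)\<^sup>2 + (ell2_norm \<psi>)\<^sup>2" for s :: real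
  proof -
    define c where "c = - of_real s * z"
    have "0 \<le> (ell2_norm (\<lambda>x. c * \<phi> x + \<psi> x))\<^sup>2" by simp
    also have "\<dots> = (cmod c * ell2_norm \<phi>)\<^sup>2 + 2 * Re (cnj c * z) + (ell2_norm \<psi>)\<^sup>2"
      by (subst ell2_norm_add_sq[OF scale_ell2[OF assms(1)] assms(2)]) (simp add: ell2_norm_scale inner_scale_left z_def)
    also have "Re (cnj c * z) = - s * (cmod z)\<^sup>2"
    proof -
      have "(cmod z)\<^sup>2 = Re z * Re z + Im z * Im z" unfolding cmod_power2 by (simp add: power2_eq_square)
      then show ?thesis by (simp add: c_def algebra_simps)
    qed
    also have "cmod c = \<bar>s\<bar> * cmod z" by (simp add: c_def norm_mult)
    finally show ?thesis by (simp add: power_mult_distrib)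
  qed
  show ?thesis
  proof (cases "ell2_norm \<phi> = 0")
    case True
    then have "\<phi> = (\<lambda>x. 0)" using assms ell2_norm_eq_0 by blast
    then show ?thesis by simp
  next
    case False
    define n where "n = (ell2_norm \<phi>)\<^sup>2"
    have n: "n > 0" using False by (simp add: n_def)
    have "(1/n)\<^sup>2 * (cmod z)\<^sup>2 * n - 2 * (1/n) * (cmod z)\<^sup>2 = - ((cmod z)\<^sup>2 / n)"
      using n by (simp add: field_simps power2_eq_square)
    then have "(cmod z)\<^sup>2 / n \<le> (ell2_norm \<psi>)\<^sup>2" using ineq[of "1/n"] by (simp only: n_def)
    then have "(cmod z)\<^sup>2 \<le> (ell2_norm \<psi>)\<^sup>2 * n" using n by (simp only: pos_divide_le_eq)
    then have "(cmod z)\<^sup>2 \<le> (ell2_norm \<phi> * ell2_norm \<psi>)\<^sup>2" by (simp add: n_def power_mult_distrib mult.commute)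
    then show ?thesis unfolding z_def by (rule power2_le_imp_le) simp
  qed
qed

lemma ell2_norm_triangle:
  assumes "\<phi> \<in> ell2 UNIV" "\<psi> \<in> ell2 UNIV"
  shows "ell2_norm (\<lambda>x. \<phi> x + \<psi> x) \<le> ell2_norm \<phi> + ell2_norm \<psi>"
proof (rule power2_le_imp_le)
  have "Re (ell2_inner \<phi> \<psi>) \<le> ell2_norm \<phi> * ell2_norm \<psi>"
    using ell2_cauchy_schwarz[OF assms] complex_Re_le_cmod order_trans by blast
  then show "(ell2_norm (\<lambda>x. \<phi> x + \<psi> x))\<^sup>2 \<le> (ell2_norm \<phi> + ell2_norm \<psi>)\<^sup>2"
    by (simp add: ell2_norm_add_sq[OF assms] power2_sum)
qed simp

lemma ell2_norm_minus: "ell2_norm (\<lambda>x. - \<psi> x) = ell2_norm \<psi>"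
  using ell2_norm_scale[of "-1" \<psi>] by simp

lemma ell2_norm_diff_commute: "ell2_norm (\<lambda>x. \<phi> x - \<psi> x) = ell2_norm (\<lambda>x. \<psi> x - \<phi> x)"
  using ell2_norm_minus[of "\<lambda>x. \<phi> x - \<psi> x"] by simp

lemma ell2_norm_triangle_diff:
  assumes "\<phi> \<in> ell2 UNIV" "\<psi> \<in> ell2 UNIV" "\<theta> \<in> ell2 UNIV"
  shows "ell2_norm (\<lambda>x. \<phi> x - \<theta> x) \<le> ell2_norm (\<lambda>x. \<phi> x - \<psi> x) + ell2_norm (\<lambda>x. \<psi> x - \<theta> x)"
  using ell2_norm_triangle[OF diff_ell2[OF assms(1,2)] diff_ell2[OF assms(2,3)]] by simp

lemma ell2_norm_sum:
  assumes "finite I" "\<And>i. i \<in> I \<Longrightarrow> f i \<in> ell2 UNIV"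
  shows "ell2_norm (\<lambda>x. \<Sum>i\<in>I. f i x) \<le> (\<Sum>i\<in>I. ell2_norm (f i))"
  using assms
proof (induction I)
  case empty then show ?case by simp
next
  case (insert i I)
  have "ell2_norm (\<lambda>x. \<Sum>i\<in>insert i I. f i x) = ell2_norm (\<lambda>x. f i x + (\<Sum>i\<in>I. f i x))" using insert by simp
  also have "\<dots> \<le> ell2_norm (f i) + ell2_norm (\<lambda>x. \<Sum>i\<in>I. f i x)"
    using insert by (intro ell2_norm_triangle sum_ell2) auto
  finally show ?case using insert by force
qed

text \<open>Coordinates converge because each is bounded by the norm. The Cauchy estimate,
  restricted to a finite set of coordinates, survives the pointwise limit, and
  \<open>ell2_I_partial\<close> reassembles the norm from finite sets.\<close>

lemma ell2_complete:
  fixes f :: "nat \<Rightarrow> 'v \<Rightarrow> complex"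
  assumes f: "\<And>n. f n \<in> ell2 U"
    and C: "\<And>e. 0 < e \<Longrightarrow> \<exists>N. \<forall>m\<ge>N. \<forall>n\<ge>N. ell2_norm (\<lambda>x. f m x - f n x) < e"
  shows "\<exists>g\<in>ell2 U. (\<lambda>n. ell2_norm (\<lambda>x. f n x - g x)) \<longlonglongrightarrow> 0"
proof -
  have fU: "f n \<in> ell2 UNIV" for n using ell2_UNIV[OF f] .
  have "Cauchy (\<lambda>n. f n x)" for x
  proof (rule CauchyI)
    fix e :: real assume "e > 0"
    then obtain N where N: "\<forall>m\<ge>N. \<forall>n\<ge>N. ell2_norm (\<lambda>x. f m x - f n x) < e" using C by blast
    show "\<exists>M. \<forall>m\<ge>M. \<forall>n\<ge>M. norm (f m x - f n x) < e"
    proof (intro exI allI impI)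
      fix m n assume "N \<le> m" "N \<le> n"
      then show "norm (f m x - f n x) < e"
        using N ell2_norm_coord[OF diff_ell2[OF fU[of m] fU[of n]], of x] by fastforce
    qed
  qed
  then have "\<forall>x. \<exists>l. (\<lambda>n. f n x) \<longlonglongrightarrow> l" by (simp add: Cauchy_convergent_iff convergent_def)
  then obtain g where g: "\<And>x. (\<lambda>n. f n x) \<longlonglongrightarrow> g x" by metis
  have g0: "g x = 0" if "x \<notin> U" for x
  proof -
    have "f n x = 0" for n by (rule ell2_outside[OF f that])
    then show ?thesis using g[of x] by (simp add: LIMSEQ_const_iff)
  qed
  have est: "\<exists>N. \<forall>m\<ge>N. (\<lambda>x. f m x - g x) \<in> ell2 U \<and> ell2_norm (\<lambda>x. f m x - g x) \<le> e" if e: "e > 0" for e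
  proof -
    obtain N where N: "\<forall>m\<ge>N. \<forall>n\<ge>N. ell2_norm (\<lambda>x. f m x - f n x) < e" using C e by blast
    have "(\<lambda>x. f m x - g x) \<in> ell2 U \<and> ell2_norm (\<lambda>x. f m x - g x) \<le> e" if m: "m \<ge> N" for m
    proof -
      have "(\<Sum>x\<in>F. (cmod (f m x - g x))\<^sup>2) \<le> e\<^sup>2" if F: "finite F" for F
      proof (rule LIMSEQ_le_const2)
        show "(\<lambda>n. \<Sum>x\<in>F. (cmod (f m x - f n x))\<^sup>2) \<longlonglongrightarrow> (\<Sum>x\<in>F. (cmod (f m x - g x))\<^sup>2)"
          by (intro tendsto_intros g)
        have "(\<Sum>x\<in>F. (cmod (f m x - f n x))\<^sup>2) \<le> e\<^sup>2" if "n \<ge> N" for n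
        proof -
          have "(\<Sum>x\<in>F. (cmod (f m x - f n x))\<^sup>2) \<le> (ell2_norm (\<lambda>x. f m x - f n x))\<^sup>2"
            by (rule ell2_norm_partial[OF diff_ell2[OF fU fU] F])
          also have "\<dots> \<le> e\<^sup>2" using N m that by (intro power_mono) (auto intro: less_imp_le)
          finally show ?thesis .
        qed
        then show "\<exists>N. \<forall>n\<ge>N. (\<Sum>x\<in>F. (cmod (f m x - f n x))\<^sup>2) \<le> e\<^sup>2" by blast
      qed
      then show ?thesis using ell2_I_partial[of U "\<lambda>x. f m x - g x" e] e g0 ell2_outside[OF f] by simp
    qed
    then show ?thesis by blast
  qed
  obtain m where m: "(\<lambda>x. f m x - g x) \<in> ell2 U" using est[of 1] by auto
  have gl: "g \<in> ell2 U" using diff_ell2[OF f[of m] m] by simp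
  have "(\<lambda>n. ell2_norm (\<lambda>x. f n x - g x)) \<longlonglongrightarrow> 0"
  proof (rule LIMSEQ_I)
    fix r :: real assume "r > 0"
    then obtain N where "\<forall>m\<ge>N. ell2_norm (\<lambda>x. f m x - g x) \<le> r/2" using est[of "r/2"] by auto
    then show "\<exists>no. \<forall>n\<ge>no. norm (ell2_norm (\<lambda>x. f n x - g x) - 0) < r"
      using \<open>r > 0\<close> by (intro exI[of _ N]) (auto intro: le_less_trans)
  qed
  then show ?thesis using gl by blast
qed

lemma inner_tendsto_right:
  assumes "\<phi> \<in> ell2 UNIV" "\<And>n. f n \<in> ell2 UNIV" "g \<in> ell2 UNIV"
    and l: "((\<lambda>n. ell2_norm (\<lambda>x. f n x - g x)) \<longlongrightarrow> 0) F"
  shows "((\<lambda>n. ell2_inner \<phi> (f n)) \<longlongrightarrow> ell2_inner \<phi> g) F"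
proof (rule LIM_zero_cancel, rule Lim_null_comparison)
  show "\<forall>\<^sub>F n in F. norm (ell2_inner \<phi> (f n) - ell2_inner \<phi> g) \<le> ell2_norm \<phi> * ell2_norm (\<lambda>x. f n x - g x)"
    using ell2_cauchy_schwarz[OF assms(1) diff_ell2[OF assms(2,3)]]
    unfolding inner_diff_right[OF assms(1-3)] by (intro always_eventually allI)
  show "((\<lambda>n. ell2_norm \<phi> * ell2_norm (\<lambda>x. f n x - g x)) \<longlongrightarrow> 0) F"
    using tendsto_mult_right_zero[OF l] .
qed

lemma norm_tendsto:
  assumes "\<And>n. f n \<in> ell2 UNIV" "g \<in> ell2 UNIV"
    and l: "((\<lambda>n. ell2_norm (\<lambda>x. f n x - g x)) \<longlongrightarrow> 0) F"
  shows "((\<lambda>n. ell2_norm (f n)) \<longlongrightarrow> ell2_norm g) F"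
proof (rule LIM_zero_cancel, rule Lim_null_comparison[OF _ l])
  have "ell2_norm (f n) \<le> ell2_norm (\<lambda>x. f n x - g x) + ell2_norm g" for n
    using ell2_norm_triangle[OF diff_ell2[OF assms(1)[of n] assms(2)] assms(2)] by simp
  moreover have "ell2_norm g \<le> ell2_norm (\<lambda>x. f n x - g x) + ell2_norm (f n)" for n
    using ell2_norm_triangle[OF diff_ell2[OF assms(2) assms(1)[of n]] assms(1)[of n]] ell2_norm_diff_commute[of g "f n"] by simp
  ultimately show "\<forall>\<^sub>F n in F. norm (ell2_norm (f n) - ell2_norm g) \<le> ell2_norm (\<lambda>x. f n x - g x)"
    by (intro always_eventually allI) (simp add: abs_le_iff diff_le_eq)
qed

section \<open>The spectral theorem for bounded self-adjoint operators\<close>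

lemma supported_sq_err_integrable:
  assumes s: "supported c \<mu>" and B: "B \<in> sets borel"
  shows "integrable \<mu> (\<lambda>t. (poly p t - indicator B t)\<^sup>2)"
proof -
  obtain K where K: "K \<ge> 0" "\<And>t. \<bar>t\<bar> \<le> c \<Longrightarrow> \<bar>poly p t\<bar> \<le> K" using poly_bounded_on_interval by blast
  show ?thesis
  proof (rule supported_integrable[OF s, where B="(K+1)\<^sup>2"])
    fix t assume "\<bar>t\<bar> \<le> c"
    then have "\<bar>poly p t - indicator B t\<bar> \<le> K + 1" using K(2)[of t] by (auto simp: indicator_def)
    then show "\<bar>(poly p t - indicator B t)\<^sup>2\<bar> \<le> (K+1)\<^sup>2" using K(1) by (simp add: abs_le_square_iff[symmetric])
  qed (use B in measurable)
qed

text \<open>The two limits become the quadratic form and the squared norm of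
  \<open>ind_op B\<close>. Their equality is the property from which idempotence is later
  derived.\<close>

lemma L2_convergence_indicator:
  assumes s: "supported c \<mu>" and B: "B \<in> sets borel"
    and E: "(\<lambda>n. integral\<^sup>L \<mu> (\<lambda>t. (poly (P n) t - indicator B t)\<^sup>2)) \<longlonglongrightarrow> 0"
  shows "(\<lambda>n. integral\<^sup>L \<mu> (poly (P n))) \<longlonglongrightarrow> measure \<mu> B"
    and "(\<lambda>n. integral\<^sup>L \<mu> (\<lambda>t. (poly (P n) t)\<^sup>2)) \<longlonglongrightarrow> measure \<mu> B"
proof -
  interpret finite_measure \<mu> using supportedD(1)[OF s] .
  have [measurable_cong]: "sets \<mu> = sets borel" using supportedD(2)[OF s] .
  define e where "e n = integral\<^sup>L \<mu> (\<lambda>t. (poly (P n) t - indicator B t)\<^sup>2)" for n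
  define d where "d n = integral\<^sup>L \<mu> (\<lambda>t. \<bar>poly (P n) t - indicator B t\<bar>)" for n
  have mB: "integral\<^sup>L \<mu> (indicator B :: real \<Rightarrow> real) = measure \<mu> B"
    using B supportedD(4)[OF s] by simp
  have intB: "integrable \<mu> (indicator B :: real \<Rightarrow> real)" using B by (intro integrable_const_bound[where B=1]) auto
  have intP: "integrable \<mu> (poly p)" for p by (rule supported_integrable_poly[OF s])
  have intd: "integrable \<mu> (\<lambda>t. poly p t - indicator B t)" for p using intP intB by auto
  have inte: "integrable \<mu> (\<lambda>t. (poly p t - indicator B t)\<^sup>2)" for p by (rule supported_sq_err_integrable[OF s B])
  have intPB: "integrable \<mu> (\<lambda>t. poly p t * indicator B t)" for p
    using integrable_mult_indicator[OF _ intP, of B] B supportedD(2)[OF s] by (simp add: mult.commute)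
  \<comment> \<open>The inequality \<open>y <= y^2 / r + r\<close> for \<open>y >= 0\<close>, by
    distinguishing \<open>y <= r\<close> from \<open>y > r\<close>, bounds the L^1 error by the L^2
    error; \<open>r\<close> is tied to the accuracy afterwards.\<close>
  have key: "d n \<le> e n / r + r * measure \<mu> UNIV" if r: "r > 0" for r n
  proof -
    let ?f = "\<lambda>t. \<bar>poly (P n) t - indicator B t\<bar>"
    have "d n \<le> integral\<^sup>L \<mu> (\<lambda>t. (poly (P n) t - indicator B t)\<^sup>2 / r + r)"
      unfolding d_def
    proof (rule integral_mono)
      show "integrable \<mu> ?f" using intd by auto
      show "integrable \<mu> (\<lambda>t. (poly (P n) t - indicator B t)\<^sup>2 / r + r)" using inte by auto
      show "?f t \<le> (poly (P n) t - indicator B t)\<^sup>2 / r + r" for t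
      proof (cases "?f t \<le> r")
        case True
        have "0 \<le> (poly (P n) t - indicator B t)\<^sup>2 / r" using r by simp
        then show ?thesis using True by linarith
      next
        case False
        have "?f t * r \<le> ?f t * ?f t" using False by (intro mult_left_mono) auto
        also have "?f t * ?f t = (poly (P n) t - indicator B t)\<^sup>2" by (simp add: power2_eq_square)
        finally have "?f t \<le> (poly (P n) t - indicator B t)\<^sup>2 / r" using r by (simp add: pos_le_divide_eq)
        then show ?thesis using r by linarith
      qed
    qed
    also have "\<dots> = e n / r + r * measure \<mu> UNIV"
      using inte supportedD(4)[OF s] by (simp add: e_def)
    finally show ?thesis .
  qed
  have d: "d \<longlonglongrightarrow> 0"
  proof (rule LIMSEQ_I)
    fix \<epsilon> :: real assume \<epsilon>: "\<epsilon> > 0"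
    define r where "r = \<epsilon> / (2 * (1 + measure \<mu> UNIV))"
    have r: "r > 0" using \<epsilon> by (simp add: r_def add_pos_nonneg)
    have "r * measure \<mu> UNIV \<le> r * (1 + measure \<mu> UNIV)" using r by simp
    also have "\<dots> = \<epsilon> / 2"
    proof -
      have "1 + measure \<mu> UNIV > 0" by (simp add: add_pos_nonneg)
      then show ?thesis by (simp add: r_def field_simps)
    qed
    finally have rm: "r * measure \<mu> UNIV \<le> \<epsilon> / 2" .
    have "r * (\<epsilon> / 2) > 0" using r \<epsilon> by simp
    from order_tendstoD(2)[OF E[folded e_def] this]
    obtain N where N: "\<And>n. n \<ge> N \<Longrightarrow> e n < r * (\<epsilon> / 2)"
      unfolding eventually_sequentially by blast
    have "norm (d n - 0) < \<epsilon>" if "n \<ge> N" for n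
    proof -
      have "e n / r < \<epsilon> / 2" using N[OF that] r by (simp add: pos_divide_less_eq mult.commute)
      then have "d n < \<epsilon>" using key[OF r, of n] rm by linarith
      moreover have "d n \<ge> 0" by (simp add: d_def)
      ultimately show ?thesis by simp
    qed
    then show "\<exists>no. \<forall>n\<ge>no. norm (d n - 0) < \<epsilon>" by blast
  qed
  show "(\<lambda>n. integral\<^sup>L \<mu> (poly (P n))) \<longlonglongrightarrow> measure \<mu> B"
  proof (rule LIM_zero_cancel, rule Lim_null_comparison[OF _ d])
    have "integral\<^sup>L \<mu> (poly (P n)) - measure \<mu> B = integral\<^sup>L \<mu> (\<lambda>t. poly (P n) t - indicator B t)" for n
      unfolding mB[symmetric] using intP intB by simp
    then show "\<forall>\<^sub>F n in sequentially. norm (integral\<^sup>L \<mu> (poly (P n)) - measure \<mu> B) \<le> d n"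
      unfolding d_def by (intro always_eventually allI) (simp only: real_norm_def integral_abs_bound)
  qed
  have PB: "(\<lambda>n. integral\<^sup>L \<mu> (\<lambda>t. poly (P n) t * indicator B t)) \<longlonglongrightarrow> measure \<mu> B"
  proof (rule LIM_zero_cancel, rule Lim_null_comparison[OF _ d])
    have "norm (integral\<^sup>L \<mu> (\<lambda>t. poly (P n) t * indicator B t) - measure \<mu> B) \<le> d n" for n
    proof -
      have "integral\<^sup>L \<mu> (\<lambda>t. poly (P n) t * indicator B t) - measure \<mu> B = integral\<^sup>L \<mu> (\<lambda>t. poly (P n) t * indicator B t - indicator B t)"
        unfolding mB[symmetric] using intPB intB by simp
      also have "norm \<dots> \<le> integral\<^sup>L \<mu> (\<lambda>t. \<bar>poly (P n) t * indicator B t - indicator B t\<bar>)"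
        unfolding real_norm_def by (rule integral_abs_bound)
      also have "\<dots> \<le> d n"
        unfolding d_def
        by (rule integral_mono[OF integrable_abs[OF Bochner_Integration.integrable_diff[OF intPB intB]] integrable_abs[OF intd]])
          (simp add: indicator_def)
      finally show ?thesis .
    qed
    then show "\<forall>\<^sub>F n in sequentially. norm (integral\<^sup>L \<mu> (\<lambda>t. poly (P n) t * indicator B t) - measure \<mu> B) \<le> d n" by simp
  qed
  have "integral\<^sup>L \<mu> (\<lambda>t. (poly (P n) t)\<^sup>2) = e n + (2 * integral\<^sup>L \<mu> (\<lambda>t. poly (P n) t * indicator B t) - measure \<mu> B)" for n
  proof -
    have "(\<lambda>t. (poly (P n) t)\<^sup>2) = (\<lambda>t. (poly (P n) t - indicator B t)\<^sup>2 + (2 * (poly (P n) t * indicator B t) - indicator B t))"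
      by (rule ext) (simp add: indicator_def power2_eq_square algebra_simps)
    then show ?thesis
      unfolding e_def mB[symmetric] using inte intPB intB by simp
  qed
  moreover have "(\<lambda>n. e n + (2 * integral\<^sup>L \<mu> (\<lambda>t. poly (P n) t * indicator B t) - measure \<mu> B)) \<longlonglongrightarrow> 0 + (2 * measure \<mu> B - measure \<mu> B)"
    by (intro tendsto_intros PB E[folded e_def])
  ultimately show "(\<lambda>n. integral\<^sup>L \<mu> (\<lambda>t. (poly (P n) t)\<^sup>2)) \<longlonglongrightarrow> measure \<mu> B" by simp
qed

text \<open>Any upper bound \<open>c\<close> of the norm is allowed. All measures built below live
  on [-c, c], so one \<open>c\<close> for a family of operators gives one compact set for all their
  measures.\<close>

locale bounded_sa =
  fixes U :: "'v set" and A :: "'v operator" and c :: real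
  assumes lin: "linear_op_on U A" and sym: "symmetric_on U A"
    and bd: "\<And>\<psi>. \<psi> \<in> ell2 U \<Longrightarrow> ell2_norm (A \<psi>) \<le> c * ell2_norm \<psi>"
    and c_pos: "0 < c"
begin

lemma A_in: "\<psi> \<in> ell2 U \<Longrightarrow> A \<psi> \<in> ell2 U"
  using lin by (simp add: linear_op_on_def)

lemma A_add: "\<phi> \<in> ell2 U \<Longrightarrow> \<psi> \<in> ell2 U \<Longrightarrow> A (\<lambda>x. \<phi> x + \<psi> x) = (\<lambda>x. A \<phi> x + A \<psi> x)"
  using lin by (simp add: linear_op_on_def)

lemma A_scale: "\<psi> \<in> ell2 U \<Longrightarrow> A (\<lambda>x. a * \<psi> x) = (\<lambda>x. a * A \<psi> x)"
  using lin by (simp add: linear_op_on_def)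

lemma A_zero: "A (\<lambda>x. 0) = (\<lambda>x. 0)"
  using A_scale[OF zero_ell2, of 0] by simp

lemma A_sym: "\<phi> \<in> ell2 U \<Longrightarrow> \<psi> \<in> ell2 U \<Longrightarrow> ell2_inner \<phi> (A \<psi>) = ell2_inner (A \<phi>) \<psi>"
  using sym by (simp add: symmetric_on_def)

lemma inner_U_add_right:
  "\<phi> \<in> ell2 U \<Longrightarrow> \<psi> \<in> ell2 U \<Longrightarrow> \<theta> \<in> ell2 U \<Longrightarrow>
    ell2_inner \<phi> (\<lambda>x. \<psi> x + \<theta> x) = ell2_inner \<phi> \<psi> + ell2_inner \<phi> \<theta>"
  by (intro inner_add_right ell2_UNIV)

lemma inner_U_add_left:
  "\<phi> \<in> ell2 U \<Longrightarrow> \<psi> \<in> ell2 U \<Longrightarrow> \<theta> \<in> ell2 U \<Longrightarrow>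
    ell2_inner (\<lambda>x. \<phi> x + \<psi> x) \<theta> = ell2_inner \<phi> \<theta> + ell2_inner \<psi> \<theta>"
  by (intro inner_add_left ell2_UNIV)

text \<open>Horner's scheme for \<open>p(A)\<close>. Real coefficients keep \<open>p(A)\<close>
  symmetric.\<close>

definition poly_op :: "real poly \<Rightarrow> 'v operator" where
  "poly_op p \<psi> = fold_coeffs (\<lambda>a \<theta>. (\<lambda>x. of_real a * \<psi> x + A \<theta> x)) p (\<lambda>x. 0)"

lemma poly_op_0 [simp]: "poly_op 0 \<psi> = (\<lambda>x. 0)"
  by (simp add: poly_op_def)

lemma poly_op_pCons: "poly_op (pCons a p) \<psi> = (\<lambda>x. of_real a * \<psi> x + A (poly_op p \<psi>) x)"
  by (cases "a = 0 \<and> p = 0") (auto simp: poly_op_def A_zero fold_coeffs_pCons_coeff_not_0_eq fold_coeffs_pCons_not_0_0_eq)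

lemma poly_op_in [intro]: "\<psi> \<in> ell2 U \<Longrightarrow> poly_op p \<psi> \<in> ell2 U"
  by (induction p) (auto simp: poly_op_pCons intro!: add_ell2 scale_ell2 A_in)

lemma poly_op_1: "poly_op 1 \<psi> = \<psi>"
  by (simp add: one_pCons poly_op_pCons A_zero)

lemma poly_op_add:
  assumes "\<psi> \<in> ell2 U"
  shows "poly_op (p + q) \<psi> = (\<lambda>x. poly_op p \<psi> x + poly_op q \<psi> x)"
proof (induction p q rule: poly_induct2)
  case 0 then show ?case by simp
next
  case (pCons a p b q)
  then show ?case using assms by (simp add: poly_op_pCons A_add poly_op_in algebra_simps)
qed

lemma poly_op_smult:
  assumes "\<psi> \<in> ell2 U"
  shows "poly_op (smult a p) \<psi> = (\<lambda>x. of_real a * poly_op p \<psi> x)"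
proof (induction p)
  case 0 then show ?case by simp
next
  case (pCons b p)
  then show ?case using assms by (simp add: poly_op_pCons A_scale poly_op_in algebra_simps)
qed

lemma poly_op_mult:
  assumes "\<psi> \<in> ell2 U"
  shows "poly_op (p * q) \<psi> = poly_op p (poly_op q \<psi>)"
proof (induction p)
  case 0 then show ?case by simp
next
  case (pCons b p)
  then show ?case using assms by (simp add: poly_op_pCons poly_op_add poly_op_smult)
qed

lemma poly_op_vec_add:
  assumes "\<phi> \<in> ell2 U" "\<psi> \<in> ell2 U"
  shows "poly_op p (\<lambda>x. \<phi> x + \<psi> x) = (\<lambda>x. poly_op p \<phi> x + poly_op p \<psi> x)"
proof (induction p)
  case 0 then show ?case by simp
next
  case (pCons b p)
  then show ?case using assms by (simp add: poly_op_pCons A_add poly_op_in algebra_simps)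
qed

lemma poly_op_vec_scale:
  assumes "\<psi> \<in> ell2 U"
  shows "poly_op p (\<lambda>x. a * \<psi> x) = (\<lambda>x. a * poly_op p \<psi> x)"
proof (induction p)
  case 0 then show ?case by simp
next
  case (pCons b p)
  then show ?case using assms by (simp add: poly_op_pCons A_scale poly_op_in algebra_simps)
qed

lemma poly_op_comm:
  assumes "\<psi> \<in> ell2 U"
  shows "A (poly_op p \<psi>) = poly_op p (A \<psi>)"
  using poly_op_mult[OF assms, of "[:0,1:]" p] poly_op_mult[OF assms, of p "[:0,1:]"]
  by (simp add: poly_op_pCons A_zero mult.commute)

lemma poly_op_sym:
  assumes "\<phi> \<in> ell2 U" "\<psi> \<in> ell2 U"
  shows "ell2_inner \<phi> (poly_op p \<psi>) = ell2_inner (poly_op p \<phi>) \<psi>"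
  using assms(2)
proof (induction p arbitrary: \<psi>)
  case 0 then show ?case by simp
next
  case (pCons b p)
  have "ell2_inner \<phi> (poly_op (pCons b p) \<psi>) = of_real b * ell2_inner \<phi> \<psi> + ell2_inner \<phi> (A (poly_op p \<psi>))"
    using assms(1) pCons.prems
    by (simp add: poly_op_pCons inner_U_add_right scale_ell2 A_in poly_op_in inner_scale_right)
  also have "ell2_inner \<phi> (A (poly_op p \<psi>)) = ell2_inner (A (poly_op p \<phi>)) \<psi>"
    using pCons.IH[OF A_in[OF pCons.prems]] pCons.prems assms(1) by (simp add: poly_op_comm A_sym poly_op_in)
  finally show ?case
    using assms(1) pCons.prems
    by (simp add: poly_op_pCons inner_U_add_left scale_ell2 A_in poly_op_in inner_scale_left)
qed

lemma poly_op_monom: "poly_op (monom 1 n) \<psi> = (A ^^ n) \<psi>"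
  by (induction n) (simp_all add: monom_0 monom_Suc poly_op_pCons A_zero)

lemma quadratic_real: "\<psi> \<in> ell2 U \<Longrightarrow> Im (ell2_inner \<psi> (A \<psi>)) = 0"
  using A_sym[of \<psi> \<psi>] inner_cnj[of \<psi> "A \<psi>"] by (metis Im_complex_of_real Reals_cases complex_is_Real_iff Reals_cnj_iff)

lemma poly_op_norm_sq:
  assumes "\<psi> \<in> ell2 U"
  shows "(ell2_norm (poly_op p \<psi>))\<^sup>2 = Re (ell2_inner \<psi> (poly_op (p * p) \<psi>))"
proof -
  have "ell2_inner \<psi> (poly_op (p * p) \<psi>) = complex_of_real ((ell2_norm (poly_op p \<psi>))\<^sup>2)"
    using assms by (simp add: poly_op_mult poly_op_sym[OF assms poly_op_in[OF assms]] inner_self del: of_real_power)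
  then show ?thesis by simp
qed

lemma quadratic_bounds:
  assumes "\<psi> \<in> ell2 U"
  shows "\<bar>Re (ell2_inner \<psi> (A \<psi>))\<bar> \<le> c * (ell2_norm \<psi>)\<^sup>2"
proof -
  have "\<bar>Re (ell2_inner \<psi> (A \<psi>))\<bar> \<le> ell2_norm \<psi> * ell2_norm (A \<psi>)"
    using ell2_cauchy_schwarz[OF ell2_UNIV[OF assms] ell2_UNIV[OF A_in[OF assms]]] abs_Re_le_cmod order_trans by blast
  also have "\<dots> \<le> ell2_norm \<psi> * (c * ell2_norm \<psi>)" using bd[OF assms] by (intro mult_left_mono) auto
  finally show ?thesis by (simp add: power2_eq_square mult_ac)
qed

lemma poly_op_linear_form:
  assumes "\<psi> \<in> ell2 U"
  shows "Re (ell2_inner \<psi> (poly_op [:a, b:] \<psi>)) = a * (ell2_norm \<psi>)\<^sup>2 + b * Re (ell2_inner \<psi> (A \<psi>))"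
proof -
  have "ell2_inner \<psi> (poly_op [:a, b:] \<psi>) = of_real a * ell2_inner \<psi> \<psi> + of_real b * ell2_inner \<psi> (A \<psi>)"
    using assms by (simp add: poly_op_pCons A_zero A_scale inner_U_add_right scale_ell2 A_in inner_scale_right)
  then show ?thesis by (simp add: inner_self)
qed

text \<open>The positivity asked for by \<open>hausdorff_moment_interval\<close>. Even powers are
  pulled out as \<open>q(A)\<close> on both sides, which symmetry turns into a change of vector.
  What remains is one of \<open>1\<close>, \<open>c + A\<close>, \<open>c - A\<close> and
  \<open>c^2 - A^2\<close>; the last is nonnegative by the norm bound, the middle two by
  Cauchy-Schwarz.\<close>

lemma bernstein_pos:
  assumes "\<psi> \<in> ell2 U"
  shows "0 \<le> Re (ell2_inner \<psi> (poly_op ([:c,1:]^i * [:c,-1:]^j) \<psi>))"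
proof -
  have sq: "Re (ell2_inner \<psi> (poly_op (q * (r * q)) \<psi>)) = Re (ell2_inner (poly_op q \<psi>) (poly_op r (poly_op q \<psi>)))" for q r
    using assms by (simp add: poly_op_mult poly_op_in poly_op_sym[OF assms, of _ q])
  have b: "\<bar>Re (ell2_inner \<phi> (A \<phi>))\<bar> \<le> c * (ell2_norm \<phi>)\<^sup>2" if "\<phi> \<in> ell2 U" for \<phi>
    by (rule quadratic_bounds[OF that])
  have p1: "0 \<le> Re (ell2_inner \<phi> (poly_op [:c,1:] \<phi>))" if "\<phi> \<in> ell2 U" for \<phi>
    unfolding poly_op_linear_form[OF that] using b[OF that] by linarith
  have p2: "0 \<le> Re (ell2_inner \<phi> (poly_op [:c,-1:] \<phi>))" if "\<phi> \<in> ell2 U" for \<phi>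
    unfolding poly_op_linear_form[OF that] using b[OF that] by linarith
  have p3: "0 \<le> Re (ell2_inner \<phi> (poly_op ([:c,1:] * [:c,-1:]) \<phi>))" if \<phi>: "\<phi> \<in> ell2 U" for \<phi>
  proof -
    have e: "[:c,1:] * [:c,-1:] = smult (c\<^sup>2) 1 + smult (-1) ([:0,1:] * [:0,1:])" by (simp add: power2_eq_square)
    have X: "poly_op [:0,1:] \<phi> = A \<phi>" by (simp add: poly_op_pCons A_zero)
    have "Re (ell2_inner \<phi> (poly_op ([:c,1:] * [:c,-1:]) \<phi>)) = c\<^sup>2 * (ell2_norm \<phi>)\<^sup>2 - (ell2_norm (A \<phi>))\<^sup>2"
    proof -
      have "ell2_inner \<phi> (poly_op ([:c,1:] * [:c,-1:]) \<phi>) = of_real (c\<^sup>2) * ell2_inner \<phi> (poly_op 1 \<phi>)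
         + of_real (-1) * ell2_inner \<phi> (poly_op ([:0,1:] * [:0,1:]) \<phi>)"
        unfolding e poly_op_add[OF \<phi>] poly_op_smult[OF \<phi>]
        by (subst inner_U_add_right[OF \<phi> scale_ell2[OF poly_op_in[OF \<phi>]] scale_ell2[OF poly_op_in[OF \<phi>]]]) (simp only: inner_scale_right)
      then show ?thesis unfolding X[symmetric] poly_op_norm_sq[OF \<phi>] poly_op_1 inner_self by simp
    qed
    moreover have "(ell2_norm (A \<phi>))\<^sup>2 \<le> (c * ell2_norm \<phi>)\<^sup>2" using bd[OF \<phi>] by (intro power_mono) auto
    ultimately show ?thesis by (simp add: power_mult_distrib)
  qed
  obtain a e where i: "i = a + a + e" "e = 0 \<or> e = 1"
    by (metis add_cancel_right_right even_two_times_div_two mult_2 odd_two_times_div_two_succ)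
  obtain b f where j: "j = b + b + f" "f = 0 \<or> f = 1"
    by (metis add_cancel_right_right even_two_times_div_two mult_2 odd_two_times_div_two_succ)
  define q where "q = [:c,1:]^a * [:c,-1:]^b"
  have "[:c,1:]^i * [:c,-1:]^j = q * (([:c,1:]^e * [:c,-1:]^f) * q)"
    unfolding q_def i(1) j(1) power_add by (simp only: mult_ac)
  moreover have "0 \<le> Re (ell2_inner \<phi> (poly_op ([:c,1:]^e * [:c,-1:]^f) \<phi>))" if "\<phi> \<in> ell2 U" for \<phi>
  proof -
    have "e = 0 \<and> f = 0 \<or> e = 1 \<and> f = 0 \<or> e = 0 \<and> f = 1 \<or> e = 1 \<and> f = 1" using i(2) j(2) by blast
    moreover have "0 \<le> Re (ell2_inner \<phi> (poly_op 1 \<phi>))" by (simp add: poly_op_1 inner_self)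
    ultimately show ?thesis
      using p1[OF that] p2[OF that] p3[OF that]
      by (elim disjE) (simp_all only: power_0 power_one_right mult_1_left mult_1_right)
  qed
  ultimately show ?thesis using sq assms by (simp only: poly_op_in)
qed

text \<open>The spectral measure of a vector, specified by its moments alone, so that it is
  available before any projection has been constructed. Compact support makes it unique.\<close>

definition vec_measure :: "('v \<Rightarrow> complex) \<Rightarrow> real measure" where
  "vec_measure \<psi> = (SOME \<mu>. supported c \<mu> \<and> (\<forall>p. integral\<^sup>L \<mu> (poly p) = Re (ell2_inner \<psi> (poly_op p \<psi>))))"

lemma vec_measure:
  assumes "\<psi> \<in> ell2 U"
  shows "supported c (vec_measure \<psi>)" "integral\<^sup>L (vec_measure \<psi>) (poly p) = Re (ell2_inner \<psi> (poly_op p \<psi>))"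
proof -
  have "\<exists>\<mu>. supported c \<mu> \<and> (\<forall>p. integral\<^sup>L \<mu> (poly p) = Re (ell2_inner \<psi> (poly_op p \<psi>)))"
  proof (rule hausdorff_moment_interval[where L="\<lambda>p. Re (ell2_inner \<psi> (poly_op p \<psi>))", OF _ _ bernstein_pos[OF assms] c_pos])
    show "Re (ell2_inner \<psi> (poly_op (p + q) \<psi>)) = Re (ell2_inner \<psi> (poly_op p \<psi>)) + Re (ell2_inner \<psi> (poly_op q \<psi>))" for p q
      unfolding poly_op_add[OF assms]
      by (subst inner_U_add_right[OF assms poly_op_in[OF assms] poly_op_in[OF assms]]) simp
    show "Re (ell2_inner \<psi> (poly_op (smult a p) \<psi>)) = a * Re (ell2_inner \<psi> (poly_op p \<psi>))" for a p
      unfolding poly_op_smult[OF assms] inner_scale_right by simp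
  qed
  from someI_ex[OF this] show "supported c (vec_measure \<psi>)" "integral\<^sup>L (vec_measure \<psi>) (poly p) = Re (ell2_inner \<psi> (poly_op p \<psi>))"
    unfolding vec_measure_def by blast+
qed

text \<open>Sending the polynomial \<open>p\<close> to the vector \<open>p(A) \<psi>\<close> is an
  isometry from L^2 of the vector measure. Cauchy sequences of polynomials thus become Cauchy
  sequences of vectors.\<close>

lemma vec_measure_norm_sq:
  assumes "\<psi> \<in> ell2 U"
  shows "(ell2_norm (poly_op p \<psi>))\<^sup>2 = integral\<^sup>L (vec_measure \<psi>) (\<lambda>t. (poly p t)\<^sup>2)"
proof -
  have "poly (p * p) = (\<lambda>t. (poly p t)\<^sup>2)" by (simp add: fun_eq_iff power2_eq_square)
  then show ?thesis using vec_measure(2)[OF assms, of "p*p"] poly_op_norm_sq[OF assms] by simp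
qed

lemma vec_measure_mass:
  assumes "\<psi> \<in> ell2 U"
  shows "measure (vec_measure \<psi>) UNIV = (ell2_norm \<psi>)\<^sup>2"
  using vec_measure_norm_sq[OF assms, of 1] supportedD(4)[OF vec_measure(1)[OF assms]] by (simp add: poly_op_1)

definition sq_err :: "real poly \<Rightarrow> real set \<Rightarrow> ('v \<Rightarrow> complex) \<Rightarrow> real" where
  "sq_err p B \<psi> = integral\<^sup>L (vec_measure \<psi>) (\<lambda>t. (poly p t - indicator B t)\<^sup>2)"

lemma sq_err_nonneg: "0 \<le> sq_err p B \<psi>"
  by (simp add: sq_err_def)

lemma sq_err_dense:
  assumes "finite S" "S \<subseteq> ell2 U" "B \<in> sets borel" "0 < e"
  shows "\<exists>p. \<forall>\<psi>\<in>S. sq_err p B \<psi> < e"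
  using poly_dense_L2[of "vec_measure ` S" c B e] assms vec_measure(1) by (auto simp: sq_err_def subset_iff)

lemma sq_err_integrable:
  assumes "\<psi> \<in> ell2 U" "B \<in> sets borel"
  shows "integrable (vec_measure \<psi>) (\<lambda>t. (poly p t - indicator B t)\<^sup>2)"
  by (rule supported_sq_err_integrable[OF vec_measure(1)[OF assms(1)] assms(2)])

lemma poly_op_diff_bound:
  assumes "\<psi> \<in> ell2 U" "B \<in> sets borel"
  shows "(ell2_norm (\<lambda>x. poly_op p \<psi> x - poly_op q \<psi> x))\<^sup>2 \<le> 2 * sq_err p B \<psi> + 2 * sq_err q B \<psi>"
proof -
  have "poly_op (p + smult (-1) q) \<psi> = (\<lambda>x. poly_op p \<psi> x - poly_op q \<psi> x)"
    unfolding poly_op_add[OF assms(1)] poly_op_smult[OF assms(1)] by simp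
  then have "(ell2_norm (\<lambda>x. poly_op p \<psi> x - poly_op q \<psi> x))\<^sup>2 = integral\<^sup>L (vec_measure \<psi>) (\<lambda>t. (poly (p + smult (-1) q) t)\<^sup>2)"
    using vec_measure_norm_sq[OF assms(1), of "p + smult (-1) q"] by (simp only:)
  also have "\<dots> \<le> integral\<^sup>L (vec_measure \<psi>) (\<lambda>t. 2 * (poly p t - indicator B t)\<^sup>2 + 2 * (poly q t - indicator B t)\<^sup>2)"
  proof (rule integral_mono)
    have "(\<lambda>t. (poly (p + smult (-1) q) t)\<^sup>2) = poly ((p + smult (-1) q) * (p + smult (-1) q))"
      by (simp add: fun_eq_iff power2_eq_square)
    then show "integrable (vec_measure \<psi>) (\<lambda>t. (poly (p + smult (-1) q) t)\<^sup>2)"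
      using supported_integrable_poly[OF vec_measure(1)[OF assms(1)]] by simp
    show "integrable (vec_measure \<psi>) (\<lambda>t. 2 * (poly p t - indicator B t)\<^sup>2 + 2 * (poly q t - indicator B t)\<^sup>2)"
      by (intro Bochner_Integration.integrable_add integrable_mult_right sq_err_integrable assms)
    show "(poly (p + smult (-1) q) t)\<^sup>2 \<le> 2 * (poly p t - indicator B t)\<^sup>2 + 2 * (poly q t - indicator B t)\<^sup>2" for t
    proof -
      have "(a - b)\<^sup>2 \<le> 2 * (a - i)\<^sup>2 + 2 * (b - i)\<^sup>2" for a b i :: real
      proof -
        have "2 * (a - i)\<^sup>2 + 2 * (b - i)\<^sup>2 - (a - b)\<^sup>2 = (a + b - 2 * i)\<^sup>2" by (simp add: power2_eq_square algebra_simps)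
        then show ?thesis by (smt (verit) zero_le_power2)
      qed
      then show ?thesis by simp
    qed
  qed
  also have "\<dots> = 2 * sq_err p B \<psi> + 2 * sq_err q B \<psi>"
    unfolding sq_err_def using sq_err_integrable[OF assms] by simp
  finally show ?thesis .
qed

text \<open>
  \<open>ind_op B\<close> is \<open>1\<^sub>B(A)\<close>. The estimate \<open>\<parallel>p(A)\<psi> - 1\<^sub>B(A)\<psi>\<parallel>\<^sup>2 \<le> 4 \<integral>(p - 1\<^sub>B)\<^sup>2 d\<mu>\<^sub>\<psi>\<close> for all polynomials
  \<open>p\<close> determines it, because polynomials are dense in \<open>L\<^sup>2(\<mu>\<^sub>\<psi>)\<close>.
\<close>
definition ind_op :: "real set \<Rightarrow> 'v operator" where
  "ind_op B \<psi> = (SOME \<theta>. \<theta> \<in> ell2 U \<and> (\<forall>p. (ell2_norm (\<lambda>x. poly_op p \<psi> x - \<theta> x))\<^sup>2 \<le> 4 * sq_err p B \<psi>))"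

lemma ind_op:
  assumes \<psi>: "\<psi> \<in> ell2 U" and B: "B \<in> sets borel"
  shows "ind_op B \<psi> \<in> ell2 U" "(ell2_norm (\<lambda>x. poly_op p \<psi> x - ind_op B \<psi> x))\<^sup>2 \<le> 4 * sq_err p B \<psi>"
proof -
  have "\<exists>p. sq_err p B \<psi> < 1 / real (Suc n)" for n
    using sq_err_dense[of "{\<psi>}" B "1 / real (Suc n)"] assms by auto
  then obtain P where P: "\<And>n. sq_err (P n) B \<psi> < 1 / real (Suc n)" by metis
  have lim: "(\<lambda>n. sq_err (P n) B \<psi>) \<longlonglongrightarrow> 0"
  proof (rule tendsto_sandwich[of "\<lambda>_. 0"])
    show "(\<lambda>n. 1 / real (Suc n)) \<longlonglongrightarrow> 0" by (rule LIMSEQ_Suc[OF lim_const_over_n])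
  qed (use P sq_err_nonneg in \<open>auto intro!: always_eventually less_imp_le\<close>)
  have "\<exists>N. \<forall>m\<ge>N. \<forall>n\<ge>N. ell2_norm (\<lambda>x. poly_op (P m) \<psi> x - poly_op (P n) \<psi> x) < e" if e: "e > 0" for e
  proof -
    have "e\<^sup>2 / 4 > 0" using e by simp
    from order_tendstoD(2)[OF lim this]
    obtain N where N: "\<And>n. n \<ge> N \<Longrightarrow> sq_err (P n) B \<psi> < e\<^sup>2 / 4"
      unfolding eventually_sequentially by blast
    have "ell2_norm (\<lambda>x. poly_op (P m) \<psi> x - poly_op (P n) \<psi> x) < e" if "m \<ge> N" "n \<ge> N" for m n
    proof (rule power_less_imp_less_base)
      show "(ell2_norm (\<lambda>x. poly_op (P m) \<psi> x - poly_op (P n) \<psi> x))\<^sup>2 < e\<^sup>2"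
        using poly_op_diff_bound[OF assms, of "P m" "P n"] N[OF that(1)] N[OF that(2)] by linarith
    qed (use e in simp)
    then show ?thesis by blast
  qed
  from ell2_complete[OF poly_op_in[OF \<psi>] this]
  obtain g where g: "g \<in> ell2 U" "(\<lambda>n. ell2_norm (\<lambda>x. poly_op (P n) \<psi> x - g x)) \<longlonglongrightarrow> 0" by blast
  \<comment> \<open>The factor 4 comes from using \<open>(a + b)^2 <= 2 a^2 + 2 b^2\<close> twice:
    once to pass through \<open>P n\<close>, once inside \<open>poly_op_diff_bound\<close>. The
    terms with \<open>P n\<close> vanish in the limit.\<close>
  have "(ell2_norm (\<lambda>x. poly_op p \<psi> x - g x))\<^sup>2 \<le> 4 * sq_err p B \<psi>" for p
  proof (rule LIMSEQ_le_const)
    show "(\<lambda>n. 4 * sq_err p B \<psi> + 4 * sq_err (P n) B \<psi> + 2 * (ell2_norm (\<lambda>x. poly_op (P n) \<psi> x - g x))\<^sup>2) \<longlonglongrightarrow> 4 * sq_err p B \<psi>"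
      using tendsto_add[OF tendsto_add[OF tendsto_const tendsto_mult[OF tendsto_const lim]] tendsto_mult[OF tendsto_const tendsto_power[OF g(2), of 2]],
          of "4 * sq_err p B \<psi>" 4 2] by simp
    have "(ell2_norm (\<lambda>x. poly_op p \<psi> x - g x))\<^sup>2 \<le> 4 * sq_err p B \<psi> + 4 * sq_err (P n) B \<psi> + 2 * (ell2_norm (\<lambda>x. poly_op (P n) \<psi> x - g x))\<^sup>2" for n
    proof -
      let ?a = "ell2_norm (\<lambda>x. poly_op p \<psi> x - poly_op (P n) \<psi> x)" and ?b = "ell2_norm (\<lambda>x. poly_op (P n) \<psi> x - g x)"
      have "ell2_norm (\<lambda>x. poly_op p \<psi> x - g x) \<le> ?a + ?b"
        using \<psi> g(1) by (intro ell2_norm_triangle_diff ell2_UNIV[of _ U] poly_op_in)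
      then have "(ell2_norm (\<lambda>x. poly_op p \<psi> x - g x))\<^sup>2 \<le> (?a + ?b)\<^sup>2" by (intro power_mono) auto
      also have "\<dots> \<le> 2 * ?a\<^sup>2 + 2 * ?b\<^sup>2" using sum_squares_bound[of ?a ?b] by (simp add: power2_sum)
      also have "?a\<^sup>2 \<le> 2 * sq_err p B \<psi> + 2 * sq_err (P n) B \<psi>" by (rule poly_op_diff_bound[OF assms])
      finally show ?thesis by simp
    qed
    then show "\<exists>N. \<forall>n\<ge>N. (ell2_norm (\<lambda>x. poly_op p \<psi> x - g x))\<^sup>2
        \<le> 4 * sq_err p B \<psi> + 4 * sq_err (P n) B \<psi> + 2 * (ell2_norm (\<lambda>x. poly_op (P n) \<psi> x - g x))\<^sup>2" by blast
  qed
  with g(1) have "\<exists>\<theta>. \<theta> \<in> ell2 U \<and> (\<forall>p. (ell2_norm (\<lambda>x. poly_op p \<psi> x - \<theta> x))\<^sup>2 \<le> 4 * sq_err p B \<psi>)" by blast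
  from someI_ex[OF this]
  show "ind_op B \<psi> \<in> ell2 U" "(ell2_norm (\<lambda>x. poly_op p \<psi> x - ind_op B \<psi> x))\<^sup>2 \<le> 4 * sq_err p B \<psi>"
    unfolding ind_op_def by blast+
qed

text \<open>One sequence of polynomials for finitely many vectors, so that algebraic identities
  valid for \<open>poly_op (P n)\<close> pass to \<open>ind_op B\<close>.\<close>

lemma ind_op_approx:
  assumes "finite S" "S \<subseteq> ell2 U" "B \<in> sets borel"
  shows "\<exists>P :: nat \<Rightarrow> real poly. \<forall>\<psi>\<in>S. (\<lambda>n. ell2_norm (\<lambda>x. poly_op (P n) \<psi> x - ind_op B \<psi> x)) \<longlonglongrightarrow> 0
    \<and> (\<lambda>n. sq_err (P n) B \<psi>) \<longlonglongrightarrow> 0"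
proof -
  have "\<exists>p. \<forall>\<psi>\<in>S. sq_err p B \<psi> < 1 / real (Suc n)" for n by (rule sq_err_dense[OF assms]) simp
  then obtain P where P: "\<And>n \<psi>. \<psi> \<in> S \<Longrightarrow> sq_err (P n) B \<psi> < 1 / real (Suc n)" by metis
  have lim: "(\<lambda>n. sq_err (P n) B \<psi>) \<longlonglongrightarrow> 0" if "\<psi> \<in> S" for \<psi>
  proof (rule tendsto_sandwich[of "\<lambda>_. 0"])
    show "(\<lambda>n. 1 / real (Suc n)) \<longlonglongrightarrow> 0" by (rule LIMSEQ_Suc[OF lim_const_over_n])
  qed (use P[OF that] sq_err_nonneg in \<open>auto intro!: always_eventually less_imp_le\<close>)
  have "(\<lambda>n. ell2_norm (\<lambda>x. poly_op (P n) \<psi> x - ind_op B \<psi> x)) \<longlonglongrightarrow> 0" if "\<psi> \<in> S" for \<psi>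
  proof -
    have "(\<lambda>n. (ell2_norm (\<lambda>x. poly_op (P n) \<psi> x - ind_op B \<psi> x))\<^sup>2) \<longlonglongrightarrow> 0"
    proof (rule tendsto_sandwich[of "\<lambda>_. 0"])
      show "(\<lambda>n. 4 * sq_err (P n) B \<psi>) \<longlonglongrightarrow> 0" using tendsto_mult[OF tendsto_const lim[OF that], of 4] by simp
    qed (use ind_op(2)[of \<psi> B] that assms in auto)
    from tendsto_real_sqrt[OF this] show ?thesis by simp
  qed
  then show ?thesis using lim by blast
qed

lemma ind_op_add:
  assumes "\<phi> \<in> ell2 U" "\<psi> \<in> ell2 U" "B \<in> sets borel"
  shows "ind_op B (\<lambda>x. \<phi> x + \<psi> x) = (\<lambda>x. ind_op B \<phi> x + ind_op B \<psi> x)"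
proof
  fix x
  have sum: "(\<lambda>x. \<phi> x + \<psi> x) \<in> ell2 U" using assms by (intro add_ell2)
  obtain P where P: "\<And>\<theta>. \<theta> \<in> {\<phi>, \<psi>, \<lambda>x. \<phi> x + \<psi> x} \<Longrightarrow> (\<lambda>n. ell2_norm (\<lambda>x. poly_op (P n) \<theta> x - ind_op B \<theta> x)) \<longlonglongrightarrow> 0"
    using ind_op_approx[of "{\<phi>, \<psi>, \<lambda>x. \<phi> x + \<psi> x}" B] assms sum by blast
  have pt: "(\<lambda>n. poly_op (P n) \<theta> x) \<longlonglongrightarrow> ind_op B \<theta> x" if "\<theta> \<in> {\<phi>, \<psi>, \<lambda>x. \<phi> x + \<psi> x}" for \<theta>
  proof (rule LIM_zero_cancel, rule Lim_null_comparison[OF _ P[OF that]])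
    have \<theta>: "\<theta> \<in> ell2 U" using that assms sum by auto
    show "\<forall>\<^sub>F n in sequentially. norm (poly_op (P n) \<theta> x - ind_op B \<theta> x) \<le> ell2_norm (\<lambda>x. poly_op (P n) \<theta> x - ind_op B \<theta> x)"
      using ell2_norm_coord[OF ell2_UNIV[OF diff_ell2[OF poly_op_in[OF \<theta>] ind_op(1)[OF \<theta> assms(3)]]]] by simp
  qed
  have "(\<lambda>n. poly_op (P n) \<phi> x + poly_op (P n) \<psi> x) \<longlonglongrightarrow> ind_op B \<phi> x + ind_op B \<psi> x"
    by (intro tendsto_add pt) auto
  moreover have "(\<lambda>n. poly_op (P n) \<phi> x + poly_op (P n) \<psi> x) \<longlonglongrightarrow> ind_op B (\<lambda>x. \<phi> x + \<psi> x) x"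
    using pt[of "\<lambda>x. \<phi> x + \<psi> x"] unfolding poly_op_vec_add[OF assms(1,2)] by simp
  ultimately show "ind_op B (\<lambda>x. \<phi> x + \<psi> x) x = ind_op B \<phi> x + ind_op B \<psi> x" by (rule LIMSEQ_unique[symmetric])
qed

lemma ind_op_scale:
  assumes "\<psi> \<in> ell2 U" "B \<in> sets borel"
  shows "ind_op B (\<lambda>x. a * \<psi> x) = (\<lambda>x. a * ind_op B \<psi> x)"
proof
  fix x
  have sum: "(\<lambda>x. a * \<psi> x) \<in> ell2 U" using assms by (intro scale_ell2)
  obtain P where P: "\<And>\<theta>. \<theta> \<in> {\<psi>, \<lambda>x. a * \<psi> x} \<Longrightarrow> (\<lambda>n. ell2_norm (\<lambda>x. poly_op (P n) \<theta> x - ind_op B \<theta> x)) \<longlonglongrightarrow> 0"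
    using ind_op_approx[of "{\<psi>, \<lambda>x. a * \<psi> x}" B] assms sum by blast
  have pt: "(\<lambda>n. poly_op (P n) \<theta> x) \<longlonglongrightarrow> ind_op B \<theta> x" if "\<theta> \<in> {\<psi>, \<lambda>x. a * \<psi> x}" for \<theta>
  proof (rule LIM_zero_cancel, rule Lim_null_comparison[OF _ P[OF that]])
    have \<theta>: "\<theta> \<in> ell2 U" using that assms sum by auto
    show "\<forall>\<^sub>F n in sequentially. norm (poly_op (P n) \<theta> x - ind_op B \<theta> x) \<le> ell2_norm (\<lambda>x. poly_op (P n) \<theta> x - ind_op B \<theta> x)"
      using ell2_norm_coord[OF ell2_UNIV[OF diff_ell2[OF poly_op_in[OF \<theta>] ind_op(1)[OF \<theta> assms(2)]]]] by simp
  qed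
  have "(\<lambda>n. a * poly_op (P n) \<psi> x) \<longlonglongrightarrow> a * ind_op B \<psi> x"
    by (intro tendsto_mult tendsto_const pt) auto
  moreover have "(\<lambda>n. a * poly_op (P n) \<psi> x) \<longlonglongrightarrow> ind_op B (\<lambda>x. a * \<psi> x) x"
    using pt[of "\<lambda>x. a * \<psi> x"] unfolding poly_op_vec_scale[OF assms(1)] by simp
  ultimately show "ind_op B (\<lambda>x. a * \<psi> x) x = a * ind_op B \<psi> x" by (rule LIMSEQ_unique[symmetric])
qed

lemma ind_op_sym:
  assumes "\<phi> \<in> ell2 U" "\<psi> \<in> ell2 U" "B \<in> sets borel"
  shows "ell2_inner \<phi> (ind_op B \<psi>) = ell2_inner (ind_op B \<phi>) \<psi>"
proof -
  obtain P where P: "\<And>\<theta>. \<theta> \<in> {\<phi>, \<psi>} \<Longrightarrow> (\<lambda>n. ell2_norm (\<lambda>x. poly_op (P n) \<theta> x - ind_op B \<theta> x)) \<longlonglongrightarrow> 0"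
    using ind_op_approx[of "{\<phi>, \<psi>}" B] assms by blast
  have *: "(\<lambda>n. ell2_inner \<xi> (poly_op (P n) \<theta>)) \<longlonglongrightarrow> ell2_inner \<xi> (ind_op B \<theta>)" if "\<theta> \<in> {\<phi>, \<psi>}" "\<xi> \<in> {\<phi>, \<psi>}" for \<theta> \<xi>
    by (rule inner_tendsto_right[OF _ _ _ P[OF that(1)]])
      (use that assms in \<open>auto intro!: ell2_UNIV[OF poly_op_in] ell2_UNIV[OF ind_op(1)] intro: ell2_UNIV\<close>)
  have "(\<lambda>n. ell2_inner \<phi> (poly_op (P n) \<psi>)) \<longlonglongrightarrow> ell2_inner \<phi> (ind_op B \<psi>)" using * by simp
  moreover have "(\<lambda>n. cnj (ell2_inner \<psi> (poly_op (P n) \<phi>))) \<longlonglongrightarrow> cnj (ell2_inner \<psi> (ind_op B \<phi>))"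
    by (intro tendsto_cnj *) auto
  then have "(\<lambda>n. ell2_inner \<phi> (poly_op (P n) \<psi>)) \<longlonglongrightarrow> ell2_inner (ind_op B \<phi>) \<psi>"
    unfolding inner_cnj poly_op_sym[OF assms(1,2), symmetric] .
  ultimately show ?thesis by (rule LIMSEQ_unique)
qed

lemma ind_op_measure:
  assumes \<psi>: "\<psi> \<in> ell2 U" and B: "B \<in> sets borel"
  shows "(ell2_norm (ind_op B \<psi>))\<^sup>2 = measure (vec_measure \<psi>) B"
    and "ell2_inner \<psi> (ind_op B \<psi>) = complex_of_real (measure (vec_measure \<psi>) B)"
proof -
  let ?\<mu> = "vec_measure \<psi>"
  note s = vec_measure(1)[OF \<psi>]
  obtain P where P: "(\<lambda>n. ell2_norm (\<lambda>x. poly_op (P n) \<psi> x - ind_op B \<psi> x)) \<longlonglongrightarrow> 0"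
     and E: "(\<lambda>n. sq_err (P n) B \<psi>) \<longlonglongrightarrow> 0"
    using ind_op_approx[of "{\<psi>}" B] assms by blast
  note L = L2_convergence_indicator[OF s B E[unfolded sq_err_def]]
  have l1: "(\<lambda>n. integral\<^sup>L ?\<mu> (poly (P n))) \<longlonglongrightarrow> measure ?\<mu> B" by (rule L)
  have l2: "(\<lambda>n. (ell2_norm (poly_op (P n) \<psi>))\<^sup>2) \<longlonglongrightarrow> measure ?\<mu> B"
    unfolding vec_measure_norm_sq[OF \<psi>] by (rule L)
  have l3: "(\<lambda>n. (ell2_norm (poly_op (P n) \<psi>))\<^sup>2) \<longlonglongrightarrow> (ell2_norm (ind_op B \<psi>))\<^sup>2"
    by (intro tendsto_power norm_tendsto[OF _ _ P]) (use assms in \<open>auto intro!: ell2_UNIV[OF poly_op_in] ell2_UNIV[OF ind_op(1)]\<close>)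
  show n: "(ell2_norm (ind_op B \<psi>))\<^sup>2 = measure ?\<mu> B" by (rule LIMSEQ_unique[OF l3 l2])
  have "(\<lambda>n. ell2_inner \<psi> (poly_op (P n) \<psi>)) \<longlonglongrightarrow> ell2_inner \<psi> (ind_op B \<psi>)"
    by (rule inner_tendsto_right[OF _ _ _ P]) (use assms in \<open>auto intro!: ell2_UNIV[OF poly_op_in] ell2_UNIV[OF ind_op(1)] intro: ell2_UNIV\<close>)
  from tendsto_Re[OF this] have "(\<lambda>n. integral\<^sup>L ?\<mu> (poly (P n))) \<longlonglongrightarrow> Re (ell2_inner \<psi> (ind_op B \<psi>))"
    by (simp only: vec_measure(2)[OF \<psi>])
  from LIMSEQ_unique[OF this l1] have re: "Re (ell2_inner \<psi> (ind_op B \<psi>)) = measure ?\<mu> B" .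
  have "Im (ell2_inner \<psi> (ind_op B \<psi>)) = 0"
    using ind_op_sym[OF \<psi> \<psi> B] inner_cnj[of \<psi> "ind_op B \<psi>"] by (metis complex_is_Real_iff Reals_cnj_iff)
  then show "ell2_inner \<psi> (ind_op B \<psi>) = complex_of_real (measure ?\<mu> B)" using re by (simp add: complex_eq_iff)
qed

end

section \<open>Existence of the spectral measure\<close>

context bounded_sa
begin

lemma ind_op_fix:
  assumes \<psi>: "\<psi> \<in> ell2 U" and B: "B \<in> sets borel" and m: "measure (vec_measure \<psi>) B = (ell2_norm \<psi>)\<^sup>2"
  shows "ind_op B \<psi> = \<psi>"
proof -
  have d: "(\<lambda>x. - 1 * ind_op B \<psi> x) \<in> ell2 U" by (intro scale_ell2 ind_op(1) assms)
  have "(ell2_norm (\<lambda>x. \<psi> x + - 1 * ind_op B \<psi> x))\<^sup>2 = (ell2_norm \<psi>)\<^sup>2 - 2 * measure (vec_measure \<psi>) B + (ell2_norm (ind_op B \<psi>))\<^sup>2"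
    unfolding ell2_norm_add_sq[OF ell2_UNIV[OF \<psi>] ell2_UNIV[OF d]] inner_scale_right ell2_norm_scale
    by (simp add: ind_op_measure(2)[OF \<psi> B])
  also have "\<dots> = 0" using ind_op_measure(1)[OF \<psi> B] m by simp
  finally have "ell2_norm (\<lambda>x. \<psi> x + - 1 * ind_op B \<psi> x) = 0" by simp
  from ell2_norm_eq_0[OF ell2_UNIV[OF add_ell2[OF \<psi> d]] this] show ?thesis by (auto simp: fun_eq_iff)
qed

text \<open>Only linearity, symmetry and the identity of quadratic form and squared norm are used,
  no product rule. With \<open>\<theta>\<close> the image of \<open>\<psi>\<close> and
  \<open>\<xi>\<close> the image of \<open>\<theta>\<close>, the squared norm of
  \<open>\<theta> - \<xi>\<close> is computed directly, and again as the quadratic form at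
  \<open>\<psi> - \<theta>\<close>, whose image is \<open>\<theta> - \<xi>\<close>. The two results
  are negatives of each other, so the norm is 0.\<close>

lemma ind_op_idem:
  assumes \<psi>: "\<psi> \<in> ell2 U" and B: "B \<in> sets borel"
  shows "ind_op B (ind_op B \<psi>) = ind_op B \<psi>"
proof -
  let ?\<theta> = "ind_op B \<psi>"
  let ?\<xi> = "ind_op B ?\<theta>"
  have \<theta>: "?\<theta> \<in> ell2 U" and \<xi>: "?\<xi> \<in> ell2 U" by (intro ind_op(1) assms)+
  have m\<theta>: "(\<lambda>x. -1 * ?\<theta> x) \<in> ell2 U" and m\<xi>: "(\<lambda>x. -1 * ?\<xi> x) \<in> ell2 U" by (intro scale_ell2 \<theta> \<xi>)+
  have sq: "ell2_inner \<phi> (ind_op B \<phi>) = complex_of_real ((ell2_norm (ind_op B \<phi>))\<^sup>2)" if "\<phi> \<in> ell2 U" for \<phi>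
    using ind_op_measure[OF that B] by simp
  let ?D = "\<lambda>x. ?\<theta> x + -1 * ?\<xi> x"
  have "(ell2_norm ?D)\<^sup>2 = (ell2_norm ?\<theta>)\<^sup>2 - (ell2_norm ?\<xi>)\<^sup>2"
    unfolding ell2_norm_add_sq[OF ell2_UNIV[OF \<theta>] ell2_UNIV[OF m\<xi>]] inner_scale_right ell2_norm_scale
    by (simp add: sq[OF \<theta>])
  moreover have "(ell2_norm ?D)\<^sup>2 = (ell2_norm ?\<xi>)\<^sup>2 - (ell2_norm ?\<theta>)\<^sup>2"
  proof -
    let ?\<phi> = "\<lambda>x. \<psi> x + -1 * ?\<theta> x"
    have \<phi>: "?\<phi> \<in> ell2 U" by (intro add_ell2 \<psi> m\<theta>)
    have E: "ind_op B ?\<phi> = ?D" unfolding ind_op_add[OF \<psi> m\<theta> B] ind_op_scale[OF \<theta> B] ..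
    have D: "?D \<in> ell2 U" by (intro add_ell2 \<theta> m\<xi>)
    have "complex_of_real ((ell2_norm ?D)\<^sup>2) = ell2_inner ?\<phi> ?D" using sq[OF \<phi>] E by simp
    also have "\<dots> = ell2_inner \<psi> ?\<theta> - ell2_inner \<psi> ?\<xi> - ell2_inner ?\<theta> ?\<theta> + ell2_inner ?\<theta> ?\<xi>"
      unfolding inner_U_add_left[OF \<psi> m\<theta> D] inner_scale_left inner_U_add_right[OF \<psi> \<theta> m\<xi>] inner_U_add_right[OF \<theta> \<theta> m\<xi>] inner_scale_right
      by simp
    also have "ell2_inner \<psi> ?\<xi> = ell2_inner ?\<theta> ?\<theta>" by (rule ind_op_sym[OF \<psi> \<theta> B])
    also have "ell2_inner \<psi> ?\<theta> = ell2_inner ?\<theta> ?\<theta>" unfolding sq[OF \<psi>] inner_self ..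
    also have "ell2_inner ?\<theta> ?\<xi> = complex_of_real ((ell2_norm ?\<xi>)\<^sup>2)" by (rule sq[OF \<theta>])
    finally have "complex_of_real ((ell2_norm ?D)\<^sup>2) = complex_of_real ((ell2_norm ?\<xi>)\<^sup>2 - (ell2_norm ?\<theta>)\<^sup>2)"
      unfolding inner_self by simp
    then show ?thesis using of_real_eq_iff by blast
  qed
  ultimately have "ell2_norm ?D = 0" by simp
  from ell2_norm_eq_0[OF ell2_UNIV[OF add_ell2[OF \<theta> m\<xi>]] this] show ?thesis by (auto simp: fun_eq_iff)
qed

lemma scalar_measure_eq:
  assumes \<mu>: "finite_measure \<mu>" "sets \<mu> = sets borel"
    and m: "\<And>B. B \<in> sets borel \<Longrightarrow> Re (ell2_inner \<psi> (E B \<psi>)) = measure \<mu> B"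
  shows "scalar_measure E \<psi> = \<mu>"
proof -
  interpret finite_measure \<mu> by fact
  have "scalar_measure E \<psi> = measure_of UNIV (sets borel) (emeasure \<mu>)"
    unfolding scalar_measure_def
    by (rule measure_of_eq) (auto simp: m emeasure_eq_measure sets.sigma_sets_eq[of borel, simplified space_borel])
  also have "\<dots> = \<mu>" using measure_of_of_measure[of \<mu>] \<mu>(2) sets_eq_imp_space_eq[OF \<mu>(2)] by simp
  finally show ?thesis .
qed

text \<open>This witness shows that the choice in \<open>spectral_projection\<close> picks an actual
  spectral measure of \<open>A\<close>.\<close>

lemma spectral_measure_ind_op: "spectral_measure_of U A ind_op"
  unfolding spectral_measure_of_def projection_valued_measure_def
proof (intro conjI ballI allI impI)
  fix B :: "real set" assume B: "B \<in> sets borel"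
  show "orthogonal_projection_on U (ind_op B)"
    unfolding orthogonal_projection_on_def linear_op_on_def symmetric_on_def
    by (intro conjI ballI allI ind_op(1) ind_op_add ind_op_scale ind_op_sym ind_op_idem B)
next
  fix \<psi> assume \<psi>: "\<psi> \<in> ell2 U"
  show "ind_op UNIV \<psi> = \<psi>" by (rule ind_op_fix[OF \<psi>]) (auto simp: vec_measure_mass[OF \<psi>])
next
  fix B :: "nat \<Rightarrow> real set" and \<psi> assume B: "range B \<subseteq> sets borel" "disjoint_family B" and \<psi>: "\<psi> \<in> ell2 U"
  interpret finite_measure "vec_measure \<psi>" using supportedD(1)[OF vec_measure(1)[OF \<psi>]] .
  have "(\<lambda>n. measure (vec_measure \<psi>) (B n)) sums measure (vec_measure \<psi>) (\<Union>n. B n)"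
    using B supportedD(2)[OF vec_measure(1)[OF \<psi>]] by (intro finite_measure_UNION) auto
  moreover have "B n \<in> sets borel" "(\<Union>n. B n) \<in> sets borel" for n using B(1) by auto
  ultimately show "(\<lambda>n. ell2_inner \<psi> (ind_op (B n) \<psi>)) sums ell2_inner \<psi> (ind_op (\<Union>n. B n) \<psi>)"
    by (simp add: ind_op_measure(2)[OF \<psi>] sums_of_real)
next
  have "ind_op {-c..c} \<psi> = \<psi>" if \<psi>: "\<psi> \<in> ell2 U" for \<psi>
  proof (rule ind_op_fix[OF \<psi>])
    interpret finite_measure "vec_measure \<psi>" using supportedD(1)[OF vec_measure(1)[OF \<psi>]] .
    have "measure (vec_measure \<psi>) {-c..c} = measure (vec_measure \<psi>) UNIV"
      using supportedD[OF vec_measure(1)[OF \<psi>]] by (intro finite_measure_eq_AE) (auto elim!: eventually_mono)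
    then show "measure (vec_measure \<psi>) {-c..c} = (ell2_norm \<psi>)\<^sup>2" using vec_measure_mass[OF \<psi>] by simp
  qed auto
  then show "\<exists>c. \<forall>\<psi>\<in>ell2 U. ind_op {-c..c} \<psi> = \<psi>" by blast
next
  fix \<psi> assume \<psi>: "\<psi> \<in> ell2 U"
  have "scalar_measure ind_op \<psi> = vec_measure \<psi>"
    using supportedD[OF vec_measure(1)[OF \<psi>]] ind_op_measure(2)[OF \<psi>] by (intro scalar_measure_eq) auto
  moreover have "poly [:0,1:] = (\<lambda>t::real. t)" by (simp add: fun_eq_iff)
  ultimately have "integral\<^sup>L (scalar_measure ind_op \<psi>) (\<lambda>t. t) = Re (ell2_inner \<psi> (A \<psi>))"
    using vec_measure(2)[OF \<psi>, of "[:0,1:]"] by (simp add: poly_op_pCons A_zero)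
  then show "ell2_inner \<psi> (A \<psi>) = complex_of_real (integral\<^sup>L (scalar_measure ind_op \<psi>) (\<lambda>t. t))"
    using quadratic_real[OF \<psi>] by (simp add: complex_eq_iff)
qed

lemma bounded_self_adjoint: "bounded_self_adjoint_on U A"
  unfolding bounded_self_adjoint_on_def using lin sym bd by blast

text \<open>For a symmetric operator the norm is controlled by the quadratic form. The form is
  evaluated at \<open>\<phi> + s D\<phi>\<close> and \<open>\<phi> - s D\<phi>\<close>: the
  difference isolates \<open>4 s\<close> times the squared norm of \<open>D\<phi>\<close>, and the
  parallelogram law bounds it. The choice \<open>s = 1 / w\<close> balances the two terms. This is
  how the weak equation \<open>A = \<integral> t dE(t)\<close> becomes an estimate in norm.\<close>

lemma symmetric_norm_bound:
  assumes D: "linear_op_on U D" "symmetric_on U D" and w: "0 < w"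
    and q: "\<And>\<phi>. \<phi> \<in> ell2 U \<Longrightarrow> \<bar>Re (ell2_inner \<phi> (D \<phi>))\<bar> \<le> w * (ell2_norm \<phi>)\<^sup>2"
    and \<phi>: "\<phi> \<in> ell2 U"
  shows "ell2_norm (D \<phi>) \<le> w * ell2_norm \<phi>"
proof -
  define s where "s = 1 / w"
  have s: "s > 0" using w by (simp add: s_def)
  have D\<phi>: "D \<phi> \<in> ell2 U" using D \<phi> by (simp add: linear_op_on_def)
  define \<theta> where "\<theta> = (\<lambda>x. of_real s * D \<phi> x)"
  define \<theta>' where "\<theta>' = (\<lambda>x. of_real (- s) * D \<phi> x)"
  have \<theta>: "\<theta> \<in> ell2 U" "\<theta>' \<in> ell2 U" unfolding \<theta>_def \<theta>'_def by (intro scale_ell2 D\<phi>)+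
  have DD: "D (D \<phi>) \<in> ell2 U" using D D\<phi> by (simp add: linear_op_on_def)
  have D\<theta>: "D \<theta> = (\<lambda>x. of_real s * D (D \<phi>) x)" "D \<theta>' = (\<lambda>x. of_real (-s) * D (D \<phi>) x)"
    using D D\<phi> unfolding linear_op_on_def \<theta>_def \<theta>'_def by blast+
  have add: "D (\<lambda>x. \<phi> x + \<xi> x) = (\<lambda>x. D \<phi> x + D \<xi> x)" if "\<xi> \<in> ell2 U" for \<xi>
    using D \<phi> that by (simp add: linear_op_on_def)
  have form: "Re (ell2_inner (\<lambda>x. \<phi> x + \<xi> x) (D (\<lambda>x. \<phi> x + \<xi> x)))
     = Re (ell2_inner \<phi> (D \<phi>)) + 2 * r * (ell2_norm (D \<phi>))\<^sup>2 + Re (ell2_inner \<xi> (D \<xi>))"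
    if \<xi>: "\<xi> = (\<lambda>x. of_real r * D \<phi> x)" and D\<xi>: "D \<xi> = (\<lambda>x. of_real r * D (D \<phi>) x)" for \<xi> r
  proof -
    have \<xi>U: "\<xi> \<in> ell2 U" unfolding \<xi> by (intro scale_ell2 D\<phi>)
    have D\<xi>U: "D \<xi> \<in> ell2 U" unfolding D\<xi> by (intro scale_ell2 DD)
    have 1: "ell2_inner \<phi> (D \<xi>) = of_real r * ell2_inner (D \<phi>) (D \<phi>)"
      unfolding D\<xi> inner_scale_right using D(2) \<phi> D\<phi> by (simp add: symmetric_on_def)
    have 2: "ell2_inner \<xi> (D \<phi>) = of_real r * ell2_inner (D \<phi>) (D \<phi>)"
      unfolding \<xi> inner_scale_left by simp
    have "ell2_inner (\<lambda>x. \<phi> x + \<xi> x) (D (\<lambda>x. \<phi> x + \<xi> x)) = ell2_inner \<phi> (D \<phi>) + ell2_inner \<phi> (D \<xi>) + (ell2_inner \<xi> (D \<phi>) + ell2_inner \<xi> (D \<xi>))"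
      unfolding add[OF \<xi>U] inner_U_add_left[OF \<phi> \<xi>U add_ell2[OF D\<phi> D\<xi>U]] inner_U_add_right[OF \<phi> D\<phi> D\<xi>U] inner_U_add_right[OF \<xi>U D\<phi> D\<xi>U] ..
    then show ?thesis unfolding 1 2 inner_self by simp
  qed
  have f1: "Re (ell2_inner (\<lambda>x. \<phi> x + \<theta> x) (D (\<lambda>x. \<phi> x + \<theta> x))) = Re (ell2_inner \<phi> (D \<phi>)) + 2 * s * (ell2_norm (D \<phi>))\<^sup>2 + Re (ell2_inner \<theta> (D \<theta>))"
    by (rule form[OF \<theta>_def D\<theta>(1)])
  have f2: "Re (ell2_inner (\<lambda>x. \<phi> x + \<theta>' x) (D (\<lambda>x. \<phi> x + \<theta>' x))) = Re (ell2_inner \<phi> (D \<phi>)) + 2 * (-s) * (ell2_norm (D \<phi>))\<^sup>2 + Re (ell2_inner \<theta>' (D \<theta>'))"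
    by (rule form[OF \<theta>'_def D\<theta>(2)])
  have e: "Re (ell2_inner \<theta>' (D \<theta>')) = Re (ell2_inner \<theta> (D \<theta>))"
    unfolding D\<theta> unfolding \<theta>_def \<theta>'_def inner_scale_left inner_scale_right by simp
  have n: "ell2_norm \<theta> = s * ell2_norm (D \<phi>)" "ell2_norm \<theta>' = s * ell2_norm (D \<phi>)"
    unfolding \<theta>_def \<theta>'_def ell2_norm_scale using s by simp_all
  have ip: "ell2_inner \<phi> \<theta>' = - ell2_inner \<phi> \<theta>" unfolding \<theta>_def \<theta>'_def inner_scale_right by simp
  have "4 * s * (ell2_norm (D \<phi>))\<^sup>2 \<le> w * (ell2_norm (\<lambda>x. \<phi> x + \<theta> x))\<^sup>2 + w * (ell2_norm (\<lambda>x. \<phi> x + \<theta>' x))\<^sup>2"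
    using q[OF add_ell2[OF \<phi> \<theta>(1)]] q[OF add_ell2[OF \<phi> \<theta>(2)]] f1 f2 e by (auto simp: abs_le_iff)
  also have "\<dots> = w * (2 * (ell2_norm \<phi>)\<^sup>2 + 2 * (s * ell2_norm (D \<phi>))\<^sup>2)"
    unfolding ell2_norm_add_sq[OF ell2_UNIV[OF \<phi>] ell2_UNIV[OF \<theta>(1)]] ell2_norm_add_sq[OF ell2_UNIV[OF \<phi>] ell2_UNIV[OF \<theta>(2)]] n ip
    by (simp add: algebra_simps)
  finally have "4 * s * (ell2_norm (D \<phi>))\<^sup>2 \<le> w * (2 * (ell2_norm \<phi>)\<^sup>2 + 2 * (s * ell2_norm (D \<phi>))\<^sup>2)" .
  moreover have ws: "w * s = 1" using w by (simp add: s_def)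
  have "w * (2 * (ell2_norm \<phi>)\<^sup>2 + 2 * (s * ell2_norm (D \<phi>))\<^sup>2) = 2 * w * (ell2_norm \<phi>)\<^sup>2 + 2 * (w * s) * s * (ell2_norm (D \<phi>))\<^sup>2"
    by (simp add: power2_eq_square algebra_simps)
  ultimately have "s * (ell2_norm (D \<phi>))\<^sup>2 \<le> w * (ell2_norm \<phi>)\<^sup>2" unfolding ws by linarith
  then have "w * (s * (ell2_norm (D \<phi>))\<^sup>2) \<le> w * (w * (ell2_norm \<phi>)\<^sup>2)" using w by (intro mult_left_mono) auto
  then have "(ell2_norm (D \<phi>))\<^sup>2 \<le> (w * ell2_norm \<phi>)\<^sup>2"
    unfolding mult.assoc[symmetric] ws power_mult_distrib by (simp only: power2_eq_square mult_1_left)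
  then show ?thesis by (rule power2_le_imp_le) (use w in simp)
qed

end

section \<open>Uniqueness of the scalar spectral measures\<close>

locale spectral_resolution = bounded_sa U A c for U :: "'v set" and A c +
  fixes E :: "real set \<Rightarrow> 'v operator" and d :: real
  assumes pvm: "projection_valued_measure U E"
    and E_supp: "\<And>\<psi>. \<psi> \<in> ell2 U \<Longrightarrow> E {-d..d} \<psi> = \<psi>"
    and E_mean: "\<And>\<psi>. \<psi> \<in> ell2 U \<Longrightarrow> ell2_inner \<psi> (A \<psi>) = complex_of_real (integral\<^sup>L (scalar_measure E \<psi>) (\<lambda>t. t))"
begin

lemma E_proj: "B \<in> sets borel \<Longrightarrow> orthogonal_projection_on U (E B)"
  using pvm by (simp add: projection_valued_measure_def)

lemma E_in: "B \<in> sets borel \<Longrightarrow> \<psi> \<in> ell2 U \<Longrightarrow> E B \<psi> \<in> ell2 U"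
  and E_add: "B \<in> sets borel \<Longrightarrow> \<phi> \<in> ell2 U \<Longrightarrow> \<psi> \<in> ell2 U \<Longrightarrow> E B (\<lambda>x. \<phi> x + \<psi> x) = (\<lambda>x. E B \<phi> x + E B \<psi> x)"
  and E_scale: "B \<in> sets borel \<Longrightarrow> \<psi> \<in> ell2 U \<Longrightarrow> E B (\<lambda>x. a * \<psi> x) = (\<lambda>x. a * E B \<psi> x)"
  and E_sym: "B \<in> sets borel \<Longrightarrow> \<phi> \<in> ell2 U \<Longrightarrow> \<psi> \<in> ell2 U \<Longrightarrow> ell2_inner \<phi> (E B \<psi>) = ell2_inner (E B \<phi>) \<psi>"
  and E_idem: "B \<in> sets borel \<Longrightarrow> \<psi> \<in> ell2 U \<Longrightarrow> E B (E B \<psi>) = E B \<psi>"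
  using E_proj[of B] unfolding orthogonal_projection_on_def linear_op_on_def symmetric_on_def by blast+

lemma E_form:
  assumes "B \<in> sets borel" "\<psi> \<in> ell2 U"
  shows "ell2_inner \<psi> (E B \<psi>) = complex_of_real ((ell2_norm (E B \<psi>))\<^sup>2)"
  using E_sym[OF assms E_in[OF assms]] E_idem[OF assms] by (simp add: inner_self)

text \<open>\<open>scalar_measure\<close> is defined through \<open>measure_of\<close>, which has
  the intended values only for a countably additive set function; this is where additivity of
  \<open>E\<close> enters.\<close>

lemma scalar_measure_E:
  assumes \<psi>: "\<psi> \<in> ell2 U"
  shows "finite_measure (scalar_measure E \<psi>)" "sets (scalar_measure E \<psi>) = sets borel"
    and "B \<in> sets borel \<Longrightarrow> measure (scalar_measure E \<psi>) B = (ell2_norm (E B \<psi>))\<^sup>2"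
proof -
  show st: "sets (scalar_measure E \<psi>) = sets borel"
    unfolding scalar_measure_def by (simp add: sets.sigma_sets_eq[of borel, simplified space_borel])
  have re: "Re (ell2_inner \<psi> (E B \<psi>)) = (ell2_norm (E B \<psi>))\<^sup>2" if "B \<in> sets borel" for B
    unfolding E_form[OF that \<psi>] by simp
  have add: "(\<lambda>n. (ell2_norm (E (B n) \<psi>))\<^sup>2) sums (ell2_norm (E (\<Union>n. B n) \<psi>))\<^sup>2"
    if B: "range B \<subseteq> sets borel" "disjoint_family B" for B :: "nat \<Rightarrow> real set"
  proof -
    have "(\<lambda>n. ell2_inner \<psi> (E (B n) \<psi>)) sums ell2_inner \<psi> (E (\<Union>n. B n) \<psi>)"
      using pvm B \<psi> unfolding projection_valued_measure_def by blast
    from sums_Re[OF this] show ?thesis using B(1) re by (subst (asm) (2) re) (auto simp: image_subset_iff)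
  qed
  \<comment> \<open>Additivity applied to the constant sequence of empty sets gives a convergent
    series of equal terms, which forces them to be 0.\<close>
  have empty: "(ell2_norm (E {} \<psi>))\<^sup>2 = 0"
    using sums_summable[OF add[of "\<lambda>_. {}"]] by (simp add: disjoint_family_on_def summable_const_iff)
  have em: "emeasure (scalar_measure E \<psi>) B = ennreal (Re (ell2_inner \<psi> (E B \<psi>)))" if "B \<in> sets borel" for B
  proof (rule emeasure_measure_of[OF scalar_measure_def])
    show "B \<in> sets (scalar_measure E \<psi>)" using that st by simp
    show "positive (sets (scalar_measure E \<psi>)) (\<lambda>B. ennreal (Re (ell2_inner \<psi> (E B \<psi>))))"
      by (simp add: positive_def re empty)
    show "countably_additive (sets (scalar_measure E \<psi>)) (\<lambda>B. ennreal (Re (ell2_inner \<psi> (E B \<psi>))))"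
    proof (rule countably_additiveI)
      fix B :: "nat \<Rightarrow> real set" assume B: "range B \<subseteq> sets (scalar_measure E \<psi>)" "disjoint_family B"
        and U: "(\<Union>n. B n) \<in> sets (scalar_measure E \<psi>)"
      have B': "range B \<subseteq> sets borel" "B n \<in> sets borel" for n using B st by auto
      show "(\<Sum>n. ennreal (Re (ell2_inner \<psi> (E (B n) \<psi>)))) = ennreal (Re (ell2_inner \<psi> (E (\<Union>n. B n) \<psi>)))"
        using add[OF B'(1) B(2)] U st by (simp add: re B'(2) suminf_ennreal_eq sums_iff)
    qed
  qed (auto simp: sets.sigma_sets_eq[of borel, simplified space_borel])
  show "finite_measure (scalar_measure E \<psi>)"
    by (rule finite_measureI) (use em[of UNIV] in \<open>simp add: scalar_measure_def\<close>)
  show "measure (scalar_measure E \<psi>) B = (ell2_norm (E B \<psi>))\<^sup>2" if "B \<in> sets borel"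
    unfolding measure_def em[OF that] re[OF that] by simp
qed

lemma E_UNIV: "\<psi> \<in> ell2 U \<Longrightarrow> E UNIV \<psi> = \<psi>"
  using pvm by (simp add: projection_valued_measure_def)

lemma scalar_measure_supported:
  assumes \<psi>: "\<psi> \<in> ell2 U"
  shows "supported d (scalar_measure E \<psi>)"
proof -
  interpret finite_measure "scalar_measure E \<psi>" by (rule scalar_measure_E(1)[OF \<psi>])
  have sp: "space (scalar_measure E \<psi>) = UNIV" by (simp add: scalar_measure_def)
  have "measure (scalar_measure E \<psi>) (- {-d..d}) = measure (scalar_measure E \<psi>) UNIV - measure (scalar_measure E \<psi>) {-d..d}"
    using finite_measure_compl[of "{-d..d}"] scalar_measure_E(2)[OF \<psi>] sp by (simp add: Compl_eq_Diff_UNIV)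
  also have "\<dots> = 0" using scalar_measure_E(3)[OF \<psi>] E_UNIV[OF \<psi>] E_supp[OF \<psi>] by simp
  finally have "emeasure (scalar_measure E \<psi>) (- {-d..d}) = 0" by (simp add: emeasure_eq_measure)
  then have "AE t in scalar_measure E \<psi>. \<bar>t\<bar> \<le> d"
    by (intro AE_I[where N="- {-d..d}"]) (use scalar_measure_E(2)[OF \<psi>] in \<open>auto simp: abs_le_iff\<close>)
  then show ?thesis using scalar_measure_E(1,2)[OF \<psi>] by (simp add: supported_def)
qed

text \<open>For the vector \<open>E B \<psi>\<close> the set \<open>B\<close> already carries the
  full mass, so additivity leaves nothing for a disjoint set \<open>D\<close>.\<close>

lemma E_orthogonal:
  assumes B: "B \<in> sets borel" "D \<in> sets borel" "B \<inter> D = {}" and \<psi>: "\<psi> \<in> ell2 U"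
  shows "E D (E B \<psi>) = (\<lambda>x. 0)"
proof -
  let ?\<phi> = "E B \<psi>"
  have \<phi>: "?\<phi> \<in> ell2 U" by (rule E_in[OF B(1) \<psi>])
  let ?S = "scalar_measure E ?\<phi>"
  interpret finite_measure ?S by (rule scalar_measure_E(1)[OF \<phi>])
  have "measure ?S (B \<union> D) = measure ?S B + measure ?S D"
    using B scalar_measure_E(2)[OF \<phi>] by (intro finite_measure_Union) auto
  moreover have "measure ?S (B \<union> D) \<le> measure ?S UNIV"
    using scalar_measure_E(2)[OF \<phi>] by (intro finite_measure_mono) auto
  ultimately have "(ell2_norm (E D ?\<phi>))\<^sup>2 \<le> 0"
    using scalar_measure_E(3)[OF \<phi>] B E_UNIV[OF \<phi>] E_idem[OF B(1) \<psi>] by simp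
  then have "ell2_norm (E D ?\<phi>) = 0" by simp
  then show ?thesis using ell2_norm_eq_0 ell2_UNIV[OF E_in[OF B(2) \<phi>]] by blast
qed

text \<open>\<open>step_op n\<close> replaces \<open>t\<close> in \<open>A = \<integral> t dE(t)\<close> by the step function \<open>\<lfloor>n t\<rfloor> / n\<close>.\<close>

definition cell :: "nat \<Rightarrow> int \<Rightarrow> real set" where
  "cell n j = {t. \<lfloor>real n * t\<rfloor> = j}"

definition cells :: "nat \<Rightarrow> int set" where
  "cells n = {-(\<lceil>real n * \<bar>d\<bar>\<rceil> + 1) .. \<lceil>real n * \<bar>d\<bar>\<rceil> + 1}"

definition step_op :: "nat \<Rightarrow> 'v operator" where
  "step_op n \<psi> = (\<lambda>x. \<Sum>j\<in>cells n. of_real (real_of_int j / real n) * E (cell n j) \<psi> x)"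

lemma cell_borel [simp]: "cell n j \<in> sets borel"
proof -
  have "(\<lambda>t. \<lfloor>real n * t\<rfloor>) -` {j} \<inter> space borel \<in> sets borel" by (rule measurable_sets[of _ borel "count_space UNIV"]) auto
  then show ?thesis by (simp add: cell_def vimage_def)
qed

lemma finite_cells [simp]: "finite (cells n)"
  by (simp add: cells_def)

lemma floor_in_cells: "\<bar>t\<bar> \<le> d \<Longrightarrow> \<lfloor>real n * t\<rfloor> \<in> cells n"
proof -
  assume t: "\<bar>t\<bar> \<le> d"
  have "\<bar>real n * t\<bar> \<le> real n * \<bar>d\<bar>" unfolding abs_mult using t by (intro mult_mono) auto
  then have "real n * t \<le> real n * \<bar>d\<bar>" "- (real n * \<bar>d\<bar>) \<le> real n * t" by (auto simp: abs_le_iff)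
  then show ?thesis unfolding cells_def by (simp; linarith)
qed

lemma step_sum:
  assumes "\<bar>t\<bar> \<le> d"
  shows "(\<Sum>j\<in>cells n. (real_of_int j / real n) ^ p * indicator (cell n j) t) = (real_of_int \<lfloor>real n * t\<rfloor> / real n) ^ p"
proof -
  have "(\<Sum>j\<in>cells n. (real_of_int j / real n) ^ p * indicator (cell n j) t)
     = (\<Sum>j\<in>{\<lfloor>real n * t\<rfloor>}. (real_of_int j / real n) ^ p * indicator (cell n j) t)"
    by (rule sum.mono_neutral_right) (use floor_in_cells[OF assms] in \<open>auto simp: cell_def\<close>)
  then show ?thesis by (simp add: cell_def)
qed

lemma floor_step_close: "n > 0 \<Longrightarrow> \<bar>t - real_of_int \<lfloor>real n * t\<rfloor> / real n\<bar> \<le> 1 / real n"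
proof -
  assume n: "n > 0"
  have "t - real_of_int \<lfloor>real n * t\<rfloor> / real n = (real n * t - real_of_int \<lfloor>real n * t\<rfloor>) / real n"
    using n by (simp add: diff_divide_distrib)
  moreover have "\<bar>real n * t - real_of_int \<lfloor>real n * t\<rfloor>\<bar> \<le> 1" by linarith
  ultimately show ?thesis using n by (simp add: divide_right_mono)
qed

lemma step_op_in: "\<psi> \<in> ell2 U \<Longrightarrow> step_op n \<psi> \<in> ell2 U"
  unfolding step_op_def by (intro sum_ell2 scale_ell2 E_in cell_borel)

lemma step_op_linear: "linear_op_on U (step_op n)"
  unfolding linear_op_on_def
proof (intro conjI ballI allI)
  fix \<phi> \<psi> assume "\<phi> \<in> ell2 U" "\<psi> \<in> ell2 U"
  then show "step_op n (\<lambda>x. \<phi> x + \<psi> x) = (\<lambda>x. step_op n \<phi> x + step_op n \<psi> x)"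
    by (simp add: step_op_def E_add ring_distribs sum.distrib)
next
  fix a \<psi> assume "\<psi> \<in> ell2 U"
  then show "step_op n (\<lambda>x. a * \<psi> x) = (\<lambda>x. a * step_op n \<psi> x)"
    by (simp add: step_op_def E_scale sum_distrib_left mult_ac)
qed (rule step_op_in)

lemma E_diff:
  assumes "B \<in> sets borel" "\<phi> \<in> ell2 U" "\<psi> \<in> ell2 U"
  shows "E B (\<lambda>x. \<phi> x - \<psi> x) = (\<lambda>x. E B \<phi> x - E B \<psi> x)"
proof -
  have "E B (\<lambda>x. \<phi> x + -1 * \<psi> x) = (\<lambda>x. E B \<phi> x + -1 * E B \<psi> x)"
    unfolding E_add[OF assms(1,2) scale_ell2[OF assms(3)]] E_scale[OF assms(1,3)] ..
  then show ?thesis by simp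
qed

lemma step_op_diff:
  assumes "\<phi> \<in> ell2 U" "\<psi> \<in> ell2 U"
  shows "step_op n (\<lambda>x. \<phi> x - \<psi> x) = (\<lambda>x. step_op n \<phi> x - step_op n \<psi> x)"
  unfolding step_op_def E_diff[OF cell_borel assms] by (simp only: right_diff_distrib sum_subtractf)

lemma inner_E_sum:
  assumes "\<phi> \<in> ell2 U" "\<psi> \<in> ell2 U" "finite I"
  shows "ell2_inner \<phi> (\<lambda>x. \<Sum>j\<in>I. a j * E (cell n j) \<psi> x) = (\<Sum>j\<in>I. a j * ell2_inner \<phi> (E (cell n j) \<psi>))"
  by (subst inner_sum_right[OF assms(3) ell2_UNIV[OF assms(1)]])
    (rule ell2_UNIV[OF scale_ell2[OF E_in[OF cell_borel assms(2)]]], simp only: inner_scale_right)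

lemma step_op_inner:
  assumes "\<phi> \<in> ell2 U" "\<psi> \<in> ell2 U"
  shows "ell2_inner \<phi> (step_op n \<psi>) = (\<Sum>j\<in>cells n. of_real (real_of_int j / real n) * ell2_inner \<phi> (E (cell n j) \<psi>))"
  unfolding step_op_def by (rule inner_E_sum[OF assms finite_cells])

lemma step_op_sym: "symmetric_on U (step_op n)"
  unfolding symmetric_on_def
proof (intro ballI)
  fix \<phi> \<psi> assume U: "\<phi> \<in> ell2 U" "\<psi> \<in> ell2 U"
  have "ell2_inner (step_op n \<phi>) \<psi> = cnj (ell2_inner \<psi> (step_op n \<phi>))" by (simp add: inner_cnj)
  also have "\<dots> = (\<Sum>j\<in>cells n. of_real (real_of_int j / real n) * ell2_inner (E (cell n j) \<phi>) \<psi>)"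
    by (simp add: step_op_inner[OF U(2,1)] inner_cnj)
  also have "\<dots> = ell2_inner \<phi> (step_op n \<psi>)"
    by (simp add: step_op_inner[OF U] E_sym[OF _ U])
  finally show "ell2_inner \<phi> (step_op n \<psi>) = ell2_inner (step_op n \<phi>) \<psi>" by simp
qed

lemma step_moment:
  assumes \<psi>: "\<psi> \<in> ell2 U"
  shows "(\<Sum>j\<in>cells n. (real_of_int j / real n) ^ p * (ell2_norm (E (cell n j) \<psi>))\<^sup>2)
    = integral\<^sup>L (scalar_measure E \<psi>) (\<lambda>t. (real_of_int \<lfloor>real n * t\<rfloor> / real n) ^ p)"
proof -
  let ?S = "scalar_measure E \<psi>"
  note s = scalar_measure_supported[OF \<psi>]
  interpret finite_measure ?S by (rule scalar_measure_E(1)[OF \<psi>])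
  have [measurable_cong]: "sets ?S = sets borel" using supportedD(2)[OF s] .
  have "(\<Sum>j\<in>cells n. (real_of_int j / real n) ^ p * (ell2_norm (E (cell n j) \<psi>))\<^sup>2)
      = (\<Sum>j\<in>cells n. (real_of_int j / real n) ^ p * integral\<^sup>L ?S (indicator (cell n j)))"
    using scalar_measure_E(3)[OF \<psi>] supportedD(4)[OF s] by simp
  also have "\<dots> = integral\<^sup>L ?S (\<lambda>t. \<Sum>j\<in>cells n. (real_of_int j / real n) ^ p * indicator (cell n j) t)"
  proof (subst Bochner_Integration.integral_sum)
    show "integrable ?S (\<lambda>t. (real_of_int j / real n) ^ p * indicator (cell n j) t)" for j
      by (intro integrable_mult_right integrable_const_bound[where B=1] borel_measurable_indicator)
        (auto simp: scalar_measure_E(2)[OF \<psi>])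
  qed simp
  also have "\<dots> = integral\<^sup>L ?S (\<lambda>t. (real_of_int \<lfloor>real n * t\<rfloor> / real n) ^ p)"
  proof (rule integral_cong_AE)
    show "(\<lambda>t. \<Sum>j\<in>cells n. (real_of_int j / real n) ^ p * indicator (cell n j) t) \<in> borel_measurable ?S"
      by (rule supported_measurable[OF s]) (intro borel_measurable_sum borel_measurable_times borel_measurable_indicator cell_borel borel_measurable_const)
    show "(\<lambda>t. (real_of_int \<lfloor>real n * t\<rfloor> / real n) ^ p) \<in> borel_measurable ?S"
      by (rule supported_measurable[OF s]) measurable
    show "AE t in ?S. (\<Sum>j\<in>cells n. (real_of_int j / real n) ^ p * indicator (cell n j) t) = (real_of_int \<lfloor>real n * t\<rfloor> / real n) ^ p"
      using supportedD(3)[OF s] by eventually_elim (rule step_sum)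
  qed
  finally show ?thesis .
qed

text \<open>The quadratic form of the difference is the integral of
  \<open>t - \<lfloor>n t\<rfloor> / n\<close>, hence at most \<open>1 / n\<close> times the squared
  norm; \<open>symmetric_norm_bound\<close> upgrades this to vectors.\<close>

lemma step_op_close:
  assumes n: "n > 0" and \<phi>: "\<phi> \<in> ell2 U"
  shows "ell2_norm (\<lambda>x. A \<phi> x - step_op n \<phi> x) \<le> 1 / real n * ell2_norm \<phi>"
proof (rule symmetric_norm_bound[where D="\<lambda>\<phi> x. A \<phi> x - step_op n \<phi> x", OF _ _ _ _ \<phi>])
  note sl = step_op_linear[of n, unfolded linear_op_on_def]
  show "linear_op_on U (\<lambda>\<phi> x. A \<phi> x - step_op n \<phi> x)"
    using A_in step_op_in A_add A_scale sl unfolding linear_op_on_def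
    by (auto intro!: diff_ell2 simp: algebra_simps)
  show "symmetric_on U (\<lambda>\<phi> x. A \<phi> x - step_op n \<phi> x)"
    unfolding symmetric_on_def
  proof (intro ballI)
    fix \<phi> \<psi> assume U: "\<phi> \<in> ell2 U" "\<psi> \<in> ell2 U"
    have "ell2_inner \<phi> (step_op n \<psi>) = ell2_inner (step_op n \<phi>) \<psi>"
      using step_op_sym[of n] U by (simp add: symmetric_on_def)
    then show "ell2_inner \<phi> (\<lambda>x. A \<psi> x - step_op n \<psi> x) = ell2_inner (\<lambda>x. A \<phi> x - step_op n \<phi> x) \<psi>"
      using A_sym[OF U] inner_diff_right[OF ell2_UNIV[OF U(1)] ell2_UNIV[OF A_in[OF U(2)]] ell2_UNIV[OF step_op_in[OF U(2)]]]
        inner_diff_left[OF ell2_UNIV[OF A_in[OF U(1)]] ell2_UNIV[OF step_op_in[OF U(1)]] ell2_UNIV[OF U(2)]] by simp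
  qed
  show "0 < 1 / real n" using n by simp
  fix \<phi> assume \<phi>: "\<phi> \<in> ell2 U"
  let ?S = "scalar_measure E \<phi>"
  note s = scalar_measure_supported[OF \<phi>]
  interpret finite_measure ?S by (rule scalar_measure_E(1)[OF \<phi>])
  have [measurable_cong]: "sets ?S = sets borel" using supportedD(2)[OF s] .
  let ?g = "\<lambda>t. real_of_int \<lfloor>real n * t\<rfloor> / real n"
  have i1: "integrable ?S (\<lambda>t. t)" by (rule supported_integrable[OF s, where B=d]) auto
  have i2: "integrable ?S ?g"
  proof (rule supported_integrable[OF s, where B="d + 1"])
    fix t :: real assume "\<bar>t\<bar> \<le> d"
    moreover have "\<bar>t - ?g t\<bar> \<le> 1" using floor_step_close[OF n, of t] n
      by (smt (verit) divide_le_eq_1 of_nat_0_less_iff of_nat_1 of_nat_le_iff Suc_leI One_nat_def)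
    ultimately show "\<bar>?g t\<bar> \<le> d + 1" by linarith
  qed simp
  have "Re (ell2_inner \<phi> (\<lambda>x. A \<phi> x - step_op n \<phi> x)) = Re (ell2_inner \<phi> (A \<phi>)) - Re (ell2_inner \<phi> (step_op n \<phi>))"
    using inner_diff_right[OF ell2_UNIV[OF \<phi>] ell2_UNIV[OF A_in[OF \<phi>]] ell2_UNIV[OF step_op_in[OF \<phi>]]] by simp
  also have "Re (ell2_inner \<phi> (A \<phi>)) = integral\<^sup>L ?S (\<lambda>t. t)" using E_mean[OF \<phi>] by simp
  also have "Re (ell2_inner \<phi> (step_op n \<phi>)) = integral\<^sup>L ?S ?g"
    unfolding step_op_inner[OF \<phi> \<phi>] using step_moment[OF \<phi>, of n 1] by (simp add: E_form[OF _ \<phi>])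
  also have "integral\<^sup>L ?S (\<lambda>t. t) - integral\<^sup>L ?S ?g = integral\<^sup>L ?S (\<lambda>t. t - ?g t)" using i1 i2 by simp
  also have "\<bar>\<dots>\<bar> \<le> integral\<^sup>L ?S (\<lambda>t. \<bar>t - ?g t\<bar>)" by (rule integral_abs_bound)
  also have "\<dots> \<le> integral\<^sup>L ?S (\<lambda>t. 1 / real n)"
    by (rule integral_mono) (use i1 i2 floor_step_close[OF n] in auto)
  also have "\<dots> = 1 / real n * (ell2_norm \<phi>)\<^sup>2"
    using scalar_measure_E(3)[OF \<phi>, of UNIV] supportedD(4)[OF s] E_UNIV[OF \<phi>] by simp
  finally show "\<bar>Re (ell2_inner \<phi> (\<lambda>x. A \<phi> x - step_op n \<phi> x))\<bar> \<le> 1 / real n * (ell2_norm \<phi>)\<^sup>2" .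
qed

text \<open>Distinct cells are disjoint, so all mixed products of their projections vanish. The
  exponent starts at 1; at exponent 0 the formula would claim that the projections of the cells add
  up to the identity.\<close>

lemma step_op_power:
  assumes \<psi>: "\<psi> \<in> ell2 U"
  shows "(step_op n ^^ Suc p) \<psi> = (\<lambda>x. \<Sum>j\<in>cells n. of_real ((real_of_int j / real n) ^ Suc p) * E (cell n j) \<psi> x)"
proof (induction p)
  case 0 then show ?case by (simp add: step_op_def)
next
  case (Suc p)
  have Esum: "E B (\<lambda>x. \<Sum>j\<in>I. a j * f j x) = (\<lambda>x. \<Sum>j\<in>I. a j * E B (f j) x)"
    if "finite I" "\<And>j. j \<in> I \<Longrightarrow> f j \<in> ell2 U" "B \<in> sets borel" for B and I :: "int set" and a f
    using that(1,2)
  proof (induction I)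
    case empty
    then show ?case using E_scale[OF that(3) zero_ell2, of 0] by simp
  next
    case (insert i I)
    then show ?case
      using E_add[OF that(3), of "\<lambda>x. a i * f i x" "\<lambda>x. \<Sum>j\<in>I. a j * f j x"] E_scale[OF that(3), of "f i" "a i"]
      by (simp add: scale_ell2 sum_ell2)
  qed
  have "E (cell n i) (\<lambda>x. \<Sum>j\<in>cells n. of_real ((real_of_int j / real n) ^ Suc p) * E (cell n j) \<psi> x)
      = (\<lambda>x. of_real ((real_of_int i / real n) ^ Suc p) * E (cell n i) \<psi> x)" if i: "i \<in> cells n" for i
  proof
    fix x
    have "E (cell n i) (\<lambda>x. \<Sum>j\<in>cells n. of_real ((real_of_int j / real n) ^ Suc p) * E (cell n j) \<psi> x) x
      = (\<Sum>j\<in>cells n. of_real ((real_of_int j / real n) ^ Suc p) * E (cell n i) (E (cell n j) \<psi>) x)"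
      using Esum[of "cells n" "\<lambda>j. E (cell n j) \<psi>" "cell n i"] \<psi> by (simp add: E_in del: power_Suc)
    also have "\<dots> = (\<Sum>j\<in>{i}. of_real ((real_of_int j / real n) ^ Suc p) * E (cell n i) (E (cell n j) \<psi>) x)"
    proof (rule sum.mono_neutral_right)
      show "\<forall>j\<in>cells n - {i}. of_real ((real_of_int j / real n) ^ Suc p) * E (cell n i) (E (cell n j) \<psi>) x = 0"
      proof
        fix j assume "j \<in> cells n - {i}"
        then have "cell n j \<inter> cell n i = {}" by (auto simp: cell_def)
        from E_orthogonal[OF _ _ this \<psi>] show "of_real ((real_of_int j / real n) ^ Suc p) * E (cell n i) (E (cell n j) \<psi>) x = 0"
          by simp
      qed
    qed (use i in auto)
    finally show "E (cell n i) (\<lambda>x. \<Sum>j\<in>cells n. of_real ((real_of_int j / real n) ^ Suc p) * E (cell n j) \<psi> x) x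
      = of_real ((real_of_int i / real n) ^ Suc p) * E (cell n i) \<psi> x"
      by (simp add: E_idem[OF cell_borel \<psi>] del: power_Suc)
  qed
  note key = this
  have "(step_op n ^^ Suc (Suc p)) \<psi> = step_op n ((step_op n ^^ Suc p) \<psi>)" by simp
  also have "\<dots> = (\<lambda>x. \<Sum>j\<in>cells n. of_real ((real_of_int j / real n) ^ Suc (Suc p)) * E (cell n j) \<psi> x)"
    unfolding Suc.IH unfolding step_op_def using key by (simp add: mult_ac del: power_Suc) (simp add: mult_ac)
  finally show ?case .
qed

lemma power_in: "\<psi> \<in> ell2 U \<Longrightarrow> (A ^^ p) \<psi> \<in> ell2 U"
  by (induction p) (auto intro: A_in)

lemma power_norm: "\<psi> \<in> ell2 U \<Longrightarrow> ell2_norm ((A ^^ p) \<psi>) \<le> c ^ p * ell2_norm \<psi>"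
proof (induction p)
  case 0 then show ?case by simp
next
  case (Suc p)
  have "ell2_norm ((A ^^ Suc p) \<psi>) \<le> c * ell2_norm ((A ^^ p) \<psi>)" using bd[OF power_in[OF Suc.prems]] by simp
  also have "\<dots> \<le> c * (c ^ p * ell2_norm \<psi>)" using Suc c_pos by (intro mult_left_mono) auto
  finally show ?case by (simp add: mult_ac)
qed

text \<open>With \<open>T = step_op n\<close>, the induction uses
  \<open>A^(p+1) - T^(p+1) = (A - T) A^p + T (A^p - T^p)\<close>. The norm of \<open>T\<close> is at
  most \<open>c + 1\<close>, since \<open>T\<close> is within \<open>1 / n <= 1\<close> of
  \<open>A\<close>.\<close>

lemma step_power_close:
  assumes \<psi>: "\<psi> \<in> ell2 U"
  shows "\<exists>K. \<forall>n>0. ell2_norm (\<lambda>x. (A ^^ p) \<psi> x - (step_op n ^^ p) \<psi> x) \<le> K / real n"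
proof (induction p)
  case 0 then show ?case by (intro exI[of _ 0]) simp
next
  case (Suc p)
  then obtain K where K: "\<And>n. n > 0 \<Longrightarrow> ell2_norm (\<lambda>x. (A ^^ p) \<psi> x - (step_op n ^^ p) \<psi> x) \<le> K / real n" by blast
  have "ell2_norm (\<lambda>x. (A ^^ Suc p) \<psi> x - (step_op n ^^ Suc p) \<psi> x) \<le> (c ^ p * ell2_norm \<psi> + (c + 1) * K) / real n" if n: "n > 0" for n
  proof -
    have Tp: "(step_op n ^^ p) \<psi> \<in> ell2 U" by (induction p) (auto intro: step_op_in \<psi>)
    note Ap = power_in[OF \<psi>, of p]
    let ?\<delta> = "\<lambda>x. (A ^^ p) \<psi> x - (step_op n ^^ p) \<psi> x"
    have \<delta>: "?\<delta> \<in> ell2 U" by (intro diff_ell2 Ap Tp)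
    have Td: "step_op n ?\<delta> = (\<lambda>x. step_op n ((A ^^ p) \<psi>) x - step_op n ((step_op n ^^ p) \<psi>) x)"
      by (rule step_op_diff[OF Ap Tp])
    have "ell2_norm (step_op n ?\<delta>) \<le> ell2_norm (\<lambda>x. step_op n ?\<delta> x - A ?\<delta> x) + ell2_norm (A ?\<delta>)"
      using ell2_norm_triangle[OF ell2_UNIV[OF diff_ell2[OF step_op_in[OF \<delta>] A_in[OF \<delta>]]] ell2_UNIV[OF A_in[OF \<delta>]]] by simp
    also have "\<dots> \<le> 1 / real n * ell2_norm ?\<delta> + c * ell2_norm ?\<delta>"
      using step_op_close[OF n \<delta>] bd[OF \<delta>] ell2_norm_diff_commute[of "A ?\<delta>" "step_op n ?\<delta>"] by simp
    also have "\<dots> \<le> 1 * ell2_norm ?\<delta> + c * ell2_norm ?\<delta>" using n by (intro add_right_mono mult_right_mono) auto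
    also have "\<dots> = (c + 1) * ell2_norm ?\<delta>" by (simp add: algebra_simps)
    also have "\<dots> \<le> (c + 1) * (K / real n)" using K[OF n] c_pos by (intro mult_left_mono) auto
    finally have 2: "ell2_norm (step_op n ?\<delta>) \<le> (c + 1) * (K / real n)" .
    have "1 / real n * ell2_norm ((A ^^ p) \<psi>) \<le> 1 / real n * (c ^ p * ell2_norm \<psi>)"
      using power_norm[OF \<psi>] by (intro mult_left_mono) auto
    then have 1: "ell2_norm (\<lambda>x. A ((A ^^ p) \<psi>) x - step_op n ((A ^^ p) \<psi>) x) \<le> 1 / real n * (c ^ p * ell2_norm \<psi>)"
      using step_op_close[OF n Ap] by linarith
    have "ell2_norm (\<lambda>x. (A ^^ Suc p) \<psi> x - (step_op n ^^ Suc p) \<psi> x) \<le>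
      ell2_norm (\<lambda>x. A ((A ^^ p) \<psi>) x - step_op n ((A ^^ p) \<psi>) x) + ell2_norm (step_op n ?\<delta>)"
      using ell2_norm_triangle[OF ell2_UNIV[OF diff_ell2[OF A_in[OF Ap] step_op_in[OF Ap]]] ell2_UNIV[OF step_op_in[OF \<delta>]], of n n]
      unfolding Td by simp
    also have "\<dots> \<le> 1 / real n * (c ^ p * ell2_norm \<psi>) + (c + 1) * (K / real n)" using 1 2 by linarith
    finally show ?thesis by (simp add: add_divide_distrib)
  qed
  then show ?case by blast
qed

text \<open>The definition of a spectral measure speaks of the first moment only. Higher moments are
  exact for the step operators, whose powers are explicit, and follow by letting \<open>n\<close>
  grow.\<close>

lemma scalar_measure_moment:
  assumes \<psi>: "\<psi> \<in> ell2 U"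
  shows "integral\<^sup>L (scalar_measure E \<psi>) (\<lambda>t. t ^ p) = Re (ell2_inner \<psi> ((A ^^ p) \<psi>))"
proof (cases p)
  case 0
  then show ?thesis
    using scalar_measure_E(3)[OF \<psi>, of UNIV] supportedD(4)[OF scalar_measure_supported[OF \<psi>]] E_UNIV[OF \<psi>]
    by (simp add: inner_self)
next
  case (Suc q)
  let ?S = "scalar_measure E \<psi>"
  note s = scalar_measure_supported[OF \<psi>]
  let ?g = "\<lambda>n t. (real_of_int \<lfloor>real n * t\<rfloor> / real n) ^ p"
  have eq: "Re (ell2_inner \<psi> ((step_op n ^^ p) \<psi>)) = integral\<^sup>L ?S (?g n)" for n
  proof -
    have "ell2_inner \<psi> ((step_op n ^^ p) \<psi>) = (\<Sum>j\<in>cells n. of_real ((real_of_int j / real n) ^ p) * ell2_inner \<psi> (E (cell n j) \<psi>))"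
      unfolding Suc step_op_power[OF \<psi>]
      by (rule inner_E_sum[OF \<psi> \<psi> finite_cells])
    then show ?thesis unfolding step_moment[OF \<psi>, symmetric] by (simp add: E_form[OF _ \<psi>] del: of_real_power of_real_divide)
  qed
  have 1: "(\<lambda>n. integral\<^sup>L ?S (?g (Suc n))) \<longlonglongrightarrow> integral\<^sup>L ?S (\<lambda>t. t ^ p)"
  proof (rule supported_dominated_convergence[OF s, where B="(\<bar>d\<bar> + 1) ^ p"])
    fix t :: real assume t: "\<bar>t\<bar> \<le> d"
    have "(\<lambda>n. t - real_of_int \<lfloor>real (Suc n) * t\<rfloor> / real (Suc n)) \<longlonglongrightarrow> 0"
    proof (rule Lim_null_comparison)
      show "\<forall>\<^sub>F n in sequentially. norm (t - real_of_int \<lfloor>real (Suc n) * t\<rfloor> / real (Suc n)) \<le> 1 / real (Suc n)"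
        using floor_step_close[of "Suc _" t] by (intro always_eventually allI) simp
      show "(\<lambda>n. 1 / real (Suc n)) \<longlonglongrightarrow> 0" by (rule LIMSEQ_Suc[OF lim_const_over_n])
    qed
    from tendsto_diff[OF tendsto_const[of t] this]
    have "(\<lambda>n. real_of_int \<lfloor>real (Suc n) * t\<rfloor> / real (Suc n)) \<longlonglongrightarrow> t" by simp
    then show "(\<lambda>n. ?g (Suc n) t) \<longlonglongrightarrow> t ^ p" by (rule tendsto_power)
  next
    fix n and t :: real assume t: "\<bar>t\<bar> \<le> d"
    have "1 / real (Suc n) \<le> 1" by simp
    then have "\<bar>real_of_int \<lfloor>real (Suc n) * t\<rfloor> / real (Suc n)\<bar> \<le> \<bar>d\<bar> + 1"
      using floor_step_close[of "Suc n" t] t by linarith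
    then show "\<bar>?g (Suc n) t\<bar> \<le> (\<bar>d\<bar> + 1) ^ p" unfolding power_abs by (intro power_mono) auto
  qed auto
  obtain K where K: "\<And>n. n > 0 \<Longrightarrow> ell2_norm (\<lambda>x. (A ^^ p) \<psi> x - (step_op n ^^ p) \<psi> x) \<le> K / real n"
    using step_power_close[OF \<psi>] by blast
  have 2: "(\<lambda>n. ell2_inner \<psi> ((step_op (Suc n) ^^ p) \<psi>)) \<longlonglongrightarrow> ell2_inner \<psi> ((A ^^ p) \<psi>)"
  proof (rule inner_tendsto_right)
    show "(step_op (Suc n) ^^ p) \<psi> \<in> ell2 UNIV" for n
      by (rule ell2_UNIV[of _ U], induction p) (auto intro: step_op_in \<psi>)
    show "(\<lambda>n. ell2_norm (\<lambda>x. (step_op (Suc n) ^^ p) \<psi> x - (A ^^ p) \<psi> x)) \<longlonglongrightarrow> 0"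
    proof (rule Lim_null_comparison)
      show "\<forall>\<^sub>F n in sequentially. norm (ell2_norm (\<lambda>x. (step_op (Suc n) ^^ p) \<psi> x - (A ^^ p) \<psi> x)) \<le> K / real (Suc n)"
        using K[of "Suc _"] by (intro always_eventually allI) (simp add: ell2_norm_diff_commute[of _ "(A ^^ p) \<psi>"])
      show "(\<lambda>n. K / real (Suc n)) \<longlonglongrightarrow> 0" by (rule LIMSEQ_Suc[OF lim_const_over_n])
    qed
  qed (auto intro: ell2_UNIV power_in \<psi>)
  from tendsto_Re[OF 2] have "(\<lambda>n. integral\<^sup>L ?S (?g (Suc n))) \<longlonglongrightarrow> Re (ell2_inner \<psi> ((A ^^ p) \<psi>))" unfolding eq .
  from LIMSEQ_unique[OF 1 this] show ?thesis .
qed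

lemma scalar_measure_unique:
  assumes \<psi>: "\<psi> \<in> ell2 U"
  shows "scalar_measure E \<psi> = vec_measure \<psi>"
proof (rule supported_moment_unique)
  show s: "supported (max c d) (scalar_measure E \<psi>)" "supported (max c d) (vec_measure \<psi>)"
    using scalar_measure_supported[OF \<psi>] vec_measure(1)[OF \<psi>] supported_mono by (meson max.cobounded1 max.cobounded2)+
  have "integral\<^sup>L (scalar_measure E \<psi>) (\<lambda>t. t^i) = integral\<^sup>L (vec_measure \<psi>) (\<lambda>t. t^i)" for i
  proof -
    have "poly (monom 1 i) = (\<lambda>t::real. t^i)" by (simp add: fun_eq_iff poly_monom)
    then show ?thesis
      using vec_measure(2)[OF \<psi>, of "monom 1 i"] by (simp add: scalar_measure_moment[OF \<psi>] poly_op_monom)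
  qed
  then show "integral\<^sup>L (scalar_measure E \<psi>) (poly p) = integral\<^sup>L (vec_measure \<psi>) (poly p)" for p
    by (simp add: integral_poly_moments[OF s(1)] integral_poly_moments[OF s(2)])
qed

end

context bounded_sa
begin

text \<open>The link from the chosen projections to \<open>vec_measure\<close>: from here on,
  statements about diagonal elements are statements about moments.\<close>

theorem spectral_projection_measure:
  assumes \<psi>: "\<psi> \<in> ell2 U" and B: "B \<in> sets borel"
  shows "Re (ell2_inner \<psi> (spectral_projection U A B \<psi>)) = measure (vec_measure \<psi>) B"
proof -
  let ?E = "spectral_projection U A"
  have "\<exists>E. bounded_self_adjoint_on U A \<and> spectral_measure_of U A E"
    using bounded_self_adjoint spectral_measure_ind_op by blast
  then have "spectral_measure_of U A ?E"
    unfolding spectral_projection_def by (rule someI2_ex) blast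
  then obtain d where "spectral_resolution U A c ?E d"
    unfolding spectral_measure_of_def spectral_resolution_def spectral_resolution_axioms_def
    using bounded_sa_axioms by blast
  then interpret spectral_resolution U A c ?E d .
  show ?thesis
    using scalar_measure_E(3)[OF \<psi> B] E_form[OF B \<psi>] scalar_measure_unique[OF \<psi>] by simp
qed

lemma vec_measure_moment:
  assumes "\<psi> \<in> ell2 U"
  shows "integral\<^sup>L (vec_measure \<psi>) (\<lambda>t. t ^ i) = Re (ell2_inner \<psi> ((A ^^ i) \<psi>))"
proof -
  have "poly (monom 1 i) = (\<lambda>t::real. t^i)" by (simp add: fun_eq_iff poly_monom)
  then show ?thesis using vec_measure(2)[OF assms, of "monom 1 i"] by (simp add: poly_op_monom)
qed

end

section \<open>Adjacency operators with a potential\<close>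

definition gop :: "'v set \<Rightarrow> ('v \<Rightarrow> 'v set) \<Rightarrow> ('v \<Rightarrow> complex) \<Rightarrow> 'v operator" where
  "gop V N v \<psi> = (\<lambda>x. if x \<in> V then (\<Sum>y\<in>N x. \<psi> y) + v x * \<psi> x else 0)"

locale bounded_graph =
  fixes V :: "'v set" and N :: "'v \<Rightarrow> 'v set" and D :: nat
  assumes N_sub: "x \<in> V \<Longrightarrow> N x \<subseteq> V"
    and N_fin: "x \<in> V \<Longrightarrow> finite (N x)"
    and N_card: "x \<in> V \<Longrightarrow> card (N x) \<le> D"
    and N_sym: "x \<in> V \<Longrightarrow> y \<in> N x \<Longrightarrow> x \<in> N y"
begin

text \<open>Schur's test: Cauchy-Schwarz on each neighbourhood costs a factor \<open>D\<close>, and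
  exchanging the sums counts every vertex at most \<open>D\<close> times, because neighbourhoods are
  symmetric.\<close>

lemma adjacency_partial_sum:
  assumes \<psi>: "\<psi> \<in> ell2 V" and F: "finite F"
  shows "(\<Sum>x\<in>F. (cmod (if x \<in> V then (\<Sum>y\<in>N x. \<psi> y) else 0))\<^sup>2) \<le> (real D * ell2_norm \<psi>)\<^sup>2"
proof -
  define G where "G = F \<inter> V"
  have G: "finite G" "G \<subseteq> V" using F by (auto simp: G_def)
  define Y where "Y = (\<Union>x\<in>G. N x)"
  have Y: "finite Y" "Y \<subseteq> V" using G N_fin N_sub by (auto simp: Y_def)
  have "(\<Sum>x\<in>F. (cmod (if x \<in> V then (\<Sum>y\<in>N x. \<psi> y) else 0))\<^sup>2) = (\<Sum>x\<in>G. (cmod (\<Sum>y\<in>N x. \<psi> y))\<^sup>2)"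
    unfolding G_def using F by (subst sum.inter_restrict) (auto intro!: sum.cong)
  also have "\<dots> \<le> (\<Sum>x\<in>G. real D * (\<Sum>y\<in>N x. (cmod (\<psi> y))\<^sup>2))"
  proof (rule sum_mono)
    fix x assume x: "x \<in> G"
    have "(cmod (\<Sum>y\<in>N x. \<psi> y))\<^sup>2 \<le> (\<Sum>y\<in>N x. cmod (\<psi> y))\<^sup>2"
      by (intro power_mono norm_sum) auto
    also have "\<dots> \<le> real (card (N x)) * (\<Sum>y\<in>N x. (cmod (\<psi> y))\<^sup>2)"
      using sum_squared_le_sum_of_squares[of "\<lambda>y. cmod (\<psi> y)" "N x"] by (simp add: mult.commute)
    also have "\<dots> \<le> real D * (\<Sum>y\<in>N x. (cmod (\<psi> y))\<^sup>2)"
      using N_card x G by (intro mult_right_mono sum_nonneg) auto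
    finally show "(cmod (\<Sum>y\<in>N x. \<psi> y))\<^sup>2 \<le> real D * (\<Sum>y\<in>N x. (cmod (\<psi> y))\<^sup>2)" .
  qed
  also have "\<dots> = real D * (\<Sum>x\<in>G. \<Sum>y\<in>Y. if y \<in> N x then (cmod (\<psi> y))\<^sup>2 else 0)"
  proof -
    have "(\<Sum>y\<in>N x. (cmod (\<psi> y))\<^sup>2) = (\<Sum>y\<in>Y. if y \<in> N x then (cmod (\<psi> y))\<^sup>2 else 0)" if "x \<in> G" for x
    proof -
      have "N x = Y \<inter> {y. y \<in> N x}" using that by (auto simp: Y_def)
      then show ?thesis
        using sum.inter_restrict[OF Y(1), of "\<lambda>y. (cmod (\<psi> y))\<^sup>2" "{y. y \<in> N x}"] by simp
    qed
    then show ?thesis by (simp add: sum_distrib_left)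
  qed
  also have "\<dots> = real D * (\<Sum>y\<in>Y. \<Sum>x\<in>G. if y \<in> N x then (cmod (\<psi> y))\<^sup>2 else 0)"
    by (subst sum.swap) simp
  also have "\<dots> \<le> real D * (\<Sum>y\<in>Y. real D * (cmod (\<psi> y))\<^sup>2)"
  proof (intro mult_left_mono sum_mono)
    fix y assume y: "y \<in> Y"
    have "(\<Sum>x\<in>G. if y \<in> N x then (cmod (\<psi> y))\<^sup>2 else 0) = real (card (G \<inter> {x. y \<in> N x})) * (cmod (\<psi> y))\<^sup>2"
      using sum.inter_restrict[OF G(1), of "\<lambda>x. (cmod (\<psi> y))\<^sup>2" "{x. y \<in> N x}"] by simp
    also have "\<dots> \<le> real D * (cmod (\<psi> y))\<^sup>2"
    proof (intro mult_right_mono)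
      have "G \<inter> {x. y \<in> N x} \<subseteq> N y" using G(2) N_sym by auto
      then have "card (G \<inter> {x. y \<in> N x}) \<le> card (N y)" using N_fin y Y(2) by (intro card_mono) auto
      also have "\<dots> \<le> D" using N_card y Y(2) by auto
      finally show "real (card (G \<inter> {x. y \<in> N x})) \<le> real D" by simp
    qed simp
    finally show "(\<Sum>x\<in>G. if y \<in> N x then (cmod (\<psi> y))\<^sup>2 else 0) \<le> real D * (cmod (\<psi> y))\<^sup>2" .
  qed simp
  also have "\<dots> = (real D)\<^sup>2 * (\<Sum>y\<in>Y. (cmod (\<psi> y))\<^sup>2)" by (simp add: sum_distrib_left power2_eq_square mult_ac)
  also have "\<dots> \<le> (real D)\<^sup>2 * (ell2_norm \<psi>)\<^sup>2"
    by (intro mult_left_mono ell2_norm_partial ell2_UNIV[OF \<psi>] Y) simp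
  finally show ?thesis by (simp add: power_mult_distrib)
qed

lemma adjacency_ell2:
  assumes \<psi>: "\<psi> \<in> ell2 V"
  defines "f \<equiv> \<lambda>x. if x \<in> V then (\<Sum>y\<in>N x. \<psi> y) else 0"
  shows "f \<in> ell2 V" "ell2_norm f \<le> real D * ell2_norm \<psi>"
  using ell2_I_partial[of V f "real D * ell2_norm \<psi>"] adjacency_partial_sum[OF \<psi>] by (auto simp: f_def)

lemma potential_ell2:
  assumes \<psi>: "\<psi> \<in> ell2 V" and v: "\<And>x. x \<in> V \<Longrightarrow> cmod (v x) \<le> b" and b: "0 \<le> b"
  defines "g \<equiv> \<lambda>x. if x \<in> V then v x * \<psi> x else 0"
  shows "g \<in> ell2 V" "ell2_norm g \<le> b * ell2_norm \<psi>"
proof -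
  have "(\<Sum>x\<in>F. (cmod (g x))\<^sup>2) \<le> (b * ell2_norm \<psi>)\<^sup>2" if F: "finite F" for F
  proof -
    have "(\<Sum>x\<in>F. (cmod (g x))\<^sup>2) \<le> (\<Sum>x\<in>F. b\<^sup>2 * (cmod (\<psi> x))\<^sup>2)"
    proof (rule sum_mono)
      fix x
      show "(cmod (g x))\<^sup>2 \<le> b\<^sup>2 * (cmod (\<psi> x))\<^sup>2"
        unfolding g_def power_mult_distrib[symmetric]
        using v[of x] b by (auto simp: norm_mult intro!: power_mono mult_right_mono)
    qed
    also have "\<dots> \<le> b\<^sup>2 * (ell2_norm \<psi>)\<^sup>2"
      unfolding sum_distrib_left[symmetric] by (intro mult_left_mono ell2_norm_partial ell2_UNIV[OF \<psi>] F) simp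
    finally show ?thesis by (simp add: power_mult_distrib)
  qed
  then show "g \<in> ell2 V" "ell2_norm g \<le> b * ell2_norm \<psi>"
    using ell2_I_partial[of V g "b * ell2_norm \<psi>"] b by (auto simp: g_def)
qed

lemma gop_split:
  "gop V N v \<psi> = (\<lambda>x. (if x \<in> V then (\<Sum>y\<in>N x. \<psi> y) else 0) + (if x \<in> V then v x * \<psi> x else 0))"
  by (auto simp: gop_def)

lemma gop_ell2:
  assumes "\<psi> \<in> ell2 V" "\<And>x. x \<in> V \<Longrightarrow> cmod (v x) \<le> b" "0 \<le> b"
  shows "gop V N v \<psi> \<in> ell2 V" "ell2_norm (gop V N v \<psi>) \<le> (real D + b) * ell2_norm \<psi>"
proof -
  note f = adjacency_ell2[OF assms(1)]
  have g: "(\<lambda>x. if x \<in> V then v x * \<psi> x else 0) \<in> ell2 V"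
    "ell2_norm (\<lambda>x. if x \<in> V then v x * \<psi> x else 0) \<le> b * ell2_norm \<psi>"
    using potential_ell2[of \<psi> v b] assms by blast+
  show "gop V N v \<psi> \<in> ell2 V" unfolding gop_split by (intro add_ell2 f g)
  show "ell2_norm (gop V N v \<psi>) \<le> (real D + b) * ell2_norm \<psi>"
    using ell2_norm_triangle[OF ell2_UNIV[OF f(1)] ell2_UNIV[OF g(1)]] f(2) g(2) unfolding gop_split by (simp add: algebra_simps)
qed

lemma swap_pairs: "bij_betw prod.swap (Sigma V N) (Sigma V N)"
proof -
  have "prod.swap p \<in> Sigma V N" if p: "p \<in> Sigma V N" for p
  proof -
    obtain x y where "p = (x, y)" "x \<in> V" "y \<in> N x" using p by blast
    moreover from this have "y \<in> V" "x \<in> N y" using N_sub[of x] N_sym[of x y] by blast+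
    ultimately show ?thesis by simp
  qed
  then show ?thesis by (intro bij_betwI[where g=prod.swap]) auto
qed

lemma adjacency_pairs_summable:
  assumes \<phi>: "\<phi> \<in> ell2 V" and \<psi>: "\<psi> \<in> ell2 V"
  shows "(\<lambda>(x,y). cnj (\<phi> x) * \<psi> y) summable_on (Sigma V N)"
proof -
  have 1: "(\<lambda>(x,y). (cmod (\<theta> x))\<^sup>2) summable_on (Sigma V N)" if \<theta>: "\<theta> \<in> ell2 V" for \<theta>
  proof (rule nonneg_bdd_above_summable_on)
    have "sum (\<lambda>(x,y). (cmod (\<theta> x))\<^sup>2) F \<le> real D * (ell2_norm \<theta>)\<^sup>2" if F: "F \<subseteq> Sigma V N" "finite F" for F
    proof -
      have "sum (\<lambda>(x,y). (cmod (\<theta> x))\<^sup>2) F \<le> sum (\<lambda>(x,y). (cmod (\<theta> x))\<^sup>2) (Sigma (fst ` F) N)"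
      proof (rule sum_mono2)
        show "finite (Sigma (fst ` F) N)" using F N_fin by (intro finite_SigmaI) auto
        show "F \<subseteq> Sigma (fst ` F) N" using F(1) by force
      qed auto
      also have "\<dots> = (\<Sum>x\<in>fst ` F. real (card (N x)) * (cmod (\<theta> x))\<^sup>2)"
        using F N_fin by (subst sum.Sigma[symmetric]) auto
      also have "\<dots> \<le> (\<Sum>x\<in>fst ` F. real D * (cmod (\<theta> x))\<^sup>2)"
        using F N_card by (intro sum_mono mult_right_mono) auto
      also have "\<dots> \<le> real D * (ell2_norm \<theta>)\<^sup>2"
        unfolding sum_distrib_left[symmetric] using F by (intro mult_left_mono ell2_norm_partial ell2_UNIV[OF \<theta>]) auto
      finally show ?thesis .
    qed
    then show "bdd_above (sum (\<lambda>(x,y). (cmod (\<theta> x))\<^sup>2) ` {F. F \<subseteq> Sigma V N \<and> finite F})"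
      by (auto simp: bdd_above_def)
  qed auto
  have 2: "(\<lambda>(x,y). (cmod (\<psi> y))\<^sup>2) summable_on (Sigma V N)"
    using 1[OF \<psi>] summable_on_reindex_bij_betw[OF swap_pairs, of "\<lambda>(x,y). (cmod (\<psi> x))\<^sup>2"] by (simp add: case_prod_unfold)
  have "(\<lambda>p. norm ((\<lambda>(x,y). cnj (\<phi> x) * \<psi> y) p)) summable_on (Sigma V N)"
  proof (rule summable_on_comparison_test)
    show "(\<lambda>p. (\<lambda>(x,y). (cmod (\<phi> x))\<^sup>2) p + (\<lambda>(x,y). (cmod (\<psi> y))\<^sup>2) p) summable_on (Sigma V N)"
      by (rule summable_on_add[OF 1[OF \<phi>] 2])
    fix p assume "p \<in> Sigma V N"
    show "norm ((\<lambda>(x,y). cnj (\<phi> x) * \<psi> y) p) \<le> (\<lambda>(x,y). (cmod (\<phi> x))\<^sup>2) p + (\<lambda>(x,y). (cmod (\<psi> y))\<^sup>2) p"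
      using sum_squares_bound[of "cmod (\<phi> (fst p))" "cmod (\<psi> (snd p))"]
        mult_nonneg_nonneg[OF norm_ge_zero[of "\<phi> (fst p)"] norm_ge_zero[of "\<psi> (snd p)"]]
      unfolding case_prod_unfold norm_mult complex_mod_cnj by linarith
  qed auto
  then show ?thesis by (rule Infinite_Sum.abs_summable_summable)
qed

lemma inner_restrict: "\<phi> \<in> ell2 V \<Longrightarrow> ell2_inner \<phi> \<psi> = (\<Sum>\<^sub>\<infinity>x\<in>V. cnj (\<phi> x) * \<psi> x)"
  unfolding ell2_inner_def by (rule infsum_cong_neutral) (auto dest: ell2_outside)

text \<open>Both adjacency terms are sums over directed edges and differ by reversal of the edges.
  Summability over all edges, from \<open>adjacency_pairs_summable\<close>, justifies the exchange
  of summations on an infinite graph.\<close>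

lemma gop_symmetric:
  assumes v: "\<And>x. x \<in> V \<Longrightarrow> \<bar>v x\<bar> \<le> b"
  shows "symmetric_on V (gop V N (\<lambda>x. complex_of_real (v x)))"
  unfolding symmetric_on_def
proof (intro ballI)
  fix \<phi> \<psi> assume U: "\<phi> \<in> ell2 V" "\<psi> \<in> ell2 V"
  define W where "W = (\<lambda>x. cnj (\<phi> x) * (of_real (v x) * \<psi> x))"
  define P where "P = (\<lambda>x. \<Sum>y\<in>N x. cnj (\<phi> x) * \<psi> y)"
  define Q where "Q = (\<lambda>x. \<Sum>y\<in>N x. cnj (\<phi> y) * \<psi> x)"
  have s1: "(\<lambda>(x,y). cnj (\<phi> x) * \<psi> y) summable_on (Sigma V N)" by (rule adjacency_pairs_summable[OF U])
  have s2: "(\<lambda>(x,y). cnj (\<phi> y) * \<psi> x) summable_on (Sigma V N)"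
    using s1 summable_on_reindex_bij_betw[OF swap_pairs, of "\<lambda>(x,y). cnj (\<phi> x) * \<psi> y"] by (simp add: case_prod_unfold)
  have PQ: "infsum P V = infsum Q V"
  proof -
    have "infsum P V = (\<Sum>\<^sub>\<infinity>x\<in>V. \<Sum>\<^sub>\<infinity>y\<in>N x. cnj (\<phi> x) * \<psi> y)" unfolding P_def using N_fin by (intro infsum_cong) simp
    also have "\<dots> = (\<Sum>\<^sub>\<infinity>(x,y)\<in>Sigma V N. cnj (\<phi> x) * \<psi> y)" using s1 by (rule infsum_Sigma'_banach)
    also have "\<dots> = (\<Sum>\<^sub>\<infinity>(x,y)\<in>Sigma V N. cnj (\<phi> y) * \<psi> x)"
      using infsum_reindex_bij_betw[OF swap_pairs, of "\<lambda>(x,y). cnj (\<phi> x) * \<psi> y"] by (simp add: case_prod_unfold)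
    also have "\<dots> = (\<Sum>\<^sub>\<infinity>x\<in>V. \<Sum>\<^sub>\<infinity>y\<in>N x. cnj (\<phi> y) * \<psi> x)" using infsum_Sigma'_banach[OF s2] by simp
    also have "\<dots> = infsum Q V" unfolding Q_def using N_fin by (intro infsum_cong) simp
    finally show ?thesis .
  qed
  have inn: "(\<lambda>x. cnj (\<alpha> x) * \<beta> x) summable_on V" if "\<alpha> \<in> ell2 V" "\<beta> \<in> ell2 V" for \<alpha> \<beta>
    by (rule Infinite_Sum.abs_summable_summable[OF ell2_inner_summable[OF ell2_UNIV[OF that(1)] ell2_UNIV[OF that(2)]]])
  have sP: "P summable_on V"
    using inn[OF U(1) adjacency_ell2(1)[OF U(2)]] by (subst summable_on_cong) (auto simp: P_def sum_distrib_left)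
  have sQ: "Q summable_on V"
    using summable_on_cnj_iff[THEN iffD2, OF inn[OF U(2) adjacency_ell2(1)[OF U(1)]]]
    by (subst summable_on_cong) (auto simp: Q_def sum_distrib_left mult.commute)
  have vb: "cmod (complex_of_real (v x)) \<le> max 0 b" if "x \<in> V" for x using v[OF that] by simp
  have sW: "W summable_on V"
  proof -
    have "(\<lambda>x. if x \<in> V then complex_of_real (v x) * \<psi> x else 0) \<in> ell2 V"
      using potential_ell2(1)[of \<psi> "\<lambda>x. complex_of_real (v x)" "max 0 b"] U(2) vb by auto
    from inn[OF U(1) this] show ?thesis by (subst summable_on_cong) (auto simp: W_def)
  qed
  have "ell2_inner \<phi> (gop V N (\<lambda>x. complex_of_real (v x)) \<psi>) = (\<Sum>\<^sub>\<infinity>x\<in>V. P x + W x)"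
    unfolding inner_restrict[OF U(1)] by (rule infsum_cong) (simp add: gop_def P_def W_def sum_distrib_left ring_distribs)
  also have "\<dots> = infsum Q V + infsum W V" by (simp only: infsum_add[OF sP sW] PQ)
  also have "\<dots> = (\<Sum>\<^sub>\<infinity>x\<in>V. Q x + W x)" by (simp only: infsum_add[OF sQ sW])
  also have "\<dots> = ell2_inner (gop V N (\<lambda>x. complex_of_real (v x)) \<phi>) \<psi>"
  proof -
    have "cnj (ell2_inner \<psi> (gop V N (\<lambda>x. complex_of_real (v x)) \<phi>)) = (\<Sum>\<^sub>\<infinity>x\<in>V. Q x + W x)"
      unfolding inner_restrict[OF U(2)] infsum_cnj[symmetric]
      by (rule infsum_cong) (simp add: gop_def Q_def W_def sum_distrib_left ring_distribs mult_ac)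
    then show ?thesis by (simp add: inner_cnj)
  qed
  finally show "ell2_inner \<phi> (gop V N (\<lambda>x. complex_of_real (v x)) \<psi>) = ell2_inner (gop V N (\<lambda>x. complex_of_real (v x)) \<phi>) \<psi>" .
qed

lemma gop_add: "gop V N v (\<lambda>x. \<phi> x + \<psi> x) = (\<lambda>x. gop V N v \<phi> x + gop V N v \<psi> x)"
  by (auto simp: gop_def fun_eq_iff sum.distrib ring_distribs)

lemma gop_scale: "gop V N v (\<lambda>x. a * \<psi> x) = (\<lambda>x. a * gop V N v \<psi> x)"
  by (auto simp: gop_def fun_eq_iff sum_distrib_left ring_distribs)

lemma gop_bounded_sa:
  assumes v: "\<And>x. x \<in> V \<Longrightarrow> \<bar>v x\<bar> \<le> b" and c: "real D + max 0 b \<le> c" "0 < c"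
  shows "bounded_sa V (gop V N (\<lambda>x. complex_of_real (v x))) c"
proof
  have vb: "cmod (complex_of_real (v x)) \<le> max 0 b" if "x \<in> V" for x using v[OF that] by simp
  have l: "gop V N (\<lambda>x. complex_of_real (v x)) \<psi> \<in> ell2 V"
    "ell2_norm (gop V N (\<lambda>x. complex_of_real (v x)) \<psi>) \<le> (real D + max 0 b) * ell2_norm \<psi>"
    if "\<psi> \<in> ell2 V" for \<psi>
    using gop_ell2[of \<psi> "\<lambda>x. complex_of_real (v x)" "max 0 b"] vb that by auto
  show "linear_op_on V (gop V N (\<lambda>x. complex_of_real (v x)))"
    unfolding linear_op_on_def using l(1) by (simp add: gop_add gop_scale)
  show "symmetric_on V (gop V N (\<lambda>x. complex_of_real (v x)))" by (rule gop_symmetric[OF v])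
  show "ell2_norm (gop V N (\<lambda>x. complex_of_real (v x)) \<psi>) \<le> c * ell2_norm \<psi>" if "\<psi> \<in> ell2 V" for \<psi>
    using l(2)[OF that] mult_right_mono[OF c(1) ell2_norm_nonneg[of \<psi>]] by linarith
qed (rule c)

text \<open>A vertex is not its own neighbour, so the potential is the diagonal of the operator and
  is visible on \<open>delta x\<close>. The lemma identifies the outcomes at which
  \<open>spectral_projection\<close> falls back to a constant.\<close>

lemma gop_unbounded:
  assumes s: "bounded_self_adjoint_on V (gop V N (\<lambda>x. complex_of_real (v x)))"
    and N_irrefl: "\<And>x. x \<in> V \<Longrightarrow> x \<notin> N x"
  shows "\<exists>b. \<forall>x\<in>V. \<bar>v x\<bar> \<le> b"
proof -
  let ?A = "gop V N (\<lambda>x. complex_of_real (v x))"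
  obtain c where c: "\<forall>\<psi>\<in>ell2 V. ell2_norm (?A \<psi>) \<le> c * ell2_norm \<psi>" and l: "\<forall>\<psi>\<in>ell2 V. ?A \<psi> \<in> ell2 V"
    using s unfolding bounded_self_adjoint_on_def linear_op_on_def by blast
  have "\<bar>v x\<bar> \<le> c" if x: "x \<in> V" for x
  proof -
    have d: "delta x \<in> ell2 V" by (rule delta_ell2[OF x])
    have "(\<Sum>y\<in>N x. delta x y) = 0" by (rule sum.neutral) (use N_irrefl[OF x] in \<open>auto simp: delta_def\<close>)
    then have "?A (delta x) x = complex_of_real (v x)" using x by (simp add: gop_def) (simp add: delta_def)
    then have "\<bar>v x\<bar> \<le> ell2_norm (?A (delta x))"
      using ell2_norm_coord[OF ell2_UNIV[OF bspec[OF l d]], of x] by simp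
    also have "\<dots> \<le> c" using c d norm_delta[of x] by force
    finally show ?thesis .
  qed
  then show ?thesis by blast
qed

end

section \<open>Layered trees\<close>

text \<open>
  Vertices carry a height above the boundary and a parent one level up. The exceptional vertices
  \<open>T\<close> (for a ball of the Bethe lattice: the root) have no parent and an irregular number of children.
\<close>

definition desc :: "'v set \<Rightarrow> ('v \<Rightarrow> 'v) \<Rightarrow> 'v \<Rightarrow> 'v set" where
  "desc V par z = {x \<in> V. \<exists>i. (par ^^ i) x = z}"

definition tree_iso :: "'v set \<Rightarrow> ('v \<Rightarrow> nat) \<Rightarrow> ('v \<Rightarrow> 'v) \<Rightarrow> 'w set \<Rightarrow> ('w \<Rightarrow> nat) \<Rightarrow> ('w \<Rightarrow> 'w) \<Rightarrow>
    ('v \<Rightarrow> 'w) \<Rightarrow> 'v \<Rightarrow> 'w \<Rightarrow> bool" where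
  "tree_iso V h par V' h' par' f z z' \<longleftrightarrow>
     bij_betw f (desc V par z) (desc V' par' z') \<and> f z = z' \<and>
     (\<forall>x\<in>desc V par z. h' (f x) = h x) \<and>
     (\<forall>x\<in>desc V par z. x \<noteq> z \<longrightarrow> par' (f x) = f (par x))"

text \<open>\<open>par\<close> is total and fixes the vertices of \<open>T\<close>, so its iterates
  never leave \<open>V\<close> and stop at \<open>T\<close>. The bound \<open>Suc K\<close> admits
  the root of the Bethe lattice; exactly \<open>K\<close> children are demanded only above the
  boundary and off \<open>T\<close>, where isomorphisms are built.\<close>

locale layered =
  fixes K :: nat and V :: "'v set" and h :: "'v \<Rightarrow> nat" and par :: "'v \<Rightarrow> 'v" and T :: "'v set"
  assumes T_sub: "T \<subseteq> V"
    and par_in: "x \<in> V \<Longrightarrow> x \<notin> T \<Longrightarrow> par x \<in> V"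
    and par_h: "x \<in> V \<Longrightarrow> x \<notin> T \<Longrightarrow> h (par x) = Suc (h x)"
    and par_T: "x \<in> T \<Longrightarrow> par x = x"
    and children_card: "y \<in> V \<Longrightarrow> y \<notin> T \<Longrightarrow> 0 < h y \<Longrightarrow> card {x \<in> V. x \<notin> T \<and> par x = y} = K"
    and children_le: "y \<in> V \<Longrightarrow> card {x \<in> V. x \<notin> T \<and> par x = y} \<le> Suc K"
    and children_finite: "y \<in> V \<Longrightarrow> finite {x \<in> V. x \<notin> T \<and> par x = y}"
begin

definition ch :: "'v \<Rightarrow> 'v set" where
  "ch y = {x \<in> V. x \<notin> T \<and> par x = y}"

definition nb :: "'v \<Rightarrow> 'v set" where
  "nb x = ch x \<union> (if x \<in> T then {} else {par x})"

lemma par_pow_in: "x \<in> V \<Longrightarrow> (par ^^ i) x \<in> V"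
  by (induction i) (use par_in par_T in fastforce)+

lemma par_pow_T: "x \<in> T \<Longrightarrow> (par ^^ i) x = x"
  by (induction i) (auto simp: par_T)

lemma par_pow_T': "(par ^^ i) x \<in> T \<Longrightarrow> (par ^^ (j + i)) x = (par ^^ i) x"
  by (simp add: funpow_add par_pow_T)

lemma par_pow_notT: "(par ^^ i) x \<notin> T \<Longrightarrow> j \<le> i \<Longrightarrow> (par ^^ j) x \<notin> T"
  using par_pow_T'[of j x "i - j"] by auto

lemma par_pow_h:
  assumes "x \<in> V" "(par ^^ i) x \<notin> T"
  shows "h ((par ^^ i) x) = h x + i"
  using assms(2)
proof (induction i)
  case (Suc i)
  have n: "(par ^^ i) x \<notin> T" using par_pow_notT[OF Suc.prems, of i] by simp
  then show ?case using par_h[OF par_pow_in[OF assms(1)] n] Suc.IH by simp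
qed simp

lemma ch_h: "x \<in> ch y \<Longrightarrow> h y = Suc (h x)"
  by (auto simp: ch_def par_h)

lemma ch_empty: "h y = 0 \<Longrightarrow> ch y = {}"
  using ch_h by fastforce

lemma ch_card: "y \<in> V \<Longrightarrow> y \<notin> T \<Longrightarrow> 0 < h y \<Longrightarrow> card (ch y) = K"
  and ch_finite: "y \<in> V \<Longrightarrow> finite (ch y)"
  unfolding ch_def by (rule children_card children_finite; assumption)+

lemma desc_self: "z \<in> V \<Longrightarrow> z \<in> desc V par z"
  by (auto simp: desc_def intro: exI[of _ 0])

lemma desc_in: "x \<in> desc V par z \<Longrightarrow> x \<in> V"
  by (simp add: desc_def)

lemma desc_D:
  assumes z: "z \<notin> T" and x: "x \<in> desc V par z"
  shows "h x \<le> h z" "(par ^^ (h z - h x)) x = z" "x \<notin> T"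
proof -
  obtain i where i: "(par ^^ i) x = z" and xV: "x \<in> V" using x by (auto simp: desc_def)
  have "h z = h x + i" using par_pow_h[OF xV, of i] i z by simp
  then show "h x \<le> h z" "(par ^^ (h z - h x)) x = z" using i by simp_all
  show "x \<notin> T" using par_pow_T[of x i] i z by auto
qed

lemma desc_par:
  assumes z: "z \<notin> T" and x: "x \<in> desc V par z" "x \<noteq> z"
  shows "par x \<in> desc V par z" "h x < h z"
proof -
  have "h x \<noteq> h z" using desc_D(2)[OF z x(1)] x(2) by auto
  then show l: "h x < h z" using desc_D(1)[OF z x(1)] by simp
  then obtain j where "h z - h x = Suc j" by (metis Suc_diff_Suc)
  then have "(par ^^ j) (par x) = z" using desc_D(2)[OF z x(1)] by (simp add: funpow_swap1)
  then show "par x \<in> desc V par z"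
    using par_in[OF desc_in[OF x(1)] desc_D(3)[OF z x(1)]] by (auto simp: desc_def)
qed

lemma desc_pow:
  assumes z: "z \<notin> T" and x: "x \<in> desc V par z" and i: "h x + i \<le> h z"
  shows "(par ^^ i) x \<in> desc V par z"
  using i
proof (induction i)
  case 0 then show ?case using x by simp
next
  case (Suc i)
  then have IH: "(par ^^ i) x \<in> desc V par z" by simp
  have "h ((par ^^ i) x) = h x + i"
    by (rule par_pow_h[OF desc_in[OF x] desc_D(3)[OF z IH]])
  then have "(par ^^ i) x \<noteq> z" using Suc.prems by auto
  then show ?case using desc_par(1)[OF z IH] by simp
qed

lemma desc_unique:
  assumes "z \<notin> T" "w \<notin> T" "h z = h w" "x \<in> desc V par z" "x \<in> desc V par w"
  shows "z = w"
  using desc_D(2)[OF assms(1,4)] desc_D(2)[OF assms(2,5)] unfolding assms(3) by (rule trans[OF sym])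

lemma desc_ch: "c \<in> ch z \<Longrightarrow> desc V par c \<subseteq> desc V par z"
proof
  fix x assume c: "c \<in> ch z" and "x \<in> desc V par c"
  then obtain i where "x \<in> V" "(par ^^ i) x = c" by (auto simp: desc_def)
  then have "(par ^^ Suc i) x = z" using c by (simp add: ch_def)
  then show "x \<in> desc V par z" using \<open>x \<in> V\<close> by (auto simp: desc_def simp del: funpow.simps)
qed

lemma desc_split:
  assumes z: "z \<notin> T" and x: "x \<in> desc V par z" "x \<noteq> z"
  shows "(par ^^ (h z - h x - 1)) x \<in> ch z" "x \<in> desc V par ((par ^^ (h z - h x - 1)) x)"
proof -
  note l = desc_par(2)[OF z x]
  let ?c = "(par ^^ (h z - h x - 1)) x"
  have e: "h z - h x = Suc (h z - h x - 1)" using l by simp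
  have p: "par ?c = z" using desc_D(2)[OF z x(1)] by (subst (asm) e) simp
  have "?c \<notin> T" using p par_T z by auto
  then show "?c \<in> ch z" using p par_pow_in[OF desc_in[OF x(1)]] by (simp add: ch_def)
  show "x \<in> desc V par ?c" using desc_in[OF x(1)] by (auto simp: desc_def)
qed

lemma ch_notT: "c \<in> ch z \<Longrightarrow> c \<notin> T" and ch_V: "c \<in> ch z \<Longrightarrow> c \<in> V" and ch_par: "c \<in> ch z \<Longrightarrow> par c = z"
  by (simp_all add: ch_def)

lemma desc_child_index:
  assumes z: "z \<notin> T" and c: "c \<in> ch z" and x: "x \<in> desc V par c"
  shows "(par ^^ (h z - h x - 1)) x = c" "x \<noteq> z"
proof -
  have "h z = Suc (h c)" by (rule ch_h[OF c])
  then show "(par ^^ (h z - h x - 1)) x = c" "x \<noteq> z"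
    using desc_D(1,2)[OF ch_notT[OF c] x] by auto
qed

lemma nb_graph: "bounded_graph V nb (K + 2)"
proof
  fix x assume x: "x \<in> V"
  show "nb x \<subseteq> V" using par_in[OF x] by (auto simp: nb_def ch_def)
  show "finite (nb x)" using ch_finite[OF x] by (simp add: nb_def)
  have "card (nb x) \<le> card (ch x) + card (if x \<in> T then {} else {par x})" unfolding nb_def by (rule card_Un_le)
  also have "\<dots> \<le> K + 2" using children_le[OF x] by (auto simp: ch_def)
  finally show "card (nb x) \<le> K + 2" .
next
  fix x y assume "x \<in> V" "y \<in> nb x"
  then show "x \<in> nb y" by (auto simp: nb_def ch_def split: if_splits)
qed

sublocale bounded_graph V nb "K + 2" by (rule nb_graph)

lemma nb_h: "y \<in> nb x \<Longrightarrow> x \<in> V \<Longrightarrow> h x \<le> Suc (h y)" "y \<in> nb x \<Longrightarrow> x \<in> V \<Longrightarrow> h y \<le> Suc (h x)"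
  using ch_h[of y x] par_h[of x] by (auto simp: nb_def split: if_splits)

lemma nb_irrefl: "x \<in> V \<Longrightarrow> x \<notin> nb x"
  using ch_h[of x x] par_h[of x] by (auto simp: nb_def split: if_splits)

text \<open>The vertex whose random variable acts on \<open>x\<close>: away from \<open>T\<close>,
  the first vertex on the way up from \<open>x\<close> whose height is congruent to
  \<open>m0\<close> modulo \<open>m0 + 1\<close>. Heights are counted from the boundary, so this is
  the indexing of the canopy tree; \<open>ball_block\<close> compares it with the indexing from the
  root.\<close>

definition block :: "nat \<Rightarrow> 'v \<Rightarrow> 'v" where
  "block m0 x = (par ^^ (m0 - h x mod (m0 + 1))) x"

definition hop :: "nat \<Rightarrow> real \<Rightarrow> ('v \<Rightarrow> real) \<Rightarrow> 'v operator" where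
  "hop m0 lam om = gop V nb (\<lambda>x. complex_of_real (lam * om (block m0 x)))"

text \<open>The full vector is kept because the recursion in \<open>q\<close> needs its values at
  all neighbours; the moment at \<open>x\<close> is the entry at \<open>x\<close>.\<close>

definition mom :: "nat \<Rightarrow> real \<Rightarrow> ('v \<Rightarrow> real) \<Rightarrow> 'v \<Rightarrow> nat \<Rightarrow> 'v \<Rightarrow> complex" where
  "mom m0 lam om x q = (hop m0 lam om ^^ q) (delta x)"

text \<open>Each power of the operator moves mass along one edge, and an edge changes the height by
  one. The bound keeps moments from seeing anything above a sufficiently high ancestor.\<close>

lemma mom_support:
  assumes x: "x \<in> V" and "mom m0 lam om x q y \<noteq> 0"
  shows "y \<in> V" "h y \<le> h x + q"
proof -
  have "y \<in> V \<and> h y \<le> h x + q" using assms(2)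
  proof (induction q arbitrary: y)
    case 0
    then show ?case using x by (auto simp: mom_def delta_def split: if_splits)
  next
    case (Suc q)
    then have yV: "y \<in> V" by (auto simp: mom_def hop_def gop_def split: if_splits)
    have "mom m0 lam om x (Suc q) y = (\<Sum>w\<in>nb y. mom m0 lam om x q w) + complex_of_real (lam * om (block m0 y)) * mom m0 lam om x q y"
      using yV by (simp add: mom_def hop_def gop_def)
    then have "mom m0 lam om x q y \<noteq> 0 \<or> (\<exists>w\<in>nb y. mom m0 lam om x q w \<noteq> 0)"
      using Suc.prems by (metis add.right_neutral mult_zero_right sum.neutral)
    then show ?case using Suc.IH nb_h(1)[OF _ yV] yV by fastforce
  qed
  then show "y \<in> V" "h y \<le> h x + q" by auto
qed

end

locale layered_pair = L1: layered K V h par T + L2: layered K V' h' par' T'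
  for K :: nat and V :: "'v set" and h par T and V' :: "'w set" and h' par' T'
begin

abbreviation iso where "iso \<equiv> tree_iso V h par V' h' par'"

text \<open>A proper descendant \<open>x\<close> of \<open>z\<close> lies below exactly one child of
  \<open>z\<close>, namely the vertex \<open>h z - h x - 1\<close> steps above \<open>x\<close>.
  This decides which of the given isomorphisms is applied to \<open>x\<close>, and preservation of
  heights keeps the pieces disjoint.\<close>

lemma iso_join:
  assumes z: "z \<in> V" "z \<notin> T" and z': "z' \<in> V'" "z' \<notin> T'" and hz: "h z = h' z'"
    and g: "bij_betw g (L1.ch z) (L2.ch z')" and F: "\<And>c. c \<in> L1.ch z \<Longrightarrow> iso (F c) c (g c)"
  shows "\<exists>f. iso f z z' \<and> (\<forall>c\<in>L1.ch z. \<forall>x\<in>desc V par c. f x = F c x)"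
proof -
  define f where "f x = (if x = z then z' else F ((par ^^ (h z - h x - 1)) x) x)" for x
  have fc: "f x = F c x" if "c \<in> L1.ch z" "x \<in> desc V par c" for c x
    using L1.desc_child_index[OF z(2) that] by (simp add: f_def)
  have gc: "g c \<in> L2.ch z'" if "c \<in> L1.ch z" for c using g that by (auto simp: bij_betw_def)
  have child: "\<exists>c\<in>L1.ch z. x \<in> desc V par c" if "x \<in> desc V par z" "x \<noteq> z" for x
    using L1.desc_split[OF z(2) that] by blast
  have FD: "F c x \<in> desc V' par' (g c)" "h' (F c x) = h x" "x \<noteq> c \<Longrightarrow> par' (F c x) = F c (par x)" "F c c = g c"
    if "c \<in> L1.ch z" "x \<in> desc V par c" for c x
    using F[OF that(1)] that(2) unfolding tree_iso_def bij_betw_def by auto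
  have hf: "h' (f x) = h x" if "x \<in> desc V par z" for x
  proof (cases "x = z")
    case True then show ?thesis using hz by (simp add: f_def)
  next
    case False
    then obtain c where "c \<in> L1.ch z" "x \<in> desc V par c" using child \<open>x \<in> desc V par z\<close> by blast
    then show ?thesis using fc FD by simp
  qed
  have inj: "inj_on f (desc V par z)"
  proof (rule inj_onI)
    fix x y assume x: "x \<in> desc V par z" and y: "y \<in> desc V par z" and e: "f x = f y"
    have hxy: "h x = h y" using hf[OF x] hf[OF y] e by simp
    show "x = y"
    proof (cases "x = z \<or> y = z")
      case True
      then show ?thesis using hxy L1.desc_par(2)[OF z(2) x] L1.desc_par(2)[OF z(2) y] by fastforce
    next
      case False
      then obtain c d where c: "c \<in> L1.ch z" "x \<in> desc V par c" and d: "d \<in> L1.ch z" "y \<in> desc V par d"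
        using child x y by blast
      have "f x \<in> desc V' par' (g c)" "f x \<in> desc V' par' (g d)"
        using FD(1)[OF c] FD(1)[OF d] fc[OF c] fc[OF d] e by auto
      moreover have "h' (g c) = h' (g d)" using L2.ch_h[OF gc[OF c(1)]] L2.ch_h[OF gc[OF d(1)]] by simp
      ultimately have "g c = g d"
        using L2.desc_unique[OF L2.ch_notT[OF gc[OF c(1)]] L2.ch_notT[OF gc[OF d(1)]]] by blast
      then have "c = d" using g c(1) d(1) by (auto simp: bij_betw_def inj_on_def)
      moreover have "inj_on (F c) (desc V par c)" using F[OF c(1)] by (simp add: tree_iso_def bij_betw_def)
      ultimately show ?thesis using fc[OF c] fc[OF d] e c(2) d(2) by (auto simp: inj_on_def)
    qed
  qed
  have img: "f ` desc V par z = desc V' par' z'"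
  proof (intro equalityI subsetI)
    fix w assume "w \<in> f ` desc V par z"
    then obtain x where x: "x \<in> desc V par z" "w = f x" by blast
    show "w \<in> desc V' par' z'"
    proof (cases "x = z")
      case True then show ?thesis using x L2.desc_self[OF z'(1)] by (simp add: f_def)
    next
      case False
      then obtain c where c: "c \<in> L1.ch z" "x \<in> desc V par c" using child x(1) by blast
      show ?thesis using FD(1)[OF c] L2.desc_ch[OF gc[OF c(1)]] fc[OF c] x(2) by auto
    qed
  next
    fix w assume w: "w \<in> desc V' par' z'"
    show "w \<in> f ` desc V par z"
    proof (cases "w = z'")
      case True then show ?thesis using L1.desc_self[OF z(1)] by (auto simp: f_def intro!: image_eqI[of _ _ z])
    next
      case False
      from L2.desc_split[OF z'(2) w this] obtain c' where c': "c' \<in> L2.ch z'" "w \<in> desc V' par' c'" by blast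
      then obtain c where c: "c \<in> L1.ch z" "c' = g c" using g by (auto simp: bij_betw_def)
      then have "w \<in> F c ` desc V par c"
        using F[OF c(1)] c'(2) by (simp add: tree_iso_def bij_betw_def)
      then obtain x where x: "x \<in> desc V par c" "w = F c x" by blast
      have "x \<in> desc V par z" using x(1) L1.desc_ch[OF c(1)] by blast
      then show ?thesis unfolding x(2) fc[OF c(1) x(1), symmetric] by (rule imageI)
    qed
  qed
  have pf: "par' (f x) = f (par x)" if x: "x \<in> desc V par z" "x \<noteq> z" for x
  proof -
    obtain c where c: "c \<in> L1.ch z" "x \<in> desc V par c" using child x by blast
    show ?thesis
    proof (cases "x = c")
      case True
      then show ?thesis using fc[OF c] FD(4)[OF c] L2.ch_par[OF gc[OF c(1)]] L1.ch_par[OF c(1)] by (simp add: f_def)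
    next
      case False
      then have "par x \<in> desc V par c" by (rule L1.desc_par(1)[OF L1.ch_notT[OF c(1)] c(2)])
      then show ?thesis using fc[OF c] FD(3)[OF c False] fc[OF c(1)] by simp
    qed
  qed
  have "iso f z z'" unfolding tree_iso_def bij_betw_def using inj img hf pf by (auto simp: f_def)
  then show ?thesis using fc by blast
qed

lemma iso_exists:
  "z \<in> V \<Longrightarrow> z \<notin> T \<Longrightarrow> z' \<in> V' \<Longrightarrow> z' \<notin> T' \<Longrightarrow> h z = h' z' \<Longrightarrow> \<exists>f. iso f z z'"
proof (induction "h z" arbitrary: z z')
  case 0
  have "L1.ch z = {}" "L2.ch z' = {}" using 0 L1.ch_empty[of z] L2.ch_empty[of z'] by auto
  then show ?case using iso_join[OF 0(2-6), of undefined undefined] by (auto simp: bij_betw_def)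
next
  case (Suc n)
  have "card (L1.ch z) = card (L2.ch z')" using Suc by (simp add: L1.ch_card L2.ch_card)
  then obtain g where g: "bij_betw g (L1.ch z) (L2.ch z')"
    using finite_same_card_bij[OF L1.ch_finite L2.ch_finite] Suc.prems by blast
  have "\<exists>f. iso f c (g c)" if c: "c \<in> L1.ch z" for c
  proof -
    have gc: "g c \<in> L2.ch z'" using g c by (auto simp: bij_betw_def)
    show ?thesis
      using Suc.hyps(1)[of c "g c"] Suc.hyps(2) Suc.prems(5) L1.ch_h[OF c] L2.ch_h[OF gc]
        L1.ch_V[OF c] L1.ch_notT[OF c] L2.ch_V[OF gc] L2.ch_notT[OF gc] by simp
  qed
  then obtain F where "\<And>c. c \<in> L1.ch z \<Longrightarrow> iso (F c) c (g c)" by metis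
  then show ?case using iso_join[OF Suc.prems g] by blast
qed

text \<open>The children other than \<open>c\<close> and \<open>c'\<close> are equally many on both
  sides and are matched arbitrarily. Keeping \<open>f0\<close> on one branch is what allows a
  prescribed vertex to be carried along while climbing.\<close>

lemma iso_extend:
  assumes z: "z \<in> V" "z \<notin> T" and z': "z' \<in> V'" "z' \<notin> T'" and hz: "h z = h' z'"
    and c: "c \<in> L1.ch z" "c' \<in> L2.ch z'" and f0: "iso f0 c c'"
  shows "\<exists>f. iso f z z' \<and> (\<forall>x\<in>desc V par c. f x = f0 x)"
proof -
  have "0 < h z" "0 < h' z'" using L1.ch_h[OF c(1)] L2.ch_h[OF c(2)] by auto
  then have "card (L1.ch z - {c}) = card (L2.ch z' - {c'})"
    using z z' c by (simp add: L1.ch_card L2.ch_card L1.ch_finite L2.ch_finite)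
  then obtain g0 where g0: "bij_betw g0 (L1.ch z - {c}) (L2.ch z' - {c'})"
    using finite_same_card_bij[of "L1.ch z - {c}" "L2.ch z' - {c'}"] L1.ch_finite[OF z(1)] L2.ch_finite[OF z'(1)] by blast
  define g where "g = g0(c := c')"
  have "bij_betw g (insert c (L1.ch z - {c})) (insert c' (L2.ch z' - {c'}))"
  proof -
    have "bij_betw g (L1.ch z - {c}) (L2.ch z' - {c'})" using g0 by (rule bij_betw_cong[THEN iffD1, rotated]) (auto simp: g_def)
    then show ?thesis using notIn_Un_bij_betw[of c "L1.ch z - {c}" g "L2.ch z' - {c'}"] by (simp add: g_def)
  qed
  then have g: "bij_betw g (L1.ch z) (L2.ch z')" using c by (simp add: insert_absorb)
  have "\<exists>f. iso f d (g d) \<and> (d = c \<longrightarrow> f = f0)" if d: "d \<in> L1.ch z" for d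
  proof (cases "d = c")
    case True then show ?thesis using f0 by (auto simp: g_def)
  next
    case False
    have gd: "g d \<in> L2.ch z'" using g d by (auto simp: bij_betw_def)
    show ?thesis using False
        iso_exists[OF L1.ch_V[OF d] L1.ch_notT[OF d] L2.ch_V[OF gd] L2.ch_notT[OF gd]] hz L1.ch_h[OF d] L2.ch_h[OF gd] by auto
  qed
  then obtain F where F: "\<And>d. d \<in> L1.ch z \<Longrightarrow> iso (F d) d (g d)" "\<And>d. d \<in> L1.ch z \<Longrightarrow> d = c \<Longrightarrow> F d = f0" by metis
  from iso_join[OF z z' hz g F(1)] F(2)[OF c(1)] show ?thesis using c(1) by auto
qed

text \<open>\<open>iso_exists\<close> alone would not send \<open>x\<close> to \<open>x'\<close>.
  The isomorphism is therefore grown upwards from that pair, one ancestor at a time.\<close>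

lemma iso_ancestor:
  assumes x: "x \<in> V" "x' \<in> V'" "h x = h' x'"
    and q: "(par ^^ q) x \<notin> T" "(par' ^^ q) x' \<notin> T'"
  shows "\<exists>f. iso f ((par ^^ q) x) ((par' ^^ q) x') \<and> f x = x'"
  using q
proof (induction q)
  case 0
  then obtain f where "iso f x x'" using iso_exists[of x x'] x by auto
  then show ?case by (auto simp: tree_iso_def)
next
  case (Suc q)
  let ?c = "(par ^^ q) x" and ?c' = "(par' ^^ q) x'"
  have n: "?c \<notin> T" "?c' \<notin> T'" using L1.par_pow_notT[OF Suc.prems(1), of q] L2.par_pow_notT[OF Suc.prems(2), of q] by auto
  then obtain f0 where f0: "iso f0 ?c ?c'" "f0 x = x'" using Suc.IH by blast
  have V: "?c \<in> V" "?c' \<in> V'" using L1.par_pow_in[OF x(1)] L2.par_pow_in[OF x(2)] by auto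
  have c: "?c \<in> L1.ch (par ?c)" "?c' \<in> L2.ch (par' ?c')" using V n by (auto simp: L1.ch_def L2.ch_def)
  have hh: "h (par ?c) = h' (par' ?c')"
    using L1.par_pow_h[OF x(1) n(1)] L2.par_pow_h[OF x(2) n(2)] L1.par_h[OF V(1) n(1)] L2.par_h[OF V(2) n(2)] x(3) by simp
  have "x \<in> desc V par ?c" using x(1) by (auto simp: desc_def)
  then show ?case
    using iso_extend[OF L1.par_in[OF V(1) n(1)] _ L2.par_in[OF V(2) n(2)] _ hh c f0(1)] Suc.prems f0(2) by fastforce
qed

lemma iso_pow:
  assumes f: "iso f z z'" and z: "z \<notin> T" and y: "y \<in> desc V par z" and i: "h y + i \<le> h z"
  shows "f ((par ^^ i) y) = (par' ^^ i) (f y)"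
  using i
proof (induction i)
  case (Suc i)
  have d: "(par ^^ i) y \<in> desc V par z" using L1.desc_pow[OF z y, of i] Suc.prems by simp
  have "h ((par ^^ i) y) = h y + i" by (rule L1.par_pow_h[OF L1.desc_in[OF y] L1.desc_D(3)[OF z d]])
  then have "(par ^^ i) y \<noteq> z" using Suc.prems by auto
  then have "par' (f ((par ^^ i) y)) = f (par ((par ^^ i) y))" using f d by (simp add: tree_iso_def)
  then show ?case using Suc by simp
qed simp

text \<open>If the top of a subtree is itself the top of a block, no block of a descendant sticks
  out of the subtree. This is the reason for the congruence condition on heights in everything that
  follows.\<close>

lemma block_in_desc:
  assumes z: "z \<notin> T" "h z mod (m0 + 1) = m0" and y: "y \<in> desc V par z"
  shows "h y + (m0 - h y mod (m0 + 1)) \<le> h z" "L1.block m0 y \<in> desc V par z" "h (L1.block m0 y) mod (m0 + 1) = m0"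
proof -
  let ?r = "h y mod (m0 + 1)" and ?n = "m0 + 1"
  have r: "?r \<le> m0" using mod_less_divisor[of ?n "h y"] by simp
  have e: "h y + (m0 - ?r) = ?n * (h y div ?n) + m0"
    using mult_div_mod_eq[of ?n "h y"] r by linarith
  have "h y div ?n \<le> h z div ?n" using L1.desc_D(1)[OF z(1) y] by (rule div_le_mono)
  then have "?n * (h y div ?n) \<le> ?n * (h z div ?n)" by (rule mult_le_mono2)
  then show l: "h y + (m0 - ?r) \<le> h z" using e z(2) mult_div_mod_eq[of ?n "h z"] by linarith
  show b: "L1.block m0 y \<in> desc V par z" unfolding L1.block_def by (rule L1.desc_pow[OF z(1) y l])
  have "h (L1.block m0 y) = h y + (m0 - ?r)"
    unfolding L1.block_def by (rule L1.par_pow_h[OF L1.desc_in[OF y] L1.desc_D(3)[OF z(1) b[unfolded L1.block_def]]])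
  then show "h (L1.block m0 y) mod (m0 + 1) = m0" unfolding e by (simp only: mod_mult_self4) simp
qed

lemma iso_ch:
  assumes f: "iso f z z'" and z: "z \<notin> T" "z' \<notin> T'" and y: "y \<in> desc V par z"
  shows "bij_betw f (L1.ch y) (L2.ch (f y))"
proof -
  have inj: "inj_on f (desc V par z)" and img: "f ` desc V par z = desc V' par' z'"
    using f by (auto simp: tree_iso_def bij_betw_def)
  have fz: "f z = z'" and fh: "\<And>x. x \<in> desc V par z \<Longrightarrow> h' (f x) = h x"
    and fp: "\<And>x. x \<in> desc V par z \<Longrightarrow> x \<noteq> z \<Longrightarrow> par' (f x) = f (par x)" using f by (auto simp: tree_iso_def)
  have yT: "y \<in> V" "y \<notin> T" using L1.desc_in[OF y] L1.desc_D(3)[OF z(1) y] by auto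
  have chd: "L1.ch y \<subseteq> desc V par z"
  proof
    fix w assume w: "w \<in> L1.ch y"
    obtain i where "(par ^^ i) y = z" using y by (auto simp: desc_def)
    then have "(par ^^ Suc i) w = z" using L1.ch_par[OF w] by (simp add: funpow_swap1)
    then show "w \<in> desc V par z" using L1.ch_V[OF w] unfolding desc_def by blast
  qed
  have nz: "w \<noteq> z" if "w \<in> L1.ch y" for w
    using L1.ch_h[OF that] L1.desc_D(1)[OF z(1) y] by auto
  show ?thesis unfolding bij_betw_def
  proof (intro conjI equalityI subsetI)
    show "inj_on f (L1.ch y)" using inj chd by (rule inj_on_subset)
  next
    fix w' assume "w' \<in> f ` L1.ch y"
    then obtain w where w: "w \<in> L1.ch y" "w' = f w" by blast
    have wd: "w \<in> desc V par z" using chd w(1) by blast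
    have w'd: "w' \<in> desc V' par' z'" using img wd w(2) by blast
    show "w' \<in> L2.ch (f y)" unfolding L2.ch_def
      using L2.desc_in[OF w'd] L2.desc_D(3)[OF z(2) w'd] fp[OF wd nz[OF w(1)]] L1.ch_par[OF w(1)] w(2) by simp
  next
    fix w' assume w': "w' \<in> L2.ch (f y)"
    have fy: "f y \<in> desc V' par' z'" using img y by blast
    obtain i where "(par' ^^ i) (f y) = z'" using fy by (auto simp: desc_def)
    then have "(par' ^^ Suc i) w' = z'" using L2.ch_par[OF w'] by (simp add: funpow_swap1)
    then have "w' \<in> desc V' par' z'" using L2.ch_V[OF w'] unfolding desc_def by blast
    then obtain w where w: "w \<in> desc V par z" "w' = f w" using img by blast
    have "h w < h z" using L2.ch_h[OF w'] fh[OF w(1)] fh[OF y] L1.desc_D(1)[OF z(1) y] w(2) by simp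
    then have "w \<noteq> z" by auto
    then have "f (par w) = f y" using fp[OF w(1)] L2.ch_par[OF w'] w(2) by simp
    then have "par w = y" using inj L1.desc_par(1)[OF z(1) w(1) \<open>w \<noteq> z\<close>] y by (auto simp: inj_on_def)
    then have "w \<in> L1.ch y" using L1.desc_in[OF w(1)] L1.desc_D(3)[OF z(1) w(1)] by (simp add: L1.ch_def)
    then show "w' \<in> f ` L1.ch y" using w(2) by blast
  qed
qed

text \<open>The recursion for powers of the operator uses only parent, children and the variable of
  the block, all of which the isomorphism respects. The one exception is the parent of
  \<open>z\<close>, where both moments vanish.\<close>

lemma mom_iso:
  assumes f: "iso f z z'" and z: "z \<in> V" "z \<notin> T" "z' \<in> V'" "z' \<notin> T'" "h z mod (m0 + 1) = m0"
    and x: "x \<in> desc V par z"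
    and om: "\<And>j. j \<in> desc V par z \<Longrightarrow> h j mod (m0 + 1) = m0 \<Longrightarrow> om' (f j) = om j"
    and q: "h x + q \<le> h z" and y: "y \<in> desc V par z"
  shows "L2.mom m0 lam om' (f x) q (f y) = L1.mom m0 lam om x q y"
  using q y
proof (induction q arbitrary: y)
  case 0
  have "f y = f x \<longleftrightarrow> y = x" using f 0 x by (auto simp: tree_iso_def bij_betw_def inj_on_def)
  then show ?case by (simp add: L1.mom_def L2.mom_def delta_def)
next
  case (Suc q)
  note y = Suc.prems(2)
  have IH: "L2.mom m0 lam om' (f x) q (f w) = L1.mom m0 lam om x q w" if "w \<in> desc V par z" for w
    using Suc.IH that Suc.prems(1) by simp
  have fh: "\<And>x. x \<in> desc V par z \<Longrightarrow> h' (f x) = h x"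
    and fp: "\<And>x. x \<in> desc V par z \<Longrightarrow> x \<noteq> z \<Longrightarrow> par' (f x) = f (par x)" and fz: "f z = z'"
    and fd: "\<And>x. x \<in> desc V par z \<Longrightarrow> f x \<in> desc V' par' z'"
    using f by (auto simp: tree_iso_def bij_betw_def)
  have yV: "y \<in> V" "y \<notin> T" using L1.desc_in[OF y] L1.desc_D(3)[OF z(2) y] by auto
  have y'V: "f y \<in> V'" "f y \<notin> T'" using L2.desc_in[OF fd[OF y]] L2.desc_D(3)[OF z(4) fd[OF y]] by auto
  have blk: "om' (L2.block m0 (f y)) = om (L1.block m0 y)"
  proof -
    note b = block_in_desc[OF z(2,5) y]
    have "f (L1.block m0 y) = L2.block m0 (f y)"
      unfolding L1.block_def L2.block_def fh[OF y] by (rule iso_pow[OF f z(2) y b(1)])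
    then show ?thesis using om[OF b(2,3)] by simp
  qed
  \<comment> \<open>At \<open>y = z\<close> the parent lies outside the subtree, but its height
    exceeds \<open>h x + q\<close>, so \<open>mom_support\<close> makes both sides 0.\<close>
  have up: "L2.mom m0 lam om' (f x) q (par' (f y)) = L1.mom m0 lam om x q (par y)"
  proof (cases "y = z")
    case True
    have "L1.mom m0 lam om x q (par z) = 0"
      using L1.mom_support(2)[OF L1.desc_in[OF x], of m0 lam om q "par z"] L1.par_h[OF z(1,2)] Suc.prems(1) by fastforce
    moreover have "L2.mom m0 lam om' (f x) q (par' z') = 0"
      using L2.mom_support(2)[OF L2.desc_in[OF fd[OF x]], of m0 lam om' q "par' z'"] L2.par_h[OF z(3,4)]
        Suc.prems(1) fh[OF x] fh[OF L1.desc_self[OF z(1)]] fz by fastforce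
    ultimately show ?thesis using True fz by simp
  next
    case False
    then show ?thesis using IH[OF L1.desc_par(1)[OF z(2) y False]] fp[OF y False] by simp
  qed
  have down: "(\<Sum>w\<in>L2.ch (f y). L2.mom m0 lam om' (f x) q w) = (\<Sum>w\<in>L1.ch y. L1.mom m0 lam om x q w)"
  proof -
    have "(\<Sum>w\<in>L2.ch (f y). L2.mom m0 lam om' (f x) q w) = (\<Sum>w\<in>L1.ch y. L2.mom m0 lam om' (f x) q (f w))"
      by (rule sum.reindex_bij_betw[OF iso_ch[OF f z(2,4) y], symmetric])
    also have "\<dots> = (\<Sum>w\<in>L1.ch y. L1.mom m0 lam om x q w)"
    proof (rule sum.cong[OF refl])
      fix w assume w: "w \<in> L1.ch y"
      obtain i where "(par ^^ i) y = z" using y by (auto simp: desc_def)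
      then have "(par ^^ Suc i) w = z" using L1.ch_par[OF w] by (simp add: funpow_swap1)
      then have "w \<in> desc V par z" using L1.ch_V[OF w] unfolding desc_def by blast
      then show "L2.mom m0 lam om' (f x) q (f w) = L1.mom m0 lam om x q w" by (rule IH)
    qed
    finally show ?thesis .
  qed
  have nb1: "(\<Sum>w\<in>L1.nb y. L1.mom m0 lam om x q w) = L1.mom m0 lam om x q (par y) + (\<Sum>w\<in>L1.ch y. L1.mom m0 lam om x q w)"
    unfolding L1.nb_def using yV L1.ch_finite[OF yV(1)] L1.ch_h[of "par y" y] L1.par_h[OF yV] by (subst sum.union_disjoint) auto
  have nb2: "(\<Sum>w\<in>L2.nb (f y). L2.mom m0 lam om' (f x) q w) = L2.mom m0 lam om' (f x) q (par' (f y)) + (\<Sum>w\<in>L2.ch (f y). L2.mom m0 lam om' (f x) q w)"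
    unfolding L2.nb_def using y'V L2.ch_finite[OF y'V(1)] L2.ch_h[of "par' (f y)" "f y"] L2.par_h[OF y'V] by (subst sum.union_disjoint) auto
  have "L2.mom m0 lam om' (f x) (Suc q) (f y) = (\<Sum>w\<in>L2.nb (f y). L2.mom m0 lam om' (f x) q w)
      + complex_of_real (lam * om' (L2.block m0 (f y))) * L2.mom m0 lam om' (f x) q (f y)"
    using y'V by (simp add: L2.mom_def L2.hop_def gop_def)
  also have "\<dots> = (\<Sum>w\<in>L1.nb y. L1.mom m0 lam om x q w) + complex_of_real (lam * om (L1.block m0 y)) * L1.mom m0 lam om x q y"
    unfolding nb1 nb2 up down blk IH[OF y] ..
  also have "\<dots> = L1.mom m0 lam om x (Suc q) y" using yV by (simp add: L1.mom_def L1.hop_def gop_def)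
  finally show ?case .
qed

end

section \<open>The Bethe lattice and the canopy tree\<close>

lemma infsum_single_index:
  fixes f :: "'i \<Rightarrow> complex"
  assumes "i \<in> J" "\<And>j. j \<in> J \<Longrightarrow> j \<noteq> i \<Longrightarrow> f j = 0"
  shows "(\<Sum>\<^sub>\<infinity>j\<in>J. f j) = f i"
proof -
  have "(\<Sum>\<^sub>\<infinity>j\<in>J. f j) = (\<Sum>\<^sub>\<infinity>j\<in>{i}. f j)" by (rule infsum_cong_neutral) (use assms in auto)
  then show ?thesis by simp
qed

section \<open>Distances and acyclicity\<close>

locale connected_graph =
  fixes adj :: "'v \<Rightarrow> 'v \<Rightarrow> bool"
  assumes simple: "simple_graph adj" and conn: "graph_connected adj"
begin

lemma adj_sym: "adj x y \<longleftrightarrow> adj y x"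
  using simple unfolding simple_graph_def symp_def by blast

lemma adj_irrefl: "\<not> adj x x"
  using simple by (simp add: simple_graph_def irreflp_def)

lemma gdist_path: "(adj ^^ gdist adj x y) x y"
proof -
  have "\<exists>n. (adj ^^ n) x y" using conn by (simp add: graph_connected_def rtranclp_power)
  then show ?thesis unfolding gdist_def by (rule LeastI_ex)
qed

lemma gdist_le: "(adj ^^ n) x y \<Longrightarrow> gdist adj x y \<le> n"
  unfolding gdist_def by (rule Least_le)

lemma relpow_sym: "(adj ^^ n) x y \<Longrightarrow> (adj ^^ n) y x"
proof (induction n arbitrary: y)
  case 0 then show ?case by simp
next
  case (Suc n)
  then obtain w where "(adj ^^ n) x w" "adj w y" by auto
  then show ?case using Suc.IH adj_sym relpowp_Suc_I2 by metis
qed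

lemma gdist_sym: "gdist adj x y = gdist adj y x"
  using gdist_le[OF relpow_sym[OF gdist_path]] by (intro antisym) auto

lemma gdist_self [simp]: "gdist adj x x = 0"
  using gdist_le[of 0 x x] by simp

lemma gdist_eq_0: "gdist adj x y = 0 \<longleftrightarrow> x = y"
  using gdist_path[of x y] by auto

lemma gdist_adj: "adj x y \<Longrightarrow> gdist adj r y \<le> Suc (gdist adj r x)"
  using gdist_le[of "Suc (gdist adj r x)" r y] gdist_path[of r x] by auto

lemma gdist_relpow: "(adj ^^ n) x y \<Longrightarrow> gdist adj r y \<le> gdist adj r x + n"
proof (induction n arbitrary: y)
  case 0 then show ?case by simp
next
  case (Suc n)
  then obtain w where "(adj ^^ n) x w" "adj w y" by auto
  then show ?case using Suc.IH[of w] gdist_adj[of w y r] by simp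
qed

lemma gdist_triangle: "gdist adj r y \<le> gdist adj r x + gdist adj x y"
  by (rule gdist_relpow[OF gdist_path])

lemma gdist_pred:
  assumes "x \<noteq> r"
  shows "\<exists>y. adj x y \<and> Suc (gdist adj r y) = gdist adj r x"
proof -
  obtain n where n: "gdist adj r x = Suc n" using assms gdist_eq_0[of r x] by (cases "gdist adj r x") auto
  obtain w where w: "(adj ^^ n) r w" "adj w x" using gdist_path[of r x] unfolding n by auto
  have "gdist adj r w \<le> n" by (rule gdist_le[OF w(1)])
  moreover have "Suc n \<le> Suc (gdist adj r w)" using gdist_adj[OF w(2), of r] n by simp
  ultimately show ?thesis using w(2) n adj_sym by (intro exI[of _ w]) auto
qed

end

text \<open>When the new first vertex already occurs on the path, the path is cut off at that
  occurrence instead of being prolonged.\<close>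

lemma rtranclp_distinct_path:
  assumes "R\<^sup>*\<^sup>* a b"
  shows "\<exists>xs. xs \<noteq> [] \<and> hd xs = a \<and> last xs = b \<and> distinct xs \<and> successively R xs"
  using assms
proof (induction rule: converse_rtranclp_induct)
  case base
  show ?case by (intro exI[of _ "[b]"]) simp
next
  case (step a a')
  then obtain xs where xs: "xs \<noteq> []" "hd xs = a'" "last xs = b" "distinct xs" "successively R xs" by blast
  show ?case
  proof (cases "a \<in> set xs")
    case True
    then obtain ys zs where s: "xs = ys @ a # zs" by (meson split_list)
    have "successively R (a # zs)" using xs(5) unfolding s by (simp add: successively_append_iff)
    moreover have "last (a # zs) = b" using xs(3) unfolding s by simp
    moreover have "distinct (a # zs)" using xs(4) unfolding s by simp
    ultimately show ?thesis by (intro exI[of _ "a # zs"]) simp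
  next
    case False
    have "successively R (a # xs)" using xs(1,2,5) step(1) by (cases xs) simp_all
    then show ?thesis using xs(1,3,4) False by (intro exI[of _ "a # xs"]) simp
  qed
qed

locale tree_graph = connected_graph adj for adj :: "'v \<Rightarrow> 'v \<Rightarrow> bool" +
  assumes acyclic: "\<nexists>xs. graph_cycle adj xs"
begin

text \<open>A repetition-free path from \<open>a\<close> to \<open>b\<close> that avoids
  \<open>x\<close> closes through \<open>x\<close> to a cycle; it has at least two vertices because
  \<open>a\<close> and \<open>b\<close> differ, so the cycle has at least three.\<close>

lemma no_detour:
  assumes "adj x a" "adj x b" "(\<lambda>u v. adj u v \<and> u \<noteq> x \<and> v \<noteq> x)\<^sup>*\<^sup>* a b"
  shows "a = b"
proof (rule ccontr)
  assume ne: "a \<noteq> b"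
  obtain xs where xs: "xs \<noteq> []" "hd xs = a" "last xs = b" "distinct xs"
    "successively (\<lambda>u v. adj u v \<and> u \<noteq> x \<and> v \<noteq> x) xs"
    using rtranclp_distinct_path[OF assms(3)] by blast
  have len: "2 \<le> length xs"
  proof (rule ccontr)
    assume "\<not> 2 \<le> length xs"
    then obtain y where "xs = [y]" using xs(1) by (cases xs) (auto simp: not_le less_Suc_eq numeral_2_eq_2)
    then show False using xs(2,3) ne by simp
  qed
  have "x \<noteq> a" using assms(1) adj_irrefl by blast
  have av: "x \<notin> set ys" if "successively (\<lambda>u v. adj u v \<and> u \<noteq> x \<and> v \<noteq> x) ys" "ys \<noteq> []" "hd ys \<noteq> x" for ys
    using that
  proof (induction ys)
    case (Cons y ys)
    then show ?case by (cases ys) auto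
  qed simp
  have x: "x \<notin> set xs" by (rule av[OF xs(5,1)]) (use xs(2) \<open>x \<noteq> a\<close> in simp)
  have "successively adj xs" using xs(5) by (rule successively_mono) auto
  then have "successively adj (x # xs)" using assms(1) xs(1,2) by (cases xs) auto
  then have "graph_cycle adj (x # xs)"
    unfolding graph_cycle_def using len x xs assms(2) adj_sym by auto
  then show False using acyclic by blast
qed

text \<open>A vertex other than \<open>x\<close> at distance at most that of \<open>x\<close>
  reaches \<open>r\<close> by steps that decrease the distance, and these never meet
  \<open>x\<close>. Both neighbours are thus joined off \<open>x\<close>. The weak inequality also
  excludes edges within a sphere.\<close>

lemma closer_neighbour_unique:
  assumes "adj x a" "adj x b" "gdist adj r a \<le> gdist adj r x" "gdist adj r b \<le> gdist adj r x"
  shows "a = b"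
proof (cases "x = r")
  case True
  then have "gdist adj r a = 0" using assms(3) by simp
  then show ?thesis using assms(1) True adj_irrefl gdist_eq_0[of r a] by auto
next
  case False
  let ?R = "\<lambda>u v. adj u v \<and> u \<noteq> x \<and> v \<noteq> x"
  have toroot: "?R\<^sup>*\<^sup>* y r" if "gdist adj r y \<le> gdist adj r x" "y \<noteq> x" for y
    using that
  proof (induction "gdist adj r y" arbitrary: y)
    case 0 then show ?case using gdist_eq_0[of r y] by simp
  next
    case (Suc n)
    have "y \<noteq> r" using Suc.hyps(2) by auto
    then obtain w where w: "adj y w" "Suc (gdist adj r w) = gdist adj r y" using gdist_pred by blast
    then have "w \<noteq> x" using Suc.prems(1) by auto
    then have "?R\<^sup>*\<^sup>* w r" using Suc.hyps w(2) Suc.prems(1) by simp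
    moreover have "?R y w" using w(1) \<open>w \<noteq> x\<close> Suc.prems(2) by simp
    ultimately show ?case by (rule converse_rtranclp_into_rtranclp[rotated])
  qed
  have sym: "?R\<^sup>*\<^sup>* u v \<Longrightarrow> ?R\<^sup>*\<^sup>* v u" for u v
    by (rule sympD[OF symp_rtranclp]) (auto simp: symp_def adj_sym)
  have "a \<noteq> x" "b \<noteq> x" using assms(1,2) adj_irrefl by auto
  then have "?R\<^sup>*\<^sup>* a b" using toroot[OF assms(3)] sym[OF toroot[OF assms(4)]] by (auto intro: rtranclp_trans)
  then show ?thesis by (rule no_detour[OF assms(1,2)])
qed

end

section \<open>The Bethe lattice and its balls\<close>

locale bethe = tree_graph adj for adj :: "'v \<Rightarrow> 'v \<Rightarrow> bool" +
  fixes K :: nat and r :: 'v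
  assumes degree: "card {y. adj x y} = K + 1" and K2: "2 \<le> K"
begin

abbreviation d where "d \<equiv> gdist adj r"

definition par :: "'v \<Rightarrow> 'v" where
  "par x = (if x = r then r else (SOME y. adj x y \<and> Suc (d y) = d x))"

lemma par:
  assumes "x \<noteq> r"
  shows "adj x (par x)" "Suc (d (par x)) = d x"
  using someI_ex[OF gdist_pred[OF assms]] assms by (auto simp: par_def)

lemma d_eq_0: "d x = 0 \<longleftrightarrow> x = r"
  using gdist_eq_0[of r x] by auto

lemma par_eq: "adj x y \<Longrightarrow> d y \<le> d x \<Longrightarrow> x \<noteq> r \<and> y = par x"
proof -
  assume a: "adj x y" "d y \<le> d x"
  have n: "x \<noteq> r" using a adj_irrefl d_eq_0[of y] by auto
  then show ?thesis using closer_neighbour_unique[OF a(1) par(1)[OF n] a(2)] par(2)[OF n] by simp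
qed

definition C :: "'v \<Rightarrow> 'v set" where
  "C y = {x. x \<noteq> r \<and> par x = y}"

lemma C_iff: "x \<in> C y \<longleftrightarrow> adj y x \<and> d x = Suc (d y)"
proof
  assume "x \<in> C y"
  then show "adj y x \<and> d x = Suc (d y)" using par[of x] adj_sym by (auto simp: C_def)
next
  assume a: "adj y x \<and> d x = Suc (d y)"
  then show "x \<in> C y" using par_eq[of x y] adj_sym by (auto simp: C_def)
qed

lemma nbhd_finite: "finite {y. adj x y}"
  using degree[of x] by (intro card_ge_0_finite) simp

lemma C_finite: "finite (C y)"
  by (rule finite_subset[OF _ nbhd_finite[of y]]) (auto simp: C_iff)

lemma adj_cases: "adj x y \<longleftrightarrow> y \<in> C x \<or> (x \<noteq> r \<and> y = par x)"
proof
  assume a: "adj x y"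
  show "y \<in> C x \<or> (x \<noteq> r \<and> y = par x)"
  proof (cases "d y \<le> d x")
    case True then show ?thesis using par_eq[OF a] by simp
  next
    case False
    then have "d y = Suc (d x)" using gdist_adj[OF a, of r] by simp
    then show ?thesis using a by (simp add: C_iff)
  qed
qed (auto simp: C_iff par)

lemma C_card: "card (C y) = (if y = r then K + 1 else K)"
proof (cases "y = r")
  case True
  then have "{x. adj y x} = C y" using adj_cases by auto
  then show ?thesis using degree[of y] True by simp
next
  case False
  then have "{x. adj y x} = insert (par y) (C y)" using adj_cases by auto
  moreover have "par y \<notin> C y" using par(2)[OF False] by (auto simp: C_iff)
  ultimately have "Suc (card (C y)) = K + 1" using degree[of y] C_finite[of y] by simp
  then show ?thesis using False by simp
qed

definition sphere :: "nat \<Rightarrow> 'v set" where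
  "sphere j = {x. d x = j}"

lemma sphere_Suc: "sphere (Suc j) = (\<Union>y\<in>sphere j. C y)"
proof (intro equalityI subsetI)
  fix x assume "x \<in> sphere (Suc j)"
  then have x: "d x = Suc j" by (simp add: sphere_def)
  then have n: "x \<noteq> r" by auto
  then have "x \<in> C (par x)" "par x \<in> sphere j" using par(2)[OF n] x by (auto simp: C_def sphere_def)
  then show "x \<in> (\<Union>y\<in>sphere j. C y)" by blast
qed (auto simp: C_iff sphere_def)

lemma sphere_0: "sphere 0 = {r}"
  by (auto simp: sphere_def gdist_eq_0)

lemma sphere_finite: "finite (sphere j)"
  by (induction j) (simp_all add: sphere_0 sphere_Suc C_finite)

lemma sphere_card_Suc: "card (sphere (Suc j)) = (\<Sum>y\<in>sphere j. card (C y))"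
proof -
  have "C y \<inter> C y' = {}" if "y \<noteq> y'" for y y' using that by (auto simp: C_def)
  then show ?thesis unfolding sphere_Suc by (intro card_UN_disjoint) (use sphere_finite C_finite in blast)+
qed

lemma sphere_card: "card (sphere (Suc j)) = (K + 1) * K ^ j"
proof (induction j)
  case 0 then show ?case by (simp add: sphere_card_Suc sphere_0 C_card)
next
  case (Suc j)
  have "card (sphere (Suc (Suc j))) = (\<Sum>y\<in>sphere (Suc j). K)"
    unfolding sphere_card_Suc[of "Suc j"] by (rule sum.cong) (auto simp: C_card sphere_def)
  then show ?case using Suc by (simp add: mult_ac)
qed

abbreviation \<Lambda> where "\<Lambda> \<equiv> gball adj r"

lemma ball_iff: "x \<in> \<Lambda> L \<longleftrightarrow> d x \<le> L"
  by (simp add: gball_def)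

lemma ball_spheres: "\<Lambda> L = (\<Union>j\<le>L. sphere j)"
  by (auto simp: ball_iff sphere_def)

lemma ball_finite: "finite (\<Lambda> L)"
  unfolding ball_spheres by (intro finite_UN_I sphere_finite) simp

text \<open>The geometric sum \<open>((K + 1) K^L - 2) / (K - 1)\<close>, rearranged so as to avoid
  division and to keep the subtracted 2 on the other side.\<close>

lemma ball_card: "(K - 1) * card (\<Lambda> L) + 2 = (K + 1) * K ^ L"
proof (induction L)
  case 0
  have "\<Lambda> 0 = {r}" by (auto simp: ball_iff gdist_eq_0)
  then show ?case using K2 by simp
next
  case (Suc L)
  have "\<Lambda> (Suc L) = \<Lambda> L \<union> sphere (Suc L)" by (auto simp: ball_iff sphere_def)
  moreover have "\<Lambda> L \<inter> sphere (Suc L) = {}" by (auto simp: ball_iff sphere_def)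
  ultimately have "card (\<Lambda> (Suc L)) = card (\<Lambda> L) + (K + 1) * K ^ L"
    using card_Un_disjoint[OF ball_finite sphere_finite] sphere_card by simp
  then have "(K - 1) * card (\<Lambda> (Suc L)) + 2 = ((K - 1) * card (\<Lambda> L) + 2) + (K - 1) * ((K + 1) * K ^ L)"
    by (simp only: distrib_left add.commute add.left_commute)
  also have "\<dots> = (K + 1) * K ^ L + (K - 1) * ((K + 1) * K ^ L)" by (simp only: Suc)
  also have "\<dots> = (1 + (K - 1)) * ((K + 1) * K ^ L)" by (simp only: distrib_right mult_1)
  also have "1 + (K - 1) = K" using K2 by simp
  finally show ?case by (simp add: mult_ac)
qed

text \<open>Heights are counted inwards from the boundary sphere. The root is the only exceptional
  vertex: it has no parent and, unless the ball is a point, \<open>K + 1\<close> children.\<close>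

lemma layered_ball: "layered K (\<Lambda> L) (\<lambda>x. L - d x) par {r}"
proof
  show "{r} \<subseteq> \<Lambda> L" by (simp add: ball_iff)
  fix x assume x: "x \<in> \<Lambda> L"
  { assume "x \<notin> {r}"
    then have n: "x \<noteq> r" by simp
    show "par x \<in> \<Lambda> L" "L - d (par x) = Suc (L - d x)"
      using par(2)[OF n] x by (auto simp: ball_iff) }
  have sub: "{y \<in> \<Lambda> L. y \<notin> {r} \<and> par y = x} \<subseteq> C x" by (auto simp: C_def)
  then show "finite {y \<in> \<Lambda> L. y \<notin> {r} \<and> par y = x}" by (rule finite_subset[OF _ C_finite])
  have "card (C x) \<le> Suc K" by (simp add: C_card)
  with card_mono[OF C_finite sub] show "card {y \<in> \<Lambda> L. y \<notin> {r} \<and> par y = x} \<le> Suc K"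
    by (rule le_trans)
  assume "x \<notin> {r}" "0 < L - d x"
  then have "C x \<subseteq> \<Lambda> L" by (auto simp: C_iff ball_iff)
  then have "{y \<in> \<Lambda> L. y \<notin> {r} \<and> par y = x} = C x" unfolding C_def by blast
  then show "card {y \<in> \<Lambda> L. y \<notin> {r} \<and> par y = x} = K" using C_card[of x] \<open>x \<notin> {r}\<close> by simp
qed (simp add: par_def)

lemma par_pow_d: "n \<le> d x \<Longrightarrow> d ((par ^^ n) x) = d x - n \<and> (adj ^^ n) ((par ^^ n) x) x"
proof (induction n)
  case 0 then show ?case by simp
next
  case (Suc n)
  let ?y = "(par ^^ n) x"
  have IH: "d ?y = d x - n" "(adj ^^ n) ?y x" using Suc by auto
  have n: "?y \<noteq> r" using IH(1) Suc.prems by auto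
  have "(adj ^^ Suc n) (par ?y) x" using par(1)[OF n] IH(2) adj_sym relpowp_Suc_I2 by metis
  then show ?case using par(2)[OF n] IH(1) by simp
qed

lemma par_pow_unique: "(adj ^^ n) y x \<Longrightarrow> d x = d y + n \<Longrightarrow> (par ^^ n) x = y"
proof (induction n arbitrary: x)
  case 0 then show ?case by simp
next
  case (Suc n)
  then obtain w where w: "(adj ^^ n) y w" "adj w x" by auto
  have "d w = d y + n" using gdist_relpow[OF w(1), of r] gdist_adj[OF w(2), of r] Suc.prems(2) by simp
  then have "par x = w" "(par ^^ n) w = y" using par_eq[of x w] w adj_sym Suc.prems(2) Suc.IH by auto
  then show ?case by (simp add: funpow_swap1)
qed

lemma descend_iff: "d x = d y + n \<and> gdist adj y x = n \<longleftrightarrow> n \<le> d x \<and> (par ^^ n) x = y"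
proof
  assume "d x = d y + n \<and> gdist adj y x = n"
  then show "n \<le> d x \<and> (par ^^ n) x = y" using par_pow_unique[of n y x] gdist_path[of y x] by auto
next
  assume a: "n \<le> d x \<and> (par ^^ n) x = y"
  then have e: "d y = d x - n" "(adj ^^ n) y x" using par_pow_d[of n x] by auto
  then show "d x = d y + n \<and> gdist adj y x = n"
    using a gdist_le[OF e(2)] gdist_triangle[of r x y] by (intro conjI; linarith)
qed

lemma block_index:
  "x \<in> bethe_block m0 adj r y \<and> y \<in> bethe_J m0 adj r \<longleftrightarrow> y = (par ^^ (d x mod (m0 + 1))) x"
proof
  assume "x \<in> bethe_block m0 adj r y \<and> y \<in> bethe_J m0 adj r"
  then obtain k where a: "gdist adj y x \<le> m0" "d x = d y + gdist adj y x" "d y = (m0 + 1) * k"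
    by (auto simp: bethe_block_def bethe_J_def precedes_def)
  have "d x mod (m0 + 1) = gdist adj y x" unfolding a(2,3) using a(1) by (simp only: mod_mult_self4) simp
  then show "y = (par ^^ (d x mod (m0 + 1))) x" using descend_iff[of x y "gdist adj y x"] a by simp
next
  assume y: "y = (par ^^ (d x mod (m0 + 1))) x"
  have "d x mod (m0 + 1) \<le> d x" by (rule mod_less_eq_dividend)
  then have e: "d x = d y + d x mod (m0 + 1)" "gdist adj y x = d x mod (m0 + 1)"
    using descend_iff[of x y "d x mod (m0 + 1)"] y by auto
  have "d x mod (m0 + 1) \<le> m0" using mod_less_divisor[of "m0 + 1" "d x"] by simp
  moreover have "d y = (m0 + 1) * (d x div (m0 + 1))" using e(1) mult_div_mod_eq[of "m0 + 1" "d x"] by linarith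
  ultimately show "x \<in> bethe_block m0 adj r y \<and> y \<in> bethe_J m0 adj r"
    using e by (auto simp: bethe_block_def bethe_J_def precedes_def)
qed

text \<open>Here the special radii matter. Since \<open>L\<close> is congruent to \<open>m0\<close>
  modulo \<open>m0 + 1\<close>, the remainders of \<open>L - d x\<close> and \<open>d x\<close> add
  up to \<open>m0\<close>, so climbing to the block top counted from the boundary takes as many
  steps as counted from the root.\<close>

lemma ball_block:
  assumes L: "L = block_radius m0 k" and x: "x \<in> \<Lambda> L"
  shows "layered.block (\<lambda>x. L - d x) par m0 x = (par ^^ (d x mod (m0 + 1))) x"
proof -
  interpret layered K "\<Lambda> L" "\<lambda>x. L - d x" par "{r}" by (rule layered_ball)
  have dL: "d x \<le> L" using x by (simp add: ball_iff)
  have dd: "d x = (m0 + 1) * (d x div (m0 + 1)) + d x mod (m0 + 1)" by (simp only: mult_div_mod_eq)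
  have le: "d x mod (m0 + 1) \<le> m0" using mod_less_divisor[of "m0 + 1" "d x"] by simp
  have "d x div (m0 + 1) \<le> k"
  proof -
    have "(m0 + 1) * (d x div (m0 + 1)) \<le> d x" using dd by linarith
    also have "d x < (m0 + 1) * (k + 1)" using dL L by (simp add: block_radius_def algebra_simps)
    finally have "d x div (m0 + 1) < k + 1" by (simp only: mult_less_cancel1)
    then show ?thesis by simp
  qed
  then obtain j where j: "k = d x div (m0 + 1) + j" using le_Suc_ex by blast
  have "L = (m0 + 1) * (d x div (m0 + 1)) + ((m0 + 1) * j + m0)"
    unfolding L block_radius_def by (subst j) (simp add: algebra_simps)
  then have "L - d x = (m0 + 1) * j + (m0 - d x mod (m0 + 1))" using dd le by linarith
  then have "(L - d x) mod (m0 + 1) = m0 - d x mod (m0 + 1)" by (simp only: mod_mult_self4) simp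
  then show ?thesis unfolding block_def using le by simp
qed

lemma bethe_op_ball_hop:
  assumes L: "L = block_radius m0 k"
  shows "bethe_op_ball m0 adj r lam om L = layered.hop (\<Lambda> L) (\<lambda>x. L - d x) par {r} m0 lam om"
proof (intro ext)
  fix \<psi> x
  interpret layered K "\<Lambda> L" "\<lambda>x. L - d x" par "{r}" by (rule layered_ball)
  show "bethe_op_ball m0 adj r lam om L \<psi> x = hop m0 lam om \<psi> x"
  proof (cases "x \<in> \<Lambda> L")
    case False
    then show ?thesis by (simp add: bethe_op_ball_def chi_def hop_def gop_def)
  next
    case True
    have nbx: "nb x = {y. adj x y} \<inter> \<Lambda> L"
      using adj_cases[of x] par_in[OF True] by (auto simp: nb_def ch_def C_def)
    have 1: "(\<Sum>y | adj x y. chi (\<Lambda> L) \<psi> y) = (\<Sum>y\<in>nb x. \<psi> y)"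
      unfolding nbx sum.inter_restrict[OF nbhd_finite] by (simp add: chi_def)
    let ?y = "(par ^^ (d x mod (m0 + 1))) x"
    have bl: "block m0 x = ?y" by (rule ball_block[OF L True])
    have iff: "x \<in> bethe_block m0 adj r y \<and> y \<in> bethe_J m0 adj r \<longleftrightarrow> y = ?y" for y by (rule block_index)
    define F where "F = (\<lambda>y. complex_of_real (om y) * chi (bethe_block m0 adj r y) (chi (\<Lambda> L) \<psi>) x)"
    have J: "?y \<in> bethe_J m0 adj r" and xb: "x \<in> bethe_block m0 adj r ?y" using iff[of ?y] by simp_all
    have "F y = 0" if "y \<in> bethe_J m0 adj r" "y \<noteq> ?y" for y using iff[of y] that by (simp add: F_def chi_def)
    from infsum_single_index[of ?y _ F, OF J this]
    have 2: "(\<Sum>\<^sub>\<infinity>y\<in>bethe_J m0 adj r. complex_of_real (om y) * chi (bethe_block m0 adj r y) (chi (\<Lambda> L) \<psi>) x)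
      = complex_of_real (om ?y) * \<psi> x"
      using xb True by (simp add: F_def chi_def)
    have "bethe_op_ball m0 adj r lam om L \<psi> x = bethe_op m0 adj r lam om (chi (\<Lambda> L) \<psi>) x"
      unfolding bethe_op_ball_def using True by (simp add: chi_def[of _ "bethe_op m0 adj r lam om (chi (\<Lambda> L) \<psi>)"])
    also have "\<dots> = (\<Sum>y\<in>nb x. \<psi> y) + complex_of_real lam * (complex_of_real (om ?y) * \<psi> x)"
      unfolding bethe_op_def block_op_def adjacency_op_def 1 2 ..
    also have "\<dots> = hop m0 lam om \<psi> x"
      unfolding hop_def gop_def bl using True by simp
    finally show ?thesis .
  qed
qed

end

section \<open>The canopy tree\<close>

locale canopy = connected_graph adj for adj :: "'v \<Rightarrow> 'v \<Rightarrow> bool" +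
  fixes K :: nat and C :: "nat \<Rightarrow> 'v set"
  assumes ct: "canopy_tree K adj C" and K2: "2 \<le> K"
begin

lemma canopy_facts:
  shows "disjoint_family C" "(\<Union>n. C n) = UNIV" "countable (C n)"
    and "\<exists>P p. partition_on (C n) P \<and> (\<forall>S\<in>P. card S = K) \<and> bij_betw p P (C (Suc n)) \<and>
        (\<forall>S\<in>P. \<forall>x\<in>S. \<forall>y\<in>C (Suc n). adj x y \<longleftrightarrow> y = p S)"
    and "adj x y \<Longrightarrow> \<exists>n. (x \<in> C n \<and> y \<in> C (Suc n)) \<or> (y \<in> C n \<and> x \<in> C (Suc n))"
  using ct unfolding canopy_tree_def by simp_all

lemma layers_disjoint:
  assumes "x \<in> C m" "x \<in> C n"
  shows "m = n"
proof (rule ccontr)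
  assume "m \<noteq> n"
  then have "C m \<inter> C n = {}" using canopy_facts(1) by (simp add: disjoint_family_on_def)
  then show False using assms by blast
qed

lemma layers_cover: "\<exists>n. x \<in> C n"
  using canopy_facts(2) by blast

definition ht :: "'v \<Rightarrow> nat" where
  "ht x = (THE n. x \<in> C n)"

lemma ht_iff: "x \<in> C n \<longleftrightarrow> ht x = n"
proof -
  obtain m where m: "x \<in> C m" using layers_cover by blast
  then have "ht x = m" unfolding ht_def using layers_disjoint by (intro the_equality) auto
  then show ?thesis using m layers_disjoint by auto
qed

lemma countable_vertices: "countable (UNIV :: 'v set)"
proof -
  have "countable (\<Union>n. C n)" by (intro countable_UN canopy_facts(3)) simp
  then show ?thesis using canopy_facts(2) by simp
qed

lemma adj_ht: "adj x y \<Longrightarrow> ht y = Suc (ht x) \<or> ht x = Suc (ht y)"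
  using canopy_facts(5)[of x y] unfolding ht_iff by auto

lemma layer_structure:
  "\<exists>P p. partition_on (C n) P \<and> (\<forall>S\<in>P. card S = K) \<and> bij_betw p P (C (Suc n)) \<and>
    (\<forall>S\<in>P. \<forall>x\<in>S. \<forall>y. ht y = Suc n \<longrightarrow> (adj x y \<longleftrightarrow> y = p S))"
  using canopy_facts(4)[of n] unfolding Ball_def[of "C (Suc n)"] ht_iff .

lemma parent_unique: "\<exists>!y. adj x y \<and> ht y = Suc (ht x)"
proof -
  obtain P p where P: "partition_on (C (ht x)) P" "\<forall>S\<in>P. card S = K" "bij_betw p P (C (Suc (ht x)))"
    "\<forall>S\<in>P. \<forall>x'\<in>S. \<forall>y. ht y = Suc (ht x) \<longrightarrow> (adj x' y \<longleftrightarrow> y = p S)"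
    using layer_structure[of "ht x"] by blast
  obtain S where S: "S \<in> P" "x \<in> S" using P(1) ht_iff[of x "ht x"] unfolding partition_on_def by blast
  have "p S \<in> C (Suc (ht x))" using P(3) S(1) by (auto simp: bij_betw_def)
  then have "ht (p S) = Suc (ht x)" by (simp add: ht_iff)
  moreover have "adj x y \<longleftrightarrow> y = p S" if "ht y = Suc (ht x)" for y using P(4) S that by simp
  ultimately show ?thesis by (intro ex1I[of _ "p S"]) auto
qed

definition par :: "'v \<Rightarrow> 'v" where
  "par x = (THE y. adj x y \<and> ht y = Suc (ht x))"

lemma par: "adj x (par x)" "ht (par x) = Suc (ht x)"
  using theI'[OF parent_unique[of x]] by (auto simp: par_def)

lemma par_eq: "adj x y \<Longrightarrow> ht y = Suc (ht x) \<Longrightarrow> y = par x"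
  using parent_unique[of x] par[of x] by blast

lemma children_iff: "par x = y \<longleftrightarrow> adj x y \<and> ht y = Suc (ht x)"
  using par par_eq by blast

lemma children: "ht y = Suc n \<Longrightarrow> card {x. par x = y} = K"
proof -
  assume y: "ht y = Suc n"
  obtain P p where P: "partition_on (C n) P" "\<forall>S\<in>P. card S = K" "bij_betw p P (C (Suc n))"
    "\<forall>S\<in>P. \<forall>x\<in>S. \<forall>y. ht y = Suc n \<longrightarrow> (adj x y \<longleftrightarrow> y = p S)"
    using layer_structure[of n] by blast
  have "y \<in> p ` P" using P(3) y by (simp add: bij_betw_def ht_iff)
  then obtain S where S: "S \<in> P" "p S = y" by blast
  have "{x. par x = y} = S"
  proof (intro equalityI subsetI)
    fix x assume "x \<in> {x. par x = y}"
    then have x: "adj x y" "ht x = n" using children_iff y by auto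
    then obtain S' where S': "S' \<in> P" "x \<in> S'" using P(1) ht_iff[of x n] unfolding partition_on_def by auto
    have "y = p S'" using P(4) S' y x(1) by simp
    then have "S' = S" using P(3) S S'(1) by (auto simp: bij_betw_def inj_on_def)
    then show "x \<in> S" using S' by simp
  next
    fix x assume x: "x \<in> S"
    have "x \<in> C n" using P(1) S(1) x unfolding partition_on_def by blast
    then have "ht x = n" by (simp add: ht_iff)
    then show "x \<in> {x. par x = y}" using P(4) S x y children_iff by auto
  qed
  then show ?thesis using P(2) S(1) by simp
qed

lemma children_finite_card: "finite {x. par x = y}" "card {x. par x = y} \<le> K"
proof -
  have "finite {x. par x = y} \<and> card {x. par x = y} \<le> K"
  proof (cases "ht y")
    case 0
    then have "{x. par x = y} = {}" using children_iff by auto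
    then show ?thesis by simp
  next
    case (Suc n)
    then show ?thesis using children[OF Suc] K2 card_ge_0_finite[of "{x. par x = y}"] by simp
  qed
  then show "finite {x. par x = y}" "card {x. par x = y} \<le> K" by auto
qed

text \<open>The tree continues upwards forever, so every vertex has a parent and the set of
  exceptional vertices is empty.\<close>

sublocale layered K UNIV ht par "{}"
proof
  show "card {x \<in> UNIV. x \<notin> {} \<and> par x = y} = K" if "0 < ht y" for y
    using children[of y "ht y - 1"] that by simp
qed (use children_finite_card par in \<open>auto intro: le_SucI\<close>)

lemma nb_adj: "nb x = {y. adj x y}"
  unfolding nb_def ch_def using adj_ht[of x] par[of x] adj_sym children_iff
  by (auto dest: par_eq)

lemma relpow_ht: "(adj ^^ n) x y \<Longrightarrow> ht y \<le> ht x + n"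
proof (induction n arbitrary: y)
  case (Suc n)
  then obtain w where "(adj ^^ n) x w" "adj w y" by auto
  then show ?case using Suc.IH[of w] adj_ht[of w y] by auto
qed simp

lemma gdist_ht: "ht y \<le> ht x + gdist adj x y"
  by (rule relpow_ht[OF gdist_path])

lemma descend: "\<exists>b. ht b = 0 \<and> (adj ^^ ht x) b x"
proof (induction "ht x" arbitrary: x)
  case 0 then show ?case by (intro exI[of _ x]) auto
next
  case (Suc n)
  have "card {w. par w = x} = K" using children[of x n] Suc.hyps(2) by simp
  then obtain w where "par w = x" using K2 by (metis (mono_tags, lifting) Collect_empty_eq card.empty not_numeral_le_zero)
  then have w: "adj w x" "ht x = Suc (ht w)" using children_iff by auto
  then obtain b where "ht b = 0" "(adj ^^ ht w) b w" using Suc.hyps by auto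
  then show ?case using w by (intro exI[of _ b]) auto
qed

text \<open>An edge changes the layer by one, which bounds the distance from below; every vertex
  above the boundary has a child, and descending attains the bound.\<close>

lemma gdist_set_ht: "gdist_set adj (C 0) x = ht x"
proof -
  obtain b where b: "ht b = 0" "(adj ^^ ht x) b x" using descend by blast
  have "(INF b\<in>C 0. gdist adj b x) \<le> gdist adj b x"
    by (rule cINF_lower) (use b ht_iff in auto)
  also have "\<dots> \<le> ht x" by (rule gdist_le[OF b(2)])
  finally have 1: "gdist_set adj (C 0) x \<le> ht x" by (simp add: gdist_set_def)
  have "ht x \<le> (INF b\<in>C 0. gdist adj b x)"
  proof (rule cINF_greatest)
    show "C 0 \<noteq> {}" using b(1) ht_iff by blast
    fix b assume "b \<in> C 0"
    then show "ht x \<le> gdist adj b x" using gdist_ht[of x b] ht_iff by simp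
  qed
  then show ?thesis using 1 by (simp add: gdist_set_def)
qed

lemma par_pow_relpow: "(adj ^^ n) x ((par ^^ n) x)"
  by (induction n) (auto intro: par)

lemma par_pow_ht: "ht ((par ^^ n) x) = ht x + n"
  by (induction n) (auto simp: par)

lemma par_pow_unique: "(adj ^^ n) x y \<Longrightarrow> ht y = ht x + n \<Longrightarrow> (par ^^ n) x = y"
proof (induction n arbitrary: y)
  case (Suc n)
  then obtain w where w: "(adj ^^ n) x w" "adj w y" by auto
  have "ht w = ht x + n" using relpow_ht[OF w(1)] adj_ht[OF w(2)] Suc.prems(2) by auto
  then show ?case using Suc.IH[OF w(1)] par_eq[OF w(2)] Suc.prems(2) by simp
qed simp

lemma ascend_iff: "ht y = ht x + n \<and> gdist adj x y = n \<longleftrightarrow> (par ^^ n) x = y"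
proof
  assume "ht y = ht x + n \<and> gdist adj x y = n"
  then show "(par ^^ n) x = y" using par_pow_unique[of n x y] gdist_path[of x y] by auto
next
  assume a: "(par ^^ n) x = y"
  then show "ht y = ht x + n \<and> gdist adj x y = n"
    using gdist_le[OF par_pow_relpow[of n x]] gdist_ht[of y x] par_pow_ht[of n x] by auto
qed

lemma canopy_J_iff: "y \<in> canopy_J m0 adj (C 0) \<longleftrightarrow> ht y mod (m0 + 1) = m0"
proof
  assume "y \<in> canopy_J m0 adj (C 0)"
  then obtain k where "ht y = (m0 + 1) * k + m0" by (auto simp: canopy_J_def gdist_set_ht add.commute)
  then show "ht y mod (m0 + 1) = m0" by (simp only: mod_mult_self4) simp
next
  assume a: "ht y mod (m0 + 1) = m0"
  have "ht y = m0 + (m0 + 1) * (ht y div (m0 + 1))" using mult_div_mod_eq[of "m0 + 1" "ht y"] a by linarith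
  then show "y \<in> canopy_J m0 adj (C 0)" unfolding canopy_J_def gdist_set_ht by blast
qed

lemma block_index:
  "x \<in> canopy_block m0 adj (C 0) y \<and> y \<in> canopy_J m0 adj (C 0) \<longleftrightarrow> y = block m0 x"
proof
  assume "x \<in> canopy_block m0 adj (C 0) y \<and> y \<in> canopy_J m0 adj (C 0)"
  then have a: "gdist adj x y \<le> m0" "ht y = ht x + gdist adj x y" "ht y mod (m0 + 1) = m0"
    by (auto simp: canopy_block_def gdist_set_ht canopy_J_iff gdist_sym[of y x])
  have "ht y = (m0 + 1) * (ht y div (m0 + 1)) + m0" using a(3) mult_div_mod_eq[of "m0 + 1" "ht y"] by linarith
  then have "ht x = (m0 + 1) * (ht y div (m0 + 1)) + (m0 - gdist adj x y)" using a(1,2) by linarith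
  then have "ht x mod (m0 + 1) = (m0 - gdist adj x y) mod (m0 + 1)" by (metis mod_mult_self4)
  then have "m0 - ht x mod (m0 + 1) = gdist adj x y" using a(1) by simp
  then show "y = block m0 x" using ascend_iff[of y x "gdist adj x y"] a by (simp add: block_def)
next
  assume y: "y = block m0 x"
  let ?n = "m0 - ht x mod (m0 + 1)"
  have e: "ht y = ht x + ?n" "gdist adj x y = ?n" using ascend_iff[of y x ?n] y by (auto simp: block_def)
  have le: "ht x mod (m0 + 1) \<le> m0" using mod_less_divisor[of "m0 + 1" "ht x"] by simp
  have "ht y = (m0 + 1) * (ht x div (m0 + 1)) + m0" using e(1) le mult_div_mod_eq[of "m0 + 1" "ht x"] by linarith
  then have "ht y mod (m0 + 1) = m0" by (simp only: mod_mult_self4) simp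
  then show "x \<in> canopy_block m0 adj (C 0) y \<and> y \<in> canopy_J m0 adj (C 0)"
    using e by (auto simp: canopy_block_def gdist_set_ht canopy_J_iff gdist_sym[of y x])
qed

lemma canopy_op_hop: "canopy_op m0 adj (C 0) lam om = hop m0 lam om"
proof (intro ext)
  fix \<psi> x
  have iff: "x \<in> canopy_block m0 adj (C 0) y \<and> y \<in> canopy_J m0 adj (C 0) \<longleftrightarrow> y = block m0 x" for y by (rule block_index)
  define F where "F = (\<lambda>y. complex_of_real (om y) * chi (canopy_block m0 adj (C 0) y) \<psi> x)"
  have J: "block m0 x \<in> canopy_J m0 adj (C 0)" and xb: "x \<in> canopy_block m0 adj (C 0) (block m0 x)"
    using iff[of "block m0 x"] by simp_all
  have "F y = 0" if "y \<in> canopy_J m0 adj (C 0)" "y \<noteq> block m0 x" for y using iff[of y] that by (simp add: F_def chi_def)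
  from infsum_single_index[of "block m0 x" _ F, OF J this]
  have 2: "(\<Sum>\<^sub>\<infinity>y\<in>canopy_J m0 adj (C 0). complex_of_real (om y) * chi (canopy_block m0 adj (C 0) y) \<psi> x)
      = complex_of_real (om (block m0 x)) * \<psi> x"
    using xb by (simp add: F_def chi_def)
  show "canopy_op m0 adj (C 0) lam om \<psi> x = hop m0 lam om \<psi> x"
    unfolding canopy_op_def block_op_def adjacency_op_def hop_def gop_def nb_adj 2 by simp
qed

end

section \<open>Spectral averaging\<close>

text \<open>By a primitive, the integral over [-R, R] equals the one over the lower half circle.
  There the hypothesis degenerates at the end points, and the weight compensates: on the circle
  \<open>R^2 - t^2\<close> has modulus \<open>2 R \<bar>Im t\<bar>\<close>. The integrand is then at
  most \<open>2 R^2 C\<close> with respect to the angle, which runs over length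
  \<open>pi\<close>.\<close>

lemma half_disc_weighted_integral:
  fixes f :: "complex \<Rightarrow> complex"
  assumes hol: "f holomorphic_on UNIV" and R: "0 < R"
    and bound: "\<And>t. cmod t = R \<Longrightarrow> Im t \<le> 0 \<Longrightarrow> \<bar>Im t\<bar> * cmod (f t) \<le> C"
  shows "cmod (\<integral>s. indicator {-R..R} s *\<^sub>R (f (of_real s) * of_real (R\<^sup>2 - s\<^sup>2)) \<partial>lborel) \<le> 2 * pi * R\<^sup>2 * C"
proof -
  define g where "g t = f t * (of_real (R\<^sup>2) - t\<^sup>2)" for t
  have gh: "g holomorphic_on UNIV" unfolding g_def by (intro holomorphic_intros hol)
  obtain F where F: "\<And>t. (F has_field_derivative g t) (at t)"
    using holomorphic_convex_primitive'[OF convex_UNIV open_UNIV gh] by auto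
  have "(\<integral>s. indicator {-R..R} s *\<^sub>R g (of_real s) \<partial>lborel) = F (of_real R) - F (of_real (-R))"
  proof (rule integral_FTC_Icc)
    show "-R \<le> R" using R by simp
    show "((\<lambda>s. F (of_real s)) has_vector_derivative g (of_real s)) (at s within {-R..R})" for s
      by (rule has_vector_derivative_real_field[OF F])
    have "continuous_on UNIV g" using gh by (rule holomorphic_on_imp_continuous_on)
    then have "continuous_on {-R..R} (g \<circ> of_real)"
      by (intro continuous_on_compose continuous_on_of_real continuous_on_id) (auto intro: continuous_on_subset)
    then show "continuous_on {-R..R} (\<lambda>s. g (of_real s))" by (simp add: comp_def)
  qed
  moreover have "cmod (F (of_real R) - F (of_real (-R))) \<le> 2 * R\<^sup>2 * C * pi"
  proof -
    define \<gamma> where "\<gamma> \<theta> = of_real R * exp (- \<i> * of_real \<theta>)" for \<theta> :: real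
    define \<gamma>' where "\<gamma>' \<theta> = of_real R * (- \<i> * exp (- \<i> * of_real \<theta>))" for \<theta> :: real
    have d\<gamma>: "(\<gamma> has_vector_derivative \<gamma>' \<theta>) (at \<theta> within A)" for \<theta> A
    proof -
      have "((\<lambda>w. of_real R * exp (- \<i> * w)) has_field_derivative of_real R * (- \<i> * exp (- \<i> * of_real \<theta>))) (at (of_real \<theta>))"
        by (auto intro!: derivative_eq_intros)
      from has_vector_derivative_real_field[OF this] show ?thesis unfolding \<gamma>_def \<gamma>'_def .
    qed
    have dF: "((\<lambda>\<theta>. F (\<gamma> \<theta>)) has_derivative (\<lambda>h. h *\<^sub>R (\<gamma>' \<theta> * g (\<gamma> \<theta>)))) (at \<theta> within {0..pi})" for \<theta>
      using field_vector_diff_chain_within[OF d\<gamma> has_field_derivative_at_within[OF F]]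
      unfolding has_vector_derivative_def comp_def .
    have nb: "cmod (\<gamma>' \<theta> * g (\<gamma> \<theta>)) \<le> 2 * R\<^sup>2 * C" if \<theta>: "\<theta> \<in> {0..pi}" for \<theta>
    proof -
      have e: "exp (- \<i> * of_real \<theta>) = cis (- \<theta>)" by (simp add: cis_conv_exp)
      have \<gamma>c: "\<gamma> \<theta> = of_real R * cis (- \<theta>)" unfolding \<gamma>_def e ..
      have s: "0 \<le> sin \<theta>" using \<theta> by (intro sin_ge_zero) auto
      have im: "Im (\<gamma> \<theta>) = - (R * sin \<theta>)" unfolding \<gamma>c by simp
      have n: "cmod (\<gamma> \<theta>) = R" unfolding \<gamma>c using R by (simp add: norm_mult)
      have n': "cmod (\<gamma>' \<theta>) = R" unfolding \<gamma>'_def e using R by (simp add: norm_mult)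
      have "of_real (R\<^sup>2) - (\<gamma> \<theta>)\<^sup>2 = of_real (R\<^sup>2) * (cis (-\<theta>) * (2 * \<i> * of_real (sin \<theta>)))"
      proof -
        have "cis (- \<theta>) * (2 * \<i> * of_real (sin \<theta>)) = 1 - (cis (-\<theta>))\<^sup>2"
          unfolding power2_eq_square
          by (simp add: complex_eq_iff) (metis (no_types, opaque_lifting) add.commute add_diff_cancel_right' diff_add_eq mult_2 power2_eq_square sin_cos_squared_add3)
        moreover have "of_real (R\<^sup>2) - (of_real R)\<^sup>2 * (cis (-\<theta>))\<^sup>2 = of_real (R\<^sup>2) * (1 - (cis (-\<theta>))\<^sup>2)"
          by (simp add: algebra_simps)
        ultimately show ?thesis unfolding \<gamma>c power_mult_distrib by simp
      qed
      then have w: "cmod (of_real (R\<^sup>2) - (\<gamma> \<theta>)\<^sup>2) = R\<^sup>2 * (2 * sin \<theta>)"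
        using s by (simp add: norm_mult norm_power del: of_real_power)
      have "cmod (\<gamma>' \<theta> * g (\<gamma> \<theta>)) = R * (cmod (f (\<gamma> \<theta>)) * (R\<^sup>2 * (2 * sin \<theta>)))"
        unfolding g_def norm_mult n' w ..
      also have "\<dots> = 2 * R\<^sup>2 * (\<bar>Im (\<gamma> \<theta>)\<bar> * cmod (f (\<gamma> \<theta>)))"
        unfolding im using s R by (simp add: abs_mult)
      also have "\<dots> \<le> 2 * R\<^sup>2 * C"
        using bound[OF n] im s R by (intro mult_left_mono) auto
      finally show ?thesis .
    qed
    have "norm (F (\<gamma> 0) - F (\<gamma> pi)) \<le> 2 * R\<^sup>2 * C * norm (0 - pi)"
    proof (rule differentiable_bound[OF convex_real_interval(5) dF])
      fix \<theta> assume \<theta>: "\<theta> \<in> {0..pi}"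
      show "onorm (\<lambda>h. h *\<^sub>R (\<gamma>' \<theta> * g (\<gamma> \<theta>))) \<le> 2 * R\<^sup>2 * C"
      proof (rule onorm_le)
        fix h :: real
        have "norm (h *\<^sub>R (\<gamma>' \<theta> * g (\<gamma> \<theta>))) = \<bar>h\<bar> * cmod (\<gamma>' \<theta> * g (\<gamma> \<theta>))" by simp
        also have "\<dots> \<le> \<bar>h\<bar> * (2 * R\<^sup>2 * C)" using nb[OF \<theta>] by (intro mult_left_mono) auto
        finally show "norm (h *\<^sub>R (\<gamma>' \<theta> * g (\<gamma> \<theta>))) \<le> 2 * R\<^sup>2 * C * norm h" by (simp add: mult.commute)
      qed
    qed auto
    moreover have "\<gamma> 0 = of_real R" by (simp add: \<gamma>_def)
    moreover have "\<gamma> pi = of_real (-R)"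
    proof -
      have "exp (- \<i> * of_real pi) = cis (- pi)" by (simp add: cis_conv_exp)
      then show ?thesis unfolding \<gamma>_def by (simp add: complex_eq_iff)
    qed
    ultimately show ?thesis by simp
  qed
  ultimately show ?thesis by (simp add: g_def mult_ac)
qed

lemma supported_integrable_complex:
  fixes f :: "real \<Rightarrow> complex"
  assumes s: "supported c \<mu>" and f: "continuous_on UNIV f"
  shows "integrable \<mu> f"
proof -
  interpret finite_measure \<mu> using supportedD(1)[OF s] .
  have "compact (f ` {-c..c})"
    using f by (intro compact_continuous_image) (auto intro: continuous_on_subset)
  then obtain B where B: "\<forall>y \<in> f ` {-c..c}. norm y \<le> B"
    using bounded_iff compact_imp_bounded by blast
  show ?thesis
  proof (rule integrable_const_bound[where B=B])
    show "AE x in \<mu>. norm (f x) \<le> B"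
      using supportedD(3)[OF s] by eventually_elim (use B in \<open>auto simp: abs_le_iff\<close>)
    show "f \<in> borel_measurable \<mu>" using borel_measurable_continuous_onI[OF f] supported_measurable[OF s] by blast
  qed
qed

context bounded_sa
begin

text \<open>\<open>poly_op\<close> has real coefficients, so complex powers of an affine function of
  \<open>A\<close> are reached by recursion. The extra polynomial \<open>p\<close> makes the
  induction work: symmetry moves \<open>A\<close> to the left, where it is absorbed as
  \<open>pCons 0 p\<close>.\<close>

lemma geometric_moment:
  assumes \<psi>: "\<psi> \<in> ell2 U" and a0: "a 0 = \<psi>"
    and a: "\<And>k. a (Suc k) = (\<lambda>x. \<alpha> * a k x + \<beta> * A (a k) x)"
  shows "ell2_inner (poly_op p \<psi>) (a k) = (\<integral>u. of_real (poly p u) * (\<alpha> + \<beta> * of_real u) ^ k \<partial>vec_measure \<psi>)"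
proof -
  have aU: "a k \<in> ell2 U" for k
    by (induction k) (auto simp: a0 a \<psi> intro!: add_ell2 scale_ell2 A_in)
  note s = vec_measure(1)[OF \<psi>]
  show ?thesis
  proof (induction k arbitrary: p)
    case 0
    have "ell2_inner (poly_op p \<psi>) \<psi> = complex_of_real (Re (ell2_inner \<psi> (poly_op p \<psi>)))"
      using poly_op_sym[OF \<psi> \<psi>, of p] inner_cnj[of \<psi> "poly_op p \<psi>"] by (metis complex_is_Real_iff of_real_Re Reals_cnj_iff)
    then show ?case by (simp add: a0 vec_measure(2)[OF \<psi>, symmetric])
  next
    case (Suc k)
    have i: "integrable (vec_measure \<psi>) (\<lambda>u. of_real (poly p u) * (\<alpha> + \<beta> * of_real u) ^ k)" for p
      by (rule supported_integrable_complex[OF s]) (intro continuous_intros)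
    have "ell2_inner (poly_op p \<psi>) (a (Suc k)) = \<alpha> * ell2_inner (poly_op p \<psi>) (a k) + \<beta> * ell2_inner (poly_op p \<psi>) (A (a k))"
      unfolding a using inner_U_add_right[OF poly_op_in[OF \<psi>] scale_ell2[OF aU] scale_ell2[OF A_in[OF aU]]]
      by (simp add: inner_scale_right)
    also have "ell2_inner (poly_op p \<psi>) (A (a k)) = ell2_inner (poly_op (pCons 0 p) \<psi>) (a k)"
      using A_sym[OF poly_op_in[OF \<psi>] aU] by (simp add: poly_op_pCons)
    also have "\<alpha> * ell2_inner (poly_op p \<psi>) (a k) + \<beta> * ell2_inner (poly_op (pCons 0 p) \<psi>) (a k)
       = (\<integral>u. \<alpha> * (of_real (poly p u) * (\<alpha> + \<beta> * of_real u) ^ k) + \<beta> * (of_real (poly (pCons 0 p) u) * (\<alpha> + \<beta> * of_real u) ^ k) \<partial>vec_measure \<psi>)"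
      unfolding Suc.IH using i[of p] i[of "pCons 0 p"] by (simp del: poly_pCons)
    also have "\<dots> = (\<integral>u. of_real (poly p u) * (\<alpha> + \<beta> * of_real u) ^ Suc k \<partial>vec_measure \<psi>)"
      by (rule Bochner_Integration.integral_cong) (auto simp: algebra_simps)
    finally show ?case .
  qed
qed

end

text \<open>The imaginary part of \<open>1 / (u - e - i \<epsilon>)\<close>, without the usual
  factor \<open>1 / pi\<close>.\<close>

definition poisson :: "real \<Rightarrow> real \<Rightarrow> real \<Rightarrow> real" where
  "poisson e \<epsilon> u = \<epsilon> / ((u - e)\<^sup>2 + \<epsilon>\<^sup>2)"

lemma poisson_nonneg: "0 < \<epsilon> \<Longrightarrow> 0 \<le> poisson e \<epsilon> u"
  by (simp add: poisson_def)

lemma poisson_continuous: "0 < \<epsilon> \<Longrightarrow> continuous_on A (poisson e \<epsilon>)"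
proof -
  assume "0 < \<epsilon>"
  then have "(u - e)\<^sup>2 + \<epsilon>\<^sup>2 \<noteq> 0" for u by (smt (verit) zero_le_power2 zero_less_power)
  then show ?thesis unfolding poisson_def by (intro continuous_intros) auto
qed

section \<open>Resolvents with complex coupling and the averaging bound\<close>

context bounded_graph
begin

definition block_potential :: "('v \<Rightarrow> real) \<Rightarrow> real \<Rightarrow> 'v set \<Rightarrow> real \<Rightarrow> 'v \<Rightarrow> real" where
  "block_potential v lam W t y = v y + (if y \<in> W then t * lam else 0)"

text \<open>
  The resolvent at \<open>e + i\<epsilon>\<close> of the operator with complex coupling \<open>t\<close> on the block \<open>W\<close>, written as
  a Neumann series. Its partial sums are polynomials in \<open>t\<close>. In the lower half plane the
  imaginary part of \<open>t\<close> adds to the absorption \<open>\<epsilon>\<close>, which bounds the diagonal matrix element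
  by \<open>1 / (lam \<bar>Im t\<bar>)\<close>.
\<close>

lemma neumann_step:
  fixes v :: "'v \<Rightarrow> real" and t z :: complex and W :: "'v set"
  assumes v: "\<forall>y\<in>V. \<bar>v y\<bar> \<le> b" and b: "0 \<le> b" and lam: "0 < lam"
    and t: "cmod t \<le> R" "Im t \<le> 0" and z: "0 < Im z" and M: "real D + b + R * lam + cmod z \<le> M"
  defines "G \<equiv> gop V N (\<lambda>y. of_real (v y) + (if y \<in> W then t * of_real lam else 0) - z)"
  assumes \<psi>: "\<psi> \<in> ell2 V"
  shows "G \<psi> \<in> ell2 V" "ell2_norm (G \<psi>) \<le> M * ell2_norm \<psi>"
    "Re (ell2_inner \<psi> (\<lambda>y. \<i> * G \<psi> y)) = \<bar>Im t\<bar> * lam * (ell2_norm (chi W \<psi>))\<^sup>2 + Im z * (ell2_norm \<psi>)\<^sup>2"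
    "chi W \<psi> \<in> ell2 V"
proof -
  have R0: "0 \<le> R" using t(1) norm_ge_zero order_trans by blast
  have bd: "cmod (of_real (v y) + (if y \<in> W then t * of_real lam else 0) - z) \<le> b + R * lam + cmod z" if "y \<in> V" for y
  proof -
    have "cmod (if y \<in> W then t * of_real lam else 0) \<le> R * lam"
      using t lam R0 by (auto simp: norm_mult intro: mult_right_mono)
    then show ?thesis
      using bspec[OF v that] norm_triangle_ineq4[of "of_real (v y) + (if y \<in> W then t * of_real lam else 0)" z]
        norm_triangle_ineq[of "of_real (v y)" "if y \<in> W then t * of_real lam else 0"] by simp
  qed
  have b0: "0 \<le> b + R * lam + cmod z" using b R0 lam by simp
  show GU: "G \<psi> \<in> ell2 V" unfolding G_def by (rule gop_ell2(1)[OF \<psi> _ b0]) (rule bd)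
  have "ell2_norm (G \<psi>) \<le> (real D + (b + R * lam + cmod z)) * ell2_norm \<psi>"
    unfolding G_def by (rule gop_ell2(2)[OF \<psi> _ b0]) (rule bd)
  also have "\<dots> \<le> M * ell2_norm \<psi>" using M by (intro mult_right_mono) auto
  finally show "ell2_norm (G \<psi>) \<le> M * ell2_norm \<psi>" .
  have c: "(\<lambda>y. if y \<in> V then (if y \<in> W then 1 else 0) * \<psi> y else 0) \<in> ell2 V"
    by (rule potential_ell2(1)[OF \<psi>, where b=1]) auto
  have "chi W \<psi> = (\<lambda>y. if y \<in> V then (if y \<in> W then 1 else 0) * \<psi> y else 0)"
    using ell2_outside[OF \<psi>] by (auto simp: chi_def)
  then show ch: "chi W \<psi> \<in> ell2 V" using c by simp
  let ?A = "gop V N (\<lambda>y. of_real (v y))"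
  interpret A: bounded_sa V ?A "real D + b + 1"
    by (rule gop_bounded_sa[where b=b]) (use v b in auto)
  have split: "G \<psi> = (\<lambda>y. ?A \<psi> y + ((t * of_real lam) * chi W \<psi> y + (- z) * \<psi> y))"
    using ell2_outside[OF \<psi>] by (auto simp: G_def gop_def chi_def algebra_simps)
  have e: "ell2_inner \<psi> (G \<psi>) = ell2_inner \<psi> (?A \<psi>) + ((t * of_real lam) * ell2_inner \<psi> (chi W \<psi>) + (- z) * ell2_inner \<psi> \<psi>)"
    unfolding split A.inner_U_add_right[OF \<psi> A.A_in[OF \<psi>] add_ell2[OF scale_ell2[OF ch] scale_ell2[OF \<psi>]]]
      A.inner_U_add_right[OF \<psi> scale_ell2[OF ch] scale_ell2[OF \<psi>]] inner_scale_right ..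
  have cc: "ell2_inner \<psi> (chi W \<psi>) = of_real ((ell2_norm (chi W \<psi>))\<^sup>2)"
    unfolding inner_self[symmetric] ell2_inner_def by (rule infsum_cong) (simp add: chi_def)
  \<comment> \<open>Multiplication by \<open>\<i>\<close> turns minus the imaginary part of the form
    into a real part. As \<open>Im t <= 0\<close> and \<open>Im z > 0\<close>, both contributions
    are nonnegative, so \<open>\<i> G\<close> is accretive.\<close>
  have "Re (ell2_inner \<psi> (\<lambda>y. \<i> * G \<psi> y)) = - Im (ell2_inner \<psi> (G \<psi>))"
    unfolding inner_scale_right by simp
  also have "\<dots> = - (Im t * lam * (ell2_norm (chi W \<psi>))\<^sup>2 - Im z * (ell2_norm \<psi>)\<^sup>2)"
    unfolding e cc inner_self by (simp add: A.quadratic_real[OF \<psi>])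
  finally show "Re (ell2_inner \<psi> (\<lambda>y. \<i> * G \<psi> y)) = \<bar>Im t\<bar> * lam * (ell2_norm (chi W \<psi>))\<^sup>2 + Im z * (ell2_norm \<psi>)\<^sup>2"
    using t(2) by simp
qed

text \<open>The iteration matrix \<open>1 - \<tau> \<i> G\<close>. Once it is a contraction,
  \<open>\<tau>\<close> times the sum of its powers inverts \<open>\<i> G\<close>.\<close>

definition neumann :: "('v \<Rightarrow> real) \<Rightarrow> real \<Rightarrow> 'v set \<Rightarrow> complex \<Rightarrow> real \<Rightarrow> complex \<Rightarrow> 'v operator" where
  "neumann v lam W z \<tau> t \<psi> =
     (\<lambda>y. \<psi> y - of_real \<tau> * (\<i> * gop V N (\<lambda>y. of_real (v y) + (if y \<in> W then t * of_real lam else 0) - z) \<psi> y))"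

lemma neumann_holomorphic:
  "(\<lambda>t. (neumann v lam W z \<tau> t ^^ k) (delta x) y) holomorphic_on UNIV"
proof (induction k arbitrary: y)
  case 0 then show ?case by simp
next
  case (Suc k)
  show ?case
  proof (cases "y \<in> V")
    case True
    then show ?thesis using Suc
      by (cases "y \<in> W") (auto simp: neumann_def gop_def intro!: holomorphic_intros)
  next
    case False
    then show ?thesis using Suc by (simp add: neumann_def gop_def)
  qed
qed

text \<open>Expanding the square gives the factor \<open>1 - 2 \<tau> Im z + \<tau>^2 M^2\<close>,
  which is smallest at \<open>\<tau> = Im z / M^2\<close>. The factor does not depend on
  \<open>t\<close> within the half disc.\<close>

lemma neumann_contraction:
  fixes v :: "'v \<Rightarrow> real" and t z :: complex
  assumes v: "\<forall>y\<in>V. \<bar>v y\<bar> \<le> b" and b: "0 \<le> b" and lam: "0 < lam"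
    and t: "cmod t \<le> R" "Im t \<le> 0" and z: "0 < Im z" and M: "real D + b + R * lam + cmod z \<le> M"
    and \<psi>: "\<psi> \<in> ell2 V"
  defines "\<tau> \<equiv> Im z / M\<^sup>2"
  shows "neumann v lam W z \<tau> t \<psi> \<in> ell2 V"
    "ell2_norm (neumann v lam W z \<tau> t \<psi>) \<le> sqrt (1 - (Im z)\<^sup>2 / M\<^sup>2) * ell2_norm \<psi>"
proof -
  note g = neumann_step[OF v b lam t z M \<psi>, where W=W]
  let ?G = "gop V N (\<lambda>y. of_real (v y) + (if y \<in> W then t * of_real lam else 0) - z) \<psi>"
  have R0: "0 \<le> R" using t(1) norm_ge_zero order_trans by blast
  have zM: "Im z \<le> M" using M abs_Im_le_cmod[of z] b R0 lam
    by (smt (verit) mult_nonneg_nonneg of_nat_0_le_iff)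
  have M0: "M > 0" using zM z by simp
  have e: "neumann v lam W z \<tau> t \<psi> = (\<lambda>y. \<psi> y + of_real (- \<tau>) * (\<i> * ?G y))"
    by (simp add: neumann_def)
  have iG: "(\<lambda>y. \<i> * ?G y) \<in> ell2 V" by (intro scale_ell2 g)
  have s: "(\<lambda>y. of_real (- \<tau>) * (\<i> * ?G y)) \<in> ell2 V" by (rule scale_ell2[OF iG])
  show "neumann v lam W z \<tau> t \<psi> \<in> ell2 V" unfolding e by (intro add_ell2 \<psi> s)
  have "(ell2_norm (neumann v lam W z \<tau> t \<psi>))\<^sup>2
     = (ell2_norm \<psi>)\<^sup>2 - 2 * \<tau> * Re (ell2_inner \<psi> (\<lambda>y. \<i> * ?G y)) + \<tau>\<^sup>2 * (ell2_norm ?G)\<^sup>2"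
    unfolding e ell2_norm_add_sq[OF ell2_UNIV[OF \<psi>] ell2_UNIV[OF s]]
    using inner_scale_right[of \<psi> "of_real (- \<tau>)" "\<lambda>y. \<i> * ?G y"] ell2_norm_scale[of "of_real (- \<tau>)" "\<lambda>y. \<i> * ?G y"]
      ell2_norm_scale[of "\<i>" ?G] by (simp add: power_mult_distrib)
  also have "\<dots> \<le> (ell2_norm \<psi>)\<^sup>2 - 2 * \<tau> * (Im z * (ell2_norm \<psi>)\<^sup>2) + \<tau>\<^sup>2 * (M * ell2_norm \<psi>)\<^sup>2"
  proof (intro add_mono diff_mono order_refl mult_left_mono power_mono)
    show "Im z * (ell2_norm \<psi>)\<^sup>2 \<le> Re (ell2_inner \<psi> (\<lambda>y. \<i> * ?G y))"
      unfolding g(3) using lam by simp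
    show "0 \<le> 2 * \<tau>" using z by (simp add: \<tau>_def)
  qed (use g(2) in auto)
  also have "\<dots> = (1 - (Im z)\<^sup>2 / M\<^sup>2) * (ell2_norm \<psi>)\<^sup>2"
    using M0 by (simp add: \<tau>_def power2_eq_square field_simps)
  finally have sq: "(ell2_norm (neumann v lam W z \<tau> t \<psi>))\<^sup>2 \<le> (1 - (Im z)\<^sup>2 / M\<^sup>2) * (ell2_norm \<psi>)\<^sup>2" .
  have "(Im z)\<^sup>2 \<le> M\<^sup>2" using zM z by (intro power_mono) auto
  then have "0 \<le> 1 - (Im z)\<^sup>2 / M\<^sup>2" using M0 by (simp add: divide_le_eq)
  then have "(ell2_norm (neumann v lam W z \<tau> t \<psi>))\<^sup>2 \<le> (sqrt (1 - (Im z)\<^sup>2 / M\<^sup>2) * ell2_norm \<psi>)\<^sup>2"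
    using sq by (simp add: power_mult_distrib)
  then show "ell2_norm (neumann v lam W z \<tau> t \<psi>) \<le> sqrt (1 - (Im z)\<^sup>2 / M\<^sup>2) * ell2_norm \<psi>"
    by (rule power2_le_imp_le) (use \<open>0 \<le> 1 - (Im z)\<^sup>2 / M\<^sup>2\<close> in simp)
qed

text \<open>The partial sum \<open>u n\<close> solves the resolvent equation with right-hand side
  \<open>delta x\<close> minus a remainder of norm at most \<open>q^n\<close>. Pairing the equation
  with \<open>u n\<close> and keeping only the absorption in the block of \<open>x\<close> bounds
  \<open>\<bar>Im t\<bar> lam\<close> times the square of \<open>u n x\<close> by
  \<open>u n x\<close> itself, up to the remainder; dividing by \<open>u n x\<close> is the source
  of the bound \<open>1 / lam\<close>.\<close>

lemma neumann_sum_bound: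
  fixes v :: "'v \<Rightarrow> real" and t z :: complex
  assumes v: "\<forall>y\<in>V. \<bar>v y\<bar> \<le> b" and b: "0 \<le> b" and lam: "0 < lam"
    and t: "cmod t \<le> R" "Im t \<le> 0" and z: "0 < Im z" and M: "real D + b + R * lam + cmod z \<le> M"
    and x: "x \<in> V" "x \<in> W"
  defines "\<tau> \<equiv> Im z / M\<^sup>2"
  defines "q \<equiv> sqrt (1 - (Im z)\<^sup>2 / M\<^sup>2)"
  defines "u \<equiv> \<lambda>n y. of_real \<tau> * (\<Sum>k<n. (neumann v lam W z \<tau> t ^^ k) (delta x) y)"
  shows "0 \<le> q" "q < 1" "cmod (u n x) \<le> \<tau> / (1 - q)"
    "\<bar>Im t\<bar> * cmod (u n x) \<le> (1 + lam * R * (\<tau> / (1 - q)) * q ^ n) / lam"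
proof -
  let ?S = "neumann v lam W z \<tau> t"
  let ?a = "\<lambda>k. (?S ^^ k) (delta x)"
  note con = neumann_contraction[OF v b lam t z M, where W=W, folded \<tau>_def q_def]
  have R0: "0 \<le> R" using t(1) norm_ge_zero order_trans by blast
  have zM: "Im z \<le> M" using M abs_Im_le_cmod[of z] b R0 lam
    by (smt (verit) mult_nonneg_nonneg of_nat_0_le_iff)
  have M0: "M > 0" using zM z by simp
  have "(Im z)\<^sup>2 \<le> M\<^sup>2" using zM z by (intro power_mono) auto
  then have q2: "0 \<le> 1 - (Im z)\<^sup>2 / M\<^sup>2" "1 - (Im z)\<^sup>2 / M\<^sup>2 < 1" using M0 z by (simp_all add: divide_le_eq)
  show q0: "0 \<le> q" and q1: "q < 1" using q2 by (simp_all add: q_def real_sqrt_lt_1_iff)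
  have \<tau>0: "\<tau> > 0" using z M0 by (simp add: \<tau>_def)
  have aU: "?a k \<in> ell2 V" for k
    by (induction k) (auto intro: con(1) delta_ell2 x(1))
  have an: "ell2_norm (?a k) \<le> q ^ k" for k
  proof (induction k)
    case (Suc k)
    have "ell2_norm (?a (Suc k)) \<le> q * ell2_norm (?a k)" using con(2)[OF aU[of k]] by simp
    also have "\<dots> \<le> q * q ^ k" using Suc q0 by (intro mult_left_mono) auto
    finally show ?case by simp
  qed simp
  have uU: "u n \<in> ell2 V" unfolding u_def by (intro scale_ell2 sum_ell2 aU)
  have un: "ell2_norm (u n) \<le> \<tau> / (1 - q)"
  proof -
    have "ell2_norm (u n) = \<tau> * ell2_norm (\<lambda>y. \<Sum>k<n. ?a k y)" unfolding u_def ell2_norm_scale using \<tau>0 by simp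
    also have "\<dots> \<le> \<tau> * (\<Sum>k<n. ell2_norm (?a k))"
      using \<tau>0 by (intro mult_left_mono ell2_norm_sum ell2_UNIV[OF aU]) auto
    also have "\<dots> \<le> \<tau> * (\<Sum>k<n. q ^ k)" using \<tau>0 an by (intro mult_left_mono sum_mono) auto
    also have "\<dots> \<le> \<tau> * (1 / (1 - q))"
    proof (intro mult_left_mono)
      have "(\<Sum>k<n. q ^ k) = (1 - q ^ n) / (1 - q)" using q1 by (simp add: sum_gp_strict)
      also have "\<dots> \<le> 1 / (1 - q)" using q0 q1 by (intro divide_right_mono) auto
      finally show "(\<Sum>k<n. q ^ k) \<le> 1 / (1 - q)" .
    qed (use \<tau>0 in simp)
    finally show ?thesis by simp
  qed
  show "cmod (u n x) \<le> \<tau> / (1 - q)" using ell2_norm_coord[OF ell2_UNIV[OF uU], of x] un by linarith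
  let ?w = "\<lambda>y. of_real (v y) + (if y \<in> W then t * of_real lam else 0) - z"
  let ?G = "gop V N ?w"
  note g = neumann_step[OF v b lam t z M uU, where W=W]
  have Gsum: "of_real \<tau> * (\<i> * ?G (u n) y) = of_real \<tau> * (delta x y - ?a n y)" for y
  proof -
    have "of_real \<tau> * (\<i> * ?G (u n) y) = of_real \<tau> * (\<Sum>k<n. of_real \<tau> * (\<i> * ?G (?a k) y))"
    proof -
      have "?G (\<lambda>y. \<Sum>k<n. ?a k y) = (\<lambda>y. \<Sum>k<n. ?G (?a k) y)"
      proof (induction n)
        case 0 show ?case by (simp add: gop_def fun_eq_iff)
      next
        case (Suc n) then show ?case by (simp add: gop_add)
      qed
      then show ?thesis unfolding u_def gop_scale by (simp add: sum_distrib_left mult_ac)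
    qed
    also have "(\<Sum>k<n. of_real \<tau> * (\<i> * ?G (?a k) y)) = (\<Sum>k<n. ?a k y - ?a (Suc k) y)"
      by (simp add: neumann_def)
    also have "\<dots> = delta x y - ?a n y" by (subst sum_lessThan_telescope') simp
    finally show ?thesis .
  qed
  have iG: "(\<lambda>y. \<i> * ?G (u n) y) = (\<lambda>y. delta x y - ?a n y)"
  proof
    fix y
    show "\<i> * ?G (u n) y = delta x y - ?a n y" using Gsum[of y] \<tau>0 by simp
  qed
  define s where "s = cmod (u n x)"
  define B where "B = \<tau> / (1 - q)"
  have "ell2_inner (u n) (\<lambda>y. \<i> * ?G (u n) y) = ell2_inner (u n) (delta x) - ell2_inner (u n) (?a n)"
    unfolding iG by (rule inner_diff_right) (intro ell2_UNIV[OF uU] ell2_UNIV[OF aU] ell2_UNIV[OF delta_ell2[OF x(1)]])+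
  moreover have "ell2_inner (u n) (delta x) = cnj (u n x)" using inner_delta[of x "u n"] inner_cnj[of "delta x" "u n"] by simp
  moreover have "cmod (ell2_inner (u n) (?a n)) \<le> B * q ^ n"
  proof -
    have "cmod (ell2_inner (u n) (?a n)) \<le> ell2_norm (u n) * ell2_norm (?a n)"
      by (intro ell2_cauchy_schwarz ell2_UNIV[OF uU] ell2_UNIV[OF aU])
    also have "\<dots> \<le> B * q ^ n" unfolding B_def using un an q1 \<tau>0 by (intro mult_mono) auto
    finally show ?thesis .
  qed
  ultimately have re: "Re (ell2_inner (u n) (\<lambda>y. \<i> * ?G (u n) y)) \<le> s + B * q ^ n"
    using complex_Re_le_cmod[of "cnj (u n x)"] abs_Re_le_cmod[of "ell2_inner (u n) (?a n)"] by (simp add: s_def)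
  have "s \<le> ell2_norm (chi W (u n))"
    using ell2_norm_coord[OF ell2_UNIV[OF g(4)], of x] x(2) by (simp add: s_def chi_def)
  then have "\<bar>Im t\<bar> * lam * s\<^sup>2 \<le> \<bar>Im t\<bar> * lam * (ell2_norm (chi W (u n)))\<^sup>2"
    using lam by (intro mult_left_mono power_mono) (auto simp: s_def)
  also have "\<dots> \<le> s + B * q ^ n" using re z unfolding g(3) by (smt (verit) mult_nonneg_nonneg zero_le_power2)
  finally have main: "\<bar>Im t\<bar> * lam * s\<^sup>2 \<le> s + B * q ^ n" .
  \<comment> \<open>Multiplied by \<open>\<bar>Im t\<bar> lam\<close>, the inequality reads
    \<open>X^2 <= X + d\<close>, which forces \<open>X <= 1 + d\<close>. No division by
    \<open>s\<close>, which may be 0, is made.\<close>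
  define X where "X = \<bar>Im t\<bar> * lam * s"
  define d where "d = lam * R * B * q ^ n"
  have B0: "0 \<le> B" using q1 \<tau>0 by (simp add: B_def)
  have d0: "0 \<le> d" unfolding d_def using lam R0 B0 q0 by simp
  have "\<bar>Im t\<bar> \<le> R" using abs_Im_le_cmod[of t] t(1) by linarith
  then have "\<bar>Im t\<bar> * lam * (B * q ^ n) \<le> d"
    using mult_right_mono[of "\<bar>Im t\<bar>" R "lam * (B * q ^ n)"] lam B0 q0 by (simp add: d_def mult_ac)
  moreover have "X\<^sup>2 \<le> X + \<bar>Im t\<bar> * lam * (B * q ^ n)"
    using mult_left_mono[OF main, of "\<bar>Im t\<bar> * lam"] lam by (simp add: X_def power2_eq_square algebra_simps)
  ultimately have X2: "X\<^sup>2 \<le> X + d" by linarith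
  have "X \<le> 1 + d"
  proof (rule ccontr)
    assume "\<not> X \<le> 1 + d"
    then have X: "X > 1 + d" by simp
    then have "X * X > X * (1 + d)" using d0 by (intro mult_strict_left_mono) auto
    moreover have "X * d \<ge> d" using X d0 by (simp add: mult_le_cancel_right1)
    ultimately show False using X2 by (simp add: power2_eq_square algebra_simps)
  qed
  then show "\<bar>Im t\<bar> * cmod (u n x) \<le> (1 + lam * R * (\<tau> / (1 - q)) * q ^ n) / lam"
    using lam by (simp add: X_def d_def s_def B_def pos_le_divide_eq mult_ac)
qed

text \<open>For real coupling the operator is self-adjoint, and the diagonal elements of the
  iterates become integrals against its spectral measure.\<close>

lemma neumann_spectral_integral:
  fixes v :: "'v \<Rightarrow> real" and s :: real
  assumes A: "bounded_sa V (gop V N (\<lambda>y. complex_of_real (block_potential v lam W s y))) c"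
    and x: "x \<in> V"
  defines "\<mu> \<equiv> bounded_sa.vec_measure (gop V N (\<lambda>y. complex_of_real (block_potential v lam W s y))) c (delta x)"
  shows "(neumann v lam W z \<tau> (of_real s) ^^ k) (delta x) x
    = (\<integral>u. (1 - of_real \<tau> * \<i> * (of_real u - z)) ^ k \<partial>\<mu>)"
proof -
  let ?A = "gop V N (\<lambda>y. complex_of_real (block_potential v lam W s y))"
  interpret A: bounded_sa V ?A c by (rule A)
  let ?a = "\<lambda>k. (neumann v lam W z \<tau> (of_real s) ^^ k) (delta x)"
  have d: "delta x \<in> ell2 V" by (rule delta_ell2[OF x])
  have out: "?a k y = 0" if "y \<notin> V" for k y
    using that x by (induction k) (auto simp: delta_def neumann_def gop_def)
  have step: "?a (Suc k) = (\<lambda>y. (1 + of_real \<tau> * \<i> * z) * ?a k y + (- of_real \<tau> * \<i>) * ?A (?a k) y)" for k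
  proof
    fix y
    show "?a (Suc k) y = (1 + of_real \<tau> * \<i> * z) * ?a k y + (- of_real \<tau> * \<i>) * ?A (?a k) y"
    proof (cases "y \<in> V")
      case True
      then show ?thesis by (simp add: neumann_def gop_def block_potential_def algebra_simps)
    next
      case False
      then show ?thesis using out[OF False, of k] out[OF False, of "Suc k"] by (simp add: gop_def)
    qed
  qed
  have "ell2_inner (A.poly_op 1 (delta x)) (?a k)
     = (\<integral>u. of_real (poly 1 u) * ((1 + of_real \<tau> * \<i> * z) + (- of_real \<tau> * \<i>) * of_real u) ^ k \<partial>A.vec_measure (delta x))"
    by (rule A.geometric_moment[where a="?a", OF d _ step]) simp
  then show ?thesis unfolding A.poly_op_1 inner_delta \<mu>_def by (simp add: algebra_simps)
qed

text \<open>The bound does not involve the background \<open>v\<close>, the energy \<open>e\<close>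
  or the absorption \<open>\<epsilon>\<close>. The partial sums satisfy the hypothesis of
  \<open>half_disc_weighted_integral\<close> with a constant tending to \<open>1 / lam\<close>, and
  their real parts on the axis tend to the Poisson integrals. This gives
  \<open>2 pi R^2 / lam\<close> for the average with weight \<open>R^2 - s^2\<close>; taking
  \<open>R = 2 r\<close> makes the weight at least \<open>3 R^2 / 4\<close> on [-r, r], and the
  quotient is \<open>8 pi / (3 lam)\<close>.\<close>

theorem spectral_averaging:
  fixes v :: "'v \<Rightarrow> real" and r e \<epsilon> :: real
  assumes v: "\<forall>y\<in>V. \<bar>v y\<bar> \<le> b" and b: "0 \<le> b" and lam: "0 < lam" and r: "0 < r" and \<epsilon>: "0 < \<epsilon>"
    and x: "x \<in> V" "x \<in> W"
    and \<mu>: "\<And>s. \<bar>s\<bar> \<le> 2 * r \<Longrightarrow> supported c (\<mu> s)"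
      "\<And>s p. \<bar>s\<bar> \<le> 2 * r \<Longrightarrow> integral\<^sup>L (\<mu> s) (\<lambda>u. u ^ p)
        = Re (((gop V N (\<lambda>y. complex_of_real (block_potential v lam W s y))) ^^ p) (delta x) x)"
  shows "(\<integral>\<^sup>+s. indicator {-r..r} s * ennreal (integral\<^sup>L (\<mu> s) (poisson e \<epsilon>)) \<partial>lborel) \<le> ennreal (8 * pi / (3 * lam))"
proof -
  define R where "R = 2 * r"
  have R: "0 < R" using r by (simp add: R_def)
  define z where "z = Complex e \<epsilon>"
  have z: "0 < Im z" "Im z = \<epsilon>" "Re z = e" using \<epsilon> by (simp_all add: z_def)
  \<comment> \<open>A norm bound for all real couplings of size at most \<open>R\<close>, hence a
    common support for all \<open>\<mu> s\<close>.\<close>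
  define c0 where "c0 = real D + b + R * lam + 1"
  have c0: "0 < c0" using b R lam by (simp add: c0_def add_nonneg_pos)
  define M where "M = c0 + cmod z"
  have M: "real D + b + R * lam + cmod z \<le> M" by (simp add: M_def c0_def)
  define \<tau> where "\<tau> = Im z / M\<^sup>2"
  define q where "q = sqrt (1 - (Im z)\<^sup>2 / M\<^sup>2)"
  define B where "B = \<tau> / (1 - q)"
  define f where "f n t = of_real \<tau> * (\<Sum>k<n. (neumann v lam W z \<tau> t ^^ k) (delta x) x)" for n t
  define w where "w u = 1 - of_real \<tau> * \<i> * (of_real u - z)" for u :: real
  define P where "P s = integral\<^sup>L (\<mu> s) (poisson e \<epsilon>)" for s
  have M0: "0 < M" using c0 by (simp add: M_def add_pos_nonneg)
  have \<tau>0: "0 < \<tau>" using z M0 by (simp add: \<tau>_def)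
  have bounds: "0 \<le> q" "q < 1" "cmod (f n t) \<le> B" "\<bar>Im t\<bar> * cmod (f n t) \<le> (1 + lam * R * B * q ^ n) / lam"
    if "cmod t \<le> R" "Im t \<le> 0" for n t
    using neumann_sum_bound(1,2)[OF v b lam that z(1) M x, folded \<tau>_def q_def]
      neumann_sum_bound(3,4)[OF v b lam that z(1) M x, of n, folded \<tau>_def q_def B_def, folded f_def] by auto
  have q: "0 \<le> q" "q < 1" using bounds(1,2)[of 0] R by auto
  have B0: "0 \<le> B" using \<tau>0 q by (simp add: B_def)
  have fh: "f n holomorphic_on UNIV" for n
    unfolding f_def by (intro holomorphic_intros neumann_holomorphic)
  have fc: "continuous_on UNIV (\<lambda>s. f n (complex_of_real s))" for n
  proof -
    have "continuous_on UNIV (f n)" using fh by (rule holomorphic_on_imp_continuous_on)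
    then have "continuous_on UNIV (f n \<circ> complex_of_real)"
      by (intro continuous_on_compose continuous_on_of_real continuous_on_id) (auto intro: continuous_on_subset)
    then show ?thesis by (simp add: comp_def)
  qed
  have wq: "cmod (w u) \<le> q" if "\<bar>u\<bar> \<le> c0" for u
  proof -
    have "(cmod (w u))\<^sup>2 = 1 - 2 * \<tau> * \<epsilon> + \<tau>\<^sup>2 * (cmod (of_real u - z))\<^sup>2"
      unfolding cmod_power2 w_def using z(2,3) by (simp add: power2_eq_square algebra_simps)
    also have "\<dots> \<le> 1 - 2 * \<tau> * \<epsilon> + \<tau>\<^sup>2 * M\<^sup>2"
    proof -
      have "cmod (of_real u - z) \<le> M" unfolding M_def
        using norm_triangle_ineq4[of "of_real u" z] that by simp
      then have "(cmod (of_real u - z))\<^sup>2 \<le> M\<^sup>2" by (intro power_mono) auto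
      then show ?thesis by (intro add_left_mono mult_left_mono) auto
    qed
    also have "\<dots> = 1 - (Im z)\<^sup>2 / M\<^sup>2"
      using M0 z(2) by (simp add: \<tau>_def power2_eq_square field_simps)
    finally have "cmod (w u) \<le> sqrt (1 - (Im z)\<^sup>2 / M\<^sup>2)" by (rule real_le_rsqrt)
    then show ?thesis by (simp add: q_def)
  qed
  have real_axis: "f n (of_real s) = (\<integral>u. of_real \<tau> * (\<Sum>k<n. w u ^ k) \<partial>\<mu> s)"
    and sup0: "supported c0 (\<mu> s)" if s: "\<bar>s\<bar> \<le> R" for n s
  proof -
    let ?A = "gop V N (\<lambda>y. complex_of_real (block_potential v lam W s y))"
    have vb: "\<bar>block_potential v lam W s y\<bar> \<le> b + R * lam" if "y \<in> V" for y
    proof -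
      have "\<bar>if y \<in> W then s * lam else 0\<bar> \<le> R * lam"
        using s lam R by (auto simp: abs_mult intro: mult_right_mono)
      then show ?thesis unfolding block_potential_def using bspec[OF v that] by linarith
    qed
    have A: "bounded_sa V ?A c0"
      by (rule gop_bounded_sa[where b="b + R * lam"]) (use vb b R lam c0 in \<open>auto simp: c0_def\<close>)
    interpret A: bounded_sa V ?A c0 by (rule A)
    have d: "delta x \<in> ell2 V" by (rule delta_ell2[OF x(1)])
    have eq: "\<mu> s = A.vec_measure (delta x)"
    proof (rule supported_moment_unique)
      show S: "supported (max c c0) (\<mu> s)" "supported (max c c0) (A.vec_measure (delta x))"
        using \<mu>(1)[of s] s A.vec_measure(1)[OF d] supported_mono max.cobounded1 max.cobounded2 unfolding R_def by blast+
      have "integral\<^sup>L (\<mu> s) (\<lambda>t. t ^ p) = integral\<^sup>L (A.vec_measure (delta x)) (\<lambda>t. t ^ p)" for p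
        using \<mu>(2)[of s p] s A.vec_measure_moment[OF d, of p] by (simp add: inner_delta R_def)
      then show "integral\<^sup>L (\<mu> s) (poly p) = integral\<^sup>L (A.vec_measure (delta x)) (poly p)" for p
        by (simp add: integral_poly_moments[OF S(1)] integral_poly_moments[OF S(2)])
    qed
    show S0: "supported c0 (\<mu> s)" unfolding eq by (rule A.vec_measure(1)[OF d])
    have i: "integrable (\<mu> s) (\<lambda>u. w u ^ k)" for k
      unfolding w_def by (rule supported_integrable_complex[OF S0]) (intro continuous_intros)
    show "f n (of_real s) = (\<integral>u. of_real \<tau> * (\<Sum>k<n. w u ^ k) \<partial>\<mu> s)"
    proof -
      have "(neumann v lam W z \<tau> (of_real s) ^^ k) (delta x) x = (\<integral>u. w u ^ k \<partial>\<mu> s)" for k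
        unfolding w_def by (rule neumann_spectral_integral[OF A x(1), folded eq])
      then show ?thesis unfolding f_def using i by simp
    qed
  qed
  have P0: "0 \<le> P s" for s unfolding P_def by (intro integral_nonneg_AE) (simp add: poisson_nonneg[OF \<epsilon>])
  \<comment> \<open>The geometric series sums to \<open>1 / (\<i> (u - z))\<close> under the
    integral, and the real part of this is the Poisson kernel at \<open>e\<close> and
    \<open>\<epsilon>\<close>.\<close>
  have conv: "(\<lambda>n. Re (f n (of_real s))) \<longlonglongrightarrow> P s" if s: "\<bar>s\<bar> \<le> R" for s
  proof -
    note S0 = sup0[OF s]
    have i: "integrable (\<mu> s) (\<lambda>u. of_real \<tau> * (\<Sum>k<n. w u ^ k))" for n
      unfolding w_def by (rule supported_integrable_complex[OF S0]) (intro continuous_intros)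
    have re: "Re (f n (of_real s)) = (\<integral>u. Re (of_real \<tau> * (\<Sum>k<n. w u ^ k)) \<partial>\<mu> s)" for n
      unfolding real_axis[OF s] by (rule integral_Re[OF i, symmetric])
    show ?thesis unfolding re P_def
    proof (rule supported_dominated_convergence[OF S0, where B=B])
      show "(\<lambda>u. Re (of_real \<tau> * (\<Sum>k<n. w u ^ k))) \<in> borel_measurable borel" for n
        unfolding w_def by (intro borel_measurable_continuous_onI continuous_intros)
      show "poisson e \<epsilon> \<in> borel_measurable borel"
        by (intro borel_measurable_continuous_onI poisson_continuous \<epsilon>)
      fix u :: real assume u: "\<bar>u\<bar> \<le> c0"
      have w1: "cmod (w u) < 1" using wq[OF u] q by simp
      have "(\<lambda>n. \<Sum>k<n. w u ^ k) \<longlonglongrightarrow> 1 / (1 - w u)"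
        using geometric_sums[OF w1] by (simp add: sums_def)
      from tendsto_Re[OF tendsto_mult[OF tendsto_const[of "complex_of_real \<tau>"] this]]
      have "(\<lambda>n. Re (of_real \<tau> * (\<Sum>k<n. w u ^ k))) \<longlonglongrightarrow> Re (of_real \<tau> * (1 / (1 - w u)))" .
      moreover have "of_real \<tau> * (1 / (1 - w u)) = 1 / (\<i> * (of_real u - z))"
        using \<tau>0 by (simp add: w_def)
      moreover have "Re (1 / (\<i> * (of_real u - z))) = poisson e \<epsilon> u"
      proof -
        have "\<i> * (of_real u - z) = Complex \<epsilon> (u - e)" using z(2,3) by (simp add: complex_eq_iff)
        then show ?thesis by (simp add: poisson_def Re_divide power2_eq_square add.commute)
      qed
      ultimately show "(\<lambda>n. Re (of_real \<tau> * (\<Sum>k<n. w u ^ k))) \<longlonglongrightarrow> poisson e \<epsilon> u" by simp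
      fix n
      have "cmod (of_real \<tau> * (\<Sum>k<n. w u ^ k)) \<le> \<tau> * (\<Sum>k<n. q ^ k)"
        unfolding norm_mult using \<tau>0 wq[OF u]
        by (intro mult_mono sum_norm_le) (auto simp: norm_power intro: power_mono sum_nonneg)
      also have "\<dots> \<le> \<tau> * (1 / (1 - q))"
      proof (intro mult_left_mono)
        have "(\<Sum>k<n. q ^ k) = (1 - q ^ n) / (1 - q)" using q by (simp add: sum_gp_strict)
        also have "\<dots> \<le> 1 / (1 - q)" using q by (intro divide_right_mono) auto
        finally show "(\<Sum>k<n. q ^ k) \<le> 1 / (1 - q)" .
      qed (use \<tau>0 in simp)
      finally have "cmod (of_real \<tau> * (\<Sum>k<n. w u ^ k)) \<le> B" by (simp add: B_def)
      then show "\<bar>Re (of_real \<tau> * (\<Sum>k<n. w u ^ k))\<bar> \<le> B" using abs_Re_le_cmod order_trans by blast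
    qed
  qed
  define I where "I = (indicator {-R..R} :: real \<Rightarrow> real)"
  define H where "H n s = I s * (Re (f n (of_real s)) * (R\<^sup>2 - s\<^sup>2))" for n s
  define H0 where "H0 s = I s * (P s * (R\<^sup>2 - s\<^sup>2))" for s
  have Hm: "H n \<in> borel_measurable lborel" for n
  proof -
    have "(\<lambda>s. Re (f n (of_real s)) * (R\<^sup>2 - s\<^sup>2)) \<in> borel_measurable borel"
      using fc by (intro borel_measurable_continuous_onI continuous_intros)
    then show ?thesis unfolding H_def I_def by simp
  qed
  have HB: "norm (H n s) \<le> I s * (B * R\<^sup>2)" for n s
  proof (cases "\<bar>s\<bar> \<le> R")
    case True
    have "\<bar>Re (f n (of_real s))\<bar> \<le> B" using bounds(3)[of "of_real s" n] True abs_Re_le_cmod order_trans by fastforce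
    moreover have "s\<^sup>2 \<le> R\<^sup>2" using True R by (simp add: abs_le_square_iff[symmetric])
    then have "\<bar>R\<^sup>2 - s\<^sup>2\<bar> \<le> R\<^sup>2" by simp
    ultimately have "\<bar>Re (f n (of_real s))\<bar> * \<bar>R\<^sup>2 - s\<^sup>2\<bar> \<le> B * R\<^sup>2" using B0 by (intro mult_mono) auto
    then show ?thesis using True by (simp add: H_def I_def abs_mult indicator_def abs_le_iff)
  next
    case False
    then have "I s = 0" by (auto simp: I_def indicator_def abs_le_iff)
    then show ?thesis by (simp add: H_def)
  qed
  have Hlim: "(\<lambda>n. H n s) \<longlonglongrightarrow> H0 s" for s
  proof (cases "\<bar>s\<bar> \<le> R")
    case True
    then show ?thesis unfolding H_def H0_def by (intro tendsto_intros conv)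
  next
    case False
    then have "I s = 0" by (auto simp: I_def indicator_def abs_le_iff)
    then show ?thesis by (simp add: H_def H0_def)
  qed
  have wint: "integrable lborel (\<lambda>s. I s * (B * R\<^sup>2))"
    unfolding I_def by (intro integrable_mult_left integrable_real_indicator) (use R in auto)
  have H0m: "H0 \<in> borel_measurable lborel" by (rule borel_measurable_LIMSEQ_real[OF Hlim Hm])
  have dc: "integrable lborel H0"
    by (rule integrable_dominated_convergence[where s=H and w="\<lambda>s. I s * (B * R\<^sup>2)"]) (use H0m Hm wint Hlim HB in auto)
  have dc2: "(\<lambda>n. integral\<^sup>L lborel (H n)) \<longlonglongrightarrow> integral\<^sup>L lborel H0"
    by (rule integral_dominated_convergence[where s=H and w="\<lambda>s. I s * (B * R\<^sup>2)"]) (use H0m Hm wint Hlim HB in auto)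
  have Hint: "integral\<^sup>L lborel (H n) \<le> 2 * pi * R\<^sup>2 * ((1 + lam * R * B * q ^ n) / lam)" for n
  proof -
    let ?h = "\<lambda>s. indicator {-R..R} s *\<^sub>R (f n (of_real s) * of_real (R\<^sup>2 - s\<^sup>2))"
    have "continuous_on {-R..R} (\<lambda>s. f n (of_real s) * of_real (R\<^sup>2 - s\<^sup>2))"
      using fc by (intro continuous_intros) (auto intro: continuous_on_subset)
    then have i: "integrable lborel ?h"
      using borel_integrable_compact[of "{-R..R}" "\<lambda>s. f n (of_real s) * of_real (R\<^sup>2 - s\<^sup>2)"] by auto
    have "H n s = Re (?h s)" for s by (simp add: H_def I_def)
    then have "integral\<^sup>L lborel (H n) = Re (integral\<^sup>L lborel ?h)" using integral_Re[OF i] by presburger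
    also have "\<dots> \<le> cmod (integral\<^sup>L lborel ?h)" by (rule complex_Re_le_cmod)
    also have "\<dots> \<le> 2 * pi * R\<^sup>2 * ((1 + lam * R * B * q ^ n) / lam)"
      by (rule half_disc_weighted_integral[OF fh R]) (use bounds(4) in auto)
    finally show ?thesis .
  qed
  have "integral\<^sup>L lborel H0 \<le> 2 * pi * R\<^sup>2 * ((1 + lam * R * B * 0) / lam)"
  proof (rule LIMSEQ_le[OF dc2])
    show "(\<lambda>n. 2 * pi * R\<^sup>2 * ((1 + lam * R * B * q ^ n) / lam)) \<longlonglongrightarrow> 2 * pi * R\<^sup>2 * ((1 + lam * R * B * 0) / lam)"
      using q lam by (intro tendsto_intros LIMSEQ_power_zero) auto
    show "\<exists>N. \<forall>n\<ge>N. integral\<^sup>L lborel (H n) \<le> 2 * pi * R\<^sup>2 * ((1 + lam * R * B * q ^ n) / lam)"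
      using Hint by blast
  qed
  then have H0le: "integral\<^sup>L lborel H0 \<le> 2 * pi * R\<^sup>2 / lam" by simp
  have H0nn: "0 \<le> H0 s" for s
  proof (cases "\<bar>s\<bar> \<le> R")
    case True
    then have "s\<^sup>2 \<le> R\<^sup>2" using R by (simp add: abs_le_square_iff[symmetric])
    then show ?thesis using P0 by (simp add: H0_def I_def)
  next
    case False
    then have "I s = 0" by (auto simp: I_def indicator_def abs_le_iff)
    then show ?thesis by (simp add: H0_def)
  qed
  \<comment> \<open>On [-r, r] one has \<open>s^2 <= R^2 / 4\<close>, so dividing by the weight
    costs at most the factor \<open>4 / (3 R^2)\<close>.\<close>
  have pt: "indicator {-r..r} s * ennreal (P s) \<le> ennreal (4 / (3 * R\<^sup>2)) * ennreal (H0 s)" for s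
  proof (cases "s \<in> {-r..r}")
    case True
    then have s: "\<bar>s\<bar> \<le> r" by (auto simp: abs_le_iff)
    then have "s\<^sup>2 \<le> r\<^sup>2" using r by (simp add: abs_le_square_iff[symmetric])
    then have "3 * R\<^sup>2 / 4 \<le> R\<^sup>2 - s\<^sup>2" by (simp add: R_def power2_eq_square)
    then have "P s * (3 * R\<^sup>2 / 4) \<le> P s * (R\<^sup>2 - s\<^sup>2)" using P0 by (intro mult_left_mono) auto
    moreover have "I s = 1" using s r by (auto simp: I_def R_def indicator_def abs_le_iff)
    ultimately have "P s \<le> 4 / (3 * R\<^sup>2) * H0 s" using R by (simp add: H0_def field_simps)
    then have "ennreal (P s) \<le> ennreal (4 / (3 * R\<^sup>2) * H0 s)" by (rule ennreal_leI)
    also have "\<dots> = ennreal (4 / (3 * R\<^sup>2)) * ennreal (H0 s)" by (rule ennreal_mult) (simp_all add: H0nn)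
    finally show ?thesis using True by simp
  qed simp
  have "(\<integral>\<^sup>+s. indicator {-r..r} s * ennreal (P s) \<partial>lborel) \<le> (\<integral>\<^sup>+s. ennreal (4 / (3 * R\<^sup>2)) * ennreal (H0 s) \<partial>lborel)"
    by (rule nn_integral_mono) (rule pt)
  also have "\<dots> = ennreal (4 / (3 * R\<^sup>2)) * (\<integral>\<^sup>+s. ennreal (H0 s) \<partial>lborel)"
    by (rule nn_integral_cmult) (use H0m in simp)
  also have "(\<integral>\<^sup>+s. ennreal (H0 s) \<partial>lborel) = ennreal (integral\<^sup>L lborel H0)"
    by (rule nn_integral_eq_integral[OF dc]) (simp add: H0nn)
  also have "ennreal (4 / (3 * R\<^sup>2)) * ennreal (integral\<^sup>L lborel H0) = ennreal (4 / (3 * R\<^sup>2) * integral\<^sup>L lborel H0)"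
    by (rule ennreal_mult[symmetric]) (auto intro: integral_nonneg_AE simp: H0nn)
  also have "\<dots> \<le> ennreal (4 / (3 * R\<^sup>2) * (2 * pi * R\<^sup>2 / lam))"
    using H0le by (intro ennreal_leI mult_left_mono) auto
  also have "4 / (3 * R\<^sup>2) * (2 * pi * R\<^sup>2 / lam) = 8 * pi / (3 * lam)" using R by simp
  finally show ?thesis by (simp add: P_def)
qed

end

section \<open>Random spectral measures\<close>

text \<open>Half-line masses are limits of integrals of the polynomials from
  \<open>poly_step\<close>, that is, of finite combinations of measurable moments; half-lines
  generate the Borel sets.\<close>

lemma kernel_measurable:
  fixes \<kappa> :: "'a \<Rightarrow> real measure"
  assumes pr: "\<And>s. s \<in> space M \<Longrightarrow> prob_space (\<kappa> s)" and sup: "\<And>s. s \<in> space M \<Longrightarrow> supported c (\<kappa> s)"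
    and mom: "\<And>i. (\<lambda>s. integral\<^sup>L (\<kappa> s) (\<lambda>t. t ^ i)) \<in> borel_measurable M"
  shows "\<kappa> \<in> measurable M (subprob_algebra borel)"
proof (rule measurable_subprob_algebra_generated[where G="range (\<lambda>a::real. {..a})" and \<Omega>=UNIV])
  show "sets (borel :: real measure) = sigma_sets UNIV (range (\<lambda>a::real. {..a}))" by (simp add: borel_eq_atMost)
  show "Int_stable (range (\<lambda>a::real. {..a}))" by (auto simp: Int_stable_def)
  show "subprob_space (\<kappa> s)" "sets (\<kappa> s) = sets borel" if "s \<in> space M" for s
    using pr[OF that] supportedD(2)[OF sup[OF that]] by (auto intro: prob_space_imp_subprob_space)
  have one: "emeasure (\<kappa> s) UNIV = 1" if "s \<in> space M" for s
    using prob_space.emeasure_space_1[OF pr[OF that]] supportedD(4)[OF sup[OF that]] by simp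
  show "(\<lambda>s. emeasure (\<kappa> s) UNIV) \<in> borel_measurable M"
    by (subst measurable_cong[OF one]) auto
  fix A assume "A \<in> range (\<lambda>a::real. {..a})"
  then obtain a where A: "A = {..a}" by auto
  obtain p :: "nat \<Rightarrow> real poly" where p: "\<And>t. \<bar>t\<bar> \<le> c \<Longrightarrow> (\<lambda>i. poly (p i) t) \<longlonglongrightarrow> indicator {..a} t"
    "\<And>i t. \<bar>t\<bar> \<le> c \<Longrightarrow> \<bar>poly (p i) t\<bar> \<le> 2"
    using poly_step[where a=a and c=c] by blast
  have lim: "(\<lambda>i. \<Sum>j\<le>degree (p i). coeff (p i) j * integral\<^sup>L (\<kappa> s) (\<lambda>t. t ^ j)) \<longlonglongrightarrow> measure (\<kappa> s) A" if s: "s \<in> space M" for s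
  proof -
    interpret prob_space "\<kappa> s" by (rule pr[OF s])
    have "(\<lambda>i. integral\<^sup>L (\<kappa> s) (poly (p i))) \<longlonglongrightarrow> integral\<^sup>L (\<kappa> s) (indicator {..a})"
      by (rule supported_dominated_convergence[OF sup[OF s]]) (use p in auto)
    moreover have "integral\<^sup>L (\<kappa> s) (indicator {..a} :: real \<Rightarrow> real) = measure (\<kappa> s) A"
      using supportedD(2,4)[OF sup[OF s]] A by simp
    ultimately show ?thesis by (simp only: integral_poly_moments[OF sup[OF s]])
  qed
  have "(\<lambda>s. measure (\<kappa> s) A) \<in> borel_measurable M"
    by (rule borel_measurable_LIMSEQ_metric[OF _ lim]) (intro borel_measurable_sum borel_measurable_times borel_measurable_const mom)
  moreover have "emeasure (\<kappa> s) A = ennreal (measure (\<kappa> s) A)" if "s \<in> space M" for s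
    using finite_measure.emeasure_eq_measure[OF supportedD(1)[OF sup[OF that]]] .
  ultimately show "(\<lambda>s. emeasure (\<kappa> s) A) \<in> borel_measurable M"
    by (subst measurable_cong) auto
qed simp

text \<open>Used for three mixtures: over the randomness, over the layers of the canopy tree with
  geometric weights, and over the vertices of a ball with uniform weights.\<close>

lemma kernel_mixture:
  fixes \<kappa> :: "'a \<Rightarrow> real measure"
  assumes M: "prob_space M"
    and \<kappa>: "\<kappa> \<in> measurable M (subprob_algebra borel)"
    and pr: "\<And>s. s \<in> space M \<Longrightarrow> prob_space (\<kappa> s)" and sup: "\<And>s. s \<in> space M \<Longrightarrow> supported c (\<kappa> s)"
  shows "prob_space (M \<bind> \<kappa>)" "supported c (M \<bind> \<kappa>)"
    "B \<in> sets borel \<Longrightarrow> measure (M \<bind> \<kappa>) B = (\<integral>s. measure (\<kappa> s) B \<partial>M)"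
    "integral\<^sup>L (M \<bind> \<kappa>) (\<lambda>t. t ^ i) = (\<integral>s. integral\<^sup>L (\<kappa> s) (\<lambda>t. t ^ i) \<partial>M)"
    "f \<in> borel_measurable borel \<Longrightarrow> (\<integral>\<^sup>+t. f t \<partial>(M \<bind> \<kappa>)) = (\<integral>\<^sup>+s. \<integral>\<^sup>+t. f t \<partial>\<kappa> s \<partial>M)"
proof -
  interpret M: prob_space M by fact
  show P: "prob_space (M \<bind> \<kappa>)" by (rule M.prob_space_bind[OF AE_I2[OF pr] \<kappa>])
  then interpret P: prob_space "M \<bind> \<kappa>" .
  have st: "sets (M \<bind> \<kappa>) = sets borel" by (rule sets_bind[OF _ M.not_empty]) (rule supportedD(2)[OF sup])
  have em: "emeasure (M \<bind> \<kappa>) B = (\<integral>\<^sup>+s. emeasure (\<kappa> s) B \<partial>M)" if "B \<in> sets borel" for B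
    by (rule emeasure_bind[OF M.not_empty \<kappa> that])
  have "(\<integral>\<^sup>+s. emeasure (\<kappa> s) (- {-c..c}) \<partial>M) = (\<integral>\<^sup>+s. 0 \<partial>M)"
  proof (rule nn_integral_cong)
    fix s assume s: "s \<in> space M"
    have "AE t in \<kappa> s. t \<notin> - {-c..c}" using supportedD(3)[OF sup[OF s]] by eventually_elim auto
    then have "- {-c..c} \<in> null_sets (\<kappa> s)"
      by (subst AE_iff_null_sets) (simp add: supportedD(2)[OF sup[OF s]])
    then show "emeasure (\<kappa> s) (- {-c..c}) = 0" by blast
  qed
  then have "emeasure (M \<bind> \<kappa>) (- {-c..c}) = 0" using em[of "- {-c..c}"] by simp
  then have "AE t in M \<bind> \<kappa>. \<bar>t\<bar> \<le> c"
    by (intro AE_I[where N="- {-c..c}"]) (auto simp: st abs_le_iff)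
  then show sP: "supported c (M \<bind> \<kappa>)" using st P.finite_measure_axioms by (simp add: supported_def)
  show "measure (M \<bind> \<kappa>) B = (\<integral>s. measure (\<kappa> s) B \<partial>M)" if B: "B \<in> sets borel"
  proof -
    have "(\<lambda>s. measure (\<kappa> s) B) \<in> borel_measurable M"
      by (rule measurable_compose[OF \<kappa> measurable_measure_subprob_algebra[OF B]])
    then have i: "integrable M (\<lambda>s. measure (\<kappa> s) B)"
      using pr by (intro M.integrable_const_bound[where B=1]) (auto simp: prob_space.prob_le_1)
    have "ennreal (measure (M \<bind> \<kappa>) B) = (\<integral>\<^sup>+s. ennreal (measure (\<kappa> s) B) \<partial>M)"
      unfolding P.emeasure_eq_measure[symmetric] em[OF B]
      using finite_measure.emeasure_eq_measure[OF supportedD(1)[OF sup]] by (intro nn_integral_cong) auto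
    also have "\<dots> = ennreal (\<integral>s. measure (\<kappa> s) B \<partial>M)" by (rule nn_integral_eq_integral[OF i]) simp
    finally show ?thesis by (subst (asm) ennreal_inj) (auto intro: integral_nonneg_AE)
  qed
  show "integral\<^sup>L (M \<bind> \<kappa>) (\<lambda>t. t ^ i) = (\<integral>s. integral\<^sup>L (\<kappa> s) (\<lambda>t. t ^ i) \<partial>M)"
  proof -
    \<comment> \<open>Integration against a bind is available for bounded functions, so the power is
      replaced by one that is constant beyond the support.\<close>
    define g where "g t = (max (-\<bar>c\<bar>) (min \<bar>c\<bar> t)) ^ i" for t :: real
    have gm: "g \<in> borel_measurable borel" unfolding g_def by measurable
    have gb: "\<bar>g t\<bar> \<le> \<bar>c\<bar> ^ i" for t unfolding g_def power_abs by (intro power_mono) auto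
    have eq: "integral\<^sup>L \<mu> (\<lambda>t. t ^ i) = integral\<^sup>L \<mu> g" if s: "supported c \<mu>" for \<mu>
    proof (rule integral_cong_AE)
      show "AE t in \<mu>. t ^ i = g t"
        using supportedD(3)[OF s]
      proof eventually_elim
        case (elim t)
        then have "max (-\<bar>c\<bar>) (min \<bar>c\<bar> t) = t" by auto
        then show ?case by (simp add: g_def)
      qed
    qed (auto intro: supported_measurable[OF s] gm)
    have "integral\<^sup>L (M \<bind> \<kappa>) g = (\<integral>s. integral\<^sup>L (\<kappa> s) g \<partial>M)"
    proof (rule integral_bind[OF gm gb \<kappa> M.finite_measure_axioms, where B'=1])
      show "AE s in M. emeasure (\<kappa> s) (space (\<kappa> s)) \<le> ennreal 1"
        using prob_space.emeasure_space_1[OF pr] by (intro AE_I2) simp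
    qed
    also have "\<dots> = (\<integral>s. integral\<^sup>L (\<kappa> s) (\<lambda>t. t ^ i) \<partial>M)"
      by (rule Bochner_Integration.integral_cong) (auto simp: eq[OF sup])
    finally show ?thesis using eq[OF sP] by simp
  qed
  show "f \<in> borel_measurable borel \<Longrightarrow> (\<integral>\<^sup>+t. f t \<partial>(M \<bind> \<kappa>)) = (\<integral>\<^sup>+s. \<integral>\<^sup>+t. f t \<partial>\<kappa> s \<partial>M)"
    by (rule nn_integral_bind[OF _ \<kappa>])
qed

text \<open>The hypothesis makes \<open>F t = C t - cdf \<nu> t\<close> nondecreasing. Its Stieltjes
  measure \<open>G\<close> satisfies \<open>G + \<nu> = C\<close> times Lebesgue measure, first on
  half-open intervals and then on all Borel sets, so \<open>\<nu>\<close> is dominated by a multiple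
  of Lebesgue measure.\<close>

lemma lipschitz_absolutely_continuous:
  assumes fin: "finite_measure \<nu>" and st: "sets \<nu> = sets borel"
    and lip: "\<And>a b. a \<le> b \<Longrightarrow> measure \<nu> {a<..b} \<le> C * (b - a)"
  shows "absolutely_continuous lborel \<nu>"
proof -
  interpret finite_measure \<nu> by fact
  have sp: "space \<nu> = UNIV" using sets_eq_imp_space_eq[OF st] by simp
  interpret finite_borel_measure \<nu> by standard (use st sp in auto)
  have "0 \<le> measure \<nu> {0<..1}" "measure \<nu> {0<..1} \<le> C * (1 - 0)" by (rule measure_nonneg, rule lip) simp
  then have C0: "0 \<le> C" by (metis diff_zero mult.right_neutral order_trans)
  define F where "F t = C * t - cdf \<nu> t" for t
  have mono: "F a \<le> F b" if "a \<le> b" for a b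
    using lip[OF that] cdf_diff_eq[of a b] that by (cases "a = b") (auto simp: F_def algebra_simps)
  have rc: "continuous (at_right a) F" for a
    unfolding F_def by (intro continuous_intros cdf_is_right_cont)
  define G where "G = interval_measure F"
  have sG: "sets G = sets borel" by (simp add: G_def)
  define S where "S = measure_of UNIV (sets borel) (\<lambda>B. emeasure G B + emeasure \<nu> B)"
  have sS: "sets S = sets borel" unfolding S_def by (simp add: sets.sigma_sets_eq[of borel, simplified space_borel])
  have em: "emeasure S B = emeasure G B + emeasure \<nu> B" if "B \<in> sets borel" for B
  proof (rule emeasure_measure_of[OF S_def])
    show "B \<in> sets S" using that sS by simp
    show "countably_additive (sets S) (\<lambda>B. emeasure G B + emeasure \<nu> B)"
    proof (rule countably_additiveI)
      fix B :: "nat \<Rightarrow> real set" assume B: "range B \<subseteq> sets S" "disjoint_family B" "(\<Union>n. B n) \<in> sets S"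
      have "(\<Sum>n. emeasure G (B n) + emeasure \<nu> (B n)) = (\<Sum>n. emeasure G (B n)) + (\<Sum>n. emeasure \<nu> (B n))"
        by (rule suminf_add[symmetric]) auto
      then show "(\<Sum>n. emeasure G (B n) + emeasure \<nu> (B n)) = emeasure G (\<Union>n. B n) + emeasure \<nu> (\<Union>n. B n)"
        using B sS sG st by (simp add: suminf_emeasure)
    qed
  qed (auto simp: positive_def sets.sigma_sets_eq[of borel, simplified space_borel])
  have Ioc: "emeasure S {a<..b} = ennreal (C * (b - a))" if "a \<le> b" for a b
  proof -
    have "emeasure G {a<..b} = ennreal (F b - F a)"
      unfolding G_def by (rule emeasure_interval_measure_Ioc[OF that mono rc])
    moreover have "emeasure \<nu> {a<..b} = ennreal (measure \<nu> {a<..b})" by (rule emeasure_eq_measure)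
    moreover have "F b - F a + measure \<nu> {a<..b} = C * (b - a)"
      using cdf_diff_eq[of a b] that by (cases "a = b") (auto simp: F_def algebra_simps)
    ultimately show ?thesis using em[of "{a<..b}"] mono[OF that] by (simp flip: ennreal_plus)
  qed
  have eq: "S = scale_measure (ennreal C) lborel"
  proof (rule measure_eqI_generator_eq[where \<Omega>=UNIV and E="range (\<lambda>(a, b). {a<..b::real})" and A="\<lambda>i. {- real i<..real i}"])
    show "Int_stable (range (\<lambda>(a, b). {a<..b::real}))"
    proof (rule Int_stableI)
      fix X Y assume "X \<in> range (\<lambda>(a, b). {a<..b::real})" "Y \<in> range (\<lambda>(a, b). {a<..b::real})"
      then obtain a b c d where "X = {a<..b}" "Y = {c<..d}" by auto
      then have "X \<inter> Y = {max a c<..min b d}" by auto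
      then show "X \<inter> Y \<in> range (\<lambda>(a, b). {a<..b::real})" by (auto intro!: image_eqI[of _ _ "(max a c, min b d)"])
    qed
    show "sets S = sigma_sets UNIV (range (\<lambda>(a, b). {a<..b::real}))"
      "sets (scale_measure (ennreal C) lborel) = sigma_sets UNIV (range (\<lambda>(a, b). {a<..b::real}))"
      unfolding sS sets_scale_measure sets_lborel by (subst borel_sigma_sets_Ioc, simp)+
    show "emeasure S X = emeasure (scale_measure (ennreal C) lborel) X" if "X \<in> range (\<lambda>(a, b). {a<..b::real})" for X
    proof -
      obtain a b where X: "X = {a<..b}" using \<open>X \<in> range (\<lambda>(a, b). {a<..b})\<close> by auto
      show ?thesis
      proof (cases "a \<le> b")
        case True then show ?thesis using Ioc[OF True] C0 by (simp add: X ennreal_mult)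
      next
        case False then show ?thesis by (simp add: X)
      qed
    qed
    show "(\<Union>i. {- real i<..real i}) = UNIV"
    proof (intro equalityI subsetI UNIV_I)
      fix x :: real
      obtain n where "\<bar>x\<bar> < real n" using reals_Archimedean2 by blast
      then show "x \<in> (\<Union>i. {- real i<..real i})" by (intro UN_I[of n]) auto
    qed
    show "emeasure S {- real i<..real i} \<noteq> \<infinity>" for i using Ioc[of "- real i" "real i"] by simp
  qed auto
  show ?thesis unfolding absolutely_continuous_def
  proof
    fix B :: "real set" assume "B \<in> null_sets lborel"
    then have B: "B \<in> sets borel" "emeasure lborel B = 0" by auto
    then have "emeasure S B = 0" by (simp add: eq)
    then have "emeasure \<nu> B = 0" using em[OF B(1)] by simp
    then show "B \<in> null_sets \<nu>" using B st by auto
  qed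
qed

text \<open>The kernel is centred at the midpoint with \<open>\<epsilon> = b - a\<close>. On the
  interval the distance to the centre is at most \<open>\<epsilon> / 2\<close>, so the denominator
  is at most \<open>5 / 4\<close> of \<open>\<epsilon>^2\<close>, which explains the
  constant.\<close>

lemma poisson_bound_interval:
  assumes fin: "finite_measure \<nu>" and st: "sets \<nu> = sets borel" and C: "0 \<le> C"
    and P: "\<And>e \<epsilon>. 0 < \<epsilon> \<Longrightarrow> (\<integral>\<^sup>+u. ennreal (poisson e \<epsilon> u) \<partial>\<nu>) \<le> ennreal C"
    and ab: "a \<le> b"
  shows "measure \<nu> {a<..b} \<le> 5 / 4 * C * (b - a)"
proof (cases "a = b")
  case False
  interpret finite_measure \<nu> by fact
  define \<epsilon> e where "\<epsilon> = b - a" and "e = (a + b) / 2"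
  have \<epsilon>: "0 < \<epsilon>" using False ab by (simp add: \<epsilon>_def)
  have low: "4 / (5 * \<epsilon>) \<le> poisson e \<epsilon> u" if u: "u \<in> {a<..b}" for u
  proof -
    have "\<bar>u - e\<bar> \<le> \<epsilon> / 2" using u by (auto simp: e_def \<epsilon>_def abs_le_iff field_simps)
    then have "(u - e)\<^sup>2 \<le> (\<epsilon> / 2)\<^sup>2" using \<epsilon> by (simp add: abs_le_square_iff[symmetric])
    then have l: "(u - e)\<^sup>2 + \<epsilon>\<^sup>2 \<le> 5 / 4 * \<epsilon>\<^sup>2" by (simp add: power2_eq_square)
    have p: "0 < (u - e)\<^sup>2 + \<epsilon>\<^sup>2" using \<epsilon> by (simp add: add_nonneg_pos)
    have "\<epsilon> / (5 / 4 * \<epsilon>\<^sup>2) \<le> \<epsilon> / ((u - e)\<^sup>2 + \<epsilon>\<^sup>2)" using l p \<epsilon> by (intro divide_left_mono) auto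
    then show ?thesis using \<epsilon> by (simp add: poisson_def power2_eq_square)
  qed
  have "ennreal (4 / (5 * \<epsilon>) * measure \<nu> {a<..b}) = ennreal (4 / (5 * \<epsilon>)) * emeasure \<nu> {a<..b}"
    unfolding emeasure_eq_measure by (rule ennreal_mult) (use \<epsilon> in auto)
  also have "\<dots> = (\<integral>\<^sup>+u. ennreal (4 / (5 * \<epsilon>)) * indicator {a<..b} u \<partial>\<nu>)"
    by (rule nn_integral_cmult_indicator[symmetric]) (simp add: st)
  also have "\<dots> \<le> (\<integral>\<^sup>+u. ennreal (poisson e \<epsilon> u) \<partial>\<nu>)"
  proof (rule nn_integral_mono)
    fix u
    show "ennreal (4 / (5 * \<epsilon>)) * indicator {a<..b} u \<le> ennreal (poisson e \<epsilon> u)"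
    proof (cases "u \<in> {a<..b}")
      case True then show ?thesis using ennreal_leI[OF low[OF True]] by simp
    qed simp
  qed
  also have "\<dots> \<le> ennreal C" by (rule P[OF \<epsilon>])
  finally have "4 / (5 * \<epsilon>) * measure \<nu> {a<..b} \<le> C" using C by (simp add: ennreal_le_iff)
  then show ?thesis using \<epsilon> by (simp add: \<epsilon>_def[symmetric] field_simps)
qed simp

context layered
begin

lemma hop_sa:
  assumes om: "\<And>y. y \<in> V \<Longrightarrow> \<bar>om (block m0 y)\<bar> \<le> R" and lam: "0 < lam" and R: "0 \<le> R"
    and c: "real (K + 2) + lam * R \<le> c" "0 < c"
  shows "bounded_sa V (hop m0 lam om) c"
  unfolding hop_def
proof (rule gop_bounded_sa[where b="lam * R"])
  show "\<bar>lam * om (block m0 x)\<bar> \<le> lam * R" if "x \<in> V" for x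
    using om[OF that] lam by (simp add: abs_mult)
  show "real (K + 2) + max 0 (lam * R) \<le> c" using c(1) lam R by simp
qed (rule c)

lemma hop_cong:
  assumes "\<And>y. y \<in> V \<Longrightarrow> om (block m0 y) = om' (block m0 y)"
  shows "hop m0 lam om = hop m0 lam om'"
  using assms by (auto simp: hop_def gop_def fun_eq_iff)

definition site_measure :: "nat \<Rightarrow> real \<Rightarrow> real \<Rightarrow> ('v \<Rightarrow> real) \<Rightarrow> 'v \<Rightarrow> real measure" where
  "site_measure m0 lam c om x = bounded_sa.vec_measure (hop m0 lam om) c (delta x)"

lemma site_measure:
  assumes om: "\<And>y. y \<in> V \<Longrightarrow> \<bar>om (block m0 y)\<bar> \<le> R" and lam: "0 < lam" and R: "0 \<le> R"
    and c: "real (K + 2) + lam * R \<le> c" "0 < c" and x: "x \<in> V"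
  shows "prob_space (site_measure m0 lam c om x)" "supported c (site_measure m0 lam c om x)"
    "integral\<^sup>L (site_measure m0 lam c om x) (\<lambda>u. u ^ p) = Re (mom m0 lam om x p x)"
    "B \<in> sets borel \<Longrightarrow> Re (ell2_inner (delta x) (spectral_projection V (hop m0 lam om) B (delta x)))
      = measure (site_measure m0 lam c om x) B"
    "\<bar>Re (mom m0 lam om x p x)\<bar> \<le> c ^ p"
proof -
  interpret A: bounded_sa V "hop m0 lam om" c by (rule hop_sa[where R=R]) (use om lam R c in auto)
  have d: "delta x \<in> ell2 V" by (rule delta_ell2[OF x])
  note s = A.vec_measure(1)[OF d]
  show P: "prob_space (site_measure m0 lam c om x)" unfolding site_measure_def
    using supportedD(4)[OF s] A.vec_measure_mass[OF d] finite_measure.emeasure_eq_measure[OF supportedD(1)[OF s], of UNIV]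
    by (intro prob_spaceI) simp
  show S: "supported c (site_measure m0 lam c om x)" unfolding site_measure_def by (rule s)
  show M: "integral\<^sup>L (site_measure m0 lam c om x) (\<lambda>u. u ^ p) = Re (mom m0 lam om x p x)"
    unfolding site_measure_def A.vec_measure_moment[OF d] mom_def by (simp add: inner_delta)
  show "Re (ell2_inner (delta x) (spectral_projection V (hop m0 lam om) B (delta x))) = measure (site_measure m0 lam c om x) B"
    if "B \<in> sets borel" unfolding site_measure_def by (rule A.spectral_projection_measure[OF d that])
  interpret P: prob_space "site_measure m0 lam c om x" by (rule P)
  have "\<bar>integral\<^sup>L (site_measure m0 lam c om x) (\<lambda>u. u ^ p)\<bar> \<le> integral\<^sup>L (site_measure m0 lam c om x) (\<lambda>u. \<bar>u ^ p\<bar>)"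
    by (rule integral_abs_bound)
  also have "\<dots> \<le> integral\<^sup>L (site_measure m0 lam c om x) (\<lambda>u. c ^ p)"
  proof (rule integral_mono_AE)
    show "integrable (site_measure m0 lam c om x) (\<lambda>u. \<bar>u ^ p\<bar>)"
      by (rule supported_integrable_cont[OF S]) (intro continuous_intros)
    show "AE u in site_measure m0 lam c om x. \<bar>u ^ p\<bar> \<le> c ^ p"
      using supportedD(3)[OF S] by eventually_elim (simp add: power_abs power_mono)
  qed simp
  also have "\<dots> = c ^ p" using P.prob_space by simp
  finally show "\<bar>Re (mom m0 lam om x p x)\<bar> \<le> c ^ p" by (simp only: M)
qed

lemma mom_measurable:
  assumes "\<And>y. y \<in> V \<Longrightarrow> (\<lambda>s. om s (block m0 y)) \<in> borel_measurable M"
  shows "(\<lambda>s. mom m0 lam (om s) x q y) \<in> borel_measurable M"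
proof (induction q arbitrary: y)
  case 0 then show ?case by (simp add: mom_def)
next
  case (Suc q)
  show ?case
  proof (cases "y \<in> V")
    case True
    have "(\<lambda>s. mom m0 lam (om s) x (Suc q) y) =
      (\<lambda>s. (\<Sum>w\<in>nb y. mom m0 lam (om s) x q w) + complex_of_real (lam * om s (block m0 y)) * mom m0 lam (om s) x q y)"
      using True by (simp add: mom_def hop_def gop_def fun_eq_iff)
    moreover have "(\<lambda>s. complex_of_real (lam * om s (block m0 y))) \<in> borel_measurable M"
      using assms[OF True] by measurable
    ultimately show ?thesis using Suc by simp
  next
    case False
    then have "(\<lambda>s. mom m0 lam (om s) x (Suc q) y) = (\<lambda>s. 0)" by (simp add: mom_def hop_def gop_def fun_eq_iff)
    then show ?thesis by simp
  qed
qed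

end

section \<open>Independent variables and cut-off spectral measures\<close>

locale iid_field = prob_space M for M :: "'a measure" +
  fixes \<rho> :: "real \<Rightarrow> real" and R c\<rho> :: real and \<omega> :: "'v \<Rightarrow> 'a \<Rightarrow> real" and J :: "'v set"
  assumes rho_measurable [measurable]: "\<rho> \<in> borel_measurable borel"
    and rho_nonneg: "AE t in lborel. 0 \<le> \<rho> t"
    and rho_bound: "AE t in lborel. \<rho> t \<le> c\<rho>"
    and rho_supp: "AE t in lborel. R < \<bar>t\<bar> \<longrightarrow> \<rho> t = 0"
    and R_pos: "0 < R" and c\<rho>_nonneg: "0 \<le> c\<rho>"
    and indep: "indep_vars (\<lambda>_. borel) \<omega> J"
    and distr: "y \<in> J \<Longrightarrow> distributed M lborel (\<omega> y) (\<lambda>t. ennreal (\<rho> t))"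
    and countable_J: "countable J"
begin

definition D :: "real measure" where "D = density lborel (\<lambda>t. ennreal (\<rho> t))"

lemma sets_D [measurable_cong, simp]: "sets D = sets borel"
  by (simp add: D_def)

lemma om_measurable [measurable]: "y \<in> J \<Longrightarrow> \<omega> y \<in> borel_measurable M"
  using distributed_measurable[OF distr] by simp

lemma distr_om: "y \<in> J \<Longrightarrow> distr M borel (\<omega> y) = D"
  using distributed_distr_eq_density[OF distr] distr_cong[of M M lborel borel "\<omega> y" "\<omega> y"] by (simp add: D_def)

lemma prob_space_D: "J \<noteq> {} \<Longrightarrow> prob_space D"
  using distr_om prob_space_distr[OF om_measurable] by (metis ex_in_conv)

lemma AE_D: "AE t in D. \<bar>t\<bar> \<le> R"
  unfolding D_def using rho_supp by (subst AE_density) (auto elim!: eventually_mono)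

lemma AE_bounded: "AE s in M. \<forall>y\<in>J. \<bar>\<omega> y s\<bar> \<le> R"
proof (rule AE_ball_countable'[OF _ countable_J])
  fix y assume y: "y \<in> J"
  have "AE t in distr M borel (\<omega> y). \<bar>t\<bar> \<le> R" unfolding distr_om[OF y] by (rule AE_D)
  then show "AE s in M. \<bar>\<omega> y s\<bar> \<le> R" using y by (subst (asm) AE_distr_iff) auto
qed

lemma law:
  assumes "A \<subseteq> J" "A \<noteq> {}"
  shows "distr M (PiM A (\<lambda>_. borel)) (\<lambda>s. \<lambda>y\<in>A. \<omega> y s) = PiM A (\<lambda>_. D)"
proof -
  have "indep_vars (\<lambda>_. borel) \<omega> A" by (rule indep_vars_subset[OF indep assms(1)])
  then have "distr M (PiM A (\<lambda>_. borel)) (\<lambda>s. \<lambda>y\<in>A. \<omega> y s) = PiM A (\<lambda>y. distr M borel (\<omega> y))"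
    using indep_vars_iff_distr_eq_PiM'[OF assms(2), where M'="\<lambda>_. borel" and X=\<omega>, OF om_measurable[OF subsetD[OF assms(1)]]]
    by simp
  also have "\<dots> = PiM A (\<lambda>_. D)" using assms(1) by (intro PiM_cong) (auto simp: distr_om)
  finally show ?thesis .
qed

end

text \<open>
  The random variables are bounded only almost surely. Cutting them off gives operators with a
  common norm bound everywhere without changing the spectral measures on an event of probability one.
\<close>
definition clamp :: "real \<Rightarrow> real \<Rightarrow> real" where
  "clamp B t = max (- B) (min B t)"

lemma abs_clamp_le: "0 \<le> B \<Longrightarrow> \<bar>clamp B t\<bar> \<le> B"
  by (auto simp: clamp_def)

lemma clamp_id: "\<bar>t\<bar> \<le> B \<Longrightarrow> clamp B t = t"
  by (auto simp: clamp_def)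

lemma clamp_measurable [measurable]: "clamp B \<in> borel_measurable borel"
  unfolding clamp_def by measurable

context layered
begin

text \<open>The constant dominates the degree bound \<open>K + 2\<close> plus the largest potential
  \<open>lam * B\<close>. It involves neither the tree nor the outcome, so the measures of all balls
  and of the canopy tree share one support.\<close>

definition cutoff_measure :: "nat \<Rightarrow> real \<Rightarrow> real \<Rightarrow> ('v \<Rightarrow> real) \<Rightarrow> 'v \<Rightarrow> real measure" where
  "cutoff_measure m0 lam B om x = site_measure m0 lam (real (K + 2) + lam * B + 1) (\<lambda>y. clamp B (om y)) x"

lemma cutoff_measure:
  assumes lam: "0 < lam" and B: "0 \<le> B" and x: "x \<in> V"
  shows "prob_space (cutoff_measure m0 lam B om x)"
    "supported (real (K + 2) + lam * B + 1) (cutoff_measure m0 lam B om x)"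
    "integral\<^sup>L (cutoff_measure m0 lam B om x) (\<lambda>u. u ^ p) = Re (mom m0 lam (\<lambda>y. clamp B (om y)) x p x)"
    "\<bar>Re (mom m0 lam (\<lambda>y. clamp B (om y)) x p x)\<bar> \<le> (real (K + 2) + lam * B + 1) ^ p"
proof -
  have l: "0 \<le> lam * B" using lam B by simp
  have c: "real (K + 2) + lam * B \<le> real (K + 2) + lam * B + 1" "0 < real (K + 2) + lam * B + 1" using l by linarith+
  note s = site_measure[where om="\<lambda>y. clamp B (om y)", OF abs_clamp_le[OF B] lam B c x]
  show "prob_space (cutoff_measure m0 lam B om x)"
    "supported (real (K + 2) + lam * B + 1) (cutoff_measure m0 lam B om x)"
    "integral\<^sup>L (cutoff_measure m0 lam B om x) (\<lambda>u. u ^ p) = Re (mom m0 lam (\<lambda>y. clamp B (om y)) x p x)"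
    unfolding cutoff_measure_def by (rule s)+
  show "\<bar>Re (mom m0 lam (\<lambda>y. clamp B (om y)) x p x)\<bar> \<le> (real (K + 2) + lam * B + 1) ^ p" by (rule s)
qed

lemma cutoff_measure_spectral:
  assumes lam: "0 < lam" and B: "0 \<le> B" and x: "x \<in> V" and S: "S \<in> sets borel"
    and om: "\<forall>y\<in>V. \<bar>om (block m0 y)\<bar> \<le> B"
  shows "Re (ell2_inner (delta x) (spectral_projection V (hop m0 lam om) S (delta x)))
    = measure (cutoff_measure m0 lam B om x) S"
proof -
  have l: "0 \<le> lam * B" using lam B by simp
  have c: "real (K + 2) + lam * B \<le> real (K + 2) + lam * B + 1" "0 < real (K + 2) + lam * B + 1" using l by linarith+
  have "hop m0 lam om = hop m0 lam (\<lambda>y. clamp B (om y))" by (rule hop_cong) (use om in \<open>auto simp: clamp_id\<close>)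
  then show ?thesis
    using site_measure(4)[where om="\<lambda>y. clamp B (om y)", OF abs_clamp_le[OF B] lam B c x S] by (simp add: cutoff_measure_def)
qed

lemma cutoff_measure_cong:
  assumes "\<And>y. y \<in> V \<Longrightarrow> om (block m0 y) = om' (block m0 y)"
  shows "cutoff_measure m0 lam B om x = cutoff_measure m0 lam B om' x"
  unfolding cutoff_measure_def site_measure_def
  by (rule arg_cong[where f="\<lambda>A. bounded_sa.vec_measure A _ _"], rule hop_cong) (simp add: assms)

lemma cutoff_measure_measurable:
  assumes lam: "0 < lam" and B: "0 \<le> B" and x: "x \<in> V"
    and om: "\<And>y. y \<in> V \<Longrightarrow> (\<lambda>s. om s (block m0 y)) \<in> borel_measurable M"
  shows "(\<lambda>s. cutoff_measure m0 lam B (om s) x) \<in> measurable M (subprob_algebra borel)"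
proof (rule kernel_measurable[where c="real (K + 2) + lam * B + 1"])
  show "(\<lambda>s. integral\<^sup>L (cutoff_measure m0 lam B (om s) x) (\<lambda>t. t ^ i)) \<in> borel_measurable M" for i
    unfolding cutoff_measure(3)[OF lam B x]
    by (intro measurable_compose[OF mom_measurable borel_measurable_Re] measurable_compose[OF om clamp_measurable])
qed (rule cutoff_measure[OF lam B x])+

end

locale random_layered = layered K V h par T + iid_field M \<rho> R c\<rho> \<omega> J
  for K :: nat and V :: "'v set" and h par T and M :: "'a measure" and \<rho> R c\<rho> and \<omega> :: "'v \<Rightarrow> 'a \<Rightarrow> real" and J +
  fixes m0 :: nat and lam :: real
  assumes lam: "0 < lam" and block_J: "x \<in> V \<Longrightarrow> block m0 x \<in> J"
begin

lemma two_R_nonneg: "0 \<le> 2 * R" using R_pos by simp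

text \<open>The cut-off at \<open>2 R\<close> instead of \<open>R\<close> leaves room for averaging over a coupling in \<open>[-2 R, 2 R]\<close>.\<close>
abbreviation cutoff :: "'a \<Rightarrow> 'v \<Rightarrow> real measure" where
  "cutoff s x \<equiv> cutoff_measure m0 lam (2 * R) (\<lambda>y. \<omega> y s) x"

abbreviation norm_bound :: real where
  "norm_bound \<equiv> real (K + 2) + lam * (2 * R) + 1"

lemmas cutoff_prob = cutoff_measure(1)[OF lam two_R_nonneg]
  and cutoff_supported = cutoff_measure(2)[OF lam two_R_nonneg]
  and cutoff_moment = cutoff_measure(3)[OF lam two_R_nonneg]
  and cutoff_moment_bound = cutoff_measure(4)[OF lam two_R_nonneg]

lemma cutoff_measurable: "x \<in> V \<Longrightarrow> (\<lambda>s. cutoff s x) \<in> measurable M (subprob_algebra borel)"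
  by (rule cutoff_measure_measurable[OF lam two_R_nonneg]) (auto intro: om_measurable block_J)

lemma cutoff_spectral:
  "AE s in M. \<forall>x\<in>V. \<forall>S\<in>sets borel. Re (ell2_inner (delta x) (spectral_projection V (hop m0 lam (\<lambda>y. \<omega> y s)) S (delta x)))
    = measure (cutoff s x) S"
  using AE_bounded
proof eventually_elim
  case (elim s)
  have "\<bar>\<omega> (block m0 y) s\<bar> \<le> 2 * R" if "y \<in> V" for y
    using bspec[OF elim block_J[OF that]] R_pos by simp
  then show ?case by (auto intro: cutoff_measure_spectral[OF lam two_R_nonneg])
qed

text \<open>
  The random variables are unbounded on a null set, which may be nonempty. There
  \<^const>\<open>spectral_projection\<close> is an arbitrary constant; elsewhere it is the limit of cut-off versions.
\<close>
lemma spectral_measurable: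
  assumes x: "x \<in> V" and S: "S \<in> sets borel"
  shows "(\<lambda>s. Re (ell2_inner (delta x) (spectral_projection V (hop m0 lam (\<lambda>y. \<omega> y s)) S (delta x)))) \<in> borel_measurable M"
proof -
  define F where "F s = Re (ell2_inner (delta x) (spectral_projection V (hop m0 lam (\<lambda>y. \<omega> y s)) S (delta x)))" for s
  define a where "a = Re (ell2_inner (delta x) ((SOME E :: real set \<Rightarrow> 'v operator. False) S (delta x)))"
  define G where "G = {s \<in> space M. \<exists>n::nat. \<forall>y\<in>block m0 ` V. \<bar>\<omega> y s\<bar> \<le> real n}"
  have sub: "block m0 ` V \<subseteq> J" using block_J by auto
  have G: "G \<in> sets M" unfolding G_def
  proof (rule sets.sets_Collect_countable_Ex)
    fix n :: nat
    have "space M - (\<Union>y\<in>block m0 ` V. {s \<in> space M. \<not> \<bar>\<omega> y s\<bar> \<le> real n}) \<in> sets M"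
    proof (intro sets.compl_sets sets.countable_UN'')
      show "countable (block m0 ` V)" by (rule countable_subset[OF sub countable_J])
      show "{s \<in> space M. \<not> \<bar>\<omega> y s\<bar> \<le> real n} \<in> sets M" if "y \<in> block m0 ` V" for y
        using om_measurable[OF subsetD[OF sub that]] by measurable
    qed
    moreover have "{s \<in> space M. \<forall>y\<in>block m0 ` V. \<bar>\<omega> y s\<bar> \<le> real n}
        = space M - (\<Union>y\<in>block m0 ` V. {s \<in> space M. \<not> \<bar>\<omega> y s\<bar> \<le> real n})"
      by blast
    ultimately show "{s \<in> space M. \<forall>y\<in>block m0 ` V. \<bar>\<omega> y s\<bar> \<le> real n} \<in> sets M" by simp
  qed
  have Fin: "(\<lambda>n. measure (cutoff_measure m0 lam (real n) (\<lambda>y. \<omega> y s) x) S) \<longlonglongrightarrow> F s" if s: "s \<in> G" for s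
  proof -
    obtain n0 :: nat where n0: "\<forall>y\<in>block m0 ` V. \<bar>\<omega> y s\<bar> \<le> real n0" using s by (auto simp: G_def)
    have "F s = measure (cutoff_measure m0 lam (real n) (\<lambda>y. \<omega> y s) x) S" if n: "n0 \<le> n" for n
      unfolding F_def
    proof (rule cutoff_measure_spectral[OF lam _ x S])
      show "\<forall>y\<in>V. \<bar>\<omega> (block m0 y) s\<bar> \<le> real n"
      proof
        fix y assume "y \<in> V"
        then have "\<bar>\<omega> (block m0 y) s\<bar> \<le> real n0" using n0 by blast
        then show "\<bar>\<omega> (block m0 y) s\<bar> \<le> real n" using n by linarith
      qed
    qed simp
    then show ?thesis by (intro tendsto_eventually eventually_sequentiallyI[of n0]) simp
  qed
  \<comment> \<open>For an unbounded potential the predicate under the choice operator is false for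
    every \<open>E\<close>, so the choice is the same at all these outcomes.\<close>
  have Fout: "F s = a" if s: "s \<in> space M" "s \<notin> G" for s
  proof -
    have "\<not> bounded_self_adjoint_on V (hop m0 lam (\<lambda>y. \<omega> y s))"
    proof
      assume "bounded_self_adjoint_on V (hop m0 lam (\<lambda>y. \<omega> y s))"
      then obtain b where b: "\<forall>x\<in>V. \<bar>lam * \<omega> (block m0 x) s\<bar> \<le> b"
        unfolding hop_def using gop_unbounded[of "\<lambda>x. lam * \<omega> (block m0 x) s"] nb_irrefl by auto
      obtain n :: nat where n: "b / lam \<le> real n" using real_arch_simple by blast
      have "\<forall>y\<in>block m0 ` V. \<bar>\<omega> y s\<bar> \<le> real n"
      proof
        fix y assume "y \<in> block m0 ` V"
        then have "lam * \<bar>\<omega> y s\<bar> \<le> b" using b lam by (auto simp: abs_mult)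
        then have "\<bar>\<omega> y s\<bar> \<le> b / lam" using lam by (simp add: field_simps)
        then show "\<bar>\<omega> y s\<bar> \<le> real n" using n by linarith
      qed
      then show False using s by (auto simp: G_def)
    qed
    then show ?thesis by (simp add: F_def a_def spectral_projection_def)
  qed
  define F' where "F' s = (if s \<in> G then lim (\<lambda>n. measure (cutoff_measure m0 lam (real n) (\<lambda>y. \<omega> y s) x) S) else a)" for s
  have "(\<lambda>s. measure (cutoff_measure m0 lam (real n) (\<lambda>y. \<omega> y s) x) S) \<in> borel_measurable M" for n :: nat
    by (rule measurable_compose[OF cutoff_measure_measurable[OF lam _ x] measurable_measure_subprob_algebra[OF S]])
       (auto intro: om_measurable block_J)
  then have "(\<lambda>s. lim (\<lambda>n. measure (cutoff_measure m0 lam (real n) (\<lambda>y. \<omega> y s) x) S)) \<in> borel_measurable M"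
    by (rule borel_measurable_lim_metric)
  then have "F' \<in> borel_measurable M"
    unfolding F'_def using G by (intro measurable_If_set) auto
  moreover have "F s = F' s" if "s \<in> space M" for s
    using limI[OF Fin, of s] Fout[OF that] by (auto simp: F'_def)
  ultimately have "F \<in> borel_measurable M" by (subst measurable_cong)
  then show ?thesis by (simp add: F_def[abs_def])
qed

lemma cutoff_integral:
  assumes x: "x \<in> V" and S: "S \<in> sets borel"
  shows "(\<integral>s. Re (ell2_inner (delta x) (spectral_projection V (hop m0 lam (\<lambda>y. \<omega> y s)) S (delta x))) \<partial>M)
    = (\<integral>s. measure (cutoff s x) S \<partial>M)"
proof (rule integral_cong_AE[OF spectral_measurable[OF assms]])
  show "(\<lambda>s. measure (cutoff s x) S) \<in> borel_measurable M"
    by (rule measurable_compose[OF cutoff_measurable[OF x] measurable_measure_subprob_algebra[OF S]])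
qed (use cutoff_spectral x S in \<open>auto elim!: eventually_mono\<close>)

text \<open>All variables except the one of the block of \<open>x\<close> are frozen. The density of
  the remaining one is at most \<open>c\<rho>\<close> and lives on [-R, R], so its expectation is
  bounded by \<open>c\<rho>\<close> times the Lebesgue average of \<open>spectral_averaging\<close>.
  That theorem looks at couplings up to \<open>2 R\<close>, which the cut-off leaves
  unchanged.\<close>

lemma density_of_states_bound:
  assumes x: "x \<in> V" and \<epsilon>: "0 < \<epsilon>"
  shows "(\<integral>\<^sup>+s. \<integral>\<^sup>+u. ennreal (poisson e \<epsilon> u) \<partial>cutoff s x \<partial>M) \<le> ennreal (c\<rho> * (8 * pi / (3 * lam)))"
proof -
  define j0 where "j0 = block m0 x"
  define I where "I = J - {j0}"
  have j0: "j0 \<in> J" using block_J[OF x] by (simp add: j0_def)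
  then have J: "J = insert j0 I" "J \<noteq> {}" "j0 \<notin> I" by (auto simp: I_def)
  note pD = prob_space_D[OF J(2)]
  interpret D: prob_space D by (rule pD)
  interpret PI: prob_space "PiM I (\<lambda>_. D)" by (rule prob_space_PiM) (rule pD)
  define g where "g X = (\<integral>\<^sup>+u. ennreal (poisson e \<epsilon> u) \<partial>cutoff_measure m0 lam (2 * R) X x)" for X
  have pm: "(\<lambda>u. ennreal (poisson e \<epsilon> u)) \<in> borel_measurable borel"
    using borel_measurable_continuous_onI[OF poisson_continuous[OF \<epsilon>]] by measurable
  have gJ: "g \<in> borel_measurable (PiM J (\<lambda>_. D))" unfolding g_def
  proof (rule measurable_compose[OF cutoff_measure_measurable[OF lam two_R_nonneg x] nn_integral_measurable_subprob_algebra[OF pm]])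
    show "(\<lambda>s. s (block m0 y)) \<in> borel_measurable (PiM J (\<lambda>_. D))" if "y \<in> V" for y
      using measurable_component_singleton[OF block_J[OF that], of "\<lambda>_. D"] by (simp add: measurable_cong_sets[OF refl sets_D])
  qed
  have upd: "(\<lambda>(t, X). X(j0 := t)) \<in> measurable (D \<Otimes>\<^sub>M PiM I (\<lambda>_. D)) (PiM J (\<lambda>_. D))"
    unfolding J(1) by measurable
  have "(\<integral>\<^sup>+s. g (\<lambda>y. \<omega> y s) \<partial>M) = (\<integral>\<^sup>+s. g (\<lambda>y\<in>J. \<omega> y s) \<partial>M)"
    unfolding g_def by (intro nn_integral_cong arg_cong2[where f="nn_integral"] cutoff_measure_cong) (auto simp: block_J)
  also have "\<dots> = (\<integral>\<^sup>+X. g X \<partial>distr M (PiM J (\<lambda>_. borel)) (\<lambda>s. \<lambda>y\<in>J. \<omega> y s))"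
  proof (rule nn_integral_distr[symmetric])
    show "(\<lambda>s. \<lambda>y\<in>J. \<omega> y s) \<in> measurable M (PiM J (\<lambda>_. borel))" by (intro measurable_restrict om_measurable)
    show "g \<in> borel_measurable (distr M (PiM J (\<lambda>_. borel)) (\<lambda>s. \<lambda>y\<in>J. \<omega> y s))" using gJ by (simp add: measurable_cong_sets[OF sets_PiM_cong[OF refl sets_D] refl])
  qed
  also have "\<dots> = (\<integral>\<^sup>+X. g X \<partial>PiM J (\<lambda>_. D))" by (simp only: law[OF subset_refl J(2)])
  also have "\<dots> = (\<integral>\<^sup>+X. g X \<partial>distr (D \<Otimes>\<^sub>M PiM I (\<lambda>_. D)) (PiM J (\<lambda>_. D)) (\<lambda>(t, X). X(j0 := t)))"
    unfolding J(1) by (subst distr_pair_PiM_eq_PiM) (rule pD refl)+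
  also have "\<dots> = (\<integral>\<^sup>+p. g ((\<lambda>(t, X). X(j0 := t)) p) \<partial>(D \<Otimes>\<^sub>M PiM I (\<lambda>_. D)))"
    by (rule nn_integral_distr[OF upd]) (use gJ in simp)
  also have "\<dots> = (\<integral>\<^sup>+X. \<integral>\<^sup>+t. g (X(j0 := t)) \<partial>D \<partial>PiM I (\<lambda>_. D))"
  proof -
    interpret pair_sigma_finite D "PiM I (\<lambda>_. D)" ..
    show ?thesis using nn_integral_snd[OF measurable_compose[OF upd gJ]] by simp
  qed
  also have "\<dots> \<le> (\<integral>\<^sup>+X. ennreal (c\<rho> * (8 * pi / (3 * lam))) \<partial>PiM I (\<lambda>_. D))"
  proof (rule nn_integral_mono)
    fix X assume X: "X \<in> space (PiM I (\<lambda>_. D))"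
    define \<mu> where "\<mu> t = cutoff_measure m0 lam (2 * R) (X(j0 := t)) x" for t
    define W where "W = {y \<in> V. block m0 y = j0}"
    \<comment> \<open>The background potential with the block of \<open>x\<close> erased; its
      variable returns as the coupling \<open>t\<close> of \<open>block_potential\<close>.\<close>
    define v where "v y = (if y \<in> W then 0 else lam * clamp (2 * R) (X (block m0 y)))" for y
    have gm: "(\<lambda>t. g (X(j0 := t))) \<in> borel_measurable D"
      using measurable_compose[OF measurable_compose[OF measurable_Pair2'[OF X] upd] gJ] by simp
    have g: "g (X(j0 := t)) = ennreal (integral\<^sup>L (\<mu> t) (poisson e \<epsilon>))" for t
      unfolding g_def \<mu>_def
      by (rule nn_integral_eq_integral[OF supported_integrable_cont[OF cutoff_supported[OF x] poisson_continuous[OF \<epsilon>]]])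
         (use poisson_nonneg[OF \<epsilon>] in auto)
    have "(\<integral>\<^sup>+t. g (X(j0 := t)) \<partial>D) = (\<integral>\<^sup>+t. ennreal (\<rho> t) * g (X(j0 := t)) \<partial>lborel)"
      unfolding D_def using gm by (intro nn_integral_density) auto
    also have "\<dots> \<le> (\<integral>\<^sup>+t. ennreal c\<rho> * (indicator {-R..R} t * g (X(j0 := t))) \<partial>lborel)"
    proof (rule nn_integral_mono_AE)
      show "AE t in lborel. ennreal (\<rho> t) * g (X(j0 := t)) \<le> ennreal c\<rho> * (indicator {-R..R} t * g (X(j0 := t)))"
        using rho_supp rho_bound
      proof eventually_elim
        case (elim t)
        show ?case
        proof (cases "\<bar>t\<bar> \<le> R")
          case True
          then show ?thesis using elim(2) by (auto simp: abs_le_iff indicator_def intro!: mult_right_mono ennreal_leI)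
        next
          case False then show ?thesis using elim(1) by simp
        qed
      qed
    qed
    also have "\<dots> = ennreal c\<rho> * (\<integral>\<^sup>+t. indicator {-R..R} t * g (X(j0 := t)) \<partial>lborel)"
      using gm by (intro nn_integral_cmult) auto
    also have "\<dots> \<le> ennreal c\<rho> * ennreal (8 * pi / (3 * lam))"
      unfolding g
    proof (rule mult_left_mono[OF spectral_averaging[where v=v and W=W and b="lam * (2 * R)"] zero_le])
      show "\<forall>y\<in>V. \<bar>v y\<bar> \<le> lam * (2 * R)" using abs_clamp_le[OF two_R_nonneg] lam R_pos by (simp add: v_def abs_mult)
      show "0 \<le> lam * (2 * R)" using lam R_pos by simp
      show "x \<in> W" using x by (simp add: W_def j0_def)
      show "supported norm_bound (\<mu> s)" for s unfolding \<mu>_def by (rule cutoff_supported[OF x])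
      fix s :: real and p assume s: "\<bar>s\<bar> \<le> 2 * R"
      have "hop m0 lam (\<lambda>y. clamp (2 * R) ((X(j0 := s)) y)) = gop V nb (\<lambda>y. complex_of_real (block_potential v lam W s y))"
        using clamp_id[OF s] by (auto simp: hop_def gop_def fun_eq_iff block_potential_def v_def W_def)
      then show "integral\<^sup>L (\<mu> s) (\<lambda>u. u ^ p)
          = Re (((gop V nb (\<lambda>y. complex_of_real (block_potential v lam W s y))) ^^ p) (delta x) x)"
        unfolding \<mu>_def cutoff_moment[OF x] mom_def by simp
    qed (use lam R_pos \<epsilon> x in auto)
    finally show "(\<integral>\<^sup>+t. g (X(j0 := t)) \<partial>D) \<le> ennreal (c\<rho> * (8 * pi / (3 * lam)))"
      by (subst ennreal_mult) (use c\<rho>_nonneg lam in auto)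
  qed
  also have "\<dots> = ennreal (c\<rho> * (8 * pi / (3 * lam)))" using PI.emeasure_space_1 by simp
  finally show ?thesis by (simp add: g_def)
qed

end

lemma integral_pmf_nat:
  fixes q :: "nat pmf" and f :: "nat \<Rightarrow> real"
  assumes f: "\<And>n. \<bar>f n\<bar> \<le> B"
  shows "(\<integral>n. f n \<partial>measure_pmf q) = (\<Sum>n. pmf q n * f n)"
proof -
  have "integrable (measure_pmf q) f"
    by (rule measure_pmf.integrable_const_bound[where B=B]) (use f in auto)
  then have "integrable (count_space UNIV) (\<lambda>n. pmf q n *\<^sub>R f n)"
    unfolding measure_pmf_eq_density by (subst (asm) integrable_density) auto
  then have "(\<Sum>n. pmf q n * f n) = (\<integral>n. pmf q n *\<^sub>R f n \<partial>count_space UNIV)"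
    by (simp add: integral_count_space_nat)
  also have "\<dots> = (\<integral>n. f n \<partial>measure_pmf q)"
    unfolding measure_pmf_eq_density by (rule integral_density[symmetric]) auto
  finally show ?thesis by simp
qed

section \<open>The density of states of the canopy tree\<close>

locale random_canopy = canopy adj K C + iid_field M \<rho> R c\<rho> \<omega> "canopy_J m0 adj (C 0)"
  for adj :: "'v \<Rightarrow> 'v \<Rightarrow> bool" and K C and M :: "'a measure" and \<rho> R c\<rho> and \<omega> :: "'v \<Rightarrow> 'a \<Rightarrow> real" and m0 :: nat +
  fixes lam :: real and x :: "nat \<Rightarrow> 'v"
  assumes lam: "0 < lam" and x: "gdist_set adj (C 0) (x n) = n"
begin

sublocale random_layered K UNIV ht par "{}" M \<rho> R c\<rho> \<omega> "canopy_J m0 adj (C 0)" m0 lam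
proof unfold_locales
  fix y :: 'v
  have "y \<in> canopy_block m0 adj (C 0) (block m0 y) \<and> block m0 y \<in> canopy_J m0 adj (C 0)"
    using block_index[of y m0 "block m0 y"] by simp
  then show "block m0 y \<in> canopy_J m0 adj (C 0)" by simp
qed (rule lam)

definition site_dos :: "nat \<Rightarrow> real measure" where
  "site_dos n = M \<bind> (\<lambda>s. cutoff s (x n))"

definition site_moment :: "nat \<Rightarrow> nat \<Rightarrow> real" where
  "site_moment n p = (\<integral>s. Re (mom m0 lam (\<lambda>y. clamp (2 * R) (\<omega> y s)) (x n) p (x n)) \<partial>M)"

text \<open>The weights \<open>(K - 1) / K * K^(-n)\<close> are those of a geometric distribution
  with success probability \<open>(K - 1) / K\<close>, so the weighted series of measures is a
  mixture and has total mass 1.\<close>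

definition dos_measure :: "real measure" where
  "dos_measure = measure_pmf (geometric_pmf ((real K - 1) / real K)) \<bind> site_dos"

lemma site_dos:
  shows "prob_space (site_dos n)" "supported norm_bound (site_dos n)"
    "B \<in> sets borel \<Longrightarrow> measure (site_dos n) B = (\<integral>s. measure (cutoff s (x n)) B \<partial>M)"
    "integral\<^sup>L (site_dos n) (\<lambda>t. t ^ p) = site_moment n p"
    "f \<in> borel_measurable borel \<Longrightarrow> (\<integral>\<^sup>+t. f t \<partial>site_dos n) = (\<integral>\<^sup>+s. \<integral>\<^sup>+t. f t \<partial>cutoff s (x n) \<partial>M)"
proof -
  note k = kernel_mixture[where \<kappa>="\<lambda>s. cutoff s (x n)", OF prob_space_axioms cutoff_measurable cutoff_prob cutoff_supported, OF UNIV_I UNIV_I UNIV_I]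
  show "prob_space (site_dos n)" "supported norm_bound (site_dos n)"
    "B \<in> sets borel \<Longrightarrow> measure (site_dos n) B = (\<integral>s. measure (cutoff s (x n)) B \<partial>M)"
    "f \<in> borel_measurable borel \<Longrightarrow> (\<integral>\<^sup>+t. f t \<partial>site_dos n) = (\<integral>\<^sup>+s. \<integral>\<^sup>+t. f t \<partial>cutoff s (x n) \<partial>M)"
    unfolding site_dos_def by (fact k)+
  show "integral\<^sup>L (site_dos n) (\<lambda>t. t ^ p) = site_moment n p"
    unfolding site_dos_def k(4) cutoff_moment[OF UNIV_I] site_moment_def ..
qed

lemma site_dos_kernel: "site_dos \<in> measurable (measure_pmf q) (subprob_algebra borel)"
  using site_dos(1) supportedD(2)[OF site_dos(2)]
  by (auto simp: space_subprob_algebra intro: prob_space_imp_subprob_space)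

lemmas dos_mixture = kernel_mixture[OF prob_space_measure_pmf site_dos_kernel site_dos(1) site_dos(2)]

lemma dos_prob: "prob_space dos_measure" and dos_supported: "supported norm_bound dos_measure"
  unfolding dos_measure_def by (rule dos_mixture)+

lemma geometric_weight: "pmf (geometric_pmf ((real K - 1) / real K)) n = (real K - 1) / real K * (1 / real K ^ n)"
proof -
  have "1 - (real K - 1) / real K = 1 / real K" using K2 by (simp add: field_simps)
  then show ?thesis using K2 by (subst pmf_geometric) (auto simp: power_one_over)
qed

lemma integral_geometric:
  assumes f: "\<And>n. \<bar>f n\<bar> \<le> B"
  shows "(\<integral>n. f n \<partial>measure_pmf (geometric_pmf ((real K - 1) / real K)))
    = (real K - 1) / real K * (\<Sum>n. 1 / real K ^ n * f n)"
proof -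
  have "summable (\<lambda>n. (1 / real K) ^ n)" using K2 by (intro summable_geometric) auto
  then have "summable (\<lambda>n. B * (1 / real K ^ n))" by (intro summable_mult) (simp add: power_one_over)
  then have "summable (\<lambda>n. 1 / real K ^ n * f n)"
    by (rule summable_comparison_test'[where N=0]) (use f in \<open>auto simp: abs_mult divide_right_mono\<close>)
  then have "(real K - 1) / real K * (\<Sum>n. 1 / real K ^ n * f n) = (\<Sum>n. (real K - 1) / real K * (1 / real K ^ n * f n))"
    by (rule suminf_mult[symmetric])
  then show ?thesis unfolding integral_pmf_nat[OF f] geometric_weight by (simp only: mult.assoc)
qed

lemma site_moment_bound: "\<bar>site_moment n p\<bar> \<le> norm_bound ^ p"
proof -
  have "\<bar>site_moment n p\<bar> \<le> (\<integral>s. \<bar>Re (mom m0 lam (\<lambda>y. clamp (2 * R) (\<omega> y s)) (x n) p (x n))\<bar> \<partial>M)"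
    unfolding site_moment_def by (rule integral_abs_bound)
  also have "\<dots> \<le> (\<integral>s. norm_bound ^ p \<partial>M)"
  proof (rule integral_mono')
    have "0 \<le> lam * (2 * R)" using lam R_pos by simp
    then show "0 \<le> norm_bound ^ p" by (intro zero_le_power) linarith
  qed (use cutoff_moment_bound[OF UNIV_I] in \<open>auto simp only: prob_space_axioms integrable_const\<close>)
  also have "\<dots> = norm_bound ^ p" using prob_space by simp
  finally show ?thesis .
qed

lemma dos_moment: "integral\<^sup>L dos_measure (\<lambda>t. t ^ p) = (real K - 1) / real K * (\<Sum>n. 1 / real K ^ n * site_moment n p)"
  unfolding dos_measure_def dos_mixture(4) site_dos(4) by (rule integral_geometric[OF site_moment_bound])

lemma dos_measure_eq:
  assumes B: "B \<in> sets borel"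
  shows "measure dos_measure B = canopy_dos K m0 lam adj (C 0) M \<omega> x B"
proof -
  have "measure dos_measure B = (\<integral>n. measure (site_dos n) B \<partial>measure_pmf (geometric_pmf ((real K - 1) / real K)))"
    unfolding dos_measure_def by (rule dos_mixture(3)[OF B])
  also have "\<dots> = (real K - 1) / real K * (\<Sum>n. 1 / real K ^ n * measure (site_dos n) B)"
    by (rule integral_geometric[where B=1]) (use site_dos(1) in \<open>simp add: prob_space.prob_le_1\<close>)
  finally show ?thesis
    unfolding canopy_dos_def canopy_op_hop site_dos(3)[OF B] cutoff_integral[OF UNIV_I B] .
qed

text \<open>The bound on Poisson integrals is the same at every vertex and therefore survives both
  the expectation and the geometric mixture.\<close>

lemma dos_absolutely_continuous: "absolutely_continuous lborel dos_measure"
proof (rule lipschitz_absolutely_continuous)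
  show fm: "finite_measure dos_measure" and st: "sets dos_measure = sets borel" using supportedD[OF dos_supported] by auto
  define C where "C = c\<rho> * (8 * pi / (3 * lam))"
  have C: "0 \<le> C" using c\<rho>_nonneg lam by (simp add: C_def)
  show "measure dos_measure {a<..b} \<le> 5 / 4 * C * (b - a)" if "a \<le> b" for a b
  proof (rule poisson_bound_interval[OF fm st C _ that])
    fix e \<epsilon> :: real assume \<epsilon>: "0 < \<epsilon>"
    have pm: "(\<lambda>u. ennreal (poisson e \<epsilon> u)) \<in> borel_measurable borel"
      using borel_measurable_continuous_onI[OF poisson_continuous[OF \<epsilon>]] by measurable
    have "(\<integral>\<^sup>+u. ennreal (poisson e \<epsilon> u) \<partial>dos_measure) =
        (\<integral>\<^sup>+n. \<integral>\<^sup>+s. \<integral>\<^sup>+u. ennreal (poisson e \<epsilon> u) \<partial>cutoff s (x n) \<partial>M \<partial>measure_pmf (geometric_pmf ((real K - 1) / real K)))"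
      unfolding dos_measure_def dos_mixture(5)[OF pm] site_dos(5)[OF pm] ..
    also have "\<dots> \<le> (\<integral>\<^sup>+n. ennreal C \<partial>measure_pmf (geometric_pmf ((real K - 1) / real K)))"
      unfolding C_def by (intro nn_integral_mono density_of_states_bound UNIV_I \<epsilon>)
    finally show "(\<integral>\<^sup>+u. ennreal (poisson e \<epsilon> u) \<partial>dos_measure) \<le> ennreal C"
      by (simp add: measure_pmf.emeasure_space_1)
  qed
qed

end

context layered
begin

section \<open>Independence and the law of large numbers\<close>

text \<open>The indices of the random variables whose blocks lie below \<open>z\<close>.\<close>

definition block_points :: "nat \<Rightarrow> 'v \<Rightarrow> 'v set" where
  "block_points m0 z = {j \<in> desc V par z. h j mod (m0 + 1) = m0}"

text \<open>\<open>mom_iso\<close> applied to the identity map of one tree with two configurations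
  that agree below \<open>z\<close>.\<close>

lemma mom_local:
  assumes z: "z \<in> V" "z \<notin> T" "h z mod (m0 + 1) = m0" and x: "x \<in> desc V par z"
    and om: "\<And>j. j \<in> block_points m0 z \<Longrightarrow> om' j = om j"
    and q: "h x + q \<le> h z"
  shows "mom m0 lam om' x q x = mom m0 lam om x q x"
proof -
  interpret P: layered_pair K V h par T V h par T ..
  have "tree_iso V h par V h par (\<lambda>x. x) z z" by (auto simp: tree_iso_def bij_betw_def)
  then show ?thesis
    using P.mom_iso[of "\<lambda>x. x" z z m0 x om' om q x lam] z x om q by (simp add: block_points_def)
qed

lemma block_points_block: "j \<in> block_points m0 z \<Longrightarrow> j \<in> V \<and> block m0 j = j"
  by (auto simp: block_points_def block_def dest: desc_in)

lemma block_points_disjoint: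
  assumes "z \<notin> T" "w \<notin> T" "h z = h w" "z \<noteq> w"
  shows "block_points m0 z \<inter> block_points m0 w = {}"
  using desc_unique[OF assms(1,2,3)] assms(4) by (auto simp: block_points_def)

end

text \<open>Any injective relabelling of the variables has the same product law. This carries the
  law across an isomorphism of subtrees.\<close>

lemma (in iid_field) law_reindex:
  assumes g: "inj_on g A" "g ` A \<subseteq> J" and A: "A \<noteq> {}"
  shows "distr M (PiM A (\<lambda>_. borel)) (\<lambda>s. \<lambda>j\<in>A. \<omega> (g j) s) = PiM A (\<lambda>_. D)"
proof -
  have J: "J \<noteq> {}" using g A by auto
  have gm: "(\<lambda>Y. \<lambda>j\<in>A. Y (g j)) \<in> measurable (PiM J (\<lambda>_. borel)) (PiM A (\<lambda>_. borel :: real measure))"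
    using g(2) by (intro measurable_restrict measurable_component_singleton) auto
  have om: "(\<lambda>s. \<lambda>y\<in>J. \<omega> y s) \<in> measurable M (PiM J (\<lambda>_. borel))" by (intro measurable_restrict om_measurable)
  have "distr M (PiM A (\<lambda>_. borel)) (\<lambda>s. \<lambda>j\<in>A. \<omega> (g j) s) =
      distr (distr M (PiM J (\<lambda>_. borel)) (\<lambda>s. \<lambda>y\<in>J. \<omega> y s)) (PiM A (\<lambda>_. borel)) (\<lambda>Y. \<lambda>j\<in>A. Y (g j))"
    unfolding distr_distr[OF gm om] by (intro distr_cong refl) (use g(2) in \<open>auto simp: fun_eq_iff\<close>)
  also have "\<dots> = distr (PiM J (\<lambda>_. D)) (PiM A (\<lambda>_. D)) (\<lambda>Y. \<lambda>j\<in>A. Y (g j))"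
    unfolding law[OF subset_refl J] by (intro distr_cong refl sets_PiM_cong) simp
  also have "\<dots> = PiM A (\<lambda>_. D)"
    by (rule distr_PiM_reindex) (use g prob_space_D[OF J] in auto)
  finally show ?thesis .
qed

context random_layered
begin

definition site :: "nat \<Rightarrow> 'v \<Rightarrow> 'a \<Rightarrow> real" where
  "site p x s = Re (mom m0 lam (\<lambda>y. clamp (2 * R) (\<omega> y s)) x p x)"

text \<open>Variables outside the subtree are set to 0, so that the moment becomes a measurable
  function on the product over \<open>block_points m0 z\<close>. Disjoint index sets then give
  independent moments.\<close>

definition local_site :: "nat \<Rightarrow> 'v \<Rightarrow> 'v \<Rightarrow> ('v \<Rightarrow> real) \<Rightarrow> real" where
  "local_site p z x Y = Re (mom m0 lam (\<lambda>j. if j \<in> block_points m0 z then clamp (2 * R) (Y j) else 0) x p x)"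

lemma site_measurable: "x \<in> V \<Longrightarrow> site p x \<in> borel_measurable M"
  unfolding site_def
  by (intro measurable_compose[OF mom_measurable borel_measurable_Re] measurable_compose[OF om_measurable clamp_measurable] block_J)

lemma site_bound: "x \<in> V \<Longrightarrow> \<bar>site p x s\<bar> \<le> norm_bound ^ p"
  unfolding site_def by (rule cutoff_moment_bound)

lemma site_integrable: "x \<in> V \<Longrightarrow> integrable M (site p x)"
  by (rule integrable_const_bound[OF _ site_measurable]) (use site_bound in \<open>auto intro!: AE_I2\<close>)

lemma local_site_measurable:
  "local_site p z x \<in> borel_measurable (PiM (block_points m0 z) (\<lambda>_. borel))"
  unfolding local_site_def
proof (rule measurable_compose[OF mom_measurable borel_measurable_Re])
  fix y
  show "(\<lambda>Y. if block m0 y \<in> block_points m0 z then clamp (2 * R) (Y (block m0 y)) else 0)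
      \<in> borel_measurable (PiM (block_points m0 z) (\<lambda>_. borel))"
    by (cases "block m0 y \<in> block_points m0 z")
       (auto intro!: measurable_compose[OF _ clamp_measurable] measurable_component_singleton)
qed

lemma local_site:
  assumes z: "z \<in> V" "z \<notin> T" "h z mod (m0 + 1) = m0" and x: "x \<in> desc V par z" and q: "h x + p \<le> h z"
  shows "site p x s = local_site p z x (\<lambda>j\<in>block_points m0 z. \<omega> j s)"
  unfolding site_def local_site_def by (rule arg_cong[where f=Re], rule mom_local[OF z x _ q]) simp

lemma block_points_J: "block_points m0 z \<subseteq> J"
  using block_points_block block_J by fastforce

lemma site_independent:
  assumes z: "z \<in> V" "z \<notin> T" "w \<in> V" "w \<notin> T" "h z mod (m0 + 1) = m0" "h w = h z" "z \<noteq> w"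
    and x: "x \<in> desc V par z" and q: "h x + p \<le> h z" and y: "y \<in> desc V par w" and q': "h y + p \<le> h w"
  shows "indep_var borel (site p x) borel (site p y)"
proof -
  have i: "indep_var (PiM (block_points m0 z) (\<lambda>_. borel)) (\<lambda>s. restrict (\<lambda>i. \<omega> i s) (block_points m0 z))
      (PiM (block_points m0 w) (\<lambda>_. borel)) (\<lambda>s. restrict (\<lambda>i. \<omega> i s) (block_points m0 w))"
    by (rule indep_var_restrict[OF indep block_points_disjoint block_points_J block_points_J]) (use z in auto)
  have "site p x = local_site p z x \<circ> (\<lambda>s. restrict (\<lambda>i. \<omega> i s) (block_points m0 z))"
    using local_site[OF z(1,2,5) x q] by (simp add: fun_eq_iff)
  moreover have "site p y = local_site p w y \<circ> (\<lambda>s. restrict (\<lambda>i. \<omega> i s) (block_points m0 w))"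
    using local_site[OF z(3,4) _ y q'] z by (simp add: fun_eq_iff)
  ultimately show ?thesis using indep_var_compose[OF i local_site_measurable local_site_measurable] by simp
qed

lemma ancestor_fibre_card:
  assumes "z \<in> V" "z \<notin> T"
  shows "finite {w \<in> V. (par ^^ q) w = z} \<and> card {w \<in> V. (par ^^ q) w = z} \<le> (K + 1) ^ q"
  using assms
proof (induction q arbitrary: z)
  case 0
  have "{w \<in> V. (par ^^ 0) w = z} = {z}" using 0 by auto
  then show ?case by simp
next
  case (Suc q)
  have c: "c \<in> V" "c \<notin> T" if "c \<in> ch z" for c using ch_V[OF that] ch_notT[OF that] by auto
  have sub: "{w \<in> V. (par ^^ Suc q) w = z} \<subseteq> (\<Union>c\<in>ch z. {w \<in> V. (par ^^ q) w = c})"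
  proof
    fix w assume w: "w \<in> {w \<in> V. (par ^^ Suc q) w = z}"
    then have "(par ^^ q) w \<notin> T" using par_pow_notT[of "Suc q" w q] Suc.prems by simp
    then have "(par ^^ q) w \<in> ch z" using w par_pow_in[of w q] by (simp add: ch_def)
    then show "w \<in> (\<Union>c\<in>ch z. {w \<in> V. (par ^^ q) w = c})" using w by blast
  qed
  have fc: "finite (ch z)" "card (ch z) \<le> Suc K"
    using children_finite[OF Suc.prems(1)] children_le[OF Suc.prems(1)] by (simp_all add: ch_def)
  have f: "finite (\<Union>c\<in>ch z. {w \<in> V. (par ^^ q) w = c})" using fc Suc.IH c by blast
  have "card {w \<in> V. (par ^^ Suc q) w = z} \<le> card (\<Union>c\<in>ch z. {w \<in> V. (par ^^ q) w = c})"
    by (rule card_mono[OF f sub])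
  also have "\<dots> \<le> (\<Sum>c\<in>ch z. card {w \<in> V. (par ^^ q) w = c})" by (rule card_UN_le[OF fc(1)])
  also have "\<dots> \<le> (\<Sum>c\<in>ch z. (K + 1) ^ q)" using Suc.IH c by (intro sum_mono) blast
  also have "\<dots> \<le> (K + 1) ^ Suc q" using mult_le_mono1[OF fc(2), of "(K + 1) ^ q"] by simp
  finally show ?case using finite_subset[OF sub f] by blast
qed

text \<open>
  Covariances vanish unless the \<open>q\<close>-th ancestors coincide, and each vertex shares its ancestor with
  at most \<open>(K + 1)\<^sup>q\<close> others.
\<close>
lemma layer_variance:
  assumes S: "finite S" "S \<noteq> {}" "S \<subseteq> V" and hS: "\<And>x. x \<in> S \<Longrightarrow> h x = n"
    and q: "\<And>x. x \<in> S \<Longrightarrow> (par ^^ q) x \<notin> T" "(n + q) mod (m0 + 1) = m0" "p \<le> q"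
    and e: "\<And>x. x \<in> S \<Longrightarrow> (\<integral>s. site p x s \<partial>M) = e"
  shows "(\<integral>s. ((\<Sum>x\<in>S. site p x s) / real (card S) - e)\<^sup>2 \<partial>M) \<le> 4 * (norm_bound ^ p)\<^sup>2 * (real K + 1) ^ q / real (card S)"
proof -
  define Y where "Y x s = site p x s - e" for x s
  let ?c = "norm_bound ^ p"
  have Ym: "Y x \<in> borel_measurable M" if "x \<in> S" for x
    unfolding Y_def using site_measurable[of x p] S(3) that by auto
  have eb: "\<bar>e\<bar> \<le> ?c"
  proof -
    obtain x where x: "x \<in> S" "x \<in> V" using S by auto
    have "\<bar>\<integral>s. site p x s \<partial>M\<bar> \<le> (\<integral>s. \<bar>site p x s\<bar> \<partial>M)" by (rule integral_abs_bound)
    also have "\<dots> \<le> (\<integral>s. ?c \<partial>M)"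
      by (rule integral_mono) (use site_integrable[OF x(2)] site_bound[OF x(2)] in auto)
    finally show ?thesis using e[OF x(1)] prob_space by simp
  qed
  have c0: "0 \<le> ?c" using eb by linarith
  have Yb: "\<bar>Y x s\<bar> \<le> 2 * ?c" if "x \<in> S" for x s
    using site_bound[of x p s] S(3) that eb by (auto simp: Y_def)
  have Yi: "integrable M (\<lambda>s. Y x s * Y y s)" if "x \<in> S" "y \<in> S" for x y
  proof (rule integrable_const_bound[where B="(2 * ?c) * (2 * ?c)"])
    show "AE s in M. norm (Y x s * Y y s) \<le> (2 * ?c) * (2 * ?c)"
      unfolding real_norm_def abs_mult by (intro AE_I2 mult_mono Yb that abs_ge_zero mult_nonneg_nonneg c0) simp
  qed (use Ym[OF that(1)] Ym[OF that(2)] in measurable)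
  have cov: "(\<integral>s. Y x s * Y y s \<partial>M) \<le> (if (par ^^ q) y = (par ^^ q) x then 4 * ?c\<^sup>2 else 0)"
    if x: "x \<in> S" and y: "y \<in> S" for x y
  proof (cases "(par ^^ q) y = (par ^^ q) x")
    case True
    have "(\<integral>s. Y x s * Y y s \<partial>M) \<le> (\<integral>s. 4 * ?c\<^sup>2 \<partial>M)"
    proof (rule integral_mono[OF Yi[OF x y]])
      fix s
      have "\<bar>Y x s * Y y s\<bar> \<le> (2 * ?c) * (2 * ?c)" unfolding abs_mult by (rule mult_mono) (use Yb x y c0 in auto)
      then show "Y x s * Y y s \<le> 4 * ?c\<^sup>2" by (simp add: power2_eq_square)
    qed simp
    then show ?thesis using True prob_space by simp
  next
    case False
    have xV: "x \<in> V" "y \<in> V" using S(3) x y by auto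
    have hz: "h ((par ^^ q) x) = n + q" "h ((par ^^ q) y) = n + q"
      using par_pow_h[OF xV(1) q(1)[OF x]] par_pow_h[OF xV(2) q(1)[OF y]] hS x y by auto
    have "indep_var borel (site p x) borel (site p y)"
    proof (rule site_independent[where z="(par ^^ q) x" and w="(par ^^ q) y"])
      show "x \<in> desc V par ((par ^^ q) x)" "y \<in> desc V par ((par ^^ q) y)" using xV by (auto simp: desc_def)
    qed (use False q x y hz xV par_pow_in hS in auto)
    then have "indep_var borel ((\<lambda>t. t - e) \<circ> site p x) borel ((\<lambda>t. t - e) \<circ> site p y)"
      by (rule indep_var_compose) measurable
    moreover have "Y x = (\<lambda>t. t - e) \<circ> site p x" for x by (simp add: Y_def fun_eq_iff)
    ultimately have "indep_var borel (Y x) borel (Y y)" by simp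
    moreover have YI: "integrable M (Y x)" "integrable M (Y y)"
      unfolding Y_def using site_integrable xV by auto
    ultimately have "(\<integral>s. Y x s * Y y s \<partial>M) = (\<integral>s. Y x s \<partial>M) * (\<integral>s. Y y s \<partial>M)"
      by (rule indep_var_lebesgue_integral)
    moreover have "(\<integral>s. Y x s \<partial>M) = 0"
      unfolding Y_def using site_integrable[OF xV(1)] e[OF x] prob_space by simp
    ultimately show ?thesis using False by simp
  qed
  have N: "0 < card S" using S by (simp add: card_gt_0_iff)
  have "(\<Sum>x\<in>S. site p x s) / real (card S) - e = (\<Sum>x\<in>S. Y x s) / real (card S)" for s
    using N by (simp add: Y_def sum_subtractf field_simps)
  then have "(\<integral>s. ((\<Sum>x\<in>S. site p x s) / real (card S) - e)\<^sup>2 \<partial>M) = (\<integral>s. (\<Sum>x\<in>S. \<Sum>y\<in>S. Y x s * Y y s) / (real (card S))\<^sup>2 \<partial>M)"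
    by (simp add: power_divide power2_eq_square sum_product)
  also have "\<dots> = (\<Sum>x\<in>S. \<Sum>y\<in>S. \<integral>s. Y x s * Y y s \<partial>M) / (real (card S))\<^sup>2"
    using Yi by (simp add: Bochner_Integration.integral_sum)
  also have "\<dots> \<le> (real (card S) * ((real K + 1) ^ q * (4 * ?c\<^sup>2))) / (real (card S))\<^sup>2"
  proof (rule divide_right_mono)
    have "(\<Sum>y\<in>S. \<integral>s. Y x s * Y y s \<partial>M) \<le> (real K + 1) ^ q * (4 * ?c\<^sup>2)" if x: "x \<in> S" for x
    proof -
      let ?F = "{y \<in> V. (par ^^ q) y = (par ^^ q) x}"
      have F: "finite ?F" "card ?F \<le> (K + 1) ^ q"
        using ancestor_fibre_card[of "(par ^^ q) x" q] par_pow_in[of x q] S(3) x q(1) by auto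
      have "(\<Sum>y\<in>S. \<integral>s. Y x s * Y y s \<partial>M) \<le> (\<Sum>y\<in>S. if (par ^^ q) y = (par ^^ q) x then 4 * ?c\<^sup>2 else 0)"
        by (rule sum_mono) (rule cov[OF x])
      also have "\<dots> = (\<Sum>y\<in>S \<inter> ?F. 4 * ?c\<^sup>2)"
        using S by (intro sum.mono_neutral_cong_right) auto
      also have "\<dots> \<le> real (card ?F) * (4 * ?c\<^sup>2)"
        using card_mono[OF F(1), of "S \<inter> ?F"] by (simp add: mult_right_mono)
      also have "\<dots> \<le> (real K + 1) ^ q * (4 * ?c\<^sup>2)"
      proof (rule mult_right_mono)
        have "real (card ?F) \<le> real ((K + 1) ^ q)" using F(2) by (simp only: of_nat_le_iff)
        then show "real (card ?F) \<le> (real K + 1) ^ q" by (simp add: add.commute)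
      qed simp
      finally show ?thesis .
    qed
    from sum_mono[OF this] show "(\<Sum>x\<in>S. \<Sum>y\<in>S. \<integral>s. Y x s * Y y s \<partial>M) \<le> real (card S) * ((real K + 1) ^ q * (4 * ?c\<^sup>2))"
      by simp
  qed simp
  also have "\<dots> = 4 * ?c\<^sup>2 * (real K + 1) ^ q / real (card S)" using N by (simp add: power2_eq_square field_simps)
  finally show ?thesis .
qed

end

section \<open>Equal expectations in two random trees\<close>

locale random_pair = A: random_layered K V h par T M \<rho> R c\<rho> \<omega> J m0 lam
  + B: random_layered K V' h' par' T' N \<rho> R c\<rho> \<eta> J' m0 lam
  for K :: nat and V :: "'v set" and h par T and M :: "'a measure" and \<rho> R c\<rho> and \<omega> :: "'v \<Rightarrow> 'a \<Rightarrow> real" and J m0 lam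
    and V' :: "'w set" and h' par' T' and N :: "'b measure" and \<eta> :: "'w \<Rightarrow> 'b \<Rightarrow> real" and J'
begin

sublocale P: layered_pair K V h par T V' h' par' T' ..

text \<open>Both moments are the same function \<open>\<phi>\<close> of a family of variables
  indexed by the blocks below \<open>z'\<close>: on one side directly, on the other through the
  inverse \<open>g\<close> of the isomorphism. Both families have the same product law.\<close>

lemma site_expectation_eq:
  assumes x: "x \<in> V" "x' \<in> V'" "h x = h' x'"
    and q: "(par ^^ q) x \<notin> T" "(par' ^^ q) x' \<notin> T'" "(h x + q) mod (m0 + 1) = m0" "p \<le> q"
  shows "(\<integral>s. A.site p x s \<partial>M) = (\<integral>s. B.site p x' s \<partial>N)"
proof -
  define z z' where "z = (par ^^ q) x" and "z' = (par' ^^ q) x'"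
  obtain f where f: "tree_iso V h par V' h' par' f z z'" "f x = x'"
    using P.iso_ancestor[OF x q(1,2)] unfolding z_def z'_def by blast
  have hz: "h z = h x + q" "h' z' = h x + q"
    using A.par_pow_h[OF x(1) q(1)] B.par_pow_h[OF x(2) q(2)] x(3) by (auto simp: z_def z'_def)
  have z: "z \<in> V" "z \<notin> T" "z' \<in> V'" "z' \<notin> T'" "h z mod (m0 + 1) = m0" "h' z' mod (m0 + 1) = m0"
    using A.par_pow_in[OF x(1)] B.par_pow_in[OF x(2)] q hz unfolding z_def z'_def by auto
  have xd: "x \<in> desc V par z" "x' \<in> desc V' par' z'" using x by (auto simp: desc_def z_def z'_def)
  let ?A = "A.block_points m0 z" and ?A' = "B.block_points m0 z'"
  have bij: "bij_betw f ?A ?A'"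
  proof -
    have fh: "h' (f j) = h j" if "j \<in> desc V par z" for j
      using f(1) that by (auto simp: tree_iso_def)
    have fd: "bij_betw f (desc V par z) (desc V' par' z')" using f(1) by (simp add: tree_iso_def)
    have "f ` ?A = ?A'"
    proof (intro equalityI subsetI)
      fix y assume "y \<in> f ` ?A"
      then show "y \<in> ?A'" using fd fh by (auto simp: A.block_points_def B.block_points_def bij_betw_def)
    next
      fix y assume y: "y \<in> ?A'"
      then obtain j where "j \<in> desc V par z" "y = f j" using fd by (auto simp: B.block_points_def bij_betw_def)
      then show "y \<in> f ` ?A" using y fh by (auto simp: A.block_points_def B.block_points_def)
    qed
    moreover have "inj_on f ?A" using fd by (auto simp: A.block_points_def bij_betw_def inj_on_def)
    ultimately show ?thesis by (simp add: bij_betw_def)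
  qed
  define g where "g = inv_into ?A f"
  have g: "bij_betw g ?A' ?A" unfolding g_def by (rule bij_betw_inv_into[OF bij])
  have gf: "g (f j) = j" "f j \<in> ?A'" if "j \<in> ?A" for j
    using bij that by (auto simp: g_def bij_betw_def)
  have "z' \<in> ?A'" using B.desc_self[OF z(3)] z(6) by (simp add: B.block_points_def)
  then have ne: "?A' \<noteq> {}" by blast
  define \<phi> where "\<phi> = B.local_site p z' x'"
  have \<phi>m: "\<phi> \<in> borel_measurable (PiM ?A' (\<lambda>_. borel))" unfolding \<phi>_def by (rule B.local_site_measurable)
  have 1: "A.site p x s = \<phi> (\<lambda>j\<in>?A'. \<omega> (g j) s)" for s
  proof -
    have "B.mom m0 lam (\<lambda>j. if j \<in> ?A' then clamp (2 * R) ((\<lambda>j\<in>?A'. \<omega> (g j) s) j) else 0) (f x) p (f x)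
        = A.mom m0 lam (\<lambda>y. clamp (2 * R) (\<omega> y s)) x p x"
    proof (rule P.mom_iso[OF f(1) z(1-5) xd(1)])
      show "(if f j \<in> ?A' then clamp (2 * R) ((\<lambda>j\<in>?A'. \<omega> (g j) s) (f j)) else 0) = clamp (2 * R) (\<omega> j s)"
        if "j \<in> desc V par z" "h j mod (m0 + 1) = m0" for j
        using gf[of j] that by (simp add: A.block_points_def)
    qed (use q(4) hz xd in auto)
    then show ?thesis by (simp add: A.site_def \<phi>_def B.local_site_def f(2))
  qed
  have 2: "B.site p x' s = \<phi> (\<lambda>j\<in>?A'. \<eta> j s)" for s
    unfolding \<phi>_def by (rule B.local_site[OF z(3,4,6) xd(2)]) (use q(4) hz x in auto)
  have sub: "g ` ?A' \<subseteq> J" using g A.block_points_J by (auto simp: bij_betw_def)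
  have "(\<integral>s. A.site p x s \<partial>M) = (\<integral>Y. \<phi> Y \<partial>distr M (PiM ?A' (\<lambda>_. borel)) (\<lambda>s. \<lambda>j\<in>?A'. \<omega> (g j) s))"
    unfolding 1 by (rule integral_distr[symmetric, OF _ \<phi>m])
      (use sub in \<open>auto intro!: measurable_restrict A.om_measurable\<close>)
  also have "\<dots> = (\<integral>Y. \<phi> Y \<partial>PiM ?A' (\<lambda>_. A.D))"
    using A.law_reindex[OF _ sub ne] g by (simp add: bij_betw_def)
  also have "\<dots> = (\<integral>Y. \<phi> Y \<partial>distr N (PiM ?A' (\<lambda>_. borel)) (\<lambda>s. \<lambda>j\<in>?A'. \<eta> j s))"
    using B.law[OF B.block_points_J ne] by simp
  also have "\<dots> = (\<integral>s. B.site p x' s \<partial>N)"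
    unfolding 2 by (rule integral_distr[OF _ \<phi>m])
      (use B.block_points_J in \<open>auto intro!: measurable_restrict B.om_measurable\<close>)
  finally show ?thesis .
qed

end

text \<open>The sum of the squares has finite expectation, so it is finite almost surely and its
  terms tend to 0.\<close>

lemma AE_tendsto_of_summable_second_moment:
  fixes Z :: "nat \<Rightarrow> 'a \<Rightarrow> real"
  assumes Z: "\<And>k. Z k \<in> borel_measurable M" and i: "\<And>k. integrable M (\<lambda>s. (Z k s)\<^sup>2)"
    and a: "\<And>k. (\<integral>s. (Z k s)\<^sup>2 \<partial>M) \<le> a k" "summable a"
  shows "AE s in M. (\<lambda>k. Z k s) \<longlonglongrightarrow> 0"
proof -
  have a0: "0 \<le> a k" for k using order_trans[OF _ a(1)[of k]] by simp
  have "(\<integral>\<^sup>+s. (\<Sum>k. ennreal ((Z k s)\<^sup>2)) \<partial>M) = (\<Sum>k. \<integral>\<^sup>+s. ennreal ((Z k s)\<^sup>2) \<partial>M)"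
    using Z by (intro nn_integral_suminf) measurable
  also have "\<dots> = (\<Sum>k. ennreal (\<integral>s. (Z k s)\<^sup>2 \<partial>M))"
    using i by (intro suminf_cong nn_integral_eq_integral) auto
  also have "\<dots> \<le> (\<Sum>k. ennreal (a k))" using a(1) by (intro suminf_le ennreal_leI summableI) auto
  also have "\<dots> = ennreal (\<Sum>k. a k)" by (rule suminf_ennreal2[OF a0 a(2)])
  finally have "(\<integral>\<^sup>+s. (\<Sum>k. ennreal ((Z k s)\<^sup>2)) \<partial>M) \<noteq> \<infinity>" by (auto simp: top_unique)
  then have "AE s in M. (\<Sum>k. ennreal ((Z k s)\<^sup>2)) \<noteq> \<infinity>"
    by (intro nn_integral_noteq_infinite) (use Z in measurable)
  then show ?thesis
  proof eventually_elim
    case (elim s)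
    then have "summable (\<lambda>k. (Z k s)\<^sup>2)" by (intro summable_suminf_not_top) auto
    then have "(\<lambda>k. sqrt ((Z k s)\<^sup>2)) \<longlonglongrightarrow> sqrt 0" by (intro tendsto_real_sqrt summable_LIMSEQ_zero)
    then show ?case by (simp add: tendsto_rabs_zero_iff)
  qed
qed

text \<open>Moments on a common compact set give weak convergence. The frontier of an interval is
  Lebesgue null, hence null for the limit, and weak convergence passes to such sets.\<close>

lemma moment_convergence_interval:
  fixes \<mu> :: "nat \<Rightarrow> real measure"
  assumes s: "\<And>n. supported c (\<mu> n)" "supported c \<nu>"
    and m: "\<And>i. (\<lambda>n. integral\<^sup>L (\<mu> n) (\<lambda>t. t^i)) \<longlonglongrightarrow> integral\<^sup>L \<nu> (\<lambda>t. t^i)"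
    and pr: "\<And>n. prob_space (\<mu> n)" "prob_space \<nu>"
    and ac: "absolutely_continuous lborel \<nu>" and I: "is_interval I"
  shows "(\<lambda>n. measure (\<mu> n) I) \<longlonglongrightarrow> measure \<nu> I"
proof -
  have rd: "real_distribution (\<mu> n)" "real_distribution \<nu>" for n
    using pr supportedD(2)[OF s(1)] supportedD(2)[OF s(2)] by (simp_all add: real_distribution_def real_distribution_axioms_def)
  have wc: "weak_conv_m \<mu> \<nu>"
    by (rule integral_bdd_continuous_conv_imp_weak_conv[OF rd])
       (intro moment_convergence_continuous[OF s m _ pr] continuous_at_imp_continuous_on ballI)
  have "negligible (frontier I)" using I by (simp add: negligible_convex_frontier is_interval_convex)
  then have "frontier I \<in> null_sets lebesgue" by (simp add: negligible_iff_null_sets)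
  then have "frontier I \<in> null_sets lborel"
    by (simp add: null_sets_completion_iff)
  then have "emeasure \<nu> (frontier I) = 0" using ac by (auto simp: absolutely_continuous_def)
  then show ?thesis
    by (rule weak_conv_imp_continuity_set_conv[OF rd wc real_interval_borel_measurable[OF I]])
qed

section \<open>Balls of the Bethe lattice against the canopy tree\<close>

locale bethe_canopy = B: bethe adjB K r + F: iid_field M \<rho> R c\<rho> \<omega> "bethe_J m0 adjB r"
  + Cn: random_canopy adjC K C N \<rho> R c\<rho> \<eta> m0 lam x
  for adjB :: "'v \<Rightarrow> 'v \<Rightarrow> bool" and K r and M :: "'a measure" and \<rho> R c\<rho> \<omega> m0
    and adjC :: "'w \<Rightarrow> 'w \<Rightarrow> bool" and C and N :: "'b measure" and \<eta> lam x
begin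

abbreviation radius :: "nat \<Rightarrow> nat" where "radius k \<equiv> block_radius m0 k"

text \<open>One instance for each \<open>k\<close>, all on the same probability space with the same
  variables, so that almost sure limits in \<open>k\<close> make sense; only the tree and its
  heights vary.\<close>

sublocale G: random_layered K "B.\<Lambda> (radius k)" "\<lambda>x. radius k - B.d x" B.par "{r}" M \<rho> R c\<rho> \<omega> "bethe_J m0 adjB r" m0 lam for k
proof -
  interpret layered K "B.\<Lambda> (radius k)" "\<lambda>x. radius k - B.d x" B.par "{r}" by (rule B.layered_ball)
  show "random_layered K (B.\<Lambda> (radius k)) (\<lambda>x. radius k - B.d x) B.par {r} M \<rho> R c\<rho> \<omega> (bethe_J m0 adjB r) m0 lam"
  proof
    show "block m0 y \<in> bethe_J m0 adjB r" if "y \<in> B.\<Lambda> (radius k)" for y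
      using B.block_index[of y m0 "block m0 y"] B.ball_block[OF refl that] by simp
  qed (rule Cn.lam)
qed


lemma radius_ge: "k \<le> radius k"
  by (simp add: block_radius_def)

lemma sphere_sub: "B.sphere (radius k - n) \<subseteq> B.\<Lambda> (radius k)"
  by (auto simp: B.sphere_def B.ball_iff)

lemma ancestor_not_root:
  assumes "y \<in> B.sphere (radius k - n)" "n + q < radius k"
  shows "(B.par ^^ q) y \<notin> {r}"
proof -
  have "B.d y = radius k - n" using assms(1) by (simp add: B.sphere_def)
  then have "0 < B.d ((B.par ^^ q) y)" using B.par_pow_d[of q y] assms(2) by simp
  then show ?thesis by auto
qed

lemma site_expectation:
  assumes y: "y \<in> B.sphere (radius k - n)" and n: "n + q < radius k" and q: "(n + q) mod (m0 + 1) = m0" "p \<le> q"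
  shows "(\<integral>s. G.site k p y s \<partial>M) = Cn.site_moment n p"
proof -
  interpret P: random_pair K "B.\<Lambda> (radius k)" "\<lambda>x. radius k - B.d x" B.par "{r}" M \<rho> R c\<rho> \<omega> "bethe_J m0 adjB r" m0 lam
    UNIV Cn.ht Cn.par "{}" N \<eta> "canopy_J m0 adjC (C 0)" ..
  have h: "radius k - B.d y = n" using y n by (simp add: B.sphere_def)
  have x: "Cn.ht (x n) = n" using Cn.x[of n] by (simp add: Cn.gdist_set_ht)
  have "(\<integral>s. G.site k p y s \<partial>M) = (\<integral>s. Cn.site p (x n) s \<partial>N)"
  proof (rule P.site_expectation_eq)
    show "y \<in> B.\<Lambda> (radius k)" using y sphere_sub by blast
    show "(B.par ^^ q) y \<notin> {r}" by (rule ancestor_not_root[OF y n])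
  qed (use h x q in auto)
  then show ?thesis by (simp add: Cn.site_moment_def Cn.site_def)
qed

definition layer_average :: "nat \<Rightarrow> nat \<Rightarrow> nat \<Rightarrow> 'a \<Rightarrow> real" where
  "layer_average k n p s = (\<Sum>y\<in>B.sphere (radius k - n). G.site k p y s) / real (card (B.sphere (radius k - n)))"

lemma sphere_card_pos: "0 < card (B.sphere j)"
  using B.sphere_card B.K2 by (cases j) (auto simp: B.sphere_0)

lemma average_bound:
  assumes S: "S \<subseteq> B.\<Lambda> (radius k)" "0 < card S"
  shows "\<bar>(\<Sum>y\<in>S. G.site k p y s) / real (card S)\<bar> \<le> G.norm_bound ^ p"
proof -
  have "\<bar>\<Sum>y\<in>S. G.site k p y s\<bar> \<le> (\<Sum>y\<in>S. \<bar>G.site k p y s\<bar>)" by (rule sum_abs)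
  also have "\<dots> \<le> (\<Sum>y\<in>S. G.norm_bound ^ p)" by (rule sum_mono) (use G.site_bound S(1) in blast)
  also have "\<dots> = real (card S) * G.norm_bound ^ p" by simp
  finally show ?thesis using S(2) by (simp add: abs_divide field_simps)
qed

lemmas layer_average_bound = average_bound[OF sphere_sub sphere_card_pos, folded layer_average_def]

lemma layer_average_measurable: "layer_average k n p \<in> borel_measurable M"
  unfolding layer_average_def[abs_def]
  by (intro borel_measurable_divide borel_measurable_sum borel_measurable_const G.site_measurable)
     (use sphere_sub in blast)

lemma sphere_card_ge: "K ^ (radius k) \<le> K ^ n * card (B.sphere (radius k - n))" if "n \<le> radius k"
proof -
  have "K ^ (radius k - n) \<le> card (B.sphere (radius k - n))"
    by (cases "radius k - n") (simp_all add: B.sphere_0 B.sphere_card)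
  then have "K ^ n * K ^ (radius k - n) \<le> K ^ n * card (B.sphere (radius k - n))" by simp
  then show ?thesis using that by (simp flip: power_add)
qed

lemma layer_average_limit: "AE s in M. (\<lambda>k. layer_average k n p s) \<longlonglongrightarrow> Cn.site_moment n p"
proof -
  \<comment> \<open>The smallest number of steps that is at least \<open>p\<close>, so that the
    moment stays below the ancestor, and leads to a height congruent to \<open>m0\<close>, so that
    the ancestor is the top of a block.\<close>
  define q where "q = p + (m0 - (n + p) mod (m0 + 1))"
  have q: "(n + q) mod (m0 + 1) = m0" "p \<le> q"
  proof -
    define a where "a = (n + p) mod (m0 + 1)"
    have a: "a \<le> m0" using mod_less_divisor[of "m0 + 1" "n + p"] by (simp add: a_def)
    have "n + p = (m0 + 1) * ((n + p) div (m0 + 1)) + a" unfolding a_def by (simp only: mult_div_mod_eq)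
    moreover have "q = p + (m0 - a)" by (simp add: q_def a_def)
    ultimately have "n + q = (m0 + 1) * ((n + p) div (m0 + 1)) + m0" using a by linarith
    then have "(n + q) mod (m0 + 1) = m0 mod (m0 + 1)" by (simp only: mod_mult_self4)
    then show "(n + q) mod (m0 + 1) = m0" by simp
    show "p \<le> q" unfolding q_def by (rule le_add1)
  qed
  let ?e = "Cn.site_moment n p"
  \<comment> \<open>For the finitely many \<open>k\<close> at which the ancestor could reach the
    root, the variable is set to 0. For the others the variance bound divided by the size of the
    layer is at most \<open>a * K^(-k)\<close>, which is summable.\<close>
  define Z where "Z k s = (if n + q < radius k then layer_average k n p s - ?e else 0)" for k s
  define a where "a = 4 * (G.norm_bound ^ p)\<^sup>2 * (real K + 1) ^ q * real K ^ n"
  have K: "1 < real K" using B.K2 by simp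
  have "AE s in M. (\<lambda>k. Z k s) \<longlonglongrightarrow> 0"
  proof (rule AE_tendsto_of_summable_second_moment)
    show Zm: "Z k \<in> borel_measurable M" for k
      unfolding Z_def[abs_def] using layer_average_measurable by (cases "n + q < radius k") auto
    show "integrable M (\<lambda>s. (Z k s)\<^sup>2)" for k
    proof (rule F.integrable_const_bound[where B="(2 * G.norm_bound ^ p)\<^sup>2"])
      have Zb: "\<bar>Z k s\<bar> \<le> 2 * G.norm_bound ^ p" for s
        using layer_average_bound[where k=k and p=p and s=s and n=n] Cn.site_moment_bound[of n p] by (auto simp: Z_def)
      have "(Z k s)\<^sup>2 \<le> (2 * G.norm_bound ^ p)\<^sup>2" for s
        using power_mono[OF Zb[of s] abs_ge_zero, of 2] by (simp only: power2_abs)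
      then show "AE s in M. norm ((Z k s)\<^sup>2) \<le> (2 * G.norm_bound ^ p)\<^sup>2"
        by (simp only: real_norm_def abs_power2 AE_I2)
    qed (use Zm[of k] in measurable)
    have a0: "0 \<le> a" by (simp add: a_def)
    show "(\<integral>s. (Z k s)\<^sup>2 \<partial>M) \<le> a * (1 / real K) ^ k" for k
    proof (cases "n + q < radius k")
      case False then show ?thesis using a0 by (simp add: Z_def)
    next
      case True
      let ?S = "B.sphere (radius k - n)"
      have "(\<integral>s. (Z k s)\<^sup>2 \<partial>M) = (\<integral>s. ((\<Sum>y\<in>?S. G.site k p y s) / real (card ?S) - ?e)\<^sup>2 \<partial>M)"
        using True by (simp add: Z_def layer_average_def)
      also have "\<dots> \<le> 4 * (G.norm_bound ^ p)\<^sup>2 * (real K + 1) ^ q / real (card ?S)"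
      proof (rule G.layer_variance[where n=n])
        show "finite ?S" by (rule B.sphere_finite)
        show "?S \<noteq> {}" using sphere_card_pos[of "radius k - n"] by auto
        show "?S \<subseteq> B.\<Lambda> (radius k)" by (rule sphere_sub)
        show "radius k - B.d y = n" if "y \<in> ?S" for y using that True by (simp add: B.sphere_def)
        show "(B.par ^^ q) y \<notin> {r}" if "y \<in> ?S" for y by (rule ancestor_not_root[OF that True])
        show "(\<integral>s. G.site k p y s \<partial>M) = ?e" if "y \<in> ?S" for y by (rule site_expectation[OF that True q])
      qed (rule q)+
      also have "\<dots> \<le> a * (1 / real K) ^ k"
      proof -
        have "real K ^ k \<le> real K ^ radius k" using radius_ge K by (intro power_increasing) auto
        also have "\<dots> \<le> real K ^ n * real (card ?S)"
          using sphere_card_ge[of n k] True by (metis add_lessD1 less_imp_le_nat of_nat_le_iff of_nat_mult of_nat_power)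
        finally have l: "1 / real (card ?S) \<le> real K ^ n / real K ^ k"
          using sphere_card_pos[of "radius k - n"] K by (simp add: field_simps)
        have "4 * (G.norm_bound ^ p)\<^sup>2 * (real K + 1) ^ q * (1 / real (card ?S))
            \<le> 4 * (G.norm_bound ^ p)\<^sup>2 * (real K + 1) ^ q * (real K ^ n / real K ^ k)"
          by (rule mult_left_mono[OF l]) simp
        then show ?thesis by (simp add: a_def power_one_over)
      qed
      finally show ?thesis .
    qed
    show "summable (\<lambda>k. a * (1 / real K) ^ k)" using K by (intro summable_mult summable_geometric) simp
  qed
  then show ?thesis
  proof eventually_elim
    case (elim s)
    have "\<forall>\<^sub>F k in sequentially. Z k s = layer_average k n p s - ?e"
    proof (rule eventually_sequentiallyI)
      fix k assume "Suc (n + q) \<le> k"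
      then have "n + q < radius k" using radius_ge[of k] by linarith
      then show "Z k s = layer_average k n p s - ?e" by (simp add: Z_def)
    qed
    from Lim_transform_eventually[OF elim this] show ?case by (simp add: LIM_zero_iff)
  qed
qed

definition layer_weight :: "nat \<Rightarrow> nat \<Rightarrow> real" where
  "layer_weight k n = real (card (B.sphere (radius k - n))) / real (card (B.\<Lambda> (radius k)))"

lemma ball_card_real: "(real K - 1) * real (card (B.\<Lambda> L)) = (real K + 1) * real K ^ L - 2"
proof -
  have "real ((K - 1) * card (B.\<Lambda> L) + 2) = real ((K + 1) * K ^ L)" by (simp only: B.ball_card)
  then show ?thesis using B.K2 by (simp add: of_nat_diff algebra_simps)
qed

lemma ball_card_ge: "real K ^ L \<le> real (card (B.\<Lambda> L))"
proof -
  have "(real K - 1) * real K ^ L \<le> (real K - 1) * real (card (B.\<Lambda> L))"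
    unfolding ball_card_real using one_le_power[of "real K" L] B.K2 by (simp add: algebra_simps)
  then show ?thesis using B.K2 by simp
qed

text \<open>The bound uniform in \<open>k\<close> that dominates the layers in the passage to the
  limit.\<close>

lemma layer_weight_bound: "n \<le> radius k \<Longrightarrow> layer_weight k n \<le> (real K + 1) * (1 / real K) ^ n"
proof -
  assume n: "n \<le> radius k"
  have K: "0 < real K" using B.K2 by simp
  have "card (B.sphere (radius k - n)) \<le> (K + 1) * K ^ (radius k - n)"
    by (cases "radius k - n") (use B.K2 in \<open>simp_all add: B.sphere_0 B.sphere_card\<close>)
  then have "real (card (B.sphere (radius k - n))) \<le> real ((K + 1) * K ^ (radius k - n))" by (simp only: of_nat_le_iff)
  then have "layer_weight k n \<le> (real K + 1) * real K ^ (radius k - n) / real K ^ radius k"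
    unfolding layer_weight_def using ball_card_ge[of "radius k"] K by (intro frac_le) (simp_all add: algebra_simps)
  also have "\<dots> = (real K + 1) * (1 / real K) ^ n"
    using n K by (simp add: power_diff power_one_over)
  finally show ?thesis .
qed

text \<open>For \<open>n < L\<close> the layer has \<open>(K + 1) K^(L-n-1)\<close> vertices and the
  ball has \<open>((K + 1) K^L - 2) / (K - 1)\<close>. In the quotient \<open>K^L\<close> cancels,
  and the 2 leaves a correction of order \<open>K^(-L)\<close>.\<close>

lemma layer_weight_limit: "(\<lambda>k. layer_weight k n) \<longlonglongrightarrow> (real K - 1) / real K * (1 / real K ^ n)"
proof -
  have K: "1 < real K" using B.K2 by simp
  define c where "c = (real K - 1) / real K * (1 / real K ^ n)"
  have "(\<lambda>k. (1 / real K) ^ radius k) \<longlonglongrightarrow> 0"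
  proof (rule tendsto_sandwich[OF _ _ tendsto_const])
    show "(\<lambda>k. (1 / real K) ^ k) \<longlonglongrightarrow> 0" using K by (intro LIMSEQ_realpow_zero) auto
    show "\<forall>\<^sub>F k in sequentially. (1 / real K) ^ radius k \<le> (1 / real K) ^ k"
      using K radius_ge by (intro always_eventually allI power_decreasing) auto
  qed (use K in auto)
  then have "(\<lambda>k. c * (real K + 1) / ((real K + 1) - 2 * (1 / real K) ^ radius k)) \<longlonglongrightarrow> c * (real K + 1) / ((real K + 1) - 2 * 0)"
    using K by (intro tendsto_intros) auto
  also have "c * (real K + 1) / ((real K + 1) - 2 * 0) = c" using K by simp
  finally have lim: "(\<lambda>k. c * (real K + 1) / ((real K + 1) - 2 * (1 / real K) ^ radius k)) \<longlonglongrightarrow> c" .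
  have eq: "c * (real K + 1) / ((real K + 1) - 2 * (1 / real K) ^ radius k) = layer_weight k n" if k: "Suc n \<le> k" for k
  proof -
    have "radius k - n = Suc (radius k - n - 1)" using k radius_ge[of k] by linarith
    then have "card (B.sphere (radius k - n)) = (K + 1) * K ^ (radius k - n - 1)" using B.sphere_card by metis
    moreover have "real K ^ (radius k - n - 1) = real K ^ radius k / (real K ^ n * real K)"
      using k radius_ge[of k] K by (simp add: power_diff)
    ultimately have 1: "real (card (B.sphere (radius k - n))) = (real K + 1) * (real K ^ radius k / (real K ^ n * real K))"
      by (simp only: of_nat_mult of_nat_power of_nat_add of_nat_1)
    have "real (card (B.\<Lambda> (radius k))) = ((real K + 1) * real K ^ radius k - 2) / (real K - 1)"
      using ball_card_real[of "radius k"] K by (simp add: field_simps)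
    then have 2: "real (card (B.\<Lambda> (radius k))) = real K ^ radius k * (((real K + 1) - 2 * (1 / real K) ^ radius k) / (real K - 1))"
    proof -
      have "(real K + 1) * real K ^ radius k - 2 = real K ^ radius k * ((real K + 1) - 2 * (1 / real K) ^ radius k)"
        using K by (simp add: power_one_over right_diff_distrib mult.commute)
      then show ?thesis using \<open>real (card (B.\<Lambda> (radius k))) = _\<close> by simp
    qed
    have 3: "0 < real K ^ radius k" using K by simp
    have alg: "(a * (P / (q * k))) / (P * (E / b)) = b / k * (1 / q) * a / E" if "P \<noteq> 0" for a P q k E b :: real
    proof -
      have "(a * (P / (q * k))) / (P * (E / b)) = (P * (a / (q * k))) / (P * (E / b))" by simp
      also have "\<dots> = (a / (q * k)) / (E / b)" using that by (rule nonzero_mult_divide_mult_cancel_left)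
      also have "\<dots> = b / k * (1 / q) * a / E" by (simp add: mult_ac)
      finally show ?thesis .
    qed
    show ?thesis unfolding layer_weight_def 1 2 c_def by (rule alg[symmetric]) (use 3 in simp)
  qed
  show ?thesis
    unfolding c_def[symmetric] by (rule Lim_transform_eventually[OF lim eventually_sequentiallyI[OF eq]])
qed

lemma ball_average:
  "(\<Sum>y\<in>B.\<Lambda> (radius k). G.site k p y s) / real (card (B.\<Lambda> (radius k)))
    = (\<Sum>n. if n \<le> radius k then layer_weight k n * layer_average k n p s else 0)"
proof -
  let ?L = "radius k"
  have "(\<Sum>y\<in>B.\<Lambda> ?L. G.site k p y s) = (\<Sum>j\<le>?L. \<Sum>y\<in>B.sphere j. G.site k p y s)"
    unfolding B.ball_spheres by (rule sum.UNION_disjoint) (auto simp: B.sphere_finite, auto simp: B.sphere_def)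
  also have "\<dots> = (\<Sum>n\<le>?L. \<Sum>y\<in>B.sphere (?L - n). G.site k p y s)"
    by (rule sum.nat_diff_reindex[of _ "Suc ?L", unfolded lessThan_Suc_atMost, simplified, symmetric])
  also have "\<dots> = (\<Sum>n\<le>?L. real (card (B.sphere (?L - n))) * layer_average k n p s)"
    using sphere_card_pos by (intro sum.cong refl) (simp add: layer_average_def)
  finally have "(\<Sum>y\<in>B.\<Lambda> ?L. G.site k p y s) / real (card (B.\<Lambda> ?L)) = (\<Sum>n\<le>?L. layer_weight k n * layer_average k n p s)"
    by (simp add: sum_divide_distrib layer_weight_def)
  also have "\<dots> = (\<Sum>n. if n \<le> ?L then layer_weight k n * layer_average k n p s else 0)"
    by (subst suminf_finite[of "{..?L}"]) auto
  finally show ?thesis .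
qed

text \<open>Countably many pairs of layer and exponent leave one null set for all. Off it, Tannery's
  theorem interchanges the limit with the sum over layers, whose number grows with \<open>k\<close>;
  the domination combines the uniform moment bound with \<open>layer_weight_bound\<close>.\<close>

lemma ball_average_limit:
  "AE s in M. \<forall>p. (\<lambda>k. (\<Sum>y\<in>B.\<Lambda> (radius k). G.site k p y s) / real (card (B.\<Lambda> (radius k))))
    \<longlonglongrightarrow> integral\<^sup>L Cn.dos_measure (\<lambda>t. t ^ p)"
proof -
  have "AE s in M. \<forall>p n. (\<lambda>k. layer_average k n p s) \<longlonglongrightarrow> Cn.site_moment n p"
    by (simp add: AE_all_countable layer_average_limit)
  then show ?thesis
  proof eventually_elim
    case (elim s)
    show ?case
    proof
      fix p
      let ?a = "\<lambda>n k. if n \<le> radius k then layer_weight k n * layer_average k n p s else 0"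
      let ?b = "\<lambda>n. (real K - 1) / real K * (1 / real K ^ n) * Cn.site_moment n p"
      let ?M = "\<lambda>n. (real K + 1) * (1 / real K) ^ n * G.norm_bound ^ p"
      have K: "1 < real K" using B.K2 by simp
      have sr: "0 \<le> G.norm_bound ^ p" using order_trans[OF abs_ge_zero Cn.site_moment_bound] by blast
      have "(\<lambda>k. suminf (\<lambda>n. ?a n k)) \<longlonglongrightarrow> suminf ?b"
      proof (rule tannerys_theorem[where M="?M", THEN conjunct2, THEN conjunct2])
        show "(\<lambda>k. ?a n k) \<longlonglongrightarrow> ?b n" for n
        proof (rule Lim_transform_eventually)
          show "(\<lambda>k. layer_weight k n * layer_average k n p s) \<longlonglongrightarrow> ?b n"
            using elim by (intro tendsto_mult layer_weight_limit) blast
          show "\<forall>\<^sub>F k in sequentially. layer_weight k n * layer_average k n p s = ?a n k"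
            by (rule eventually_sequentiallyI[of n]) (use radius_ge in \<open>auto intro: order_trans\<close>)
        qed
        have b: "norm (?a n k) \<le> ?M n" for n k
        proof (cases "n \<le> radius k")
          case True
          have "0 \<le> layer_weight k n" by (simp add: layer_weight_def)
          then have "\<bar>layer_weight k n * layer_average k n p s\<bar> \<le> ?M n"
            unfolding abs_mult using layer_weight_bound[OF True] layer_average_bound[where k=k and p=p and s=s and n=n] K
            by (intro mult_mono) auto
          then show ?thesis using True by simp
        next
          case False then show ?thesis using sr K by simp
        qed
        show "\<forall>\<^sub>F (n, k) in at_top \<times>\<^sub>F sequentially. norm (?a n k) \<le> ?M n"
          by (rule always_eventually) (auto simp only: split_paired_All prod.case b)
        show "summable ?M" using K by (intro summable_mult2 summable_mult summable_geometric) simp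
      qed simp
      also have "suminf ?b = integral\<^sup>L Cn.dos_measure (\<lambda>t. t ^ p)"
      proof -
        have "summable (\<lambda>n. 1 / real K ^ n * Cn.site_moment n p)"
        proof (rule summable_comparison_test')
          show "summable (\<lambda>n. (1 / real K) ^ n * G.norm_bound ^ p)"
            using K by (intro summable_mult2 summable_geometric) simp
          show "norm (1 / real K ^ n * Cn.site_moment n p) \<le> (1 / real K) ^ n * G.norm_bound ^ p" if "0 \<le> n" for n
            using Cn.site_moment_bound[of n p] K by (simp add: abs_mult power_one_over divide_right_mono)
        qed
        from suminf_mult[OF this, of "(real K - 1) / real K"] show ?thesis
          unfolding Cn.dos_moment by (simp only: mult.assoc)
      qed
      finally show "(\<lambda>k. (\<Sum>y\<in>B.\<Lambda> (radius k). G.site k p y s) / real (card (B.\<Lambda> (radius k))))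
          \<longlonglongrightarrow> integral\<^sup>L Cn.dos_measure (\<lambda>t. t ^ p)"
        unfolding ball_average .
    qed
  qed
qed

text \<open>The normalised trace is the mass that the uniform mixture \<open>\<mu> k\<close> of the
  vertex measures gives to the interval. Convergence of all moments holds off one null set, which
  therefore does not depend on the interval.\<close>

lemma trace_limit:
  "AE s in M. \<forall>I. is_interval I \<longrightarrow>
    (\<lambda>k. Re (trace_on (B.\<Lambda> (radius k))
           (spectral_projection (B.\<Lambda> (radius k)) (bethe_op_ball m0 adjB r lam (\<lambda>y. \<omega> y s) (radius k)) I))
         / real (card (B.\<Lambda> (radius k))))
    \<longlonglongrightarrow> measure Cn.dos_measure I"
proof -
  have "AE s in M. \<forall>k. \<forall>y\<in>B.\<Lambda> (radius k). \<forall>S\<in>sets borel.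
      Re (ell2_inner (delta y) (spectral_projection (B.\<Lambda> (radius k)) (G.hop k m0 lam (\<lambda>y. \<omega> y s)) S (delta y)))
      = measure (G.cutoff k s y) S"
    unfolding AE_all_countable by (rule allI) (rule G.cutoff_spectral)
  with ball_average_limit show ?thesis
  proof eventually_elim
    case (elim s)
    define \<mu> where "\<mu> k = uniform_count_measure (B.\<Lambda> (radius k)) \<bind> G.cutoff k s" for k
    have ne: "finite (B.\<Lambda> (radius k))" "B.\<Lambda> (radius k) \<noteq> {}" for k
    proof -
      have "r \<in> B.\<Lambda> (radius k)" by (simp add: B.ball_iff)
      then show "B.\<Lambda> (radius k) \<noteq> {}" by blast
    qed (rule B.ball_finite)
    have ker: "G.cutoff k s \<in> measurable (uniform_count_measure (B.\<Lambda> (radius k))) (subprob_algebra borel)" for k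
      unfolding measurable_cong_sets[OF sets_uniform_count_measure_count_space refl]
      using G.cutoff_prob supportedD(2)[OF G.cutoff_supported]
      by (auto simp: space_subprob_algebra intro: prob_space_imp_subprob_space)
    have mix: "prob_space (\<mu> k)" "supported G.norm_bound (\<mu> k)"
      "\<And>S. S \<in> sets borel \<Longrightarrow> measure (\<mu> k) S = (\<Sum>y\<in>B.\<Lambda> (radius k). measure (G.cutoff k s y) S) / real (card (B.\<Lambda> (radius k)))"
      "integral\<^sup>L (\<mu> k) (\<lambda>t. t ^ p) = (\<Sum>y\<in>B.\<Lambda> (radius k). G.site k p y s) / real (card (B.\<Lambda> (radius k)))" for k p
    proof -
      have pr: "prob_space (G.cutoff k s y)" and sup: "supported G.norm_bound (G.cutoff k s y)"
        if "y \<in> space (uniform_count_measure (B.\<Lambda> (radius k)))" for y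
        using that G.cutoff_prob G.cutoff_supported by (simp_all add: space_uniform_count_measure)
      note km = kernel_mixture[OF prob_space_uniform_count_measure[OF ne] ker pr sup]
      show "prob_space (\<mu> k)" "supported G.norm_bound (\<mu> k)" unfolding \<mu>_def by (rule km; assumption)+
      show "measure (\<mu> k) S = (\<Sum>y\<in>B.\<Lambda> (radius k). measure (G.cutoff k s y) S) / real (card (B.\<Lambda> (radius k)))"
        if "S \<in> sets borel" for S
        unfolding \<mu>_def by (rule trans[OF km(3) integral_uniform_count_measure[OF ne(1)]]) (assumption | rule that)+
      have "integral\<^sup>L (\<mu> k) (\<lambda>t. t ^ p) = (\<Sum>y\<in>B.\<Lambda> (radius k). integral\<^sup>L (G.cutoff k s y) (\<lambda>t. t ^ p)) / real (card (B.\<Lambda> (radius k)))"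
        unfolding \<mu>_def by (rule trans[OF km(4) integral_uniform_count_measure[OF ne(1)]])
      then show "integral\<^sup>L (\<mu> k) (\<lambda>t. t ^ p) = (\<Sum>y\<in>B.\<Lambda> (radius k). G.site k p y s) / real (card (B.\<Lambda> (radius k)))"
        by (simp add: G.cutoff_moment G.site_def)
    qed
    show ?case
    proof (intro allI impI)
      fix I :: "real set" assume I: "is_interval I"
      have "(\<lambda>k. measure (\<mu> k) I) \<longlonglongrightarrow> measure Cn.dos_measure I"
        by (rule moment_convergence_interval[OF mix(2) Cn.dos_supported _ mix(1) Cn.dos_prob Cn.dos_absolutely_continuous I])
           (use elim(1) mix(4) in simp)
      moreover have "measure (\<mu> k) I = Re (trace_on (B.\<Lambda> (radius k))
           (spectral_projection (B.\<Lambda> (radius k)) (bethe_op_ball m0 adjB r lam (\<lambda>y. \<omega> y s) (radius k)) I))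
         / real (card (B.\<Lambda> (radius k)))" for k
        unfolding mix(3)[OF real_interval_borel_measurable[OF I]] B.bethe_op_ball_hop[OF refl] trace_on_def Re_sum
        using elim(2) real_interval_borel_measurable[OF I] by simp
      ultimately show "(\<lambda>k. Re (trace_on (B.\<Lambda> (radius k))
           (spectral_projection (B.\<Lambda> (radius k)) (bethe_op_ball m0 adjB r lam (\<lambda>y. \<omega> y s) (radius k)) I))
         / real (card (B.\<Lambda> (radius k)))) \<longlonglongrightarrow> measure Cn.dos_measure I" by simp
    qed
  qed
qed

end

theorem theorem1p2:
  fixes K m0 :: nat and lam :: real and \<rho> :: "real \<Rightarrow> real"
    and adjB :: "'v \<Rightarrow> 'v \<Rightarrow> bool" and root :: 'v
    and M :: "'a measure" and \<omega> :: "'v \<Rightarrow> 'a \<Rightarrow> real"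
    and adjC :: "'c \<Rightarrow> 'c \<Rightarrow> bool" and C :: "nat \<Rightarrow> 'c set"
    and N :: "'b measure" and \<eta> :: "'c \<Rightarrow> 'b \<Rightarrow> real"
    and x :: "nat \<Rightarrow> 'c"
  assumes "2 \<le> K" and "1 \<le> m0" and "0 < lam"
    and "bounded_compact_density \<rho>"
    and "bethe_lattice K adjB"
    and "iid_density M \<rho> \<omega> (bethe_J m0 adjB root)"
    and "canopy_tree K adjC C"
    and "iid_density N \<rho> \<eta> (canopy_J m0 adjC (C 0))"
    and "\<And>n. gdist_set adjC (C 0) (x n) = n"
  shows "(\<forall>I. is_interval I \<longrightarrow>
      (AE s in M.
        (\<lambda>k. let L = block_radius m0 k; \<Lambda> = gball adjB root L in
           Re (trace_on \<Lambda>
             (spectral_projection \<Lambda> (bethe_op_ball m0 adjB root lam (\<lambda>y. \<omega> y s) L) I))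
           / real (card \<Lambda>))
        \<longlonglongrightarrow> canopy_dos K m0 lam adjC (C 0) N \<eta> x I)) \<and>
    (\<exists>\<nu>. sets \<nu> = sets borel \<and> finite_measure \<nu> \<and>
      (\<forall>B\<in>sets borel. measure \<nu> B = canopy_dos K m0 lam adjC (C 0) N \<eta> x B) \<and>
      absolutely_continuous lborel \<nu>)"
proof -
  obtain c1 R1 where \<rho>: "\<rho> \<in> borel_measurable borel" "AE t in lborel. 0 \<le> \<rho> t" "AE t in lborel. \<rho> t \<le> c1"
      "AE t in lborel. R1 < \<bar>t\<bar> \<longrightarrow> \<rho> t = 0"
    using assms(4) by (auto simp: bounded_compact_density_def)
  \<comment> \<open>Enlarging the essential bounds ensures \<open>0 \<le> c\<rho>\<close> and
    \<open>0 < R\<close>, as \<open>iid_field\<close> requires.\<close>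
  define c\<rho> R where "c\<rho> = max 0 c1" and "R = max 1 R1"
  have \<rho>': "AE t in lborel. \<rho> t \<le> c\<rho>" "AE t in lborel. R < \<bar>t\<bar> \<longrightarrow> \<rho> t = 0"
    using \<rho>(3,4) by (eventually_elim, simp add: c\<rho>_def R_def max_def)+
  interpret B: bethe adjB K root
    using assms(1,5) by unfold_locales (auto simp: bethe_lattice_def is_tree_def)
  interpret Cc: canopy adjC K C
    using assms(1,7) by unfold_locales (auto simp: canopy_tree_def is_tree_def)
  have "countable (UNIV :: 'v set)"
  proof -
    have "(UNIV :: 'v set) = (\<Union>j. B.sphere j)" by (auto simp: B.sphere_def)
    then show ?thesis using B.sphere_finite by (metis countable_UN countable_finite countableI_type)
  qed
  then have cB: "countable (bethe_J m0 adjB root)" by (rule countable_subset[OF subset_UNIV])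
  have cC: "countable (canopy_J m0 adjC (C 0))" by (rule countable_subset[OF subset_UNIV Cc.countable_vertices])
  have F: "iid_field M \<rho> R c\<rho> \<omega> (bethe_J m0 adjB root)"
    using assms(6) \<rho> \<rho>' cB unfolding iid_field_def iid_field_axioms_def iid_density_def
    by (auto simp: c\<rho>_def R_def)
  have G: "iid_field N \<rho> R c\<rho> \<eta> (canopy_J m0 adjC (C 0))"
    using assms(8) \<rho> \<rho>' cC unfolding iid_field_def iid_field_axioms_def iid_density_def
    by (auto simp: c\<rho>_def R_def)
  interpret bethe_canopy adjB K root M \<rho> R c\<rho> \<omega> m0 adjC C N \<eta> lam x
    by (intro bethe_canopy.intro random_canopy.intro random_canopy_axioms.intro B.bethe_axioms F Cc.canopy_axioms G assms)
  note dos = Cn.dos_measure_eq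
  have "AE s in M. (\<lambda>k. let L = block_radius m0 k; \<Lambda> = gball adjB root L in
           Re (trace_on \<Lambda> (spectral_projection \<Lambda> (bethe_op_ball m0 adjB root lam (\<lambda>y. \<omega> y s) L) I)) / real (card \<Lambda>))
        \<longlonglongrightarrow> canopy_dos K m0 lam adjC (C 0) N \<eta> x I" if "is_interval I" for I
    using trace_limit by eventually_elim (use that in \<open>simp add: Let_def flip: dos[OF real_interval_borel_measurable[OF that]]\<close>)
  moreover have "sets Cn.dos_measure = sets borel" "finite_measure Cn.dos_measure"
    using supportedD[OF Cn.dos_supported] by auto
  ultimately show ?thesis using dos Cn.dos_absolutely_continuous by blast
qed

end
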